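(* For every real constant $t>1$, the variations of the decision problems LWS$t$ and LWPS$t$ and of the optimization problems MWS$t$ and MWPS$t$, as well as of the optimization problem MDG, in which the underlying graph is an arbitrary geometric graph (given as part of the input, not necessarily complete), are NP-hard. The same holds for the variations in which the underlying graph is an arbitrary weighted graph (not necessarily geometric).
   Context: Let $G=(V,E)$ be a graph with positive edge weights. $\delta_G(u,v)$ is the weight of a shortest path between $u$ and $v$ in $G$. For a spanning subgraph $G'$ of $G$, the dilation of $G'$ (with respect to $G$) is $\max_{u\ne v\in V}\delta_{G'}(u,v)/\delta_G(u,v)$. For $t>1$, a $t$-spanner of $G$ is a spanning subgraph of $G$ with dilation at most $t$. The weight of a graph is the sum of its edge weights. A geometric graph is a graph whose vertices are points in the plane and whose edges are straight segments weighted by Euclidean length. Problems, with underlying graph $G$ (geometric, or general weighted) given as input, and $t$ a fixed constant that is not part of the input in the first four: LWS$t$: given $G$ and $w>0$, decide whether $G$ has a $t$-spanner of weight at most $w$. LWPS$t$: given $G$ and $w>0$, decide whether $G$ has a plane $t$-spanner of weight at most $w$ (for geometric graphs: no two edges of the spanner cross; for general weighted graphs: the spanner is a planar graph). MWS$t$: given $G$, find a minimum weight $t$-spanner of $G$. MWPS$t$: given $G$, find a minimum weight plane (respectively planar) $t$-spanner of $G$. MDG: given $G$ and $w>0$, find a spanning subgraph of $G$ of minimum dilation among those of weight at most $w$. NP-hardness is understood with respect to polynomial-time reductions (polynomial-time Turing reductions for optimization problems), with inputs encoded in binary. *)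

theory Defs
  imports "HOL-Analysis.Analysis" "HOL-Computational_Algebra.Polynomial"
begin

record 'v wgraph =
  verts :: "'v set"
  edges :: "'v set set"
  weight :: "'v set \<Rightarrow> real"

definition wf_wgraph :: "'v wgraph \<Rightarrow> bool" where
  "wf_wgraph G \<longleftrightarrow> finite (verts G) \<and>
     (\<forall>e\<in>edges G. e \<subseteq> verts G \<and> card e = 2 \<and> weight G e > 0)"

definition is_path :: "'v wgraph \<Rightarrow> 'v \<Rightarrow> 'v list \<Rightarrow> 'v \<Rightarrow> bool" where
  "is_path G u p v \<longleftrightarrow> p \<noteq> [] \<and> hd p = u \<and> last p = v \<and> distinct p \<and> set p \<subseteq> verts G \<and>
     (\<forall>i<length p - 1. {p ! i, p ! Suc i} \<in> edges G)"

definition path_weight :: "'v wgraph \<Rightarrow> 'v list \<Rightarrow> real" where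
  "path_weight G p = (\<Sum>i<length p - 1. weight G {p ! i, p ! Suc i})"

text \<open>The distance is \<open>\<infinity>\<close> if there is no path.\<close>

definition graph_dist :: "'v wgraph \<Rightarrow> 'v \<Rightarrow> 'v \<Rightarrow> ereal" where
  "graph_dist G u v = (INF p\<in>{p. is_path G u p v}. ereal (path_weight G p))"

definition spanning_subgraph :: "'v wgraph \<Rightarrow> 'v wgraph \<Rightarrow> bool" where
  "spanning_subgraph H G \<longleftrightarrow>
     verts H = verts G \<and> edges H \<subseteq> edges G \<and> weight H = weight G"

text \<open>For a finite \<open>G\<close> the supremum is a maximum. In \<^typ>\<open>ereal\<close> we have \<open>\<infinity> / \<infinity> = 0\<close>, so pairs
  that are already disconnected in \<open>G\<close> impose no constraint, whereas a pair that is
  disconnected in \<open>H\<close> only makes the dilation infinite.\<close>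

definition dilation :: "'v wgraph \<Rightarrow> 'v wgraph \<Rightarrow> ereal" where
  "dilation H G =
     (SUP (u, v)\<in>{(u, v). u \<in> verts G \<and> v \<in> verts G \<and> u \<noteq> v}. graph_dist H u v / graph_dist G u v)"

definition t_spanner :: "real \<Rightarrow> 'v wgraph \<Rightarrow> 'v wgraph \<Rightarrow> bool" where
  "t_spanner t H G \<longleftrightarrow> spanning_subgraph H G \<and> dilation H G \<le> ereal t"

definition total_weight :: "'v wgraph \<Rightarrow> real" where
  "total_weight G = (\<Sum>e\<in>edges G. weight G e)"

text \<open>For an edge \<open>e = {u, v}\<close> of a geometric graph, \<open>convex hull e\<close> is the segment from \<open>u\<close> to \<open>v\<close>.
  Edges cross if they meet in a point that is not a common endpoint; overlapping collinear edges
  and an edge ending in the interior of another one count as crossing.\<close>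

definition edges_cross :: "(real \<times> real) set \<Rightarrow> (real \<times> real) set \<Rightarrow> bool" where
  "edges_cross e f \<longleftrightarrow> e \<noteq> f \<and> \<not> convex hull e \<inter> convex hull f \<subseteq> e \<inter> f"

definition plane_geometric :: "(real \<times> real) wgraph \<Rightarrow> bool" where
  "plane_geometric G \<longleftrightarrow> (\<forall>e\<in>edges G. \<forall>f\<in>edges G. \<not> edges_cross e f)"

definition planar :: "'v wgraph \<Rightarrow> bool" where
  "planar G \<longleftrightarrow> (\<exists>(pos :: 'v \<Rightarrow> real \<times> real) (\<gamma> :: 'v set \<Rightarrow> real \<Rightarrow> real \<times> real).
     inj_on pos (verts G) \<and>
     (\<forall>e\<in>edges G. arc (\<gamma> e) \<and> {pathstart (\<gamma> e), pathfinish (\<gamma> e)} = pos ` e \<and>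
        path_image (\<gamma> e) \<inter> pos ` verts G \<subseteq> pos ` e) \<and>
     (\<forall>e\<in>edges G. \<forall>f\<in>edges G. e \<noteq> f \<longrightarrow>
        path_image (\<gamma> e) \<inter> path_image (\<gamma> f) \<subseteq> pos ` (e \<inter> f)))"

text \<open>
  States are \<open>0, \<dots>, n_states - 1\<close>, with initial state \<open>0\<close> and halting state \<open>1\<close>; tape symbols are
  \<open>0, \<dots>, n_symbols - 1\<close>, where \<open>0\<close> is the blank and \<open>1\<close>, \<open>2\<close> stand for the bits \<^term>\<open>False\<close>, \<^term>\<open>True\<close>.
  Tape 0 holds the input, tape 1 the output, and tape 2 the oracle queries and answers.
  A machine with \<open>query_state = None\<close> is an ordinary Turing machine.
\<close>

datatype move = Go_Left | Go_Right | Stay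

record machine =
  n_tapes :: nat
  n_states :: nat
  n_symbols :: nat
  delta :: "nat \<Rightarrow> nat list \<Rightarrow> nat \<times> (nat \<times> move) list"
  query_state :: "nat option"
  answer_state :: nat

text \<open>Only finitely many values of \<^const>\<open>delta\<close> matter: those on the domain below.\<close>

definition wf_machine :: "machine \<Rightarrow> bool" where
  "wf_machine M \<longleftrightarrow>
     n_tapes M \<ge> 2 \<and> n_states M \<ge> 2 \<and> n_symbols M \<ge> 3 \<and>
     (\<forall>q syms. q < n_states M \<and> length syms = n_tapes M \<and> set syms \<subseteq> {..<n_symbols M} \<longrightarrow>
        fst (delta M q syms) < n_states M \<and>
        length (snd (delta M q syms)) = n_tapes M \<and>
        fst ` set (snd (delta M q syms)) \<subseteq> {..<n_symbols M}) \<and>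
     (query_state M \<noteq> None \<longrightarrow> n_tapes M \<ge> 3 \<and> answer_state M < n_states M)"

text \<open>Tapes are infinite in both directions; a tape consists of its cells and the head position.\<close>

type_synonym tape = "(int \<Rightarrow> nat) \<times> int"
type_synonym config = "nat \<times> tape list"

definition tape_of :: "bool list \<Rightarrow> tape" where
  "tape_of x = (\<lambda>i. if 0 \<le> i \<and> i < int (length x) then (if x ! nat i then 2 else 1) else 0, 0)"

text \<open>The maximal block of bits starting at cell 0.\<close>

definition contents :: "tape \<Rightarrow> bool list" where
  "contents T = map (\<lambda>i. fst T (int i) = 2) [0..<(LEAST n. fst T (int n) \<notin> {1, 2})]"

definition read :: "tape \<Rightarrow> nat" where
  "read T = fst T (snd T)"

fun act :: "nat \<times> move \<Rightarrow> tape \<Rightarrow> tape" where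
  "act (s, m) (c, h) =
     (c(h := s), case m of Go_Left \<Rightarrow> h - 1 | Go_Right \<Rightarrow> h + 1 | Stay \<Rightarrow> h)"

fun step :: "machine \<Rightarrow> (bool list \<Rightarrow> bool list) \<Rightarrow> config \<Rightarrow> config" where
  "step M f (q, Ts) =
     (if q = 1 then (q, Ts)
      else if query_state M = Some q
        then (answer_state M, Ts[2 := tape_of (f (contents (Ts ! 2)))])
      else (let (q', acts) = delta M q (map read Ts) in (q', map2 act acts Ts)))"

definition init_config :: "machine \<Rightarrow> bool list \<Rightarrow> config" where
  "init_config M x = (0, tape_of x # replicate (n_tapes M - 1) (tape_of []))"

definition computes_within ::
    "machine \<Rightarrow> (bool list \<Rightarrow> bool list) \<Rightarrow> nat poly \<Rightarrow> (bool list \<Rightarrow> bool list) \<Rightarrow> bool" where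
  "computes_within M f p g \<longleftrightarrow>
     (\<forall>x. \<exists>n \<le> poly p (length x).
        fst ((step M f ^^ n) (init_config M x)) = 1 \<and>
        contents (snd ((step M f ^^ n) (init_config M x)) ! 1) = g x)"

definition poly_time :: "(bool list \<Rightarrow> bool list) \<Rightarrow> bool" where
  "poly_time g \<longleftrightarrow>
     (\<exists>M p. wf_machine M \<and> query_state M = None \<and> computes_within M (\<lambda>_. []) p g)"

text \<open>All encodings below are prefix-free, hence can be concatenated without separators.\<close>

definition enc_list :: "('a \<Rightarrow> bool list) \<Rightarrow> 'a list \<Rightarrow> bool list" where
  "enc_list f xs = concat (map (\<lambda>x. True # f x) xs) @ [False]"

text \<open>Binary representation, least significant bit first.\<close>

fun bin :: "nat \<Rightarrow> bool list" where
  "bin n = (if n = 0 then [] else odd n # bin (n div 2))"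

declare bin.simps [simp del]

definition enc_bits :: "bool list \<Rightarrow> bool list" where
  "enc_bits = enc_list (\<lambda>b. [b])"

definition enc_nat :: "nat \<Rightarrow> bool list" where
  "enc_nat n = enc_bits (bin n)"

definition enc_int :: "int \<Rightarrow> bool list" where
  "enc_int k = (k < 0) # enc_nat (nat \<bar>k\<bar>)"

definition enc_rat :: "rat \<Rightarrow> bool list" where
  "enc_rat r = enc_int (fst (quotient_of r)) @ enc_nat (nat (snd (quotient_of r)))"

definition poly_time_decidable :: "bool list set \<Rightarrow> bool" where
  "poly_time_decidable A \<longleftrightarrow> poly_time (\<lambda>x. [x \<in> A])"

definition in_NP :: "bool list set \<Rightarrow> bool" where
  "in_NP A \<longleftrightarrow> (\<exists>B p. poly_time_decidable B \<and>
     (\<forall>x. x \<in> A \<longleftrightarrow> (\<exists>y. length y \<le> poly p (length x) \<and> enc_bits x @ y \<in> B)))"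

definition poly_reducible :: "bool list set \<Rightarrow> bool list set \<Rightarrow> bool" where
  "poly_reducible A B \<longleftrightarrow> (\<exists>g. poly_time g \<and> (\<forall>x. x \<in> A \<longleftrightarrow> g x \<in> B))"

definition NP_hard :: "bool list set \<Rightarrow> bool" where
  "NP_hard B \<longleftrightarrow> (\<forall>A. in_NP A \<longrightarrow> poly_reducible A B)"

text \<open>A search problem is a set of pairs of an encoded instance and the set of its encoded solutions.
  A solver returns some solution (preceded by a bit \<^term>\<open>True\<close>) if there is one, and reports
  with the empty string that there is none otherwise.
  Its behaviour on strings that do not encode an instance is arbitrary.\<close>

type_synonym search_problem = "(bool list \<times> bool list set) set"

definition solves :: "(bool list \<Rightarrow> bool list) \<Rightarrow> search_problem \<Rightarrow> bool" where
  "solves f P \<longleftrightarrow>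
     (\<forall>(x, S)\<in>P. if S = {} then f x = [] else \<exists>s\<in>S. f x = True # s)"

text \<open>The reducing machine and its time bound must be the same for all solvers.\<close>

definition Turing_reducible :: "bool list set \<Rightarrow> search_problem \<Rightarrow> bool" where
  "Turing_reducible A P \<longleftrightarrow>
     (\<exists>M p. wf_machine M \<and> (\<forall>f. solves f P \<longrightarrow> computes_within M f p (\<lambda>x. [x \<in> A])))"

definition NP_hard_search :: "search_problem \<Rightarrow> bool" where
  "NP_hard_search P \<longleftrightarrow> (\<forall>A. in_NP A \<longrightarrow> Turing_reducible A P)"

text \<open>The field \<open>edge_list\<close> enumerates the edges of the graph without repetitions, so that the graph's
  spanning subgraphs can be written as bit vectors; \<open>is_plane\<close> is the class's notion of being
  plane (respectively planar).\<close>

record ('i, 'v) graph_class =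
  inputs :: "'i set"
  encode :: "'i \<Rightarrow> bool list"
  graph_of :: "'i \<Rightarrow> 'v wgraph"
  edge_list :: "'i \<Rightarrow> 'v set list"
  is_plane :: "'v wgraph \<Rightarrow> bool"

text \<open>Geometric graphs: a list of points with rational coordinates, and a list of edges given as
  pairs of positions in that list.\<close>

type_synonym geometric_input = "(rat \<times> rat) list \<times> (nat \<times> nat) list"

definition point :: "rat \<times> rat \<Rightarrow> real \<times> real" where
  "point a = (of_rat (fst a), of_rat (snd a))"

definition geometric_edge_list :: "geometric_input \<Rightarrow> (real \<times> real) set list" where
  "geometric_edge_list I = map (\<lambda>(i, j). {point (fst I ! i), point (fst I ! j)}) (snd I)"

lemma diameter_pair: "diameter {u, v} = dist u (v :: 'a :: metric_space)"
  by (simp add: diameter_def dist_commute cSup_eq_Max insert_Times_insert)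

definition geometric_graph :: "geometric_input \<Rightarrow> (real \<times> real) wgraph" where
  "geometric_graph I = \<lparr>verts = point ` set (fst I), edges = set (geometric_edge_list I),
     weight = diameter\<rparr>"

definition geometric :: "(geometric_input, real \<times> real) graph_class" where
  "geometric = \<lparr>
     inputs = {(ps, es). distinct ps \<and>
       (\<forall>(i, j)\<in>set es. i < length ps \<and> j < length ps \<and> i \<noteq> j) \<and>
       distinct (geometric_edge_list (ps, es))},
     encode = (\<lambda>(ps, es). enc_list (\<lambda>(a, b). enc_rat a @ enc_rat b) ps @
       enc_list (\<lambda>(i, j). enc_nat i @ enc_nat j) es),
     graph_of = geometric_graph,
     edge_list = geometric_edge_list,
     is_plane = plane_geometric\<rparr>"

text \<open>General weighted graphs: the number of vertices, and a list of edges with positive rational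
  weights. The vertex set \<open>{0..<n}\<close> is listed in the input: \<open>n\<close> is written in unary, so that
  the size of the input is at least the number of vertices.\<close>

type_synonym weighted_input = "nat \<times> (nat \<times> nat \<times> rat) list"

definition weighted_edge_list :: "weighted_input \<Rightarrow> nat set list" where
  "weighted_edge_list I = map (\<lambda>(i, j, r). {i, j}) (snd I)"

text \<open>For inputs in the class, the sum defining the weight of an edge has exactly one term.\<close>

definition weighted_graph :: "weighted_input \<Rightarrow> nat wgraph" where
  "weighted_graph I = \<lparr>verts = {0..<fst I}, edges = set (weighted_edge_list I),
     weight = (\<lambda>e. \<Sum>(i, j, r)\<leftarrow>snd I. if {i, j} = e then of_rat r else 0)\<rparr>"

definition weighted :: "(weighted_input, nat) graph_class" where
  "weighted = \<lparr>
     inputs = {(n, es). (\<forall>(i, j, r)\<in>set es. i < n \<and> j < n \<and> i \<noteq> j \<and> r > 0) \<and>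
       distinct (weighted_edge_list (n, es))},
     encode = (\<lambda>(n, es). replicate n True @ [False] @
       enc_list (\<lambda>(i, j, r). enc_nat i @ enc_nat j @ enc_rat r) es),
     graph_of = weighted_graph,
     edge_list = weighted_edge_list,
     is_plane = planar\<rparr>"

lemma wf_geometric: "I \<in> inputs geometric \<Longrightarrow> wf_wgraph (graph_of geometric I)"
proof -
  have inj: "inj point"
    by (auto simp: inj_def point_def prod_eq_iff)
  assume I: "I \<in> inputs geometric"
  have "e \<subseteq> point ` set (fst I) \<and> card e = 2 \<and> diameter e > 0"
    if "e \<in> set (geometric_edge_list I)" for e
  proof -
    obtain i j where e: "(i, j) \<in> set (snd I)" "e = {point (fst I ! i), point (fst I ! j)}"
      using \<open>e \<in> set (geometric_edge_list I)\<close> by (auto simp: geometric_edge_list_def)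
    then have ij: "i < length (fst I)" "j < length (fst I)" "i \<noteq> j" "distinct (fst I)"
      using I by (auto simp: geometric_def)
    then have "point (fst I ! i) \<noteq> point (fst I ! j)"
      by (simp add: inj_eq[OF inj] nth_eq_iff_index_eq)
    then show ?thesis
      using e ij by (simp add: diameter_pair)
  qed
  then show ?thesis
    by (simp add: wf_wgraph_def geometric_def geometric_graph_def)
qed

lemma weight_weighted:
  assumes "I \<in> inputs weighted" "(i, j, r) \<in> set (snd I)"
  shows "weight (graph_of weighted I) {i, j} = of_rat r"
proof -
  define ends :: "nat \<times> nat \<times> rat \<Rightarrow> nat set" where "ends = (\<lambda>(a, b, s). {a, b})"
  define h :: "nat \<times> nat \<times> rat \<Rightarrow> real"
    where "h x = (if ends x = {i, j} then of_rat (snd (snd x)) else 0)" for x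
  have eij: "ends (i, j, r) = {i, j}"
    by (simp add: ends_def)
  have dist: "distinct (map ends (snd I))"
    using assms(1) by (cases I) (simp add: weighted_def weighted_edge_list_def ends_def)
  then have "distinct (snd I)" and inj: "inj_on ends (set (snd I))"
    by (simp_all add: distinct_map)
  have 0: "h x = 0" if "x \<in> set (snd I) - {(i, j, r)}" for x
  proof -
    have "ends x \<noteq> ends (i, j, r)"
      using inj_on_contraD[OF inj, of x "(i, j, r)"] that assms(2) by simp
    then show ?thesis
      by (simp add: h_def eij)
  qed
  have "weight (graph_of weighted I) {i, j} = sum_list (map h (snd I))"
    by (simp add: weighted_def weighted_graph_def h_def[abs_def] ends_def case_prod_unfold)
  also have "\<dots> = sum h (set (snd I))"
    by (rule sum_list_distinct_conv_sum_set) fact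
  also have "\<dots> = h (i, j, r) + sum h (set (snd I) - {(i, j, r)})"
    by (rule sum.remove) (use assms in simp_all)
  also have "sum h (set (snd I) - {(i, j, r)}) = 0"
    using 0 by (rule sum.neutral[OF ballI])
  finally show ?thesis
    by (simp add: h_def eij)
qed

lemma wf_weighted: "I \<in> inputs weighted \<Longrightarrow> wf_wgraph (graph_of weighted I)"
proof -
  assume I: "I \<in> inputs weighted"
  have "e \<subseteq> {0..<fst I} \<and> card e = 2 \<and> weight (graph_of weighted I) e > 0"
    if "e \<in> set (weighted_edge_list I)" for e
  proof -
    obtain i j r where e: "(i, j, r) \<in> set (snd I)" "e = {i, j}"
      using \<open>e \<in> set (weighted_edge_list I)\<close> by (auto simp: weighted_edge_list_def)
    then have "i < fst I \<and> j < fst I \<and> i \<noteq> j \<and> r > 0"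
      using I by (auto simp: weighted_def)
    then show ?thesis
      using e weight_weighted[OF I e(1)] by auto
  qed
  then show ?thesis
    by (simp add: wf_wgraph_def weighted_def weighted_graph_def)
qed

definition selected_subgraph :: "('i, 'v) graph_class \<Rightarrow> 'i \<Rightarrow> bool list \<Rightarrow> 'v wgraph" where
  "selected_subgraph C I bs =
     (graph_of C I)\<lparr>edges := {edge_list C I ! i |i. i < length (edge_list C I) \<and> bs ! i}\<rparr>"

definition LWS :: "('i, 'v) graph_class \<Rightarrow> real \<Rightarrow> bool list set" where
  "LWS C t = {encode C I @ enc_rat w |I w. I \<in> inputs C \<and> w > 0 \<and>
     (\<exists>H. t_spanner t H (graph_of C I) \<and> total_weight H \<le> of_rat w)}"

definition LWPS :: "('i, 'v) graph_class \<Rightarrow> real \<Rightarrow> bool list set" where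
  "LWPS C t = {encode C I @ enc_rat w |I w. I \<in> inputs C \<and> w > 0 \<and>
     (\<exists>H. t_spanner t H (graph_of C I) \<and> is_plane C H \<and> total_weight H \<le> of_rat w)}"

definition MWS :: "('i, 'v) graph_class \<Rightarrow> real \<Rightarrow> search_problem" where
  "MWS C t = {(encode C I, {bs. length bs = length (edge_list C I) \<and>
       is_arg_min total_weight (\<lambda>H. t_spanner t H (graph_of C I)) (selected_subgraph C I bs)})
     |I. I \<in> inputs C}"

definition MWPS :: "('i, 'v) graph_class \<Rightarrow> real \<Rightarrow> search_problem" where
  "MWPS C t = {(encode C I, {bs. length bs = length (edge_list C I) \<and>
       is_arg_min total_weight (\<lambda>H. t_spanner t H (graph_of C I) \<and> is_plane C H)
         (selected_subgraph C I bs)})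
     |I. I \<in> inputs C}"

definition MDG :: "('i, 'v) graph_class \<Rightarrow> search_problem" where
  "MDG C = {(encode C I @ enc_rat w, {bs. length bs = length (edge_list C I) \<and>
       is_arg_min (\<lambda>H. dilation H (graph_of C I))
         (\<lambda>H. spanning_subgraph H (graph_of C I) \<and> total_weight H \<le> of_rat w)
         (selected_subgraph C I bs)})
     |I w. I \<in> inputs C \<and> w > 0}"

end

theory Submission
  imports Defs
begin

text \<open>The computation tableau of a verifier turns a problem in NP into a colouring problem for the
  sides of the cells of a grid, and this in turn becomes a weighted covering problem: buy items
  \<open>U1 u\<close>, \<open>U2 u\<close> (a Boolean variable is set to false or true) and \<open>Y j\<close> (a tuple of
  colours around a cell is given up) such that every constraint contains a bought item. An item of
  the first kind costs so much that it never pays to buy both \<open>U1 u\<close> and \<open>U2 u\<close>.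

  Covers are encoded by spanners of a graph of long chains issuing from a hub. Items are shortcuts
  around turns of the chains, and constraints are edges joining points of two chains on opposite
  sides of the hub, or such a point to the hub. The way along the chains exceeds \<open>t\<close> times
  the length of a constraint edge by less than a single bought shortcut saves. The unit edges of the
  chains belong to every light spanner, and a constraint edge costs more than it is worth; chains and
  shortcuts can be drawn without crossings. Scaling the plane by a large power of two in one
  direction makes Euclidean lengths integral up to an error that is negligible even for the total
  weight, so no precise knowledge of \<open>t\<close> is needed.

  The constraint that the machine accepts can also be satisfied by one additional item \<open>Y 0\<close>.
  A minimum weight spanner contains that edge iff the word is rejected, which reduces the search
  problems. For the dilation problem the budget always suffices for a 2-spanner, and exactly for
  accepted words it also pays for the edge \<open>Y 1\<close>, which every spanner of some smaller dilation
  must contain.\<close>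

subsection \<open>Stack programs and their compilation to Turing machines\<close>

text \<open>No NP-complete problem serves as the source: an arbitrary verifier is simulated
  directly. What depends on the verifier (the colours, hence the price ratio
  \<open>8 * K + 2\<close> and all lengths of a template) is constant across inputs. The obstacle is
  that \<open>t\<close> is an arbitrary real and Euclidean lengths are irrational, while a budget
  has to separate two values exactly. So the price of every item that enters a cover is a multiple
  of \<open>yl\<close>, one such unit is worth at least 3 units of length, and the errors of all
  edges together amount to at most 1/2. Distances in an unknown spanner are bounded from below by
  potentials, which only see the integral lengths \<open>len\<close>; distances in a known one are
  bounded from above by walks. A second obstacle is to write the instance down: programs compute
  with unary numbers of polynomial size, but coordinates are exponentially large. Powers of two as
  scales and slopes make the binary digits of a coordinate a fixed pattern padded by runs of zeros,
  which loops can print.\<close>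

type_synonym store = "nat \<Rightarrow> nat list"

datatype com = Push nat nat | Pop nat | Sq com com | Cond nat nat com com | Wh nat com

text \<open>The value 0 for an empty stack is the blank, which is what the head reads there. Since
  only 1 and 2 are ever pushed, reading 0 is at the same time the test for emptiness.\<close>

fun top :: "nat list \<Rightarrow> nat" where
  "top [] = 0"
| "top (a # _) = a"

text \<open>The number is the exact step count of the compiled code: a push moves the head and then
  writes, the first branch of \<open>Cond\<close> pays for the test and for the jump over the second
  branch, and an iteration of \<open>Wh\<close> pays for the test and for the jump back.\<close>

inductive run :: "com \<Rightarrow> store \<Rightarrow> nat \<Rightarrow> store \<Rightarrow> bool" where
  Push: "run (Push r a) s 2 (s(r := a # s r))"
| Pop: "run (Pop r) s 1 (s(r := tl (s r)))"
| Sq: "run c1 s n s' \<Longrightarrow> run c2 s' m s'' \<Longrightarrow> run (Sq c1 c2) s (n + m) s''"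
| CondT: "top (s r) = a \<Longrightarrow> run c1 s n s' \<Longrightarrow> run (Cond r a c1 c2) s (n + 2) s'"
| CondF: "top (s r) \<noteq> a \<Longrightarrow> run c2 s n s' \<Longrightarrow> run (Cond r a c1 c2) s (n + 1) s'"
| WhF: "s r = [] \<Longrightarrow> run (Wh r c) s 1 s"
| WhT: "s r \<noteq> [] \<Longrightarrow> run c s n s' \<Longrightarrow> run (Wh r c) s' m s'' \<Longrightarrow> run (Wh r c) s (n + m + 2) s''"

fun wf_com :: "nat \<Rightarrow> com \<Rightarrow> bool" where
  "wf_com K (Push r a) \<longleftrightarrow> r < K \<and> a \<in> {1, 2}"
| "wf_com K (Pop r) \<longleftrightarrow> r < K"
| "wf_com K (Sq c1 c2) \<longleftrightarrow> wf_com K c1 \<and> wf_com K c2"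
| "wf_com K (Cond r a c1 c2) \<longleftrightarrow> r < K \<and> wf_com K c1 \<and> wf_com K c2"
| "wf_com K (Wh r c) \<longleftrightarrow> r < K \<and> wf_com K c"

text \<open>An instruction works on a single tape; the read symbol determines the written symbol, the
  movement and the next state. Tape 0 holds its stack with the top to the left, so that the input
  is a stack already; all other tapes grow to the right.\<close>

type_synonym instr = "nat \<times> (nat \<Rightarrow> nat \<times> move \<times> nat)"

declare step.simps [simp del]

definition up :: "nat \<Rightarrow> move" where "up r = (if r = 0 then Go_Left else Go_Right)"
definition down :: "nat \<Rightarrow> move" where "down r = (if r = 0 then Go_Right else Go_Left)"

fun clen :: "com \<Rightarrow> nat" where
  "clen (Push r a) = 2"
| "clen (Pop r) = 1"
| "clen (Sq c1 c2) = clen c1 + clen c2"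
| "clen (Cond r a c1 c2) = clen c1 + clen c2 + 2"
| "clen (Wh r c) = clen c + 2"

text \<open>Addresses are machine states, so falling through means naming the next address. A plain
  jump is an instruction on tape 0 that writes back the symbol it reads.\<close>

fun comp :: "com \<Rightarrow> nat \<Rightarrow> instr list" where
  "comp (Push r a) l = [(r, \<lambda>x. (x, up r, l + 1)), (r, \<lambda>x. (a, Stay, l + 2))]"
| "comp (Pop r) l = [(r, \<lambda>x. (0, if x = 0 then Stay else down r, l + 1))]"
| "comp (Sq c1 c2) l = comp c1 l @ comp c2 (l + clen c1)"
| "comp (Cond r a c1 c2) l =
     [(r, \<lambda>x. (x, Stay, if x = a then l + 1 else l + clen c1 + 2))] @ comp c1 (l + 1) @
     [(0, \<lambda>x. (x, Stay, l + clen c1 + clen c2 + 2))] @ comp c2 (l + clen c1 + 2)"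
| "comp (Wh r c) l =
     [(r, \<lambda>x. (x, Stay, if x = 0 then l + clen c + 2 else l + 1))] @ comp c (l + 1) @
     [(0, \<lambda>x. (x, Stay, l))]"

lemma length_comp [simp]: "length (comp c l) = clen c"
  by (induction c arbitrary: l) auto

definition instr_delta :: "instr list \<Rightarrow> nat \<Rightarrow> nat list \<Rightarrow> nat \<times> (nat \<times> move) list" where
  "instr_delta is q syms = (if q < length is then
     (let (a, m, q') = snd (is ! q) (syms ! fst (is ! q))
      in (q', (map (\<lambda>x. (x, Stay)) syms)[fst (is ! q) := (a, m)]))
     else (1, map (\<lambda>x. (x, Stay)) syms))"

definition code_at :: "instr list \<Rightarrow> nat \<Rightarrow> instr list \<Rightarrow> bool" where
  "code_at is l c \<longleftrightarrow> l + length c \<le> length is \<and> (\<forall>i<length c. is ! (l + i) = c ! i)"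

lemma code_at_append:
  "code_at is l (c1 @ c2) \<longleftrightarrow> code_at is l c1 \<and> code_at is (l + length c1) c2"
proof
  assume *: "code_at is l (c1 @ c2)"
  have "is ! (l + length c1 + i) = c2 ! i" if "i < length c2" for i
    using * that unfolding code_at_def
    by (metis add.assoc add_less_cancel_left length_append nth_append_length_plus)
  moreover have "is ! (l + i) = c1 ! i" if "i < length c1" for i
    using * that unfolding code_at_def by (simp add: nth_append)
  ultimately show "code_at is l c1 \<and> code_at is (l + length c1) c2"
    using * by (simp add: code_at_def)
next
  assume *: "code_at is l c1 \<and> code_at is (l + length c1) c2"
  have "is ! (l + i) = (c1 @ c2) ! i" if "i < length (c1 @ c2)" for i
  proof (cases "i < length c1")
    case False
    then obtain j where j: "i = length c1 + j" by (metis le_Suc_ex not_less)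
    then show ?thesis using * that by (simp add: code_at_def add.assoc[symmetric])
  qed (use * in \<open>simp add: code_at_def nth_append\<close>)
  then show "code_at is l (c1 @ c2)" using * by (simp add: code_at_def)
qed

lemma code_at_Cons:
  "code_at is l (i # c) \<longleftrightarrow> l < length is \<and> is ! l = i \<and> code_at is (Suc l) c"
  using code_at_append[of "is" l "[i]" c] by (auto simp: code_at_def)

lemma code_at_Nil [simp]: "code_at is l [] \<longleftrightarrow> l \<le> length is"
  by (simp add: code_at_def)

definition dir :: "nat \<Rightarrow> int" where "dir r = (if r = 0 then -1 else 1)"

text \<open>Tape \<open>out\<close> is the one whose contents are read off at the end: its stack starts at cell 0.\<close>

definition holds_stack :: "nat \<Rightarrow> nat \<Rightarrow> nat list \<Rightarrow> tape \<Rightarrow> bool" where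
  "holds_stack out r l T \<longleftrightarrow>
     (\<forall>i. fst T (snd T - dir r * int i) = (if i < length l then l ! i else 0)) \<and>
     (\<forall>i. fst T (snd T + dir r * int (Suc i)) = 0) \<and>
     (r \<noteq> 0 \<longrightarrow> snd T = int (length l) - (if r = out then 1 else 0)) \<and> set l \<subseteq> {1, 2}"

definition holds_store :: "nat \<Rightarrow> nat \<Rightarrow> store \<Rightarrow> tape list \<Rightarrow> bool" where
  "holds_store out K s Ts \<longleftrightarrow> length Ts = K \<and> (\<forall>r<K. holds_stack out r (s r) (Ts ! r))"

lemma holds_stack_read: "holds_stack out r l T \<Longrightarrow> read T = top l"
  by (cases l) (auto simp: holds_stack_def read_def dest!: spec[of _ 0])

lemma top_eq_0: "set l \<subseteq> {1, 2} \<Longrightarrow> top l = 0 \<longleftrightarrow> l = []"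
  by (cases l) auto

lemma map2_act_update:
  assumes "length Ts = K" "r < K"
  shows "map2 act ((map (\<lambda>x. (x, Stay)) (map read Ts))[r := (a, m)]) Ts = Ts[r := act (a, m) (Ts ! r)]"
proof (rule nth_equalityI)
  show "length (map2 act ((map (\<lambda>x. (x, Stay)) (map read Ts))[r := (a, m)]) Ts) =
      length (Ts[r := act (a, m) (Ts ! r)])" by simp
next
  fix i assume "i < length (map2 act ((map (\<lambda>x. (x, Stay)) (map read Ts))[r := (a, m)]) Ts)"
  then have i: "i < length Ts" by simp
  have *: "act (read T, Stay) T = T" for T
    by (cases T) (simp add: read_def)
  show "map2 act ((map (\<lambda>x. (x, Stay)) (map read Ts))[r := (a, m)]) Ts ! i = Ts[r := act (a, m) (Ts ! r)] ! i"
    using i assms * by (cases "i = r") (auto simp: nth_list_update)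
qed

lemma holds_stack_push:
  assumes "holds_stack out r l T" "a \<in> {1, 2}" "out \<noteq> 0"
  shows "holds_stack out r (a # l) (act (a, Stay) (act (read T, up r) T))"
proof -
  obtain c h where T: "T = (c, h)" by force
  have d: "dir r = 1 \<or> dir r = -1" "dir r \<noteq> 0" by (auto simp: dir_def)
  have 1: "act (a, Stay) (act (read T, up r) T) = (c(h + dir r := a), h + dir r)"
    by (auto simp: T read_def up_def dir_def)
  have A: "\<And>i. c (h - dir r * int i) = (if i < length l then l ! i else 0)"
    and B: "\<And>i. c (h + dir r * int (Suc i)) = 0"
    using assms by (auto simp: holds_stack_def T)
  have "(c(h + dir r := a)) (h + dir r - dir r * int i) =
      (if i < length (a # l) then (a # l) ! i else 0)" for i
  proof (cases i)
    case (Suc j)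
    have *: "h + dir r - dir r * int i = h - dir r * int j"
      by (simp add: Suc algebra_simps)
    have "h - dir r * int j \<noteq> h + dir r" using d by auto
    then show ?thesis unfolding * using A[of j] by (simp add: Suc)
  qed simp
  moreover have "(c(h + dir r := a)) (h + dir r + dir r * int (Suc i)) = 0" for i
    using B[of "Suc i"] d by (auto simp: algebra_simps)
  moreover have "r \<noteq> 0 \<longrightarrow> h + dir r = int (length (a # l)) - (if r = out then 1 else 0)"
    using assms by (auto simp: holds_stack_def T dir_def)
  ultimately show ?thesis
    using assms unfolding 1 holds_stack_def by (auto simp: T)
qed

text \<open>Popping an empty stack must leave the head in place, in accordance with
  \<open>tl [] = []\<close>; the symbol read tells the two cases apart because no entry of a stack
  is blank.\<close>

lemma holds_stack_pop:
  assumes "holds_stack out r l T" "out \<noteq> 0"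
  shows "holds_stack out r (tl l) (act (0, if top l = 0 then Stay else down r) T)"
proof (cases l)
  case Nil
  then show ?thesis
    using assms by (cases T) (auto simp: holds_stack_def)
next
  case (Cons a l')
  obtain c h where T: "T = (c, h)" by force
  have d: "dir r = 1 \<or> dir r = -1" "dir r \<noteq> 0" by (auto simp: dir_def)
  have "top l \<noteq> 0" using assms by (auto simp: holds_stack_def Cons)
  then have 1: "act (0, if top l = 0 then Stay else down r) T = (c(h := 0), h - dir r)"
    by (auto simp: T down_def dir_def)
  have A: "\<And>i. c (h - dir r * int i) = (if i < length l then l ! i else 0)"
    and B: "\<And>i. c (h + dir r * int (Suc i)) = 0"
    using assms by (auto simp: holds_stack_def T)
  have "(c(h := 0)) (h - dir r - dir r * int i) = (if i < length l' then l' ! i else 0)" for i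
    using A[of "Suc i"] d by (auto simp: Cons algebra_simps)
  moreover have "(c(h := 0)) (h - dir r + dir r * int (Suc i)) = 0" for i
    using B[of "i - 1"] d by (cases i) (auto simp: algebra_simps)
  moreover have "r \<noteq> 0 \<longrightarrow> h - dir r = int (length l') - (if r = out then 1 else 0)"
    using assms by (auto simp: holds_stack_def T dir_def Cons)
  ultimately show ?thesis
    using assms unfolding 1 holds_stack_def by (auto simp: T Cons)
qed

text \<open>State \<open>0\<close> only moves the head of the output tape to cell \<open>-1\<close>, so that the first
  pushed symbol lands in cell \<open>0\<close>; the code itself starts in state \<open>2\<close>.\<close>

definition code_of :: "nat \<Rightarrow> instr list \<Rightarrow> instr list" where
  "code_of out c = (out, \<lambda>x. (x, Go_Left, 2)) # (0, \<lambda>x. (x, Stay, 1)) # c"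

lemma length_code_of: "length (code_of out c) = length c + 2"
  by (simp add: code_of_def)

text \<open>States below \<open>lim\<close> are never query states, so there a step executes one
  instruction whatever the oracle \<open>f\<close> is. Ordinary machines and the part of an oracle
  machine before its query are thus treated alike.\<close>

locale code_machine =
  fixes M :: machine and code :: "instr list" and f :: "bool list \<Rightarrow> bool list"
    and out K lim :: nat
  assumes out: "0 < out" "out < K" and delta: "delta M = instr_delta code"
    and query: "\<And>q. query_state M = Some q \<Longrightarrow> lim \<le> q" and lim: "lim \<le> length code"
begin

lemma step_instr:
  assumes "q < lim" "q \<noteq> 1" "code ! q = (r, g)" "r < K" "length Ts = K"
    "g (read (Ts ! r)) = (a, m, q')"
  shows "step M f (q, Ts) = (q', Ts[r := act (a, m) (Ts ! r)])"
proof -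
  have "query_state M \<noteq> Some q" "q < length code" using query assms(1) lim by force+
  moreover have "map read Ts ! r = read (Ts ! r)" using assms by simp
  ultimately show ?thesis
    using assms map2_act_update[OF assms(5,4), of a m] by (simp add: delta instr_delta_def step.simps)
qed

lemma holds_store_update:
  assumes "holds_store out K s Ts" "holds_stack out r l T" "r < K"
  shows "holds_store out K (s(r := l)) (Ts[r := T])"
  using assms by (auto simp: holds_store_def nth_list_update)

lemma act_read: "act (read T, Stay) T = T"
  by (cases T) (simp add: read_def)

lemma step_jump:
  assumes "q < lim" "q \<noteq> 1" "code ! q = (r, g)" "r < K" "length Ts = K"
    "g (read (Ts ! r)) = (read (Ts ! r), Stay, q')"
  shows "step M f (q, Ts) = (q', Ts)"
  using step_instr[OF assms] by (simp add: act_read)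

text \<open>The induction follows the derivation of \<open>run\<close>, not the program, because a
  loop executes the same code at the same address again. The assumption \<open>2 \<le> l\<close>
  keeps the code away from the halting state 1, in which \<open>step\<close> does nothing.\<close>

lemma run_comp:
  assumes "run c s n s'" "wf_com K c" "code_at code l (comp c l)" "l + clen c \<le> lim" "2 \<le> l"
    "holds_store out K s Ts"
  shows "\<exists>Ts'. (step M f ^^ n) (l, Ts) = (l + clen c, Ts') \<and> holds_store out K s' Ts'"
  using assms
proof (induction arbitrary: l Ts rule: run.induct)
  case (Push r a s)
  let ?T = "Ts ! r"
  let ?T1 = "act (read ?T, up r) ?T"
  have r: "r < K" "length Ts = K" "holds_stack out r (s r) ?T"
    using Push by (auto simp: holds_store_def)
  have 1: "step M f (l, Ts) = (l + 1, Ts[r := ?T1])"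
    by (rule step_instr) (use Push r in \<open>auto simp: code_at_Cons\<close>)
  have 2: "step M f (l + 1, Ts[r := ?T1]) = (l + 2, (Ts[r := ?T1])[r := act (a, Stay) (Ts[r := ?T1] ! r)])"
    by (rule step_instr) (use Push r in \<open>auto simp: code_at_Cons\<close>)
  have "holds_store out K (s(r := a # s r)) (Ts[r := act (a, Stay) ?T1])"
    by (rule holds_store_update) (use Push r out holds_stack_push in auto)
  moreover have "(step M f ^^ 2) (l, Ts) = (l + 2, Ts[r := act (a, Stay) ?T1])"
    using 1 2 r by (simp add: numeral_2_eq_2)
  ultimately show ?case by (auto simp: fun_upd_def)
next
  case (Pop r s)
  let ?T = "Ts ! r"
  have r: "r < K" "length Ts = K" "holds_stack out r (s r) ?T"
    using Pop by (auto simp: holds_store_def)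
  have 1: "step M f (l, Ts) = (l + 1, Ts[r := act (0, if read ?T = 0 then Stay else down r) ?T])"
    by (rule step_instr) (use Pop r in \<open>auto simp: code_at_Cons\<close>)
  have "holds_store out K (s(r := tl (s r))) (Ts[r := act (0, if top (s r) = 0 then Stay else down r) ?T])"
    by (rule holds_store_update) (use Pop r out holds_stack_pop in auto)
  then show ?case using 1 r by (simp add: holds_stack_read[OF r(3)] fun_upd_def)
next
  case (Sq c1 s n s' c2 m s'')
  have c: "code_at code l (comp c1 l)" "code_at code (l + clen c1) (comp c2 (l + clen c1))"
    using Sq.prems by (auto simp: code_at_append)
  obtain T1 where 1: "(step M f ^^ n) (l, Ts) = (l + clen c1, T1)" "holds_store out K s' T1"
    using Sq.IH(1)[OF _ c(1)] Sq.prems by auto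
  obtain T2 where 2: "(step M f ^^ m) (l + clen c1, T1) = (l + clen c1 + clen c2, T2)"
      "holds_store out K s'' T2"
    using Sq.IH(2)[OF _ c(2)] Sq.prems 1 by auto
  show ?case using 1 2 by (simp add: add.commute[of n m] funpow_add add.assoc)
next
  case (CondT s r a c1 n s' c2)
  have r: "r < K" "length Ts = K" "read (Ts ! r) = top (s r)"
    using CondT by (auto simp: holds_store_def holds_stack_read)
  have c0: "code ! l = (r, \<lambda>x. (x, Stay, if x = a then l + 1 else l + clen c1 + 2))"
    using CondT.prems by (auto simp: code_at_Cons)
  have c: "code_at code (l + 1) (comp c1 (l + 1))"
      "code ! (l + clen c1 + 1) = (0, \<lambda>x. (x, Stay, l + clen c1 + clen c2 + 2))"
    using CondT.prems by (auto simp: code_at_append code_at_Cons)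
  have 1: "step M f (l, Ts) = (l + 1, Ts)"
    by (rule step_jump[OF _ _ c0]) (use CondT r in auto)
  obtain T1 where 2: "(step M f ^^ n) (l + 1, Ts) = (l + 1 + clen c1, T1)" "holds_store out K s' T1"
    using CondT.IH[OF _ c(1)] CondT.prems by auto
  have 3: "step M f (l + clen c1 + 1, T1) = (l + clen c1 + clen c2 + 2, T1)"
    by (rule step_jump[OF _ _ c(2)]) (use CondT.prems 2 r in \<open>auto simp: holds_store_def\<close>)
  show ?case using 1 2 3 by (simp add: funpow_swap1)
next
  case (CondF s r a c2 n s' c1)
  have r: "r < K" "length Ts = K" "read (Ts ! r) = top (s r)"
    using CondF by (auto simp: holds_store_def holds_stack_read)
  have c0: "code ! l = (r, \<lambda>x. (x, Stay, if x = a then l + 1 else l + clen c1 + 2))"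
    using CondF.prems by (auto simp: code_at_Cons)
  have c: "code_at code (l + clen c1 + 2) (comp c2 (l + clen c1 + 2))"
    using CondF.prems by (auto simp: code_at_append code_at_Cons)
  have 1: "step M f (l, Ts) = (l + clen c1 + 2, Ts)"
    by (rule step_jump[OF _ _ c0]) (use CondF r in auto)
  obtain T1 where 2: "(step M f ^^ n) (l + clen c1 + 2, Ts) = (l + clen c1 + 2 + clen c2, T1)"
      "holds_store out K s' T1"
    using CondF.IH[OF _ c(1)] CondF.prems by auto
  show ?case using 1 2 by (simp add: funpow_swap1 algebra_simps)
next
  case (WhF s r c)
  have r: "r < K" "length Ts = K" "read (Ts ! r) = top (s r)"
    using WhF by (auto simp: holds_store_def holds_stack_read)
  have c0: "code ! l = (r, \<lambda>x. (x, Stay, if x = 0 then l + clen c + 2 else l + 1))"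
    using WhF.prems by (auto simp: code_at_Cons)
  have 1: "step M f (l, Ts) = (l + clen c + 2, Ts)"
    by (rule step_jump[OF _ _ c0]) (use WhF r in auto)
  then show ?case using WhF by (simp add: algebra_simps)
next
  case (WhT s r c n s' m s'')
  have r: "r < K" "length Ts = K" "read (Ts ! r) = top (s r)" "top (s r) \<noteq> 0"
    using WhT top_eq_0[of "s r"] by (auto simp: holds_store_def holds_stack_read, simp add: holds_stack_def)
  have c: "code_at code (l + 1) (comp c (l + 1))"
      "code ! (l + clen c + 1) = (0, \<lambda>x. (x, Stay, l))"
    using WhT.prems by (auto simp: code_at_append code_at_Cons)
  have c0: "code ! l = (r, \<lambda>x. (x, Stay, if x = 0 then l + clen c + 2 else l + 1))"
    using WhT.prems by (auto simp: code_at_Cons)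
  have 1: "step M f (l, Ts) = (l + 1, Ts)"
    by (rule step_jump[OF _ _ c0]) (use WhT r in auto)
  obtain T1 where 2: "(step M f ^^ n) (l + 1, Ts) = (l + 1 + clen c, T1)" "holds_store out K s' T1"
    using WhT.IH(1)[OF _ c(1)] WhT.prems by auto
  have 3: "step M f (l + clen c + 1, T1) = (l, T1)"
    by (rule step_jump[OF _ _ c(2)]) (use WhT.prems 2 r in \<open>auto simp: holds_store_def\<close>)
  obtain T2 where 4: "(step M f ^^ m) (l, T1) = (l + clen (Wh r c), T2)" "holds_store out K s'' T2"
    using WhT.IH(2)[OF _ WhT.prems(2)] WhT.prems 2 by auto
  have "n + m + 2 = m + (1 + (n + 1))" by simp
  then have "(step M f ^^ (n + m + 2)) (l, Ts) = (step M f ^^ m) ((step M f ^^ 1) ((step M f ^^ n) ((step M f ^^ 1) (l, Ts))))"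
    by (simp only: funpow_add o_def)
  then show ?case using 1 2 3 4 by simp
qed

end

section \<open>Input, output and oracle answer of compiled programs\<close>

definition bits :: "bool list \<Rightarrow> nat list" where
  "bits x = map (\<lambda>b. if b then 2 else 1) x"

definition init_store :: "bool list \<Rightarrow> store" where
  "init_store x = (\<lambda>r. if r = 0 then bits x else [])"

definition instr_ok :: "nat \<Rightarrow> nat \<Rightarrow> instr \<Rightarrow> bool" where
  "instr_ok K N i \<longleftrightarrow> fst i < K \<and>
     (\<forall>x<3. fst (snd i x) < 3 \<and> snd (snd (snd i x)) < N)"

lemma instr_ok_comp:
  assumes "wf_com K c" "l + clen c < N" "0 < K" "i \<in> set (comp c l)"
  shows "instr_ok K N i"
  using assms
proof (induction c arbitrary: l)
  case (Sq c1 c2)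
  have "instr_ok K N i" if "i \<in> set (comp c1 l)"
    by (rule Sq.IH(1)) (use Sq.prems that in auto)
  moreover have "instr_ok K N i" if "i \<in> set (comp c2 (l + clen c1))"
    by (rule Sq.IH(2)) (use Sq.prems that in auto)
  ultimately show ?case using Sq.prems by auto
next
  case (Cond r a c1 c2)
  have "instr_ok K N i" if "i \<in> set (comp c1 (l + 1))"
    by (rule Cond.IH(1)[of "l + 1"]) (use Cond.prems that in auto)
  moreover have "instr_ok K N i" if "i \<in> set (comp c2 (l + clen c1 + 2))"
    by (rule Cond.IH(2)[of "l + clen c1 + 2"]) (use Cond.prems that in auto)
  ultimately show ?case using Cond.prems by (auto simp: instr_ok_def)
next
  case (Wh r c)
  have "instr_ok K N i" if "i \<in> set (comp c (l + 1))"
    by (rule Wh.IH[of "l + 1"]) (use Wh.prems that in auto)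
  then show ?case using Wh.prems by (auto simp: instr_ok_def)
qed (auto simp: instr_ok_def)

lemma wf_instr_delta:
  assumes "delta M = instr_delta code" "n_states M = length code" "n_symbols M = 3"
    "\<And>i. i \<in> set code \<Longrightarrow> instr_ok (n_tapes M) (length code) i" "2 \<le> n_tapes M" "2 \<le> length code"
    "query_state M \<noteq> None \<Longrightarrow> n_tapes M \<ge> 3 \<and> answer_state M < n_states M"
  shows "wf_machine M"
proof -
  have "fst (delta M q syms) < n_states M \<and> length (snd (delta M q syms)) = n_tapes M \<and>
      fst ` set (snd (delta M q syms)) \<subseteq> {..<n_symbols M}"
    if *: "q < n_states M" "length syms = n_tapes M" "set syms \<subseteq> {..<n_symbols M}" for q syms
  proof -
    obtain r g where i: "code ! q = (r, g)" by force
    have ok: "instr_ok (n_tapes M) (length code) (r, g)"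
      using assms(4)[of "code ! q"] *(1) assms(2) i by (metis nth_mem)
    obtain a m q' where g: "g (syms ! r) = (a, m, q')" by (metis prod_cases3)
    have "syms ! r \<in> set syms" using ok *(2) by (simp add: instr_ok_def)
    then have "syms ! r < 3" using *(3) assms(3) by auto
    then have "a < 3" "q' < length code" using ok g by (auto simp: instr_ok_def)
    moreover have "delta M q syms = (q', (map (\<lambda>x. (x, Stay)) syms)[r := (a, m)])"
      using *(1) assms(1,2) by (simp add: instr_delta_def i g)
    ultimately show ?thesis
      using * assms(2,3) set_update_subset_insert[of "map (\<lambda>x. (x, Stay)) syms" r "(a, m)"]
      by (auto dest!: subsetD)
  qed
  then show ?thesis using assms by (simp add: wf_machine_def)
qed

text \<open>The bottom of the output stack lies in cell 0 and the first blank is the cell above its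
  top, so the output is the stack read from the bottom. This is why programs must leave
  \<open>rev\<close> of the desired word.\<close>

lemma contents_stack:
  assumes "holds_stack out out l T" "0 < out"
  shows "contents T = map (\<lambda>a. a = 2) (rev l)"
proof -
  obtain c h where T: "T = (c, h)" by force
  have h: "h = int (length l) - 1" and l: "set l \<subseteq> {1, 2}"
    using assms by (auto simp: holds_stack_def T)
  have A: "\<And>i. c (h - int i) = (if i < length l then l ! i else 0)"
    and B: "\<And>i. c (h + int (Suc i)) = 0"
    using assms by (auto simp: holds_stack_def T dir_def)
  have C: "c (int i) = rev l ! i" if "i < length l" for i
  proof -
    have "h - int (length l - Suc i) = int i" using that h by simp
    then have "c (int i) = l ! (length l - Suc i)" using A[of "length l - Suc i"] that by (simp only: if_True) simp
    then show ?thesis using that by (simp add: rev_nth)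
  qed
  have "(LEAST n. c (int n) \<notin> {1, 2}) = length l"
  proof (rule Least_equality)
    show "c (int (length l)) \<notin> {1, 2}" using B[of 0] h by simp
  next
    fix n assume n: "c (int n) \<notin> {1, 2}"
    show "length l \<le> n"
    proof (rule ccontr)
      assume "\<not> length l \<le> n"
      then have "c (int n) \<in> set l" using C[of n] nth_mem[of n "rev l"] by simp
      then show False using n l by auto
    qed
  qed
  then show ?thesis
    using C by (intro nth_equalityI) (auto simp: contents_def T)
qed

lemma bits_inverse [simp]: "map (\<lambda>a. a = 2) (bits x) = x"
  by (induction x) (auto simp: bits_def)

lemma contents_bits:
  "holds_stack out out (rev (bits x)) T \<Longrightarrow> 0 < out \<Longrightarrow> contents T = x"
  using contents_stack[of out "rev (bits x)" T] by simp

lemma holds_init: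
  assumes "0 < out" "out < K"
  shows "holds_store out K (init_store x)
    ((tape_of x # replicate (K - 1) (tape_of []))[out := act (0, Go_Left) (tape_of [])])"
proof -
  have 1: "holds_stack out 0 (bits x) (tape_of x)"
    using assms by (auto simp: holds_stack_def tape_of_def bits_def dir_def)
  have 2: "holds_stack out r [] (tape_of [])" if "r \<noteq> out" for r
    using that by (auto simp: holds_stack_def tape_of_def)
  have 3: "holds_stack out out [] (act (0, Go_Left) (tape_of []))"
    by (auto simp: holds_stack_def tape_of_def)
  show ?thesis
    unfolding holds_store_def
    using assms 1 2 3
    by (auto simp: nth_list_update nth_Cons' init_store_def simp del: list_update.simps)
qed

lemma (in code_machine) run_from_init:
  assumes "run c (init_store x) n s" "wf_com K c" "code_at code 0 (code_of out (comp c 2))"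
    "lim = 2 + clen c" "n_tapes M = K"
  shows "\<exists>Ts. (step M f ^^ (n + 1)) (init_config M x) = (2 + clen c, Ts) \<and> holds_store out K s Ts"
proof -
  let ?Ts = "tape_of x # replicate (K - 1) (tape_of [])"
  have c: "code ! 0 = (out, \<lambda>x. (x, Go_Left, 2))" "code_at code 2 (comp c 2)"
    using assms(3) by (auto simp: code_of_def code_at_Cons numeral_2_eq_2)
  have o: "?Ts ! out = tape_of []" using out by (cases out) auto
  have r: "read (tape_of []) = 0" by (simp add: read_def tape_of_def)
  have "step M f (0, ?Ts) = (2, ?Ts[out := act (0, Go_Left) (?Ts ! out)])"
    by (rule step_instr[OF _ _ c(1)]) (use out assms o r in auto)
  then have "step M f (0, ?Ts) = (2, ?Ts[out := act (0, Go_Left) (tape_of [])])"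
    unfolding o .
  moreover obtain Ts where "(step M f ^^ n) (2, ?Ts[out := act (0, Go_Left) (tape_of [])]) =
      (2 + clen c, Ts)" "holds_store out K s Ts"
    using run_comp[OF assms(1,2) c(2) _ _ holds_init[OF out]] assms(4) by auto
  moreover have "(step M f ^^ (n + 1)) (init_config M x) = (step M f ^^ n) (step M f (0, ?Ts))"
    by (simp add: init_config_def assms(5) funpow_swap1)
  ultimately show ?thesis by simp
qed

lemma code_at_prefix: "code_at (c @ d) 0 c"
  by (simp add: code_at_def nth_append)

lemma contents_single:
  assumes "a \<in> {1, 2}"
  shows "contents (\<lambda>i. if i = 0 then a else 0, h) = [a = 2]"
proof -
  have "(LEAST n. fst (\<lambda>i. if i = 0 then a else 0, h) (int n) \<notin> {1, 2}) = 1"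
    by (rule Least_equality) (use assms in \<open>auto simp: Suc_le_eq split: if_splits\<close>)
  then show ?thesis unfolding contents_def by simp
qed

theorem poly_time_run:
  assumes "wf_com K c" "2 \<le> K"
    and "\<And>x. \<exists>n s. n \<le> poly p (length x) \<and> run c (init_store x) n s \<and> s 1 = rev (bits (g x))"
  shows "poly_time g"
proof -
  define code where "code = code_of 1 (comp c 2) @ [(0, \<lambda>x. (x, Stay, 1))]"
  define M where "M = \<lparr>n_tapes = K, n_states = length code, n_symbols = 3,
     delta = instr_delta code, query_state = None, answer_state = 0\<rparr>"
  have len: "length code = clen c + 3" by (simp add: code_def length_code_of)
  have cl: "code ! (2 + clen c) = (0, \<lambda>x. (x, Stay, 1))"
    by (simp add: code_def code_of_def nth_append)
  have wf: "wf_machine M"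
  proof (rule wf_instr_delta[where code = code])
    fix i assume "i \<in> set code"
    moreover have "instr_ok K (length code) i" if "i \<in> set (comp c 2)"
      by (rule instr_ok_comp[OF assms(1) _ _ that]) (use assms len in auto)
    ultimately show "instr_ok (n_tapes M) (length code) i"
      using assms(2) len by (auto simp: code_def M_def code_of_def instr_ok_def)
  qed (auto simp: M_def assms len)
  interpret A: code_machine M code "\<lambda>_. []" 1 K "2 + clen c"
    by unfold_locales (use assms len in \<open>auto simp: M_def\<close>)
  \<comment> \<open>The limit is moved past the end of the program, so that the final jump to state
    1 can be executed.\<close>
  interpret B: code_machine M code "\<lambda>_. []" 1 K "3 + clen c"
    by unfold_locales (use assms len in \<open>auto simp: M_def\<close>)
  have "computes_within M (\<lambda>_. []) (p + [:2:]) g"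
    unfolding computes_within_def
  proof
    fix x
    obtain n s where n: "n \<le> poly p (length x)" "run c (init_store x) n s" "s 1 = rev (bits (g x))"
      using assms(3) by blast
    obtain Ts where 1: "(step M (\<lambda>_. []) ^^ (n + 1)) (init_config M x) = (2 + clen c, Ts)"
        "holds_store 1 K s Ts"
      using A.run_from_init[OF n(2) assms(1)] by (auto simp: code_def code_at_prefix M_def)
    have 2: "step M (\<lambda>_. []) (2 + clen c, Ts) = (1, Ts)"
      by (rule B.step_jump[OF _ _ cl]) (use 1 assms in \<open>auto simp: holds_store_def\<close>)
    have "holds_stack 1 1 (rev (bits (g x))) (Ts ! 1)"
      using 1(2) assms n(3) by (auto simp: holds_store_def dest!: spec[of _ 1])
    then have "contents (Ts ! 1) = g x" by (rule contents_bits) simp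
    moreover have "(step M (\<lambda>_. []) ^^ (n + 2)) (init_config M x) = (1, Ts)"
      using 1 2 by (simp add: numeral_2_eq_2)
    ultimately show "\<exists>n\<le>poly (p + [:2:]) (length x). fst ((step M (\<lambda>_. []) ^^ n) (init_config M x)) = 1 \<and>
      contents (snd ((step M (\<lambda>_. []) ^^ n) (init_config M x)) ! 1) = g x"
      using n(1) by (intro exI[of _ "n + 2"]) simp
  qed
  then show ?thesis
    unfolding poly_time_def using wf by (auto simp: M_def)
qed

text \<open>A single query suffices, made by running into the query state right behind the program.
  The program leaves tape 1 empty, so the bit written there afterwards is the whole output. The time
  bound is uniform in the solver since only the first \<open>pos + 1\<close> cells of the answer are
  visited.\<close>

theorem Turing_reducible_run:
  assumes "wf_com K c" "3 \<le> K"
    and "\<And>x. \<exists>n s. n \<le> poly p (length x) \<and> run c (init_store x) n s \<and>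
          s 1 = [] \<and> s 2 = rev (bits (g x))"
    and "\<And>x f. solves f P \<Longrightarrow> pos < length (f (g x)) \<and> (f (g x) ! pos \<noteq> neg \<longleftrightarrow> x \<in> A)"
  shows "Turing_reducible A P"
proof -
  define L where "L = 2 + clen c"
  \<comment> \<open>The first entry merely occupies the address \<open>L\<close> of the query state,
    where no instruction is executed. Entries \<open>1\<close> to \<open>pos\<close> move along the
    answer, entry \<open>pos + 1\<close> inspects the bit, and the last two write it to tape
    1.\<close>
  define d :: "instr list" where "d = (0, \<lambda>x::nat. (x, Stay, 1::nat)) #
    map (\<lambda>i. (2, \<lambda>x. (x, Go_Right, L + i + 2))) [0..<pos] @
    [(2, \<lambda>x. (x, Stay, if (x = 2) \<noteq> neg then L + pos + 2 else L + pos + 3)),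
     (1, \<lambda>x. (2, Stay, 1)), (1, \<lambda>x. (1, Stay, 1))]"
  define code where "code = code_of 2 (comp c 2) @ d"
  define M where "M = \<lparr>n_tapes = K, n_states = length code, n_symbols = 3,
     delta = instr_delta code, query_state = Some L, answer_state = L + 1\<rparr>"
  have len: "length code = L + pos + 4" by (simp add: code_def length_code_of d_def L_def)
  have cd: "code ! (L + i) = d ! i" for i
    by (simp add: code_def nth_append length_code_of L_def)
  have c1: "code ! (L + i + 1) = (2, \<lambda>x. (x, Go_Right, L + i + 2))" if "i < pos" for i
    using cd[of "i + 1"] that by (simp add: d_def nth_append)
  have c2: "code ! (L + pos + 1) = (2, \<lambda>x. (x, Stay, if (x = 2) \<noteq> neg then L + pos + 2 else L + pos + 3))"
    "code ! (L + pos + 2) = (1, \<lambda>x. (2, Stay, 1))" "code ! (L + pos + 3) = (1, \<lambda>x. (1, Stay, 1))"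
    using cd[of "pos + 1"] cd[of "pos + 2"] cd[of "pos + 3"]
    by (auto simp: d_def nth_append numeral_2_eq_2 numeral_3_eq_3)
  have wf: "wf_machine M"
  proof (rule wf_instr_delta[where code = code])
    fix i assume "i \<in> set code"
    moreover have "instr_ok K (length code) i" if "i \<in> set (comp c 2)"
      by (rule instr_ok_comp[OF assms(1) _ _ that]) (use assms len in \<open>auto simp: L_def\<close>)
    ultimately show "instr_ok (n_tapes M) (length code) i"
      using assms(2) unfolding len by (auto simp: code_def d_def M_def code_of_def instr_ok_def L_def)
  qed (use assms in \<open>auto simp: M_def len\<close>)
  have "computes_within M f (p + [:pos + 4:]) (\<lambda>x. [x \<in> A])" if f: "solves f P" for f
    unfolding computes_within_def
  proof
    fix x
    interpret A: code_machine M code f 2 K L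
      by unfold_locales (use assms len in \<open>auto simp: M_def\<close>)
    have delta: "delta M = instr_delta code" "query_state M = Some L" "answer_state M = L + 1"
      by (simp_all add: M_def)
    have step: "step M f (q, Ts) = (q', Ts[r := act (a, m) (Ts ! r)])"
      if "q < length code" "L < q" "code ! q = (r, g)" "r < K" "length Ts = K"
        "g (read (Ts ! r)) = (a, m, q')" for q r g Ts a m q'
      using that map2_act_update[OF that(5,4), of a m]
      by (simp add: delta instr_delta_def step.simps L_def)
    obtain n s where n: "n \<le> poly p (length x)" "run c (init_store x) n s"
        "s 1 = []" "s 2 = rev (bits (g x))"
      using assms(3) by blast
    obtain Ts where 1: "(step M f ^^ (n + 1)) (init_config M x) = (L, Ts)" "holds_store 2 K s Ts"
      using A.run_from_init[OF n(2) assms(1)] by (auto simp: code_def code_at_prefix M_def L_def)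
    have Ts: "length Ts = K" "holds_stack 2 2 (rev (bits (g x))) (Ts ! 2)" "holds_stack 2 1 [] (Ts ! 1)"
      using 1(2) assms n by (auto simp: holds_store_def dest: spec[of _ 1] spec[of _ 2])
    define z where "z = f (g x)"
    have z: "pos < length z" "(z ! pos \<noteq> neg) = (x \<in> A)" using assms(4)[OF f] by (auto simp: z_def)
    define Tz where "Tz i = Ts[2 := (fst (tape_of z), int i)]" for i
    have 2: "step M f (L, Ts) = (L + 1, Tz 0)"
      using contents_bits[OF Ts(2)]
      by (simp add: step.simps delta Tz_def z_def tape_of_def L_def)
    have 3: "(step M f ^^ i) (L + 1, Tz 0) = (L + i + 1, Tz i)" if "i \<le> pos" for i
      using that
    proof (induction i)
      case (Suc i)
      have "step M f (L + i + 1, Tz i) = (L + i + 2, (Tz i)[2 := act (read (Tz i ! 2), Go_Right) (Tz i ! 2)])"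
        by (rule step[OF _ _ c1]) (use Suc assms Ts len in \<open>auto simp: Tz_def\<close>)
      also have "act (read (Tz i ! 2), Go_Right) (Tz i ! 2) = (fst (tape_of z), int (Suc i))"
        using assms Ts by (simp add: Tz_def read_def)
      also have "(Tz i)[2 := (fst (tape_of z), int (Suc i))] = Tz (Suc i)"
        unfolding Tz_def list_update_overwrite ..
      finally show ?case using Suc by simp
    qed simp
    let ?b = "z ! pos \<noteq> neg"
    have rd: "read (Tz pos ! 2) = (if z ! pos then 2 else 1)"
      using z assms Ts by (simp add: Tz_def read_def tape_of_def)
    have 4: "step M f (L + pos + 1, Tz pos) = (if ?b then L + pos + 2 else L + pos + 3, Tz pos)"
    proof -
      have "step M f (L + pos + 1, Tz pos) = (if ?b then L + pos + 2 else L + pos + 3,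
          (Tz pos)[2 := act (read (Tz pos ! 2), Stay) (Tz pos ! 2)])"
        by (rule step[OF _ _ c2(1)]) (use rd assms Ts len in \<open>auto simp: Tz_def\<close>)
      then show ?thesis by (simp add: A.act_read)
    qed
    let ?T = "act (if ?b then 2 else 1, Stay) (Ts ! 1)"
    have 5: "step M f (if ?b then L + pos + 2 else L + pos + 3, Tz pos) = (1, (Tz pos)[1 := ?T])"
    proof (cases ?b)
      case True
      have "step M f (L + pos + 2, Tz pos) = (1, (Tz pos)[1 := act (2, Stay) (Tz pos ! 1)])"
        by (rule step[OF _ _ c2(2)]) (use assms Ts len in \<open>auto simp: Tz_def\<close>)
      then show ?thesis using True by (simp add: Tz_def)
    next
      case False
      have "step M f (L + pos + 3, Tz pos) = (1, (Tz pos)[1 := act (1, Stay) (Tz pos ! 1)])"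
        by (rule step[OF _ _ c2(3)]) (use assms Ts len in \<open>auto simp: Tz_def\<close>)
      then show ?thesis using False by (simp add: Tz_def)
    qed
    \<comment> \<open>Apart from the new bit, tape 1 is blank: it holds an empty stack with its head
      at cell 0, as the program wrote its result to tape 2.\<close>
    have "contents ?T = [?b]"
    proof -
      have T1: "fst (Ts ! 1) i = 0" for i
      proof (cases "i \<le> snd (Ts ! 1)")
        case True
        then show ?thesis using Ts(3)
          by (auto simp: holds_stack_def dir_def dest!: spec[of _ "nat (snd (Ts ! 1) - i)"])
      next
        case False
        then show ?thesis using Ts(3)
          by (auto simp: holds_stack_def dir_def dest!: spec[of _ "nat (i - snd (Ts ! 1) - 1)"])
      qed
      have h: "snd (Ts ! 1) = 0" using Ts(3) by (simp add: holds_stack_def)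
      obtain c where T: "Ts ! 1 = (c, 0)" using h by (metis prod.collapse)
      have "c = (\<lambda>_. 0)" using T1 T by auto
      then have "?T = (\<lambda>i. if i = 0 then (if ?b then 2 else 1) else 0, 0)"
        by (auto simp: T fun_eq_iff simp del: One_nat_def)
      then show ?thesis using contents_single[of "if ?b then 2 else 1" 0] by simp
    qed
    have L1: "(step M f ^^ 1) (L, Ts) = (L + 1, Tz 0)" using 2 by simp
    have "(step M f ^^ (2 + (pos + (1 + (n + 1))))) (init_config M x) = (1, (Tz pos)[1 := ?T])"
    proof -
      have "(step M f ^^ (2 + (pos + (1 + (n + 1))))) (init_config M x) =
         (step M f ^^ 2) ((step M f ^^ pos) ((step M f ^^ 1) ((step M f ^^ (n + 1)) (init_config M x))))"
        by (simp only: funpow_add o_def)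
      also have "\<dots> = (step M f ^^ 2) (L + pos + 1, Tz pos)"
        unfolding 1(1) L1 3[OF order_refl] ..
      also have "\<dots> = (1, (Tz pos)[1 := ?T])"
        using 4 5 by (simp add: numeral_2_eq_2)
      finally show ?thesis .
    qed
    with \<open>contents ?T = [?b]\<close> show "\<exists>n\<le>poly (p + [:pos + 4:]) (length x). fst ((step M f ^^ n) (init_config M x)) = 1 \<and>
      contents (snd ((step M f ^^ n) (init_config M x)) ! 1) = [x \<in> A]"
      using n(1) z assms(2) Ts(1) by (intro exI[of _ "2 + (pos + (1 + (n + 1)))"]) (simp add: Tz_def)
  qed
  then show ?thesis unfolding Turing_reducible_def using wf by blast
qed

subsection \<open>A loop language whose programs run in polynomial time\<close>

datatype aexp = Const nat | Var nat | Plus aexp aexp | Times aexp aexp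

fun aval :: "aexp \<Rightarrow> (nat \<Rightarrow> nat) \<Rightarrow> nat" where
  "aval (Const n) env = n"
| "aval (Var v) env = env v"
| "aval (Plus a b) env = aval a env + aval b env"
| "aval (Times a b) env = aval a env * aval b env"

fun avars :: "aexp \<Rightarrow> nat set" where
  "avars (Const n) = {}"
| "avars (Var v) = {v}"
| "avars (Plus a b) = avars a \<union> avars b"
| "avars (Times a b) = avars a \<union> avars b"

text \<open>There is no assignment: a variable is changed only by its own loop, whose bound is a
  polynomial in the enclosing variables and is evaluated once. Hence values, output and running time
  are polynomial in the length of the input for every program.\<close>

datatype em = Out "bool list" | Seq em em | For nat aexp em | Num aexp | Bit nat em em

fun eval :: "em \<Rightarrow> bool list \<Rightarrow> (nat \<Rightarrow> nat) \<Rightarrow> bool list" where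
  "eval (Out bs) x env = bs"
| "eval (Seq a b) x env = eval a x env @ eval b x env"
| "eval (For v e a) x env = concat (map (\<lambda>i. eval a x (env(v := i))) [0..<aval e env])"
| "eval (Num e) x env = enc_nat (aval e env)"
| "eval (Bit v a b) x env = (if x ! env v then eval a x env else eval b x env)"

text \<open>Variable 0 holds the length of the input. A bit test must stay within the input;
  \<open>bit_ok\<close> says that this holds in all iterations.\<close>

fun scoped :: "nat set \<Rightarrow> em \<Rightarrow> bool" where
  "scoped A (Out bs) \<longleftrightarrow> True"
| "scoped A (Seq a b) \<longleftrightarrow> scoped A a \<and> scoped A b"
| "scoped A (For v e a) \<longleftrightarrow> v \<notin> A \<and> avars e \<subseteq> A \<and> scoped (insert v A) a"
| "scoped A (Num e) \<longleftrightarrow> avars e \<subseteq> A"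
| "scoped A (Bit v a b) \<longleftrightarrow> v \<in> A \<and> scoped A a \<and> scoped A b"

fun bit_ok :: "em \<Rightarrow> nat \<Rightarrow> (nat \<Rightarrow> nat) \<Rightarrow> bool" where
  "bit_ok (Out bs) n env \<longleftrightarrow> True"
| "bit_ok (Seq a b) n env \<longleftrightarrow> bit_ok a n env \<and> bit_ok b n env"
| "bit_ok (For v e a) n env \<longleftrightarrow> (\<forall>i<aval e env. bit_ok a n (env(v := i)))"
| "bit_ok (Num e) n env \<longleftrightarrow> True"
| "bit_ok (Bit v a b) n env \<longleftrightarrow> env v < n \<and> bit_ok a n env \<and> bit_ok b n env"

text \<open>Registers: 0 is the input, \<open>o \<in> {1, 2}\<close> the output, 3 and 4 are scratch registers,
  variable \<open>v\<close> lives in register \<open>2 * v + 6\<close>, its loop counter in \<open>2 * v + 5\<close>, and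
  registers from \<open>k\<close> on are free.\<close>

definition reg :: "nat \<Rightarrow> nat" where "reg v = 2 * v + 6"
definition ctr :: "nat \<Rightarrow> nat" where "ctr v = 2 * v + 5"

lemma reg_simps [simp]:
  "reg v = reg w \<longleftrightarrow> v = w" "ctr v = ctr w \<longleftrightarrow> v = w" "reg v \<noteq> ctr w" "ctr w \<noteq> reg v"
  "reg v \<noteq> 0" "0 \<noteq> reg v" "ctr v \<noteq> 0" "0 \<noteq> ctr v" "reg v \<noteq> 1" "ctr v \<noteq> 1" "reg v \<noteq> 2"
  "ctr v \<noteq> 2" "reg v \<noteq> 3" "ctr v \<noteq> 3" "reg v \<noteq> 4" "ctr v \<noteq> 4" "1 \<noteq> reg v" "2 \<noteq> reg v"
  "1 \<noteq> ctr v" "2 \<noteq> ctr v" "3 \<noteq> reg v" "4 \<noteq> reg v" "3 \<noteq> ctr v" "4 \<noteq> ctr v"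
  "reg v \<noteq> Suc 0" "ctr v \<noteq> Suc 0" "Suc 0 \<noteq> reg v" "Suc 0 \<noteq> ctr v"
  unfolding reg_def ctr_def by presburger+

abbreviation unary :: "nat \<Rightarrow> nat list" where "unary n \<equiv> replicate n 1"

definition skip :: com where "skip = Wh 4 (Pop 4)"

fun push_all :: "nat \<Rightarrow> nat list \<Rightarrow> com" where
  "push_all r [] = skip"
| "push_all r (a # as) = Sq (Push r a) (push_all r as)"

text \<open>Reading a unary register destroys it. A variable is therefore moved to register 3 and
  back, and \<open>d\<close> receives a copy on the way back; a product repeats the loading of the
  second factor, with \<open>k\<close> as a counter.\<close>

fun load :: "aexp \<Rightarrow> nat \<Rightarrow> nat \<Rightarrow> com" where
  "load (Const n) d k = push_all d (unary n)"
| "load (Var v) d k = Sq (Wh (reg v) (Sq (Pop (reg v)) (Push 3 1)))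
     (Wh 3 (Sq (Pop 3) (Sq (Push (reg v) 1) (Push d 1))))"
| "load (Plus a b) d k = Sq (load a d k) (load b d k)"
| "load (Times a b) d k = Sq (load a k (k + 1)) (Wh k (Sq (Pop k) (load b d (k + 1))))"

definition move_bit :: "nat \<Rightarrow> nat \<Rightarrow> com" where
  "move_bit r r' = Cond r 2 (Sq (Pop r) (Push r' 2)) (Sq (Pop r) (Push r' 1))"

definition halve :: "nat \<Rightarrow> com" where
  "halve k = Wh k (Sq (Pop k) (Cond k 1 (Sq (Pop k) (Push (k + 1) 1)) (Push 3 1)))"

text \<open>Repeated halving yields the digits, least significant first. Each is preceded by the
  symbol 2, the bit \<open>True\<close> that \<open>enc_list\<close> puts before an entry; the
  closing \<open>False\<close> is pushed by \<open>emit\<close>.\<close>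

definition put_bin :: "nat \<Rightarrow> nat \<Rightarrow> com" where
  "put_bin out k = Wh k (Sq (halve k) (Sq (Push out 2)
     (Sq (Cond 3 1 (Sq (Pop 3) (Push out 2)) (Push out 1))
       (Wh (k + 1) (Sq (Pop (k + 1)) (Push k 1))))))"

text \<open>The bits before the tested one are moved to register 4 and put back later. The verdict
  left in register 3 is 1 for a set bit and 2 for a clear one, so that \<open>Cond 3 1\<close>
  enters its first branch on \<open>True\<close>.\<close>

definition test_bit :: "nat \<Rightarrow> com" where
  "test_bit k = Sq (Wh k (Sq (Pop k) (move_bit 0 4)))
     (Sq (Cond 0 2 (Push 3 1) (Push 3 2)) (Wh 4 (move_bit 4 0)))"

fun emit :: "nat \<Rightarrow> nat \<Rightarrow> em \<Rightarrow> com" where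
  "emit out k (Out bs) = push_all out (bits bs)"
| "emit out k (Seq a b) = Sq (emit out k a) (emit out k b)"
| "emit out k (For v e a) = Sq (load e (ctr v) k)
     (Sq (Wh (ctr v) (Sq (Pop (ctr v)) (Sq (emit out k a) (Push (reg v) 1))))
       (Wh (reg v) (Pop (reg v))))"
| "emit out k (Num e) = Sq (load e k (k + 1)) (Sq (put_bin out k) (Push out 1))"
| "emit out k (Bit v a b) = Sq (load (Var v) k (k + 1)) (Sq (test_bit k)
     (Cond 3 1 (Sq (Pop 3) (emit out k a)) (Sq (Pop 3) (emit out k b))))"

section \<open>Correctness and running time of the emitted programs\<close>

definition runs :: "com \<Rightarrow> store \<Rightarrow> nat \<Rightarrow> store \<Rightarrow> bool" where
  "runs c s b s' \<longleftrightarrow> (\<exists>n\<le>b. run c s n s')"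

lemma runs_Push: "runs (Push r a) s 2 (s(r := a # s r))"
  using run.Push by (auto simp: runs_def)

lemma runs_Pop: "runs (Pop r) s 1 (s(r := tl (s r)))"
  using run.Pop by (auto simp: runs_def)

lemma runs_Sq: "runs c1 s a s' \<Longrightarrow> runs c2 s' b s'' \<Longrightarrow> runs (Sq c1 c2) s (a + b) s''"
  unfolding runs_def by (meson add_mono run.Sq)

lemma runs_CondT: "top (s r) = a \<Longrightarrow> runs c1 s b s' \<Longrightarrow> runs (Cond r a c1 c2) s (b + 2) s'"
  unfolding runs_def by (meson add_le_mono1 run.CondT)

lemma runs_CondF: "top (s r) \<noteq> a \<Longrightarrow> runs c2 s b s' \<Longrightarrow> runs (Cond r a c1 c2) s (b + 2) s'"
  unfolding runs_def by (metis add_le_mono one_le_numeral run.CondF)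

lemma runs_mono: "runs c s a s' \<Longrightarrow> a \<le> b \<Longrightarrow> runs c s b s'"
  unfolding runs_def by (meson order_trans)

lemma runs_eq: "runs c s a s' \<Longrightarrow> a \<le> b \<Longrightarrow> s' = s'' \<Longrightarrow> runs c s b s''"
  using runs_mono by blast

text \<open>The loop is given by its sequence \<open>st\<close> of stores; the induction runs
  backwards from the final store, where \<open>WhF\<close> applies.\<close>

lemma runs_loop:
  assumes "\<And>i. i < m \<Longrightarrow> st i r \<noteq> []" "st m r = []"
    and "\<And>i. i < m \<Longrightarrow> runs c (st i) b (st (Suc i))"
  shows "runs (Wh r c) (st 0) (m * (b + 2) + 1) (st m)"
proof -
  have "runs (Wh r c) (st (m - i)) (i * (b + 2) + 1) (st m)" if "i \<le> m" for i
    using that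
  proof (induction i)
    case 0
    then show ?case using assms(2) run.WhF[of "st m" r c] by (auto simp: runs_def)
  next
    case (Suc i)
    have *: "m - Suc i < m" "Suc (m - Suc i) = m - i" using Suc.prems by auto
    obtain n where n: "n \<le> b" "run c (st (m - Suc i)) n (st (m - i))"
      using assms(3)[OF *(1)] *(2) by (auto simp: runs_def)
    obtain n' where n': "n' \<le> i * (b + 2) + 1" "run (Wh r c) (st (m - i)) n' (st m)"
      using Suc by (auto simp: runs_def)
    have "n + n' + 2 \<le> Suc i * (b + 2) + 1" using n(1) n'(1) by simp
    then show ?case
      using run.WhT[of "st (m - Suc i)" r, OF assms(1)[OF *(1)] n(2) n'(2)]
      unfolding runs_def by blast
  qed
  from this[of m] show ?thesis by simp
qed

lemma runs_skip: "s 4 = [] \<Longrightarrow> runs skip s 1 s"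
  using run.WhF[of s 4] by (auto simp: runs_def skip_def)

lemma runs_push_all: "s 4 = [] \<Longrightarrow> r \<noteq> 4 \<Longrightarrow> runs (push_all r as) s (2 * length as + 1) (s(r := rev as @ s r))"
proof (induction "as" arbitrary: s)
  case (Cons a "as")
  have "runs (push_all r as) (s(r := a # s r)) (2 * length as + 1) (s(r := rev (a # as) @ s r))"
    by (rule runs_eq[OF Cons.IH[of "s(r := a # s r)"]]) (use Cons.prems in auto)
  from runs_Sq[OF runs_Push this] show ?case unfolding push_all.simps by (rule runs_mono) simp
qed (use runs_skip in auto)

fun load_time :: "aexp \<Rightarrow> nat \<Rightarrow> nat" where
  "load_time (Const n) B = 2 * n + 1"
| "load_time (Var v) B = 12 * B + 2"
| "load_time (Plus a b) B = load_time a B + load_time b B"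
| "load_time (Times a b) B = load_time a B + aval a (\<lambda>_. B) * (load_time b B + 3) + 1"

lemma aval_mono: "(\<And>v. v \<in> avars e \<Longrightarrow> env v \<le> env' v) \<Longrightarrow> aval e env \<le> aval e env'"
  by (induction e) (auto intro: add_mono mult_le_mono)

lemma runs_load:
  assumes "\<And>v. v \<in> avars e \<Longrightarrow> s (reg v) = unary (env v) \<and> env v \<le> B \<and> d \<noteq> reg v \<and> reg v < k"
    "d < k" "d \<noteq> 3" "d \<noteq> 4" "s 3 = []" "s 4 = []" "5 \<le> k" "\<And>r. k \<le> r \<Longrightarrow> s r = []"
  shows "runs (load e d k) s (load_time e B) (s(d := unary (aval e env) @ s d))"
  using assms
proof (induction e arbitrary: s d k)
  case (Const n)
  then show ?case using runs_push_all[of s d "unary n"] by (simp add: fun_upd_def)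
next
  case (Var v)
  let ?r = "reg v" and ?m = "env v"
  have r: "s ?r = unary ?m" "?m \<le> B" "d \<noteq> ?r" "?r \<noteq> 3" using Var.prems(1)[of v] by auto
  let ?st = "\<lambda>i. s(?r := unary (?m - i), 3 := unary i)"
  have 1: "runs (Wh ?r (Sq (Pop ?r) (Push 3 1))) (?st 0) (?m * (3 + 2) + 1) (?st ?m)"
  proof (rule runs_loop)
    fix i assume i: "i < ?m"
    then have "?m - i = Suc (?m - Suc i)" by simp
    then show "runs (Sq (Pop ?r) (Push 3 1)) (?st i) 3 (?st (Suc i))"
      by (intro runs_eq[OF runs_Sq[OF runs_Pop runs_Push]]) (auto simp: fun_eq_iff r)
  qed (use r in auto)
  let ?st' = "\<lambda>i. s(?r := unary i, 3 := unary (?m - i), d := unary i @ s d)"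
  have 2: "runs (Wh 3 (Sq (Pop 3) (Sq (Push ?r 1) (Push d 1)))) (?st' 0) (?m * (5 + 2) + 1) (?st' ?m)"
  proof (rule runs_loop)
    fix i assume i: "i < ?m"
    then have "?m - i = Suc (?m - Suc i)" by simp
    then show "runs (Sq (Pop 3) (Sq (Push ?r 1) (Push d 1))) (?st' i) 5 (?st' (Suc i))"
      using Var.prems by (intro runs_eq[OF runs_Sq[OF runs_Pop runs_Sq[OF runs_Push runs_Push]]]) (auto simp: fun_eq_iff r)
  qed (use r Var.prems in auto)
  have e: "?st 0 = s" "?st ?m = ?st' 0" "?st' ?m = s(d := unary ?m @ s d)"
    using r Var.prems by (auto simp: fun_eq_iff)
  show ?case
    unfolding load.simps
    by (rule runs_eq[OF runs_Sq[OF 1[unfolded e(1,2)] 2]]) (use r(2) e(3) in auto)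
next
  case (Plus a b)
  have 1: "runs (load a d k) s (load_time a B) (s(d := unary (aval a env) @ s d))"
    by (rule Plus.IH(1)) (use Plus.prems in auto)
  let ?s = "s(d := unary (aval a env) @ s d)"
  have 2: "runs (load b d k) ?s (load_time b B) (?s(d := unary (aval b env) @ ?s d))"
    by (rule Plus.IH(2)) (use Plus.prems in auto)
  have "?s(d := unary (aval b env) @ ?s d) = s(d := unary (aval (Plus a b) env) @ s d)"
    by (simp add: replicate_add[symmetric] add.commute flip: append_assoc)
  then show ?case unfolding load.simps by (intro runs_eq[OF runs_Sq[OF 1 2]]) auto
next
  case (Times a b)
  let ?m = "aval a env" and ?n = "aval b env"
  have 1: "runs (load a k (k + 1)) s (load_time a B) (s(k := unary ?m @ s k))"
    by (rule Times.IH(1)) (use Times.prems in fastforce)+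
  have m: "?m \<le> aval a (\<lambda>_. B)" by (rule aval_mono) (use Times.prems in auto)
  let ?st = "\<lambda>i. s(k := unary (?m - i), d := unary (i * ?n) @ s d)"
  have 2: "runs (Wh k (Sq (Pop k) (load b d (k + 1)))) (?st 0) (?m * ((1 + load_time b B) + 2) + 1) (?st ?m)"
  proof (rule runs_loop)
    fix i assume i: "i < ?m"
    then have mi: "?m - i = Suc (?m - Suc i)" by simp
    let ?s = "s(k := unary (?m - Suc i), d := unary (i * ?n) @ s d)"
    have "runs (load b d (k + 1)) ?s (load_time b B) (?s(d := unary ?n @ ?s d))"
      by (rule Times.IH(2)) (use Times.prems in fastforce)+
    moreover have "?s(d := unary ?n @ ?s d) = ?st (Suc i)"
      by (auto simp: fun_eq_iff replicate_add)
    moreover have "(?st i)(k := tl (?st i k)) = ?s" using mi Times.prems by (auto simp: fun_eq_iff)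
    ultimately show "runs (Sq (Pop k) (load b d (k + 1))) (?st i) (1 + load_time b B) (?st (Suc i))"
      using runs_Sq[OF runs_Pop] by metis
  qed (use Times.prems in auto)
  have e: "s(k := unary ?m @ s k) = ?st 0" "?st ?m = s(d := unary (aval (Times a b) env) @ s d)"
    using Times.prems by (auto simp: fun_eq_iff)
  have "load_time a B + (?m * ((1 + load_time b B) + 2) + 1) \<le> load_time (Times a b) B"
    using mult_le_mono1[OF m, of "load_time b B + 3"] by (simp add: algebra_simps)
  then show ?case
    using runs_Sq[OF 1 2[folded e(1)]] unfolding e(2) load.simps by (rule runs_mono[rotated])
qed

lemma runs_move_bit:
  assumes "s r = (if b then 2 else 1) # l" "r \<noteq> r'"
  shows "runs (move_bit r r') s 5 (s(r := l, r' := (if b then 2 else 1) # s r'))"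
proof (cases b)
  case True
  have "runs (Sq (Pop r) (Push r' 2)) s 3 (s(r := l, r' := 2 # s r'))"
    by (rule runs_eq[OF runs_Sq[OF runs_Pop runs_Push]]) (use assms True in auto)
  then show ?thesis
    using runs_CondT[of s r 2] assms True by (fastforce simp: move_bit_def)
next
  case False
  have "runs (Sq (Pop r) (Push r' 1)) s 3 (s(r := l, r' := 1 # s r'))"
    by (rule runs_eq[OF runs_Sq[OF runs_Pop runs_Push]]) (use assms False in auto)
  then show ?thesis
    using runs_CondF[of s r 2] assms False by (fastforce simp: move_bit_def)
qed

lemma bits_simps [simp]:
  "bits [] = []" "bits (b # x) = (if b then 2 else 1) # bits x" "bits (x @ y) = bits x @ bits y"
  "length (bits x) = length x" "bits x = [] \<longleftrightarrow> x = []" "rev (bits x) = bits (rev x)"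
  "drop n (bits x) = bits (drop n x)"
  by (auto simp: bits_def rev_map drop_map)

lemma drop_nth_Cons: "i < length x \<Longrightarrow> drop i x = x ! i # drop (Suc i) x"
  by (rule Cons_nth_drop_Suc[symmetric])

lemma rev_take_Suc: "i < length x \<Longrightarrow> rev (take (Suc i) x) = x ! i # rev (take i x)"
  by (simp add: take_Suc_conv_app_nth)

lemma runs_test_bit:
  assumes "n < length x" "s k = unary n" "s 0 = bits x" "s 3 = []" "s 4 = []" "5 \<le> k" "n \<le> B"
  shows "runs (test_bit k) s (16 * B + 8) (s(k := [], 3 := [if x ! n then 1 else 2]))"
proof -
  let ?st = "\<lambda>i. s(k := unary (n - i), 0 := bits (drop i x), 4 := bits (rev (take i x)))"
  have 1: "runs (Wh k (Sq (Pop k) (move_bit 0 4))) (?st 0) (n * (6 + 2) + 1) (?st n)"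
  proof (rule runs_loop)
    fix i assume i: "i < n"
    then have ni: "n - i = Suc (n - Suc i)" "i < length x" using assms(1) by auto
    have "runs (move_bit 0 4) ((?st i)(k := tl (?st i k))) 5 (?st (Suc i))"
      by (rule runs_eq[OF runs_move_bit[where b = "x ! i" and l = "bits (drop (Suc i) x)"]])
        (use ni assms in \<open>auto simp: fun_eq_iff drop_nth_Cons[OF ni(2)] rev_take_Suc[OF ni(2)]\<close>)
    from runs_Sq[OF runs_Pop this] show "runs (Sq (Pop k) (move_bit 0 4)) (?st i) 6 (?st (Suc i))"
      by simp
  qed (use assms in auto)
  let ?f = "if x ! n then 1 else 2"
  have t: "?st n 0 = (if x ! n then 2 else 1) # bits (drop (Suc n) x)"
    using assms drop_nth_Cons[OF assms(1)] by auto
  have 2: "runs (Cond 0 2 (Push 3 1) (Push 3 2)) (?st n) 4 ((?st n)(3 := [?f]))"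
  proof (cases "x ! n")
    case True
    then show ?thesis using runs_eq[OF runs_CondT[OF _ runs_Push]] t assms by auto
  next
    case False
    then show ?thesis using runs_eq[OF runs_CondF[OF _ runs_Push]] t assms by auto
  qed
  let ?st' = "\<lambda>i. s(k := [], 3 := [?f], 0 := bits (drop (n - i) x), 4 := bits (rev (take (n - i) x)))"
  have 3: "runs (Wh 4 (move_bit 4 0)) (?st' 0) (n * (5 + 2) + 1) (?st' n)"
  proof (rule runs_loop)
    fix i assume i: "i < n"
    then have ni: "n - i = Suc (n - Suc i)" "n - Suc i < length x" using assms(1) by auto
    show "runs (move_bit 4 0) (?st' i) 5 (?st' (Suc i))"
      by (rule runs_eq[OF runs_move_bit[where b = "x ! (n - Suc i)" and l = "bits (rev (take (n - Suc i) x))"]])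
        (use assms in \<open>auto simp: fun_eq_iff ni(1) drop_nth_Cons[OF ni(2)] rev_take_Suc[OF ni(2)]\<close>)
  qed (use assms in auto)
  have e: "?st 0 = s" "(?st n)(3 := [?f]) = ?st' 0" "?st' n = s(k := [], 3 := [?f])"
    using assms by (auto simp: fun_eq_iff)
  show ?thesis
    unfolding test_bit_def
    by (rule runs_eq[OF runs_Sq[OF 1[unfolded e(1)] runs_Sq[OF 2[unfolded e(2)] 3]]]) (use assms e(3) in auto)
qed

lemma runs_halve:
  assumes "s k = unary m" "s (k + 1) = []" "s 3 = []" "5 \<le> k"
  shows "runs (halve k) s (8 * m + 9) (s(k := [], k + 1 := unary (m div 2), 3 := unary (m mod 2)))"
proof -
  let ?c = "Sq (Pop k) (Cond k 1 (Sq (Pop k) (Push (k + 1) 1)) (Push 3 1))"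
  let ?n = "(m + 1) div 2"
  have k3: "k \<noteq> 3" "3 \<noteq> k" "k \<noteq> 2" using assms(4) by auto
  \<comment> \<open>For odd \<open>m\<close> the last pass finds a single symbol and sends it to
    register 3 instead of \<open>k + 1\<close>; \<open>min\<close> and the truncated subtraction
    describe both parities at once.\<close>
  let ?st = "\<lambda>i. s(k := unary (m - 2 * i), k + 1 := unary (min i (m div 2)), 3 := unary (i - m div 2))"
  have W: "runs (Wh k ?c) (?st 0) (?n * (6 + 2) + 1) (?st ?n)"
  proof (rule runs_loop)
    fix i assume i: "i < ?n"
    show "?st i k \<noteq> []" using i assms by auto
    let ?s = "(?st i)(k := tl (?st i k))"
    have "runs (Cond k 1 (Sq (Pop k) (Push (k + 1) 1)) (Push 3 1)) ?s 5 (?st (Suc i))"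
    proof (cases "m - 2 * i = 1")
      case False
      then have "m - 2 * i = Suc (Suc (m - 2 * Suc i))" using i by simp
      then have t: "?st i k = 1 # 1 # unary (m - 2 * Suc i)" using k3 by simp
      have d: "min (Suc i) (m div 2) = Suc i" "min i (m div 2) = i" "Suc i - m div 2 = 0" "i - m div 2 = 0"
        using False i by auto
      have "runs (Sq (Pop k) (Push (k + 1) 1)) ?s 3 (?st (Suc i))"
        by (rule runs_eq[OF runs_Sq[OF runs_Pop runs_Push]]) (use k3 t d in \<open>auto simp: fun_eq_iff\<close>)
      moreover have "top (?s k) = 1" using t k3 by simp
      ultimately show ?thesis by (intro runs_mono[OF runs_CondT]) auto
    next
      case True
      have d: "min (Suc i) (m div 2) = i" "min i (m div 2) = i" "Suc i - m div 2 = 1" "i - m div 2 = 0"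
        "m - 2 * Suc i = 0"
        using True by auto
      have "runs (Push 3 1) ?s 2 (?st (Suc i))"
        by (rule runs_eq[OF runs_Push]) (use assms True d in \<open>auto simp: fun_eq_iff\<close>)
      moreover have "top (?s k) \<noteq> 1" using True k3 by simp
      ultimately show ?thesis by (intro runs_mono[OF runs_CondF]) auto
    qed
    from runs_Sq[OF runs_Pop this] show "runs ?c (?st i) 6 (?st (Suc i))" by simp
  qed (use assms in auto)
  have e1: "?st 0 = s" using assms by (auto simp: fun_eq_iff)
  have e2: "?st ?n = s(k := [], k + 1 := unary (m div 2), 3 := unary (m mod 2))"
  proof -
    have "m - 2 * ?n = 0" "min ?n (m div 2) = m div 2" "?n - m div 2 = m mod 2"
      by presburger+
    then show ?thesis by simp
  qed
  have "?n * (6 + 2) + 1 \<le> 8 * m + 9" by simp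
  then show ?thesis unfolding halve_def by (rule runs_eq[OF W[unfolded e1] _ e2])
qed

lemma enc_bits_Cons: "enc_bits (b # x) = True # b # enc_bits x"
  by (simp add: enc_bits_def enc_list_def)

text \<open>A bound quadratic in the value \<open>m\<close>, not in its number of digits, is good
  enough because all numbers are held in unary. The induction unfolds one pass of the loop and
  continues with \<open>m div 2\<close>.\<close>

lemma runs_put_bin:
  assumes "s k = unary m" "s (k + 1) = []" "s 3 = []" "5 \<le> k" "o' < 3"
  shows "runs (put_bin o' k) s (m * (15 * m + 30) + 1)
    (s(k := [], o' := rev (bits (concat (map (\<lambda>b. [True, b]) (bin m)))) @ s o'))"
  using assms
proof (induction m arbitrary: s rule: less_induct)
  case (less m)
  let ?enc = "\<lambda>m. rev (bits (concat (map (\<lambda>b. [True, b]) (bin m))))"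
  show ?case
  proof (cases "m = 0")
    case True
    then have "runs (Wh k c) s 1 s" for c using less.prems run.WhF[of s k] by (auto simp: runs_def)
    then show ?thesis
      using True less.prems(1) by (simp add: put_bin_def bin.simps[of 0] fun_upd_idem)
  next
    case False
    let ?h = "m div 2"
    let ?b = "if odd m then 2 else 1"
    let ?s1 = "s(k := [], k + 1 := unary ?h, 3 := unary (m mod 2))"
    let ?s2 = "?s1(o' := 2 # s o')"
    let ?s3 = "s(k := [], k + 1 := unary ?h, o' := ?b # 2 # s o')"
    let ?s4 = "s(k := unary ?h, o' := ?b # 2 # s o')"
    have o: "o' \<noteq> 3" "o' \<noteq> k" "o' \<noteq> k + 1" using less.prems by auto
    have 1: "runs (halve k) s (8 * m + 9) ?s1" by (rule runs_halve) (use less.prems in auto)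
    have 2: "runs (Push o' 2) ?s1 2 ?s2" by (rule runs_eq[OF runs_Push]) (use o in auto)
    have 3: "runs (Cond 3 1 (Sq (Pop 3) (Push o' 2)) (Push o' 1)) ?s2 5 ?s3"
    proof (cases "odd m")
      case True
      then have "m mod 2 = 1" by presburger
      then have "runs (Sq (Pop 3) (Push o' 2)) ?s2 3 ?s3" "top (?s2 3) = 1"
        using o less.prems True
        by (auto intro!: runs_eq[OF runs_Sq[OF runs_Pop runs_Push]] simp: fun_eq_iff)
      then show ?thesis by (intro runs_mono[OF runs_CondT]) auto
    next
      case False
      then have "m mod 2 = 0" by presburger
      then have "runs (Push o' 1) ?s2 2 ?s3" "top (?s2 3) \<noteq> 1"
        using o less.prems False by (auto intro!: runs_eq[OF runs_Push] simp: fun_eq_iff)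
      then show ?thesis by (intro runs_mono[OF runs_CondF]) auto
    qed
    let ?st = "\<lambda>i. s(k := unary i, k + 1 := unary (?h - i), o' := ?b # 2 # s o')"
    have 4: "runs (Wh (k + 1) (Sq (Pop (k + 1)) (Push k 1))) (?st 0) (?h * (3 + 2) + 1) (?st ?h)"
    proof (rule runs_loop)
      fix i assume "i < ?h"
      then have "?h - i = Suc (?h - Suc i)" by simp
      then show "runs (Sq (Pop (k + 1)) (Push k 1)) (?st i) 3 (?st (Suc i))"
        using o by (intro runs_eq[OF runs_Sq[OF runs_Pop runs_Push]]) (auto simp: fun_eq_iff)
    qed (use o in auto)
    have e: "?st 0 = ?s3" "?st ?h = ?s4" using o less.prems by (auto simp: fun_eq_iff)
    let ?body = "Sq (halve k) (Sq (Push o' 2) (Sq (Cond 3 1 (Sq (Pop 3) (Push o' 2)) (Push o' 1))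
       (Wh (k + 1) (Sq (Pop (k + 1)) (Push k 1)))))"
    have body: "runs ?body s (13 * m + 19) ?s4"
      by (rule runs_mono[OF runs_Sq[OF 1 runs_Sq[OF 2 runs_Sq[OF 3 4[unfolded e]]]]]) simp
    have rest: "runs (put_bin o' k) ?s4 (?h * (15 * ?h + 30) + 1)
        (?s4(k := [], o' := ?enc ?h @ ?s4 o'))"
      by (rule less.IH) (use False less.prems o in auto)
    obtain n where n: "n \<le> 13 * m + 19" "run ?body s n ?s4" using body by (auto simp: runs_def)
    obtain n' where n': "n' \<le> ?h * (15 * ?h + 30) + 1" "run (put_bin o' k) ?s4 n' (?s4(k := [], o' := ?enc ?h @ ?s4 o'))"
      using rest by (auto simp: runs_def)
    have "s k \<noteq> []" using False less.prems(1) by simp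
    then have R: "run (put_bin o' k) s (n + n' + 2) (?s4(k := [], o' := ?enc ?h @ ?s4 o'))"
      using run.WhT[OF _ n(2) n'(2)[unfolded put_bin_def]] unfolding put_bin_def by simp
    have E: "?s4(k := [], o' := ?enc ?h @ ?s4 o') = s(k := [], o' := ?enc m @ s o')"
      using False o by (auto simp: fun_eq_iff bin.simps[of m])
    have L: "n + n' + 2 \<le> m * (15 * m + 30) + 1"
    proof -
      have "?h * (15 * ?h + 30) \<le> (m - 1) * (15 * m + 30)" by (rule mult_le_mono) (use False in auto)
      moreover have "m * (15 * m + 30) = (m - 1) * (15 * m + 30) + (15 * m + 30)"
        using False by (cases m) auto
      ultimately show ?thesis using n(1) n'(1) by linarith
    qed
    show ?thesis unfolding runs_def by (rule exI[of _ "n + n' + 2"], rule conjI[OF L], rule R[unfolded E])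
  qed
qed

text \<open>In the body of a loop the loop variable is an additional variable below the loop bound,
  hence the enlarged bound \<open>B + aval e (\<lambda>_. B)\<close>.\<close>

fun emit_time :: "em \<Rightarrow> nat \<Rightarrow> nat" where
  "emit_time (Out bs) B = 2 * length bs + 1"
| "emit_time (Seq a b) B = emit_time a B + emit_time b B"
| "emit_time (For v e a) B = load_time e B +
     aval e (\<lambda>_. B) * (emit_time a (B + aval e (\<lambda>_. B)) + 8) + 2"
| "emit_time (Num e) B = load_time e B + aval e (\<lambda>_. B) * (15 * aval e (\<lambda>_. B) + 30) + 3"
| "emit_time (Bit v a b) B = 28 * B + 13 + emit_time a B + emit_time b B"

fun below :: "nat \<Rightarrow> em \<Rightarrow> bool" where
  "below k (Out bs) \<longleftrightarrow> True"
| "below k (Seq a b) \<longleftrightarrow> below k a \<and> below k b"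
| "below k (For v e a) \<longleftrightarrow> reg v < k \<and> below k a"
| "below k (Num e) \<longleftrightarrow> True"
| "below k (Bit v a b) \<longleftrightarrow> below k a \<and> below k b"

text \<open>Variables outside \<open>A\<close> have empty registers: a loop starts from an empty
  variable and clears it at the end, so a later loop may reuse it.\<close>

definition good_store :: "nat \<Rightarrow> bool list \<Rightarrow> nat set \<Rightarrow> (nat \<Rightarrow> nat) \<Rightarrow> nat \<Rightarrow> store \<Rightarrow> bool" where
  "good_store k x A env B s \<longleftrightarrow> s 0 = bits x \<and> s 3 = [] \<and> s 4 = [] \<and> (\<forall>r\<ge>k. s r = []) \<and>
     (\<forall>v\<in>A. s (reg v) = unary (env v) \<and> env v \<le> B \<and> reg v < k) \<and>
     (\<forall>v. v \<notin> A \<longrightarrow> s (reg v) = [] \<and> s (ctr v) = [])"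

lemma good_store_out:
  "good_store k x A env B s \<Longrightarrow> o' \<in> {1, 2} \<Longrightarrow> 5 \<le> k \<Longrightarrow> good_store k x A env B (s(o' := l))"
  by (auto simp: good_store_def)

lemma good_store_var:
  "good_store k x A env B s \<Longrightarrow> v \<in> A \<Longrightarrow> s (reg v) = unary (env v) \<and> env v \<le> B \<and> k \<noteq> reg v \<and> reg v < k + 1"
  by (auto simp: good_store_def)

lemma good_store_free: "good_store k x A env B s \<Longrightarrow> k \<le> r \<Longrightarrow> s r = []"
  by (auto simp: good_store_def)

lemma runs_emit:
  assumes "scoped A E" "bit_ok E (length x) env" "below k E" "good_store k x A env B s"
    "o' \<in> {1, 2}" "5 \<le> k"
  shows "runs (emit o' k E) s (emit_time E B) (s(o' := rev (bits (eval E x env)) @ s o'))"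
  using assms
proof (induction E arbitrary: A env B s)
  case (Out bs)
  show ?case unfolding emit.simps
    by (rule runs_eq[OF runs_push_all]) (use Out.prems in \<open>auto simp: good_store_def\<close>)
next
  case (Seq a b)
  let ?s = "s(o' := rev (bits (eval a x env)) @ s o')"
  have 1: "runs (emit o' k a) s (emit_time a B) ?s"
    by (rule Seq.IH(1)) (use Seq.prems in auto)
  have 2: "runs (emit o' k b) ?s (emit_time b B) (?s(o' := rev (bits (eval b x env)) @ ?s o'))"
    by (rule Seq.IH(2)[OF _ _ _ good_store_out]) (use Seq.prems in auto)
  show ?case unfolding emit.simps by (rule runs_eq[OF runs_Sq[OF 1 2]]) auto
next
  case (For v e a)
  let ?m = "aval e env" and ?M = "aval e (\<lambda>_. B)"
  have o: "o' < 3" "o' \<noteq> 0" using For.prems by auto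
  have v: "v \<notin> A" "avars e \<subseteq> A" "scoped (insert v A) a" "below k a" "reg v < k"
    using For.prems by auto
  have s: "s (reg v) = []" "s (ctr v) = []" using For.prems v by (auto simp: good_store_def)
  have ctr: "ctr v < k" using v(5) by (simp add: reg_def ctr_def)
  have m: "?m \<le> ?M" by (rule aval_mono) (use For.prems v in \<open>auto simp: good_store_def\<close>)
  have 1: "runs (load e (ctr v) k) s (load_time e B) (s(ctr v := unary ?m @ s (ctr v)))"
    by (rule runs_load) (use For.prems v ctr in \<open>auto simp: good_store_def\<close>)
  let ?out = "\<lambda>i. rev (bits (concat (map (\<lambda>i. eval a x (env(v := i))) [0..<i]))) @ s o'"
  let ?st = "\<lambda>i. s(ctr v := unary (?m - i), reg v := unary i, o' := ?out i)"
  let ?b = "emit_time a (B + ?M)"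
  have ne: "o' \<noteq> reg v" "o' \<noteq> ctr v" "reg v \<noteq> o'" "ctr v \<noteq> o'" using For.prems(5) by auto
  have 2: "runs (Wh (ctr v) (Sq (Pop (ctr v)) (Sq (emit o' k a) (Push (reg v) 1)))) (?st 0)
      (?m * ((1 + (?b + 2)) + 2) + 1) (?st ?m)"
  proof (rule runs_loop)
    fix i assume i: "i < ?m"
    then have mi: "?m - i = Suc (?m - Suc i)" by simp
    let ?s = "s(ctr v := unary (?m - Suc i), reg v := unary i, o' := ?out i)"
    have p: "runs (Pop (ctr v)) (?st i) 1 ?s"
      by (rule runs_eq[OF runs_Pop]) (use mi ne in \<open>auto simp: fun_eq_iff\<close>)
    have "good_store k x (insert v A) (env(v := i)) (B + ?M)
        (s(ctr v := unary (?m - Suc i), reg v := unary i))"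
      using For.prems(4,6) i m v ctr by (auto simp: good_store_def)
    then have gs: "good_store k x (insert v A) (env(v := i)) (B + ?M) ?s"
      by (rule good_store_out) (use For.prems in auto)
    have bo: "bit_ok a (length x) (env(v := i))" using For.prems(2) i by simp
    have "runs (emit o' k a) ?s ?b (?s(o' := rev (bits (eval a x (env(v := i)))) @ ?s o'))"
      by (rule For.IH[OF v(3) bo v(4) gs For.prems(5,6)])
    then have "runs (Sq (emit o' k a) (Push (reg v) 1)) ?s (?b + 2) (?st (Suc i))"
      by (intro runs_eq[OF runs_Sq[OF _ runs_Push]]) (use ne in \<open>auto simp: fun_eq_iff\<close>)
    from runs_Sq[OF p this]
    show "runs (Sq (Pop (ctr v)) (Sq (emit o' k a) (Push (reg v) 1))) (?st i) (1 + (?b + 2)) (?st (Suc i))" .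
  qed (use ne in auto)
  let ?st' = "\<lambda>i. s(reg v := unary (?m - i), o' := ?out ?m)"
  have 3: "runs (Wh (reg v) (Pop (reg v))) (?st' 0) (?m * (1 + 2) + 1) (?st' ?m)"
  proof (rule runs_loop)
    fix i assume "i < ?m"
    then have "?m - i = Suc (?m - Suc i)" by simp
    then show "runs (Pop (reg v)) (?st' i) 1 (?st' (Suc i))"
      by (intro runs_eq[OF runs_Pop]) (use ne in \<open>auto simp: fun_eq_iff\<close>)
  qed (use ne in auto)
  have e: "s(ctr v := unary ?m @ s (ctr v)) = ?st 0" "?st ?m = ?st' 0"
    "?st' ?m = s(o' := rev (bits (eval (For v e a) x env)) @ s o')"
    using s ne by (auto simp: fun_eq_iff)
  have "load_time e B + ((?m * ((1 + (?b + 2)) + 2) + 1) + (?m * (1 + 2) + 1)) \<le> emit_time (For v e a) B"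
    using mult_le_mono1[OF m, of "?b + 8"] by (simp add: algebra_simps)
  then show ?case
    unfolding emit.simps
    by (rule runs_eq[OF runs_Sq[OF 1[unfolded e(1)] runs_Sq[OF 2[unfolded e(2)] 3]]]) (rule e(3))
next
  case (Num e)
  let ?m = "aval e env" and ?M = "aval e (\<lambda>_. B)"
  let ?s = "s(k := unary ?m)"
  have o: "o' < 3" "o' \<noteq> k" using Num.prems by auto
  have m: "?m \<le> ?M" by (rule aval_mono) (use Num.prems in \<open>auto simp: good_store_def\<close>)
  have 1: "runs (load e k (k + 1)) s (load_time e B) ?s"
  proof (rule runs_eq[OF runs_load])
    fix v assume "v \<in> avars e"
    then have "v \<in> A" using Num.prems(1) by auto
    from good_store_var[OF Num.prems(4) this]
    show "s (reg v) = unary (env v) \<and> env v \<le> B \<and> k \<noteq> reg v \<and> reg v < k + 1" .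
  qed (use Num.prems good_store_free[OF Num.prems(4)] in \<open>auto simp: good_store_def\<close>)
  have 2: "runs (put_bin o' k) ?s (?m * (15 * ?m + 30) + 1)
     (?s(k := [], o' := rev (bits (concat (map (\<lambda>b. [True, b]) (bin ?m)))) @ ?s o'))"
    by (rule runs_put_bin) (use Num.prems o in \<open>auto simp: good_store_def\<close>)
  have c: "concat (map (\<lambda>b. [True, b]) l) @ [False] = enc_bits l" for l
    by (simp add: enc_bits_def enc_list_def)
  have sk: "s k = []" using Num.prems by (auto simp: good_store_def)
  have *: "enc_nat ?m = concat (map (\<lambda>b. [True, b]) (bin ?m)) @ [False]"
    unfolding c enc_nat_def ..
  have "?m * (15 * ?m + 30) \<le> ?M * (15 * ?M + 30)" by (rule mult_le_mono) (use m in auto)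
  then have t: "load_time e B + ((?m * (15 * ?m + 30) + 1) + 2) \<le> emit_time (Num e) B" by simp
  show ?case
    unfolding emit.simps
    by (rule runs_eq[OF runs_Sq[OF 1 runs_Sq[OF 2 runs_Push]] t]) (use o * sk in \<open>auto simp: fun_eq_iff\<close>)
next
  case (Bit v a b)
  let ?m = "env v"
  let ?s = "s(k := unary ?m)"
  let ?f = "if x ! ?m then 1 else 2"
  have o: "o' < 3" "o' \<noteq> k" using Bit.prems by auto
  have v: "v \<in> A" "?m < length x" "?m \<le> B" "s k = []" using Bit.prems by (auto simp: good_store_def)
  have 1: "runs (load (Var v) k (k + 1)) s (12 * B + 2) ?s"
  proof (rule runs_eq[OF runs_load[where env = env and B = B]])
    fix w assume "w \<in> avars (Var v)"
    then have "w \<in> A" using v(1) by auto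
    from good_store_var[OF Bit.prems(4) this]
    show "s (reg w) = unary (env w) \<and> env w \<le> B \<and> k \<noteq> reg w \<and> reg w < k + 1" .
  qed (use Bit.prems good_store_free[OF Bit.prems(4)] in \<open>auto simp: good_store_def\<close>)
  have 2: "runs (test_bit k) ?s (16 * B + 8) (s(3 := [?f]))"
    by (rule runs_eq[OF runs_test_bit[where n = ?m and x = x]])
      (use Bit.prems v in \<open>auto simp: good_store_def fun_eq_iff\<close>)
  have s3: "s 3 = []" using Bit.prems by (auto simp: good_store_def)
  have 3: "runs (Cond 3 1 (Sq (Pop 3) (emit o' k a)) (Sq (Pop 3) (emit o' k b))) (s(3 := [?f]))
     (emit_time a B + emit_time b B + 3) (s(o' := rev (bits (eval (Bit v a b) x env)) @ s o'))"
  proof (cases "x ! ?m")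
    case True
    have "runs (emit o' k a) s (emit_time a B) (s(o' := rev (bits (eval a x env)) @ s o'))"
      by (rule Bit.IH(1)) (use Bit.prems in auto)
    moreover have p: "runs (Pop 3) (s(3 := [?f])) 1 s"
      by (rule runs_eq[OF runs_Pop]) (use s3 in \<open>auto simp: fun_eq_iff\<close>)
    ultimately have "runs (Sq (Pop 3) (emit o' k a)) (s(3 := [?f])) (1 + emit_time a B) (s(o' := rev (bits (eval a x env)) @ s o'))"
      using runs_Sq by blast
    from runs_CondT[OF _ this, of 3 1] show ?thesis by (rule runs_eq) (use True in auto)
  next
    case False
    have "runs (emit o' k b) s (emit_time b B) (s(o' := rev (bits (eval b x env)) @ s o'))"
      by (rule Bit.IH(2)) (use Bit.prems in auto)
    moreover have p: "runs (Pop 3) (s(3 := [?f])) 1 s"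
      by (rule runs_eq[OF runs_Pop]) (use s3 in \<open>auto simp: fun_eq_iff\<close>)
    ultimately have "runs (Sq (Pop 3) (emit o' k b)) (s(3 := [?f])) (1 + emit_time b B) (s(o' := rev (bits (eval b x env)) @ s o'))"
      using runs_Sq by blast
    from runs_CondF[OF _ this, of 3 1] show ?thesis by (rule runs_eq) (use False in auto)
  qed
  show ?case
    unfolding emit.simps
    by (rule runs_mono[OF runs_Sq[OF 1 runs_Sq[OF 2 3]]]) simp
qed

section \<open>Polynomial bounds on running times\<close>

definition poly_bounded :: "(nat \<Rightarrow> nat) \<Rightarrow> bool" where
  "poly_bounded f \<longleftrightarrow> (\<exists>p :: nat poly. \<forall>B. f B \<le> poly p B)"

lemma poly_nat_mono: "a \<le> b \<Longrightarrow> poly (p :: nat poly) a \<le> poly p b"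
  by (induction p) (auto intro: add_mono mult_le_mono)

lemma poly_bounded_const: "poly_bounded (\<lambda>_. c)"
  unfolding poly_bounded_def by (rule exI[of _ "[:c:]"]) simp

lemma poly_bounded_id: "poly_bounded (\<lambda>B. B)"
  unfolding poly_bounded_def by (rule exI[of _ "[:0, 1:]"]) simp

lemma poly_bounded_add: "poly_bounded f \<Longrightarrow> poly_bounded g \<Longrightarrow> poly_bounded (\<lambda>B. f B + g B)"
proof -
  assume "poly_bounded f" "poly_bounded g"
  then obtain p q where "\<And>B. f B \<le> poly p B" "\<And>B. g B \<le> poly q B"
    by (auto simp: poly_bounded_def)
  then have "\<And>B. f B + g B \<le> poly (p + q) B" by (simp add: add_mono)
  then show ?thesis unfolding poly_bounded_def by blast
qed

lemma poly_bounded_mult: "poly_bounded f \<Longrightarrow> poly_bounded g \<Longrightarrow> poly_bounded (\<lambda>B. f B * g B)"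
proof -
  assume "poly_bounded f" "poly_bounded g"
  then obtain p q where "\<And>B. f B \<le> poly p B" "\<And>B. g B \<le> poly q B"
    by (auto simp: poly_bounded_def)
  then have "\<And>B. f B * g B \<le> poly (p * q) B" by (simp add: mult_le_mono)
  then show ?thesis unfolding poly_bounded_def by blast
qed

lemma poly_bounded_comp:
  assumes "poly_bounded f" "poly_bounded g"
  shows "poly_bounded (\<lambda>B. f (g B))"
proof -
  obtain p q where p: "\<And>B. f B \<le> poly p B" and q: "\<And>B. g B \<le> poly q B"
    using assms by (auto simp: poly_bounded_def)
  have "f (g B) \<le> poly (pcompose p q) B" for B
    using p[of "g B"] poly_nat_mono[OF q[of B], of p] by (simp add: poly_pcompose)
  then show ?thesis by (auto simp: poly_bounded_def)
qed

lemma poly_bounded_aval: "poly_bounded (\<lambda>B. aval e (\<lambda>_. B))"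
  by (induction e) (auto intro: poly_bounded_const poly_bounded_id poly_bounded_add poly_bounded_mult)

lemma poly_bounded_load_time: "poly_bounded (load_time e)"
proof (induction e)
  case (Const n)
  show ?case using poly_bounded_const[of "2 * n + 1"] by simp
next
  case (Var v)
  have "poly_bounded (\<lambda>B. 12 * B + 2)"
    by (intro poly_bounded_add poly_bounded_mult poly_bounded_const poly_bounded_id)
  then show ?case by simp
next
  case (Plus a b)
  then show ?case using poly_bounded_add[of "load_time a" "load_time b"] by simp
next
  case (Times a b)
  then have "poly_bounded (\<lambda>B. load_time a B + aval a (\<lambda>_. B) * (load_time b B + 3) + 1)"
    by (intro poly_bounded_add poly_bounded_mult poly_bounded_const poly_bounded_aval)
  then show ?case by simp
qed

lemma poly_bounded_emit_time: "poly_bounded (emit_time E)"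
proof (induction E)
  case (Out bs)
  show ?case using poly_bounded_const[of "2 * length bs + 1"] by simp
next
  case (Seq a b)
  then show ?case using poly_bounded_add[of "emit_time a" "emit_time b"] by simp
next
  case (For v e a)
  have "poly_bounded (\<lambda>B. load_time e B + aval e (\<lambda>_. B) * (emit_time a (B + aval e (\<lambda>_. B)) + 8) + 2)"
    by (intro poly_bounded_add poly_bounded_mult poly_bounded_const poly_bounded_aval
        poly_bounded_load_time poly_bounded_comp[OF For] poly_bounded_id)
  then show ?case by simp
next
  case (Num e)
  have "poly_bounded (\<lambda>B. load_time e B + aval e (\<lambda>_. B) * (15 * aval e (\<lambda>_. B) + 30) + 3)"
    by (intro poly_bounded_add poly_bounded_mult poly_bounded_const poly_bounded_aval poly_bounded_load_time)
  then show ?case by simp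
next
  case (Bit v a b)
  then have "poly_bounded (\<lambda>B. 28 * B + 13 + emit_time a B + emit_time b B)"
    by (intro poly_bounded_add poly_bounded_mult poly_bounded_const poly_bounded_id)
  then show ?case by simp
qed

definition load_length :: com where
  "load_length = Sq (Wh 0 (Sq (Push (reg 0) 1) (move_bit 0 4))) (Wh 4 (move_bit 4 0))"

lemma runs_load_length:
  assumes "s 0 = bits x" "s 4 = []" "s (reg 0) = []"
  shows "runs load_length s (16 * length x + 2) (s(reg 0 := unary (length x)))"
proof -
  let ?n = "length x"
  let ?st = "\<lambda>i. s(reg 0 := unary i, 0 := bits (drop i x), 4 := bits (rev (take i x)))"
  have 1: "runs (Wh 0 (Sq (Push (reg 0) 1) (move_bit 0 4))) (?st 0) (?n * (7 + 2) + 1) (?st ?n)"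
  proof (rule runs_loop)
    fix i assume i: "i < ?n"
    have "runs (move_bit 0 4) ((?st i)(reg 0 := 1 # ?st i (reg 0))) 5 (?st (Suc i))"
      by (rule runs_eq[OF runs_move_bit[where b = "x ! i" and l = "bits (drop (Suc i) x)"]])
        (use assms in \<open>auto simp: fun_eq_iff drop_nth_Cons[OF i] rev_take_Suc[OF i]\<close>)
    from runs_Sq[OF runs_Push this] show "runs (Sq (Push (reg 0) 1) (move_bit 0 4)) (?st i) 7 (?st (Suc i))"
      by simp
  qed auto
  let ?st' = "\<lambda>i. s(reg 0 := unary ?n, 0 := bits (drop (?n - i) x), 4 := bits (rev (take (?n - i) x)))"
  have 2: "runs (Wh 4 (move_bit 4 0)) (?st' 0) (?n * (5 + 2) + 1) (?st' ?n)"
  proof (rule runs_loop)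
    fix i assume i: "i < ?n"
    then have ni: "?n - i = Suc (?n - Suc i)" "?n - Suc i < length x" by auto
    show "runs (move_bit 4 0) (?st' i) 5 (?st' (Suc i))"
      by (rule runs_eq[OF runs_move_bit[where b = "x ! (?n - Suc i)" and l = "bits (rev (take (?n - Suc i) x))"]])
        (use assms in \<open>auto simp: fun_eq_iff ni(1) drop_nth_Cons[OF ni(2)] rev_take_Suc[OF ni(2)]\<close>)
  qed auto
  have e: "?st 0 = s" "?st ?n = ?st' 0" "?st' ?n = s(reg 0 := unary ?n)"
    using assms by (auto simp: fun_eq_iff)
  show ?thesis
    unfolding load_length_def
    by (rule runs_eq[OF runs_Sq[OF 1[unfolded e(1,2)] 2]]) (use e(3) in auto)
qed

definition lenv :: "bool list \<Rightarrow> nat \<Rightarrow> nat" where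
  "lenv x = (\<lambda>_. 0)(0 := length x)"

definition well_formed :: "em \<Rightarrow> bool" where
  "well_formed E \<longleftrightarrow> scoped {0} E \<and> (\<forall>x. bit_ok E (length x) (lenv x))"

fun for_vars :: "em \<Rightarrow> nat set" where
  "for_vars (Out bs) = {}"
| "for_vars (Seq a b) = for_vars a \<union> for_vars b"
| "for_vars (For v e a) = insert v (for_vars a)"
| "for_vars (Num e) = {}"
| "for_vars (Bit v a b) = for_vars a \<union> for_vars b"

lemma finite_for_vars: "finite (for_vars E)"
  by (induction E) auto

lemma below_for_vars: "(\<And>v. v \<in> for_vars E \<Longrightarrow> reg v < k) \<Longrightarrow> below k E"
  by (induction E) auto

lemma runs_program:
  assumes "well_formed E" "below k E" "o' \<in> {1, 2}" "6 < k"
  shows "\<exists>s. runs (Sq load_length (emit o' k E)) (init_store x)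
      (16 * length x + 2 + emit_time E (length x)) s \<and>
    s o' = rev (bits (eval E x (lenv x))) \<and> (o' = 2 \<longrightarrow> s 1 = [])"
proof -
  let ?s = "(init_store x)(reg 0 := unary (length x))"
  have 1: "runs load_length (init_store x) (16 * length x + 2) ?s"
    by (rule runs_load_length) (auto simp: init_store_def)
  have "good_store k x {0} (lenv x) (length x) ?s"
    using assms by (auto simp: good_store_def init_store_def lenv_def reg_def ctr_def)
  then have "runs (emit o' k E) ?s (emit_time E (length x)) (?s(o' := rev (bits (eval E x (lenv x))) @ ?s o'))"
    using assms by (intro runs_emit) (auto simp: well_formed_def)
  from runs_Sq[OF 1 this] show ?thesis
    apply (rule_tac exI)
    apply (rule conjI, assumption)
    by (use assms(3) in \<open>auto simp: init_store_def\<close>)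
qed

lemma wf_com_push_all: "r < K \<Longrightarrow> 4 < K \<Longrightarrow> set l \<subseteq> {1, 2} \<Longrightarrow> wf_com K (push_all r l)"
  by (induction l) (auto simp: skip_def)

lemma wf_com_load: "\<exists>K0. \<forall>K\<ge>K0. wf_com K (load e d k)"
proof (induction e arbitrary: d k)
  case (Const n)
  have "wf_com K (push_all d (unary n))" if "d + 5 \<le> K" for K
    by (rule wf_com_push_all) (use that in auto)
  then show ?case by auto
next
  case (Var v)
  show ?case by (rule exI[of _ "reg v + d + 4"]) auto
next
  case (Plus a b)
  obtain K1 K2 where "\<forall>K\<ge>K1. wf_com K (load a d k)" "\<forall>K\<ge>K2. wf_com K (load b d k)"
    using Plus by meson
  then show ?case by (intro exI[of _ "K1 + K2"]) auto
next
  case (Times a b)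
  obtain K1 K2 where "\<forall>K\<ge>K1. wf_com K (load a k (k + 1))" "\<forall>K\<ge>K2. wf_com K (load b d (k + 1))"
    using Times by meson
  then show ?case by (intro exI[of _ "K1 + K2 + k + 1"]) auto
qed

lemma set_bits: "set (bits x) \<subseteq> {1, 2}"
  by (auto simp: bits_def)

lemma wf_com_emit: "\<exists>K0. \<forall>K\<ge>K0. wf_com K (emit o' k E)"
proof (induction E)
  case (Out bs)
  have "wf_com K (push_all o' (bits bs))" if "o' + 5 \<le> K" for K
    by (rule wf_com_push_all) (use that set_bits in auto)
  then show ?case by auto
next
  case (Seq a b)
  obtain K1 K2 where "\<forall>K\<ge>K1. wf_com K (emit o' k a)" "\<forall>K\<ge>K2. wf_com K (emit o' k b)"
    using Seq by meson
  then show ?case by (intro exI[of _ "K1 + K2"]) auto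
next
  case (For v e a)
  obtain K1 K2 where "\<forall>K\<ge>K1. wf_com K (load e (ctr v) k)" "\<forall>K\<ge>K2. wf_com K (emit o' k a)"
    using For wf_com_load by meson
  then show ?case by (intro exI[of _ "K1 + K2 + reg v + 1 + ctr v"]) auto
next
  case (Num e)
  obtain K1 where "\<forall>K\<ge>K1. wf_com K (load e k (k + 1))" using wf_com_load by meson
  then show ?case by (intro exI[of _ "K1 + k + o' + 4"]) (auto simp: put_bin_def halve_def)
next
  case (Bit v a b)
  obtain K1 K2 where "\<forall>K\<ge>K1. wf_com K (emit o' k a)" "\<forall>K\<ge>K2. wf_com K (emit o' k b)"
    using Bit by meson
  then show ?case by (intro exI[of _ "K1 + K2 + k + reg v + 5"]) (auto simp: test_bit_def move_bit_def)
qed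

lemma program_exists:
  assumes "well_formed E" "o' \<in> {1, 2}"
  shows "\<exists>c K p. wf_com K c \<and> 3 \<le> K \<and>
    (\<forall>x. \<exists>n s. n \<le> poly p (length x) \<and> run c (init_store x) n s \<and>
       s o' = rev (bits (eval E x (lenv x))) \<and> (o' = 2 \<longrightarrow> s 1 = []))"
proof -
  have "finite (reg ` for_vars E)" by (simp add: finite_for_vars)
  then obtain k0 where k0: "\<forall>r\<in>reg ` for_vars E. r < k0"
    using finite_nat_set_iff_bounded by blast
  define k where "k = k0 + 7"
  have k: "below k E" by (rule below_for_vars) (use k0 k_def in auto)
  obtain K0 where K0: "\<forall>K\<ge>K0. wf_com K (emit o' k E)" using wf_com_emit by blast
  let ?c = "Sq load_length (emit o' k E)"
  have wf: "wf_com (K0 + 7) ?c"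
    using K0 by (auto simp: load_length_def move_bit_def reg_def)
  have "poly_bounded (\<lambda>B. 16 * B + 2 + emit_time E B)"
    by (intro poly_bounded_add poly_bounded_mult poly_bounded_const poly_bounded_id poly_bounded_emit_time)
  then obtain p where p: "\<And>B. 16 * B + 2 + emit_time E B \<le> poly p B"
    by (auto simp: poly_bounded_def)
  have "\<exists>n s. n \<le> poly p (length x) \<and> run ?c (init_store x) n s \<and>
       s o' = rev (bits (eval E x (lenv x))) \<and> (o' = 2 \<longrightarrow> s 1 = [])" for x
  proof -
    have "6 < k" by (simp add: k_def)
    from runs_program[OF assms(1) k assms(2) this, of x]
    obtain s where s: "runs ?c (init_store x) (16 * length x + 2 + emit_time E (length x)) s"
      "s o' = rev (bits (eval E x (lenv x)))" "o' = 2 \<longrightarrow> s 1 = []" by blast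
    from runs_mono[OF s(1) p] obtain n where "n \<le> poly p (length x)" "run ?c (init_store x) n s"
      unfolding runs_def by blast
    then show ?thesis using s by blast
  qed
  with wf show ?thesis
    by (intro exI[of _ ?c], intro exI[of _ "K0 + 7"], intro exI[of _ p]) simp
qed

theorem poly_time_eval:
  assumes "well_formed E"
  shows "poly_time (\<lambda>x. eval E x (lenv x))"
proof -
  have "(1::nat) \<in> {1, 2}" by simp
  from program_exists[OF assms this] obtain c K p where *: "wf_com K c" "3 \<le> K"
    "\<And>x. \<exists>n s. n \<le> poly p (length x) \<and> run c (init_store x) n s \<and>
       s 1 = rev (bits (eval E x (lenv x))) \<and> (1 = (2::nat) \<longrightarrow> s 1 = [])" by blast
  show ?thesis by (rule poly_time_run[OF *(1)]) (use *(2,3) in simp_all)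
qed

theorem Turing_reducible_eval:
  assumes "well_formed E"
    and "\<And>x f. solves f P \<Longrightarrow> pos < length (f (eval E x (lenv x))) \<and>
           (f (eval E x (lenv x)) ! pos \<noteq> neg \<longleftrightarrow> x \<in> A)"
  shows "Turing_reducible A P"
proof -
  have "(2::nat) \<in> {1, 2}" by simp
  from program_exists[OF assms(1) this] obtain c K p where *: "wf_com K c" "3 \<le> K"
    "\<And>x. \<exists>n s. n \<le> poly p (length x) \<and> run c (init_store x) n s \<and>
       s 2 = rev (bits (eval E x (lenv x))) \<and> (2 = (2::nat) \<longrightarrow> s 1 = [])" by blast
  show ?thesis
  proof (rule Turing_reducible_run[OF *(1,2)])
    show "\<exists>n s. n \<le> poly p (length x) \<and> run c (init_store x) n s \<and> s 1 = [] \<and>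
        s 2 = rev (bits (eval E x (lenv x)))" for x
      using *(3)[of x] by blast
  qed (rule assms(2))
qed

subsection \<open>Distances and spanners\<close>

lemma path_weight_Cons:
  "path_weight G (a # b # p) = weight G {a, b} + path_weight G (b # p)"
  unfolding path_weight_def
  using sum.lessThan_Suc_shift[of "\<lambda>i. weight G {(a # b # p) ! i, (a # b # p) ! Suc i}" "length p"]
  by (simp del: sum.lessThan_Suc)

lemma path_weight_single [simp]: "path_weight G [a] = 0"
  by (simp add: path_weight_def)

lemma is_path_Cons:
  "is_path G u (a # b # p) v \<longleftrightarrow>
     u = a \<and> a \<in> verts G \<and> a \<notin> set (b # p) \<and> {a, b} \<in> edges G \<and> is_path G b (b # p) v"
proof -
  have "(\<forall>i<Suc (length p). {(a # b # p) ! i, (b # p) ! i} \<in> edges G) \<longleftrightarrow>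
     {a, b} \<in> edges G \<and> (\<forall>i<length p. {(b # p) ! i, p ! i} \<in> edges G)"
    by (auto simp: less_Suc_eq_0_disj)
  then show ?thesis unfolding is_path_def by auto
qed

lemma is_path_single: "is_path G u [a] v \<longleftrightarrow> u = a \<and> v = a \<and> a \<in> verts G"
  by (auto simp: is_path_def)

lemma path_potential:
  assumes "is_path H u p v" "\<And>a b. {a, b} \<in> edges H \<Longrightarrow> \<bar>f a - f b\<bar> \<le> weight H {a, b}"
  shows "\<bar>f u - f v\<bar> \<le> path_weight H p"
  using assms(1)
proof (induction p arbitrary: u rule: induct_list012)
  case (2 a)
  then show ?case by (simp add: is_path_single)
next
  case (3 a b p)
  have "u = a" "{a, b} \<in> edges H" "is_path H b (b # p) v" using 3(3) by (auto simp: is_path_Cons)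
  moreover have "\<bar>f b - f v\<bar> \<le> path_weight H (b # p)" using 3 calculation by blast
  ultimately show ?case using assms(2)[of a b] by (simp add: path_weight_Cons)
qed (simp add: is_path_def)

text \<open>Weak duality for shortest paths: a function that changes by at most the weight across
  every edge bounds distances from below. Each statement that a spanner must contain something
  exhibits such a function on a graph without it.\<close>

lemma graph_dist_potential:
  assumes "\<And>a b. {a, b} \<in> edges H \<Longrightarrow> \<bar>f a - f b\<bar> \<le> weight H {a, b}"
  shows "ereal \<bar>f u - f v\<bar> \<le> graph_dist H u v"
  unfolding graph_dist_def by (rule INF_greatest) (use path_potential[OF _ assms] in auto)

text \<open>Unlike an \<open>is_path\<close>, a walk may repeat vertices, so walks concatenate and
  reverse freely; \<open>walk_path\<close> cuts out the loops, which costs nothing as weights are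
  nonnegative.\<close>

inductive walk :: "'v wgraph \<Rightarrow> 'v \<Rightarrow> 'v \<Rightarrow> real \<Rightarrow> bool" for G where
  stop: "u \<in> verts G \<Longrightarrow> walk G u u 0"
| step: "{u, v} \<in> edges G \<Longrightarrow> u \<in> verts G \<Longrightarrow> walk G v w r \<Longrightarrow> walk G u w (weight G {u, v} + r)"

lemma walk_trans: "walk G u v r \<Longrightarrow> walk G v w s \<Longrightarrow> walk G u w (r + s)"
proof (induction rule: walk.induct)
  case (step u v' w' r)
  then show ?case using walk.step[of u v' G w "r + s"] by (simp add: add.assoc)
qed simp

lemma walk_verts: "walk G u v r \<Longrightarrow> u \<in> verts G \<and> v \<in> verts G"
  by (induction rule: walk.induct) auto

lemma walk_edge: "{u, v} \<in> edges G \<Longrightarrow> u \<in> verts G \<Longrightarrow> v \<in> verts G \<Longrightarrow> walk G u v (weight G {u, v})"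
  using walk.step[of u v G v 0] walk.stop[of v G] by simp

lemma walk_sym: "walk G u v r \<Longrightarrow> walk G v u r"
proof (induction rule: walk.induct)
  case (step u v w r)
  have "walk G v u (weight G {u, v})"
    using walk_edge[of v u G] step walk_verts[of G v w r] by (simp add: insert_commute)
  from walk_trans[OF step.IH this] show ?case by (simp add: add.commute)
qed (rule walk.stop)

lemma path_weight_nonneg:
  assumes "\<And>e. e \<in> edges G \<Longrightarrow> 0 \<le> weight G e" "is_path G u p v"
  shows "0 \<le> path_weight G p"
  unfolding path_weight_def using assms by (intro sum_nonneg) (auto simp: is_path_def)

lemma path_suffix:
  assumes "\<And>e. e \<in> edges G \<Longrightarrow> 0 \<le> weight G e" "is_path G u p v" "w \<in> set p"
  shows "\<exists>q. is_path G w q v \<and> path_weight G q \<le> path_weight G p"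
  using assms(2,3)
proof (induction p arbitrary: u rule: induct_list012)
  case (3 a b p)
  show ?case
  proof (cases "w = a")
    case False
    have *: "is_path G b (b # p) v" "{a, b} \<in> edges G" using 3(3) by (auto simp: is_path_Cons)
    then obtain q where q: "is_path G w q v" "path_weight G q \<le> path_weight G (b # p)"
      using 3(2)[of b] 3(4) False by auto
    then show ?thesis using assms(1)[OF *(2)] by (intro exI[of _ q]) (simp add: path_weight_Cons)
  next
    case True
    then show ?thesis using 3(3) by (intro exI[of _ "a # b # p"]) (auto simp: is_path_Cons)
  qed
qed (auto simp: is_path_def)

lemma walk_path:
  assumes "\<And>e. e \<in> edges G \<Longrightarrow> 0 \<le> weight G e" "walk G u v r"
  shows "\<exists>p. is_path G u p v \<and> path_weight G p \<le> r"
  using assms(2)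
proof (induction rule: walk.induct)
  case (stop u)
  then show ?case by (intro exI[of _ "[u]"]) (simp add: is_path_single)
next
  case (step u v w r)
  obtain p where p: "is_path G v p w" "path_weight G p \<le> r" using step by blast
  have 0: "0 \<le> weight G {u, v}" using assms(1) step by blast
  show ?case
  proof (cases "u \<in> set p")
    case True
    then show ?thesis using path_suffix[OF assms(1) p(1) True] p(2) 0 by force
  next
    case False
    obtain q where q: "p = v # q" using p(1) by (cases p) (auto simp: is_path_def)
    then show ?thesis using p False step 0
      by (intro exI[of _ "u # p"]) (simp add: is_path_Cons path_weight_Cons)
  qed
qed

lemma graph_dist_walk:
  assumes "\<And>e. e \<in> edges G \<Longrightarrow> 0 \<le> weight G e" "walk G u v r"
  shows "graph_dist G u v \<le> ereal r"
proof -
  obtain p where "is_path G u p v" "path_weight G p \<le> r" using walk_path[OF assms] by blast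
  then show ?thesis unfolding graph_dist_def by (intro INF_lower2[of p]) auto
qed

lemma graph_dist_nonneg:
  assumes "\<And>e. e \<in> edges G \<Longrightarrow> 0 \<le> weight G e"
  shows "0 \<le> graph_dist G u v"
  unfolding graph_dist_def
  by (rule INF_greatest) (use path_weight_nonneg[OF assms] in auto)

lemma wf_weight_nonneg: "wf_wgraph G \<Longrightarrow> e \<in> edges G \<Longrightarrow> 0 \<le> weight G e"
  by (auto simp: wf_wgraph_def less_imp_le)

lemma subgraph_weight_nonneg:
  "wf_wgraph G \<Longrightarrow> spanning_subgraph H G \<Longrightarrow> e \<in> edges H \<Longrightarrow> 0 \<le> weight H e"
  using wf_weight_nonneg by (auto simp: spanning_subgraph_def)

text \<open>An edge need not be a shortest path, but its weight bounds the distance in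
  \<open>G\<close> from above, which is the direction needed.\<close>

lemma t_spanner_edge:
  assumes "wf_wgraph G" "t_spanner t H G" "{u, v} \<in> edges G" "0 < t"
  shows "graph_dist H u v \<le> ereal (t * weight G {u, v})"
proof -
  have uv: "u \<in> verts G" "v \<in> verts G" "u \<noteq> v" "0 < weight G {u, v}"
  proof -
    have "{u, v} \<subseteq> verts G \<and> card {u, v} = 2 \<and> weight G {u, v} > 0"
      using assms(1,3) unfolding wf_wgraph_def by blast
    then show "u \<in> verts G" "v \<in> verts G" "u \<noteq> v" "0 < weight G {u, v}" by (auto simp: card_insert_if)
  qed
  have sp: "spanning_subgraph H G" and d: "dilation H G \<le> ereal t"
    using assms(2) by (auto simp: t_spanner_def)
  note w0 = wf_weight_nonneg[OF assms(1)] subgraph_weight_nonneg[OF assms(1) sp]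
  let ?a = "graph_dist H u v" and ?b = "graph_dist G u v"
  have "?a / ?b \<le> dilation H G" unfolding dilation_def
    by (rule SUP_upper2[of "(u, v)"]) (use uv(1-3) in simp_all)
  then have q: "?a / ?b \<le> ereal t" using d by simp
  have b: "0 \<le> ?b" "?b \<le> ereal (weight G {u, v})"
    using graph_dist_nonneg[OF w0(1)] graph_dist_walk[OF w0(1) walk_edge[OF assms(3) uv(1,2)]] by auto
  have a: "0 \<le> ?a" using graph_dist_nonneg[OF w0(2)] .
  obtain r where r: "?b = ereal r" "0 \<le> r" "r \<le> weight G {u, v}"
    using b by (cases ?b) auto
  have "?a \<le> ereal (t * r)"
  proof (cases "r = 0")
    \<comment> \<open>Division by 0 in \<open>ereal\<close> is multiplication by infinity, so a
      finite quotient forces the distance in \<open>H\<close> to be 0 as well.\<close>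
    case True
    then have "?a * \<infinity> \<le> ereal t" using q r by (simp add: divide_ereal_def zero_ereal_def[symmetric])
    then have "?a = 0" using a by (cases ?a) (auto split: if_splits)
    then show ?thesis using True by (simp add: zero_ereal_def)
  next
    case False
    then have "?a \<le> ereal t * ?b" using q r by (subst (asm) ereal_divide_le_pos) (auto simp: mult.commute)
    then show ?thesis using r by simp
  qed
  also have "\<dots> \<le> ereal (t * weight G {u, v})" using r assms(4) by simp
  finally show ?thesis .
qed

lemma path_stretch:
  assumes "\<And>a b. {a, b} \<in> edges G \<Longrightarrow> \<exists>r \<le> t * weight G {a, b}. walk H a b r"
    and "is_path G u p v" "verts H = verts G"
  shows "\<exists>r \<le> t * path_weight G p. walk H u v r"
  using assms(2)
proof (induction p arbitrary: u rule: induct_list012)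
  case (2 a)
  then show ?case using walk.stop[of a H] assms(3) by (auto simp: is_path_single)
next
  case (3 a b p)
  have e: "u = a" "{a, b} \<in> edges G" "is_path G b (b # p) v" using 3(3) by (auto simp: is_path_Cons)
  obtain r s where "r \<le> t * weight G {a, b}" "walk H a b r"
    "s \<le> t * path_weight G (b # p)" "walk H b v s"
    using assms(1)[OF e(2)] 3(2)[OF e(3)] by blast
  then show ?case using walk_trans[of H a b r v s] e(1)
    by (intro exI[of _ "r + s"]) (simp add: path_weight_Cons distrib_left)
qed (simp add: is_path_def)

text \<open>Stretch adds up along a path, so it suffices to bound the detours of single edges. Pairs
  disconnected in \<open>G\<close> are harmless since dividing by infinity gives 0.\<close>

lemma t_spannerI:
  assumes "wf_wgraph G" "spanning_subgraph H G" "0 < t"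
    and "\<And>a b. {a, b} \<in> edges G \<Longrightarrow> \<exists>r \<le> t * weight G {a, b}. walk H a b r"
  shows "t_spanner t H G"
proof -
  note w0 = wf_weight_nonneg[OF assms(1)] subgraph_weight_nonneg[OF assms(1,2)]
  have "graph_dist H u v / graph_dist G u v \<le> ereal t" for u v
  proof -
    let ?a = "graph_dist H u v" and ?b = "graph_dist G u v"
    have a: "0 \<le> ?a" by (rule graph_dist_nonneg) (rule w0(2))
    have b: "0 \<le> ?b" by (rule graph_dist_nonneg) (rule w0(1))
    have path: "?a \<le> ereal (t * path_weight G p)" if p: "is_path G u p v" for p
    proof -
      have "verts H = verts G" using assms(2) by (simp add: spanning_subgraph_def)
      from path_stretch[OF assms(4) p this]
      obtain r where r: "r \<le> t * path_weight G p" "walk H u v r" by blast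
      have "?a \<le> ereal r" using w0(2) r(2) by (rule graph_dist_walk)
      also have "\<dots> \<le> ereal (t * path_weight G p)" using r(1) by simp
      finally show ?thesis .
    qed
    have ab: "?a \<le> ereal t * ?b"
    proof -
      have "ereal (1 / t) * ?a \<le> ?b" unfolding graph_dist_def[of G]
      proof (rule INF_greatest)
        fix p assume "p \<in> {p. is_path G u p v}"
        then have "?a \<le> ereal (t * path_weight G p)" using path by simp
        then show "ereal (1 / t) * ?a \<le> ereal (path_weight G p)"
          using assms(3) a by (cases ?a) (auto simp: field_simps)
      qed
      then show ?thesis using assms(3) a b by (cases ?a; cases ?b) (auto simp: field_simps)
    qed
    consider "?b = \<infinity>" | "?b = 0" | r where "?b = ereal r" "0 < r"
      using b by (cases ?b) (auto simp: order_le_less zero_ereal_def)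
    then show ?thesis
    proof cases
      case 1
      then show ?thesis using assms(3) by (simp add: zero_ereal_def[symmetric])
    next
      case 2
      then have "?a = 0" using a ab by simp
      then show ?thesis using assms(3) by simp
    next
      case 3
      then show ?thesis using ab by (subst ereal_divide_le_pos) (auto simp: mult.commute)
    qed
  qed
  then have "dilation H G \<le> ereal t" unfolding dilation_def by (intro SUP_least) auto
  then show ?thesis using assms(2) by (simp add: t_spanner_def)
qed

subsection \<open>The gadget graph\<close>

text \<open>All branches are copies of one chain of \<open>last\<close> unit edges that starts in a common hub.
  In the plane a branch runs back and forth along a thin cone, on the right of the hub for the
  first \<open>nR\<close> branches and on the left for the others; \<open>turn1\<close> and \<open>turn2\<close>
  are its turning points closest to the hub, and \<open>port1\<close> and \<open>last\<close> are at distances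
  \<open>pos1\<close> and \<open>pos2\<close> from the hub. A shortcut of length \<open>yl\<close>, \<open>zl\<close> or \<open>ul\<close>
  cuts off such a turning point; it is an item that can be bought. The edges \<open>D0\<close> and
  \<open>Link\<close> impose the constraints: they are stretched too much along the chains unless a
  shortcut on the way is bought.\<close>

datatype desc = Chain nat nat | Y nat | U1 nat | U2 nat | D0 nat | Link nat bool nat

record template =
  turn1 :: nat
  turn2 :: nat
  port1 :: nat
  last :: nat
  pos1 :: nat
  pos2 :: nat
  half :: nat
  yl :: nat
  zl :: nat
  ul :: nat
  rise :: nat

text \<open>\<open>Y 1\<close> is set apart as the tell-tale item of the dilation problem: its own
  length \<open>zl\<close> allows its detour to be too long at stretch \<open>t0\<close> while the
  detours of all other items are still short enough.\<close>

definition ylen :: "template \<Rightarrow> nat \<Rightarrow> nat" where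
  "ylen T j = (if j = 1 then zl T else yl T)"

text \<open>The first \<open>n\<close> branches carry the items \<open>Y\<close>, the others the
  items \<open>U1\<close> and \<open>U2\<close>. A link with \<open>b\<close> false ends at
  \<open>port1\<close>, before the second turn, so \<open>U2\<close> is not on its way; one with
  \<open>b\<close> true ends at \<open>last\<close> and passes both turns.\<close>

fun ends :: "template \<Rightarrow> nat \<Rightarrow> desc \<Rightarrow> (nat \<times> nat) \<times> (nat \<times> nat)" where
  "ends T n (Chain b i) = ((b, i), (b, Suc i))"
| "ends T n (Y j) = ((j, turn2 T - 2 * half T), (j, turn2 T + 2 * half T + ylen T j))"
| "ends T n (U1 u) = ((n + u, turn1 T - half T), (n + u, turn1 T + half T + ul T))"
| "ends T n (U2 u) = ((n + u, turn2 T - 2 * half T), (n + u, turn2 T + 2 * half T + ul T))"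
| "ends T n (D0 u) = ((n + u, 0), (n + u, last T))"
| "ends T n (Link u b j) = ((j, last T), (n + u, if b then last T else port1 T))"

fun len :: "template \<Rightarrow> desc \<Rightarrow> nat" where
  "len T (Chain b i) = 1"
| "len T (Y j) = ylen T j"
| "len T (U1 u) = ul T"
| "len T (U2 u) = ul T"
| "len T (D0 u) = pos2 T"
| "len T (Link u b j) = (if b then 2 * pos2 T else pos1 T + pos2 T)"

text \<open>Around its turn, \<open>U1\<close> saves \<open>2 * half\<close>, and each of
  \<open>U2\<close> and \<open>Y\<close> saves \<open>4 * half\<close>. Apart from the order along
  the chain, the conditions say the following. All other edges are too long to replace a chain edge
  (\<open>t1 + 1 \<le> zl T\<close>). A constraint edge costs at least two items \<open>U\<close>,
  one item \<open>Y\<close> and \<open>2 * yl\<close> more. Stretch \<open>t0\<close> is achieved by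
  a constraint one of whose items is bought, and by the chain around an unbought \<open>Y\<close> or
  \<open>U\<close>; for length \<open>zl\<close> this is demanded only at \<open>t1\<close>. Stretch
  \<open>t1\<close> is exceeded by a constraint without its items, for a link with \<open>b\<close>
  true even if \<open>U1\<close> is bought, whence the term \<open>2 * half\<close> on the right.
  The summands 1 leave room for the errors of the weights.\<close>

definition good_template :: "real \<Rightarrow> real \<Rightarrow> template \<Rightarrow> bool" where
  "good_template t0 t1 T \<longleftrightarrow> 1 < t0 \<and> t0 \<le> t1 \<and> 0 < half T \<and> half T < turn1 T \<and>
     turn1 T + half T + ul T \<le> port1 T \<and> port1 T + 2 * half T \<le> turn2 T \<and>
     turn2 T + 2 * half T + ul T \<le> last T \<and> zl T \<le> yl T \<and> yl T \<le> ul T \<and>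
     t1 + 1 \<le> zl T \<and> 2 * ul T + 3 * yl T \<le> pos1 T \<and> pos1 T \<le> pos2 T \<and>
     real (port1 T + last T) - 2 * half T + 1 \<le> t0 * (pos1 T + pos2 T) \<and>
     2 * real (last T) - 4 * half T + 1 \<le> t0 * (2 * pos2 T) \<and>
     real (last T) - 2 * half T + 1 \<le> t0 * pos2 T \<and>
     real (yl T) + 4 * half T + 1 \<le> t0 * yl T \<and>
     real (zl T) + 4 * half T + 1 \<le> t1 * zl T \<and>
     t1 * (pos1 T + pos2 T) + 1 \<le> port1 T + last T \<and>
     t1 * (2 * pos2 T) + 1 \<le> 2 * real (last T) - 2 * half T \<and>
     t1 * pos2 T + 1 \<le> last T"

definition descs :: "template \<Rightarrow> nat \<Rightarrow> nat \<Rightarrow> (nat \<times> bool \<times> nat) set \<Rightarrow> desc set" where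
  "descs T nR nU links = {Chain b i | b i. b < nR + nU \<and> i < last T} \<union> Y ` {..<nR} \<union>
     U1 ` {..<nU} \<union> U2 ` {..<nU} \<union> D0 ` {..<nU} \<union> (\<lambda>(u, b, j). Link u b j) ` links"

definition cover :: "nat \<Rightarrow> (nat \<times> bool \<times> nat) set \<Rightarrow> nat set \<Rightarrow> nat set \<Rightarrow> nat set \<Rightarrow> bool" where
  "cover nU links A1 A2 Ys \<longleftrightarrow> (\<forall>u<nU. u \<in> A1 \<or> u \<in> A2) \<and>
     (\<forall>(u, b, j)\<in>links. u \<in> (if b then A2 else A1) \<or> j \<in> Ys)"

locale layout =
  fixes T :: template and t0 t1 :: real and nR nU :: nat and links :: "(nat \<times> bool \<times> nat) set"
    and \<nu> :: "nat \<Rightarrow> nat \<Rightarrow> 'v"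
  assumes good: "good_template t0 t1 T" and nR: "2 \<le> nR"
    and links: "\<And>u b j. (u, b, j) \<in> links \<Longrightarrow> u < nU \<and> j < nR \<and> j \<noteq> 1" "finite links"
    and hub: "\<And>b. \<nu> b 0 = \<nu> 0 0"
    and inj: "\<And>b i b' i'. b < nR + nU \<Longrightarrow> i \<le> last T \<Longrightarrow> b' < nR + nU \<Longrightarrow> i' \<le> last T \<Longrightarrow>
       \<nu> b i = \<nu> b' i' \<Longrightarrow> i = i' \<and> (i = 0 \<or> b = b')"
begin

abbreviation "B \<equiv> nR + nU"
abbreviation "P \<equiv> last T"
abbreviation "D \<equiv> descs T nR nU links"

definition eset :: "desc \<Rightarrow> 'v set" where
  "eset d = {case_prod \<nu> (fst (ends T nR d)), case_prod \<nu> (snd (ends T nR d))}"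

lemma finite_D: "finite D"
proof -
  have "{Chain b i | b i. b < B \<and> i < P} = (\<lambda>(b, i). Chain b i) ` ({..<B} \<times> {..<P})" by auto
  then show ?thesis using links(2) by (simp add: descs_def)
qed

lemma t_bounds: "1 < t0" "t0 \<le> t1" "0 < t1" "0 < t0"
  using good by (auto simp: good_template_def)

definition canon :: "nat \<times> nat \<Rightarrow> nat \<times> nat" where
  "canon p = (if snd p = 0 then (0, 0) else p)"

definition valid :: "nat \<times> nat \<Rightarrow> bool" where "valid p \<longleftrightarrow> fst p < B \<and> snd p \<le> P"

lemma \<nu>_eq: "valid p \<Longrightarrow> valid q \<Longrightarrow> case_prod \<nu> p = case_prod \<nu> q \<longleftrightarrow> canon p = canon q"
  using inj[of "fst p" "snd p" "fst q" "snd q"] hub[of "fst p"] hub[of "fst q"]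
  by (cases p; cases q) (auto simp: valid_def canon_def)

lemma valid_ends: "d \<in> D \<Longrightarrow> valid (fst (ends T nR d))" "d \<in> D \<Longrightarrow> valid (snd (ends T nR d))"
  using good links(1) unfolding descs_def
  by (auto simp: valid_def good_template_def ylen_def, fastforce+)

lemma D_cases:
  assumes "d \<in> D"
  obtains (chain) b i where "d = Chain b i" "b < B" "i < P"
  | (y) j where "d = Y j" "j < nR"
  | (u1) u where "d = U1 u" "u < nU"
  | (u2) u where "d = U2 u" "u < nU"
  | (d0) u where "d = D0 u" "u < nU"
  | (link) u b j where "d = Link u b j" "(u, b, j) \<in> links"
  using assms unfolding descs_def by auto

text \<open>The two ends of an edge are ordered lexicographically with the hub first, so that
  equality of unordered pairs of ends reduces to equality of ordered ones.\<close>

lemma canon_less: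
  assumes "d \<in> D"
  shows "fst (canon (fst (ends T nR d))) < fst (canon (snd (ends T nR d))) \<or>
    fst (canon (fst (ends T nR d))) = fst (canon (snd (ends T nR d))) \<and>
    snd (canon (fst (ends T nR d))) < snd (canon (snd (ends T nR d)))"
proof -
  have g: "half T < turn1 T" "turn1 T + half T + ul T \<le> port1 T" "port1 T + 2 * half T \<le> turn2 T"
     "turn2 T + 2 * half T + ul T \<le> P" "0 < half T"
    using good by (auto simp: good_template_def)
  show ?thesis
    using assms by (cases rule: D_cases) (use g nR in \<open>auto simp: canon_def dest: links(1)\<close>)
qed

lemma canon_pair_inj:
  assumes "d \<in> D" "d' \<in> D"
    "{canon (fst (ends T nR d)), canon (snd (ends T nR d))} = {canon (fst (ends T nR d')), canon (snd (ends T nR d'))}"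
  shows "d = d'"
proof -
  define x1 y1 x2 y2 where "x1 = turn1 T - half T" and "y1 = turn1 T + half T + ul T"
    and "x2 = turn2 T - 2 * half T" and "y2 = turn2 T + 2 * half T + ul T"
  define z where "z j = turn2 T + 2 * half T + ylen T j" for j
  have g: "0 < x1" "Suc x1 < y1" "y1 \<le> port1 T" "port1 T \<le> x2" "Suc x2 < y2" "y2 \<le> P"
    "\<And>j. Suc x2 < z j" "\<And>j. z j \<le> y2"
    using good by (auto simp: good_template_def x1_def x2_def y1_def y2_def z_def ylen_def)
  have g': "x1 \<noteq> x2" "x2 \<noteq> x1" "z j \<noteq> Suc x2" "P \<noteq> port1 T" "port1 T \<noteq> P" "0 < x1" "0 < x2" "P \<noteq> Suc 0" "Suc 0 \<noteq> P"
     "y1 \<noteq> Suc x1" "y2 \<noteq> Suc x2" "x1 \<noteq> P" "x2 \<noteq> P" "P \<noteq> x1" "P \<noteq> x2" "0 < P" "0 < port1 T" for j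
    using g(1-6) g(7)[of j] g(8)[of j] by auto
  note lk = links(1)
  note [[linarith_neq_limit = 0]]
  have e: "canon (fst (ends T nR d)) = canon (fst (ends T nR d'))" "canon (snd (ends T nR d)) = canon (snd (ends T nR d'))"
    using assms(3) canon_less[OF assms(1)] canon_less[OF assms(2)] unfolding doubleton_eq_iff by auto
  from assms(1) show ?thesis
  proof (cases rule: D_cases)
  case 1: (chain b i)
    from assms(2) show ?thesis
      by (cases rule: D_cases) (use e 1 g' in \<open>auto simp: canon_def x1_def[symmetric] x2_def[symmetric]
          y1_def[symmetric] y2_def[symmetric] z_def[symmetric] dest: lk split: if_splits\<close>)
  next
  case 1: (y j)
    from assms(2) show ?thesis
      by (cases rule: D_cases) (use e 1 g' in \<open>auto simp: canon_def x1_def[symmetric] x2_def[symmetric]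
          y1_def[symmetric] y2_def[symmetric] z_def[symmetric] dest: lk split: if_splits\<close>)
  next
  case 1: (u1 u)
    from assms(2) show ?thesis
      by (cases rule: D_cases) (use e 1 g' in \<open>auto simp: canon_def x1_def[symmetric] x2_def[symmetric]
          y1_def[symmetric] y2_def[symmetric] z_def[symmetric] dest: lk split: if_splits\<close>)
  next
  case 1: (u2 u)
    from assms(2) show ?thesis
      by (cases rule: D_cases) (use e 1 g' in \<open>auto simp: canon_def x1_def[symmetric] x2_def[symmetric]
          y1_def[symmetric] y2_def[symmetric] z_def[symmetric] dest: lk split: if_splits\<close>)
  next
  case 1: (d0 u)
    from assms(2) show ?thesis
      by (cases rule: D_cases) (use e 1 g' in \<open>auto simp: canon_def x1_def[symmetric] x2_def[symmetric]
          y1_def[symmetric] y2_def[symmetric] z_def[symmetric] dest: lk split: if_splits\<close>)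
  next
  case 1: (link u b j)
    from assms(2) show ?thesis
      by (cases rule: D_cases) (use e 1 g' lk[OF 1(2)] in \<open>auto simp: canon_def x1_def[symmetric] x2_def[symmetric]
          y1_def[symmetric] y2_def[symmetric] z_def[symmetric] dest: lk split: if_splits\<close>)
  qed
qed

lemma eset_inj: "inj_on eset D"
proof (rule inj_onI)
  fix d d' assume d: "d \<in> D" "d' \<in> D" "eset d = eset d'"
  then have "{canon (fst (ends T nR d)), canon (snd (ends T nR d))} = {canon (fst (ends T nR d')), canon (snd (ends T nR d'))}"
    unfolding eset_def doubleton_eq_iff by (simp add: \<nu>_eq valid_ends)
  then show "d = d'" using canon_pair_inj d by blast
qed

end

text \<open>Edge weights are the integral lengths \<open>len\<close> at scale \<open>\<Lambda>\<close>; \<open>\<epsilon>\<close>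
  absorbs the error of Euclidean lengths.\<close>

locale gadget = layout T t0 t1 nR nU links \<nu>
  for T t0 t1 nR nU links and \<nu> :: "nat \<Rightarrow> nat \<Rightarrow> 'v" +
  fixes G :: "'v wgraph" and \<Lambda> \<epsilon> :: real
  assumes wf: "wf_wgraph G"
    and verts: "verts G = {\<nu> b i | b i. b < nR + nU \<and> i \<le> last T}"
    and edges: "edges G = (\<lambda>d. {case_prod \<nu> (fst (ends T nR d)), case_prod \<nu> (snd (ends T nR d))}) `
       descs T nR nU links"
    and scale: "0 < \<Lambda>" "0 \<le> \<epsilon>" "card (descs T nR nU links) * \<epsilon> \<le> 1 / 2" "t1 * \<epsilon> \<le> 1 / 2"
    and weights: "\<And>d. d \<in> descs T nR nU links \<Longrightarrow>
       \<Lambda> * len T d \<le> weight G {case_prod \<nu> (fst (ends T nR d)), case_prod \<nu> (snd (ends T nR d))} \<and>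
       weight G {case_prod \<nu> (fst (ends T nR d)), case_prod \<nu> (snd (ends T nR d))} \<le> \<Lambda> * (len T d + \<epsilon>)"
begin

lemma edges': "edges G = eset ` D"
  by (simp add: edges eset_def[abs_def])

lemma weights': "d \<in> D \<Longrightarrow> \<Lambda> * len T d \<le> weight G (eset d)" "d \<in> D \<Longrightarrow> weight G (eset d) \<le> \<Lambda> * (len T d + \<epsilon>)"
  using weights by (simp_all add: eset_def)

definition used :: "'v wgraph \<Rightarrow> desc set" where
  "used H = {d \<in> D. eset d \<in> edges H}"

lemma edges_used: "spanning_subgraph H G \<Longrightarrow> edges H = eset ` used H"
  unfolding used_def spanning_subgraph_def edges' by auto

lemma weight_used: "spanning_subgraph H G \<Longrightarrow> total_weight H = (\<Sum>d\<in>used H. weight G (eset d))"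
proof -
  assume H: "spanning_subgraph H G"
  have "inj_on eset (used H)" using eset_inj by (rule inj_on_subset) (auto simp: used_def)
  then show ?thesis
    using H unfolding total_weight_def edges_used[OF H] by (simp add: sum.reindex spanning_subgraph_def)
qed

lemma weight_lower: "spanning_subgraph H G \<Longrightarrow> \<Lambda> * (\<Sum>d\<in>used H. real (len T d)) \<le> total_weight H"
  unfolding weight_used sum_distrib_left by (rule sum_mono) (use weights' in \<open>auto simp: used_def\<close>)

lemma potential:
  assumes H: "spanning_subgraph H G" and f0: "\<And>b. f b 0 = 0"
    and step: "\<And>d. d \<in> used H \<Longrightarrow>
       \<bar>case_prod f (fst (ends T nR d)) - case_prod f (snd (ends T nR d))\<bar> \<le> real (len T d)"
    and pq: "valid p" "valid q"
  shows "ereal (\<Lambda> * \<bar>case_prod f p - case_prod f q\<bar>) \<le> graph_dist H (case_prod \<nu> p) (case_prod \<nu> q)"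
proof -
  \<comment> \<open>Distinct positions share a vertex only at the hub, where \<open>f\<close>
    vanishes, so every choice of the position gives the same value.\<close>
  define \<phi> where "\<phi> v = \<Lambda> * case_prod f (SOME p. valid p \<and> case_prod \<nu> p = v)" for v
  have fc: "case_prod f (canon p) = case_prod f p" for p
    by (cases p) (simp add: canon_def f0)
  have \<phi>: "\<phi> (case_prod \<nu> p) = \<Lambda> * case_prod f p" if "valid p" for p
  proof -
    let ?q = "SOME q. valid q \<and> case_prod \<nu> q = case_prod \<nu> p"
    have "valid ?q \<and> case_prod \<nu> ?q = case_prod \<nu> p" 
      using someI[of "\<lambda>q. valid q \<and> case_prod \<nu> q = case_prod \<nu> p" p] that by simp
    then have "canon ?q = canon p" using \<nu>_eq[of ?q p] that by simp
    then have "case_prod f ?q = case_prod f p" using fc[of ?q] fc[of p] by simp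
    then show ?thesis by (simp add: \<phi>_def)
  qed
  have "\<bar>\<phi> a - \<phi> b\<bar> \<le> weight H {a, b}" if e: "{a, b} \<in> edges H" for a b
  proof -
    obtain d where d: "d \<in> used H" "{a, b} = eset d" using e edges_used[OF H] by auto
    then have dD: "d \<in> D" by (simp add: used_def)
    let ?p = "fst (ends T nR d)" and ?q = "snd (ends T nR d)"
    have "\<bar>\<phi> a - \<phi> b\<bar> = \<bar>\<phi> (case_prod \<nu> ?p) - \<phi> (case_prod \<nu> ?q)\<bar>"
      using d(2) unfolding eset_def doubleton_eq_iff by (auto simp: abs_minus_commute)
    also have "\<dots> = \<Lambda> * \<bar>case_prod f ?p - case_prod f ?q\<bar>"
      using \<phi>[OF valid_ends(1)[OF dD]] \<phi>[OF valid_ends(2)[OF dD]] scale(1)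
      by (simp add: abs_mult flip: right_diff_distrib)
    also have "\<dots> \<le> \<Lambda> * len T d" using step[OF d(1)] scale(1) by simp
    also have "\<dots> \<le> weight G (eset d)" using weights'(1)[OF dD] .
    finally show ?thesis using d(2) H by (simp add: spanning_subgraph_def)
  qed
  then have "ereal \<bar>\<phi> (case_prod \<nu> p) - \<phi> (case_prod \<nu> q)\<bar> \<le> graph_dist H (case_prod \<nu> p) (case_prod \<nu> q)"
    by (rule graph_dist_potential)
  then show ?thesis
    using \<phi>[OF pq(1)] \<phi>[OF pq(2)] scale(1) by (simp add: abs_mult flip: right_diff_distrib)
qed

text \<open>The common form of all lower bounds: a potential admissible for the used edges separates
  the ends of \<open>d\<close> by at least 1 more than the stretch permits, while the error in the
  weight of \<open>d\<close> accounts for only \<open>t * \<epsilon> \<le> 1 / 2\<close>.\<close>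

lemma stretch_violation:
  assumes t: "t_spanner t H G" "t \<in> {t0, t1}" and d: "d \<in> D" and f0: "\<And>b. f b 0 = 0"
    and step: "\<And>d. d \<in> used H \<Longrightarrow>
       \<bar>case_prod f (fst (ends T nR d)) - case_prod f (snd (ends T nR d))\<bar> \<le> real (len T d)"
    and far: "t * len T d + 1 \<le> \<bar>case_prod f (fst (ends T nR d)) - case_prod f (snd (ends T nR d))\<bar>"
  shows False
proof -
  let ?p = "fst (ends T nR d)" and ?q = "snd (ends T nR d)"
  have H: "spanning_subgraph H G" using t by (simp add: t_spanner_def)
  have t1: "0 < t" "t * \<epsilon> \<le> 1 / 2"
    using t(2) t_bounds scale(2,4) mult_right_mono[of t0 t1 \<epsilon>] by auto
  have "{case_prod \<nu> ?p, case_prod \<nu> ?q} \<in> edges G" using d by (auto simp: edges)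
  from t_spanner_edge[OF wf t(1) this t1(1)]
  have "graph_dist H (case_prod \<nu> ?p) (case_prod \<nu> ?q) \<le> ereal (t * weight G (eset d))"
    by (simp add: eset_def)
  moreover have "ereal (\<Lambda> * \<bar>case_prod f ?p - case_prod f ?q\<bar>) \<le> graph_dist H (case_prod \<nu> ?p) (case_prod \<nu> ?q)"
    by (rule potential[OF H f0 step]) (use valid_ends d in auto)
  ultimately have "ereal (\<Lambda> * \<bar>case_prod f ?p - case_prod f ?q\<bar>) \<le> ereal (t * weight G (eset d))"
    by (rule order_trans[rotated])
  then have "\<Lambda> * \<bar>case_prod f ?p - case_prod f ?q\<bar> \<le> t * weight G (eset d)" by simp
  also have "\<dots> \<le> t * (\<Lambda> * (len T d + \<epsilon>))" using weights'(2)[OF d] t1 by simp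
  also have "\<dots> = \<Lambda> * (t * len T d + t * \<epsilon>)" by (simp add: algebra_simps)
  finally have "\<bar>case_prod f ?p - case_prod f ?q\<bar> \<le> t * len T d + t * \<epsilon>" using scale(1) by simp
  then show False using far t1 by linarith
qed

lemma len_nonchain:
  assumes "d \<in> D" "\<forall>b i. d \<noteq> Chain b i"
  shows "real (zl T) \<le> len T d"
proof -
  have "zl T \<le> len T d"
    using assms(1)
    by (cases rule: D_cases) (use good assms(2) in \<open>auto simp: good_template_def ylen_def\<close>)
  then show ?thesis by simp
qed

text \<open>Without the edge, a potential that jumps by \<open>zl\<close> behind it is admissible,
  because only edges of length at least \<open>zl\<close> cross the jump. Its ends are then further
  apart than stretch \<open>t1\<close> allows.\<close>

lemma chain_used:
  assumes t: "t_spanner t1 H G" and b: "b < B" "i < P"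
  shows "Chain b i \<in> used H"
proof (rule ccontr)
  assume c: "Chain b i \<notin> used H"
  define f where "f b' i' = (if b' = b \<and> i < i' then real (zl T) else 0)" for b' i'
  have D: "Chain b i \<in> D" using b by (auto simp: descs_def)
  have g: "t1 + 1 \<le> zl T" using good by (simp add: good_template_def)
  show False
  proof (rule stretch_violation[OF t _ D, of f])
    fix d assume d: "d \<in> used H"
    then have dD: "d \<in> D" by (simp add: used_def)
    have f: "f x y \<in> {0, real (zl T)}" for x y by (simp add: f_def)
    show "\<bar>case_prod f (fst (ends T nR d)) - case_prod f (snd (ends T nR d))\<bar> \<le> real (len T d)"
    proof (cases "\<exists>b' i'. d = Chain b' i'")
      case True
      then obtain b' i' where "d = Chain b' i'" by blast
      moreover from this have "\<not> (b' = b \<and> i' = i)" using c d by auto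
      ultimately show ?thesis by (auto simp: f_def)
    next
      case False
      have "\<bar>case_prod f p - case_prod f q\<bar> \<le> real (zl T)" for p q
        using f[of "fst p" "snd p"] f[of "fst q" "snd q"] by (auto simp: case_prod_beta)
      then show ?thesis using len_nonchain[OF dD] False by (meson order_trans)
    qed
  qed (use g t_bounds in \<open>auto simp: f_def\<close>)
qed

section \<open>From light spanners to covers\<close>

definition con :: "'v wgraph \<Rightarrow> desc set" where
  "con H = {d \<in> used H. (\<exists>u. d = D0 u) \<or> (\<exists>u b j. d = Link u b j)}"

definition touchU :: "'v wgraph \<Rightarrow> nat set" where
  "touchU H = {u. D0 u \<in> used H \<or> (\<exists>b j. Link u b j \<in> used H)}"

definition touchY :: "'v wgraph \<Rightarrow> nat set" where
  "touchY H = {j. \<exists>u b. Link u b j \<in> used H}"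

text \<open>An exchange argument: every used constraint edge is given up, and all items at its ends
  are bought instead, whether useful or not. By \<open>good_template\<close> this saves at least
  \<open>2 * yl\<close> per constraint edge.\<close>

definition selU1 where "selU1 H = {u. U1 u \<in> used H} \<union> touchU H"
definition selU2 where "selU2 H = {u. U2 u \<in> used H} \<union> touchU H"
definition selY where "selY H = {j. j \<noteq> 1 \<and> Y j \<in> used H} \<union> touchY H"

text \<open>A clause violated by the selection yields a potential that only varies along the two
  branches concerned, and no used edge leaves these.\<close>

lemma potential_step:
  fixes f g :: "nat \<Rightarrow> real"
  assumes "d \<in> used H" "u \<notin> touchU H" "j \<notin> touchY H" "Y j \<notin> used H \<or> g = (\<lambda>_. 0)"
    and g0: "g 0 = 0" "f 0 = 0" and gs: "\<And>i. \<bar>g i - g (Suc i)\<bar> \<le> 1" and fs: "\<And>i. \<bar>f i - f (Suc i)\<bar> \<le> 1"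
    and f1: "U1 u \<in> used H \<Longrightarrow> \<bar>f (turn1 T - half T) - f (turn1 T + half T + ul T)\<bar> \<le> ul T"
    and f2: "U2 u \<in> used H \<Longrightarrow> \<bar>f (turn2 T - 2 * half T) - f (turn2 T + 2 * half T + ul T)\<bar> \<le> ul T"
    and j: "j < nR"
  defines "F \<equiv> \<lambda>b i. if b = j then g i else if b = nR + u then - f i else (0::real)"
  shows "\<bar>case_prod F (fst (ends T nR d)) - case_prod F (snd (ends T nR d))\<bar> \<le> real (len T d)"
proof -
  have "d \<in> D" using assms(1) by (simp add: used_def)
  then show ?thesis
  proof (cases rule: D_cases)
    case (chain b i)
    then show ?thesis using gs[of i] fs[of i] by (auto simp: F_def)
  next
    case (y k)
    then show ?thesis using assms(1,4) j by (auto simp: F_def)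
  next
    case (u1 v)
    then show ?thesis using f1 assms(1) j by (auto simp: F_def)
  next
    case (u2 v)
    then show ?thesis using f2 assms(1) j by (auto simp: F_def)
  next
    case (d0 v)
    then show ?thesis using assms(1,2) j g0 by (auto simp: F_def touchU_def)
  next
    case (link v b k)
    then show ?thesis using assms(1,2,3) j links(1)[OF link(2)] by (auto simp: F_def touchU_def touchY_def)
  qed
qed

lemma cover_selection:
  assumes t: "t_spanner t1 H G"
  shows "cover nU links (selU1 H) (selU2 H) (selY H)"
  unfolding cover_def
proof (intro conjI allI impI ballI)
  note good' = good[unfolded good_template_def]
  fix u assume u: "u < nU"
  show "u \<in> selU1 H \<or> u \<in> selU2 H"
  proof (rule ccontr)
    assume "\<not> ?thesis"
    then have n: "u \<notin> touchU H" "U1 u \<notin> used H" "U2 u \<notin> used H" by (auto simp: selU1_def selU2_def)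
    have dD: "D0 u \<in> D" using u by (auto simp: descs_def)
    \<comment> \<open>Branch 1, where no link ends, stands in for the second branch of
      \<open>potential_step\<close>, with potential 0.\<close>
    define F where "F = (\<lambda>b i. if b = 1 then 0 else if b = nR + u then - real i else (0::real))"
    show False
    proof (rule stretch_violation[OF t _ dD, of F])
      fix d assume "d \<in> used H"
      then show "\<bar>case_prod F (fst (ends T nR d)) - case_prod F (snd (ends T nR d))\<bar> \<le> real (len T d)"
        unfolding F_def using n nR links(1)
        by (intro potential_step[where g = "\<lambda>_. 0" and f = real and j = 1])
          (auto simp: touchY_def used_def descs_def)
    qed (use good' nR in \<open>auto simp: F_def\<close>)
  qed
next
  note good' = good[unfolded good_template_def]
  fix l assume l: "l \<in> links"
  obtain u b j where lj: "l = (u, b, j)" by (cases l)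
  have uj: "u < nU" "j < nR" "j \<noteq> 1" using links(1) l lj by auto
  have dD: "Link u b j \<in> D" using l lj by (force simp: descs_def)
  have "u \<in> (if b then selU2 H else selU1 H) \<or> j \<in> selY H"
  proof (rule ccontr)
    assume "\<not> ?thesis"
    then have n: "u \<notin> touchU H" "(if b then U2 u else U1 u) \<notin> used H" "j \<notin> touchY H" "Y j \<notin> used H"
      using uj by (auto simp: selU1_def selU2_def selY_def split: if_splits)
    \<comment> \<open>The item that may still be bought on branch \<open>nR + u\<close> is the one
      that does not serve the link. For \<open>b\<close> true this is \<open>U1\<close>: the
      potential pauses for \<open>2 * half\<close> inside its range, so that it rises by exactly
      \<open>ul\<close> across it. For \<open>b\<close> false it is \<open>U2\<close>: the potential
      stops at \<open>port1\<close>, before the range of \<open>U2\<close>.\<close>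
    define f :: "nat \<Rightarrow> real" where "f i = (if b
      then min (real i) (max (real (turn1 T - half T + ul T)) (real i - 2 * half T))
      else min (real i) (real (port1 T)))" for i
    define F where "F = (\<lambda>b i. if b = j then real i else if b = nR + u then - f i else (0::real))"
    have h: "half T \<le> turn1 T" "2 * half T \<le> turn2 T" "turn1 T + half T + ul T \<le> port1 T"
      "port1 T + 2 * half T \<le> turn2 T" "port1 T \<le> last T"
      using good' by auto
    show False
    proof (rule stretch_violation[OF t _ dD, of F])
      fix d assume "d \<in> used H"
      then show "\<bar>case_prod F (fst (ends T nR d)) - case_prod F (snd (ends T nR d))\<bar> \<le> real (len T d)"
        unfolding F_def
      proof (rule potential_step)
        show "\<bar>f i - f (Suc i)\<bar> \<le> 1" for i by (auto simp: f_def min_def max_def)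
        show "\<bar>f (turn1 T - half T) - f (turn1 T + half T + ul T)\<bar> \<le> ul T" if "U1 u \<in> used H"
          using that n(2) h by (auto simp: f_def of_nat_diff)
        show "\<bar>f (turn2 T - 2 * half T) - f (turn2 T + 2 * half T + ul T)\<bar> \<le> ul T" if "U2 u \<in> used H"
          using that n(2) h by (auto simp: f_def of_nat_diff)
      qed (use n uj in \<open>auto simp: f_def\<close>)
    next
      have "f P = real P - 2 * half T" if b
        using that h good' by (auto simp: f_def of_nat_diff min_def max_def)
      moreover have "f (port1 T) = port1 T" if "\<not> b" using that by (simp add: f_def)
      ultimately show "t1 * real (len T (Link u b j)) + 1 \<le> \<bar>case_prod F (fst (ends T nR (Link u b j))) -
          case_prod F (snd (ends T nR (Link u b j)))\<bar>"
        using good' uj by (auto simp: F_def)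
    qed (auto simp: F_def f_def)
  qed
  then show "case l of (u, b, j) \<Rightarrow> u \<in> (if b then selU2 H else selU1 H) \<or> j \<in> selY H"
    by (simp add: lj)
qed

end

context gadget begin

definition conlen :: nat where "conlen = 2 * ul T + 3 * yl T"

lemma touch_card:
  shows "card (touchU H) \<le> card (con H)" "card (touchY H) \<le> card (con H)"
    "finite (touchU H)" "finite (touchY H)" "finite (con H)" "finite (used H)"
proof -
  have fu: "finite (used H)" using finite_D by (auto simp: used_def)
  then have fc: "finite (con H)" by (auto simp: con_def)
  let ?g = "\<lambda>d. case d of D0 u \<Rightarrow> u | Link u b j \<Rightarrow> u | _ \<Rightarrow> 0"
  let ?h = "\<lambda>d. case d of Link u b j \<Rightarrow> j | _ \<Rightarrow> 0"
  have "touchU H \<subseteq> ?g ` con H" by (force simp: touchU_def con_def image_iff)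
  moreover have "touchY H \<subseteq> ?h ` con H" by (force simp: touchY_def con_def image_iff)
  ultimately show "card (touchU H) \<le> card (con H)" "card (touchY H) \<le> card (con H)"
    "finite (touchU H)" "finite (touchY H)"
    using fc by (meson card_image_le card_mono finite_imageI le_trans finite_subset)+
  show "finite (con H)" "finite (used H)" by fact+
qed

text \<open>The chains are forced, each selected item is bought or charged to a constraint edge, and
  each constraint edge has \<open>2 * yl\<close> to spare after that.\<close>

lemma spanner_lower:
  assumes t: "t_spanner t1 H G"
  shows "\<Lambda> * (B * P + ul T * (card (selU1 H) + card (selU2 H)) + yl T * card (selY H) +
      (if Y 1 \<in> used H then zl T else 0) + 2 * yl T * card (con H)) \<le> total_weight H"
proof -
  have H: "spanning_subgraph H G" using t by (simp add: t_spanner_def)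
  let ?Ch = "(\<lambda>(b, i). Chain b i) ` ({..<B} \<times> {..<P})"
  define V1 V2 W where "V1 = {u. U1 u \<in> used H}" and "V2 = {u. U2 u \<in> used H}"
    and "W = {j. j \<noteq> 1 \<and> Y j \<in> used H}"
  define Z where "Z = (if Y 1 \<in> used H then {Y 1} else {})"
  note fin = touch_card[of H]
  have sub: "V1 \<subseteq> {..<nU}" "V2 \<subseteq> {..<nU}" "W \<subseteq> {..<nR}"
    by (auto simp: V1_def V2_def W_def used_def descs_def)
  then have fV: "finite V1" "finite V2" "finite W" by (auto intro: finite_subset)
  have Ch: "?Ch \<subseteq> used H" using chain_used[OF t] by auto
  have used: "used H = ?Ch \<union> (U1 ` V1 \<union> (U2 ` V2 \<union> (Y ` W \<union> (Z \<union> con H))))"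
  proof
    show "used H \<subseteq> ?Ch \<union> (U1 ` V1 \<union> (U2 ` V2 \<union> (Y ` W \<union> (Z \<union> con H))))"
    proof
      fix d assume d: "d \<in> used H"
      then have "d \<in> D" by (simp add: used_def)
      then show "d \<in> ?Ch \<union> (U1 ` V1 \<union> (U2 ` V2 \<union> (Y ` W \<union> (Z \<union> con H))))"
        by (cases rule: D_cases) (use d in \<open>auto simp: V1_def V2_def W_def Z_def con_def\<close>)
    qed
    show "?Ch \<union> (U1 ` V1 \<union> (U2 ` V2 \<union> (Y ` W \<union> (Z \<union> con H)))) \<subseteq> used H"
      using Ch by (auto simp: V1_def V2_def W_def Z_def con_def split: if_splits)
  qed
  have zf: "finite Z" by (simp add: Z_def)
  have "(\<Sum>d\<in>used H. len T d) = (\<Sum>d\<in>?Ch. len T d) + ((\<Sum>d\<in>U1 ` V1. len T d) + ((\<Sum>d\<in>U2 ` V2. len T d) +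
     ((\<Sum>d\<in>Y ` W. len T d) + ((\<Sum>d\<in>Z. len T d) + (\<Sum>d\<in>con H. len T d)))))"
    unfolding used using fV zf fin
    by (subst sum.union_disjoint, simp, simp, force simp: Z_def con_def W_def split: if_splits)+ simp
  also have "(\<Sum>d\<in>?Ch. len T d) = B * P"
    by (subst sum.reindex) (auto simp: inj_on_def case_prod_beta)
  also have "(\<Sum>d\<in>U1 ` V1. len T d) = ul T * card V1"
    by (subst sum.reindex) (auto simp: inj_on_def)
  also have "(\<Sum>d\<in>U2 ` V2. len T d) = ul T * card V2"
    by (subst sum.reindex) (auto simp: inj_on_def)
  also have "(\<Sum>d\<in>Y ` W. len T d) = yl T * card W"
    by (subst sum.reindex) (auto simp: inj_on_def ylen_def W_def)
  also have "(\<Sum>d\<in>Z. len T d) = (if Y 1 \<in> used H then zl T else 0)"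
    by (simp add: Z_def ylen_def)
  finally have s: "(\<Sum>d\<in>used H. len T d) = B * P + (ul T * card V1 + (ul T * card V2 + (yl T * card W +
     ((if Y 1 \<in> used H then zl T else 0) + (\<Sum>d\<in>con H. len T d)))))" .
  have con: "conlen * card (con H) \<le> (\<Sum>d\<in>con H. len T d)"
  proof -
    have "conlen \<le> len T d" if "d \<in> con H" for d
      using that good by (auto simp: con_def conlen_def good_template_def)
    then have "(\<Sum>d\<in>con H. conlen) \<le> (\<Sum>d\<in>con H. len T d)" by (rule sum_mono)
    then show ?thesis by (simp add: mult.commute)
  qed
  have c: "card (selU1 H) \<le> card V1 + card (con H)" "card (selU2 H) \<le> card V2 + card (con H)"
    "card (selY H) \<le> card W + card (con H)"
    unfolding selU1_def selU2_def selY_def V1_def[symmetric] V2_def[symmetric] W_def[symmetric]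
    using fin(1,2) by (meson card_Un_le add_left_mono le_trans)+
  have "ul T * card (selU1 H) \<le> ul T * card V1 + ul T * card (con H)"
    "ul T * card (selU2 H) \<le> ul T * card V2 + ul T * card (con H)"
    "yl T * card (selY H) \<le> yl T * card W + yl T * card (con H)"
    using c by (metis add_mult_distrib2 mult_le_mono2)+
  then have "B * P + ul T * (card (selU1 H) + card (selU2 H)) + yl T * card (selY H) +
      (if Y 1 \<in> used H then zl T else 0) + 2 * yl T * card (con H) \<le> (\<Sum>d\<in>used H. len T d)"
    unfolding s using con by (simp add: conlen_def algebra_simps)
  then have "real (B * P + ul T * (card (selU1 H) + card (selU2 H)) + yl T * card (selY H) +
      (if Y 1 \<in> used H then zl T else 0) + 2 * yl T * card (con H)) \<le> (\<Sum>d\<in>used H. real (len T d))"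
    by (metis of_nat_le_iff of_nat_sum)
  then show ?thesis
    using weight_lower[OF H] scale(1) by (meson mult_le_cancel_left_pos order_trans)
qed

lemma selY_no_con: "con H = {} \<Longrightarrow> selY H = {j. j \<noteq> 1 \<and> Y j \<in> used H}"
proof -
  assume "con H = {}"
  then have "Link u b j \<notin> used H" for u b j unfolding con_def by blast
  then show ?thesis by (simp add: selY_def touchY_def)
qed

lemma selY_subset: "selY H \<subseteq> {j. j < nR \<and> j \<noteq> 1}" "selU1 H \<subseteq> {..<nU}" "selU2 H \<subseteq> {..<nU}"
  using links(1)
  by (auto simp: selY_def touchY_def used_def descs_def selU1_def selU2_def touchU_def)

text \<open>On branch 1 only \<open>Y 1\<close> bypasses chain edges, so without it the ends of its
  range are as far apart as along the chain.\<close>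

lemma z_required:
  assumes t: "t_spanner t0 H G" and z: "t0 * zl T + 1 \<le> zl T + 4 * half T"
  shows "Y 1 \<in> used H"
proof (rule ccontr)
  assume c: "Y 1 \<notin> used H"
  note good' = good[unfolded good_template_def]
  have D: "Y 1 \<in> D" using nR by (auto simp: descs_def)
  define f where "f b i = (if b = 1 then real i else 0)" for b i :: nat
  show False
  proof (rule stretch_violation[OF t _ D, of f])
    fix d assume d: "d \<in> used H"
    then have "d \<in> D" by (simp add: used_def)
    then show "\<bar>case_prod f (fst (ends T nR d)) - case_prod f (snd (ends T nR d))\<bar> \<le> real (len T d)"
    proof (cases rule: D_cases)
      case (link u b j)
      then show ?thesis using links(1)[OF link(2)] nR by (auto simp: f_def)
    qed (use d c nR in \<open>auto simp: f_def\<close>)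
  next
    show "t0 * real (len T (Y 1)) + 1 \<le>
       \<bar>case_prod f (fst (ends T nR (Y 1))) - case_prod f (snd (ends T nR (Y 1)))\<bar>"
      using z good' by (auto simp: f_def ylen_def of_nat_diff)
  qed (auto simp: f_def)
qed

section \<open>From covers to light spanners\<close>

definition canonical :: "nat set \<Rightarrow> nat set \<Rightarrow> nat set \<Rightarrow> 'v wgraph" where
  "canonical A1 A2 Ys = G\<lparr>edges := eset ` ({Chain b i | b i. b < B \<and> i < P} \<union>
     U1 ` A1 \<union> U2 ` A2 \<union> Y ` Ys)\<rparr>"

lemma canonical_subset:
  assumes "A1 \<subseteq> {..<nU}" "A2 \<subseteq> {..<nU}" "Ys \<subseteq> {..<nR}"
  shows "{Chain b i | b i. b < B \<and> i < P} \<union> U1 ` A1 \<union> U2 ` A2 \<union> Y ` Ys \<subseteq> D"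
  using assms by (auto simp: descs_def)

lemma spanning_canonical:
  assumes "A1 \<subseteq> {..<nU}" "A2 \<subseteq> {..<nU}" "Ys \<subseteq> {..<nR}"
  shows "spanning_subgraph (canonical A1 A2 Ys) G"
  using canonical_subset[OF assms] by (auto simp: spanning_subgraph_def canonical_def edges')

lemma used_edges:
  assumes "X \<subseteq> D"
  shows "used (G\<lparr>edges := eset ` X\<rparr>) = X"
  using assms inj_on_image_mem_iff[OF eset_inj _ assms] by (auto simp: used_def)

lemma used_canonical:
  assumes "A1 \<subseteq> {..<nU}" "A2 \<subseteq> {..<nU}" "Ys \<subseteq> {..<nR}"
  shows "used (canonical A1 A2 Ys) = {Chain b i | b i. b < B \<and> i < P} \<union> U1 ` A1 \<union> U2 ` A2 \<union> Y ` Ys"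
  unfolding canonical_def by (rule used_edges[OF canonical_subset[OF assms]])

lemma canonical_weight:
  assumes "A1 \<subseteq> {..<nU}" "A2 \<subseteq> {..<nU}" "Ys \<subseteq> {..<nR}"
  shows "total_weight (canonical A1 A2 Ys) \<le>
    \<Lambda> * (B * P + ul T * (card A1 + card A2) + yl T * card (Ys - {1}) + (if 1 \<in> Ys then zl T else 0) + 1 / 2)"
proof -
  let ?H = "canonical A1 A2 Ys"
  let ?Ch = "(\<lambda>(b, i). Chain b i) ` ({..<B} \<times> {..<P})"
  define Z where "Z = (if 1 \<in> Ys then {Y 1} else {})"
  have f: "finite A1" "finite A2" "finite Ys" using assms by (auto intro: finite_subset)
  have "{Chain b i | b i. b < B \<and> i < P} = ?Ch" by auto
  then have used: "used ?H = ?Ch \<union> (U1 ` A1 \<union> (U2 ` A2 \<union> (Y ` (Ys - {1}) \<union> Z)))"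
    unfolding used_canonical[OF assms] by (auto simp: Z_def)
  have "(\<Sum>d\<in>used ?H. len T d) = (\<Sum>d\<in>?Ch. len T d) + ((\<Sum>d\<in>U1 ` A1. len T d) + ((\<Sum>d\<in>U2 ` A2. len T d) +
     ((\<Sum>d\<in>Y ` (Ys - {1}). len T d) + (\<Sum>d\<in>Z. len T d))))"
    unfolding used using f by (subst sum.union_disjoint, simp, simp add: Z_def, force simp: Z_def split: if_splits)+ simp
  also have "(\<Sum>d\<in>?Ch. len T d) = B * P"
    by (subst sum.reindex) (auto simp: inj_on_def case_prod_beta)
  also have "(\<Sum>d\<in>U1 ` A1. len T d) = ul T * card A1"
    by (subst sum.reindex) (auto simp: inj_on_def)
  also have "(\<Sum>d\<in>U2 ` A2. len T d) = ul T * card A2"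
    by (subst sum.reindex) (auto simp: inj_on_def)
  also have "(\<Sum>d\<in>Y ` (Ys - {1}). len T d) = yl T * card (Ys - {1})"
    by (subst sum.reindex) (auto simp: inj_on_def ylen_def)
  also have "(\<Sum>d\<in>Z. len T d) = (if 1 \<in> Ys then zl T else 0)"
    by (simp add: Z_def ylen_def)
  finally have s: "(\<Sum>d\<in>used ?H. len T d) = B * P + (ul T * card A1 + (ul T * card A2 +
      (yl T * card (Ys - {1}) + (if 1 \<in> Ys then zl T else 0))))" .
  have "total_weight ?H = (\<Sum>d\<in>used ?H. weight G (eset d))"
    by (rule weight_used[OF spanning_canonical[OF assms]])
  also have "\<dots> \<le> (\<Sum>d\<in>used ?H. \<Lambda> * (len T d + \<epsilon>))"
    by (rule sum_mono) (use weights'(2) in \<open>auto simp: used_def\<close>)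
  also have "\<dots> = \<Lambda> * (real (\<Sum>d\<in>used ?H. len T d) + card (used ?H) * \<epsilon>)"
    by (simp add: sum.distrib flip: sum_distrib_left)
  also have "\<dots> \<le> \<Lambda> * (real (\<Sum>d\<in>used ?H. len T d) + 1 / 2)"
  proof -
    have "card (used ?H) \<le> card D" by (rule card_mono[OF finite_D]) (auto simp: used_def)
    then have "card (used ?H) * \<epsilon> \<le> card D * \<epsilon>" using scale(2) by (intro mult_right_mono) auto
    then show ?thesis using scale(1,3) by simp
  qed
  finally show ?thesis unfolding s by (simp add: add.assoc distrib_left)
qed

lemma canonical_walk_edge:
  assumes "d \<in> used H" "spanning_subgraph H G"
  shows "\<exists>r \<le> \<Lambda> * (len T d + \<epsilon>). walk H (case_prod \<nu> (fst (ends T nR d))) (case_prod \<nu> (snd (ends T nR d))) r"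
proof -
  have dD: "d \<in> D" and e: "eset d \<in> edges H" using assms(1) by (auto simp: used_def)
  have v: "case_prod \<nu> p \<in> verts H" if "valid p" for p
    using that assms(2) verts by (cases p) (auto simp: valid_def spanning_subgraph_def)
  have "walk H (case_prod \<nu> (fst (ends T nR d))) (case_prod \<nu> (snd (ends T nR d))) (weight H (eset d))"
    unfolding eset_def by (rule walk_edge) (use e v valid_ends[OF dD] in \<open>auto simp: eset_def\<close>)
  then show ?thesis using weights'(2)[OF dD] assms(2) by (auto simp: spanning_subgraph_def)
qed

lemma chain_walk:
  assumes H: "spanning_subgraph H G" and ch: "\<And>b i. b < B \<Longrightarrow> i < P \<Longrightarrow> Chain b i \<in> used H"
    and b: "b < B" "i + k \<le> P"
  shows "\<exists>r \<le> \<Lambda> * (k + k * \<epsilon>). walk H (\<nu> b i) (\<nu> b (i + k)) r"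
  using b(2)
proof (induction k)
  case 0
  have "\<nu> b i \<in> verts G"
    unfolding verts using b(1) 0 by (intro CollectI exI[of _ b] exI[of _ i]) simp
  then have "\<nu> b i \<in> verts H" using H by (simp add: spanning_subgraph_def)
  then show ?case using walk.stop by force
next
  case (Suc k)
  obtain r where r: "r \<le> \<Lambda> * (k + k * \<epsilon>)" "walk H (\<nu> b i) (\<nu> b (i + k)) r" using Suc by auto
  obtain s where s: "s \<le> \<Lambda> * (1 + \<epsilon>)" "walk H (\<nu> b (i + k)) (\<nu> b (Suc (i + k))) s"
    using canonical_walk_edge[OF ch[OF b(1), of "i + k"] H] Suc.prems by auto
  show ?case
    using walk_trans[OF r(2) s(2)] r(1) s(1) by (intro exI[of _ "r + s"]) (simp add: algebra_simps)
qed

lemma shortcut_walk: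
  assumes H: "spanning_subgraph H G" and ch: "\<And>b i. b < B \<Longrightarrow> i < P \<Longrightarrow> Chain b i \<in> used H"
    and d: "d \<in> used H" "ends T nR d = ((b, x), (b, y))" "x \<le> y" "y \<le> n" "n \<le> P" "b < B" "len T d + s = y - x"
  shows "\<exists>r \<le> \<Lambda> * (real n - s + P * \<epsilon>). walk H (\<nu> b 0) (\<nu> b n) r"
proof -
  obtain r1 where r1: "r1 \<le> \<Lambda> * (x + x * \<epsilon>)" "walk H (\<nu> b 0) (\<nu> b x) r1"
    using chain_walk[OF H ch, of b 0 x] d by auto
  obtain r2 where r2: "r2 \<le> \<Lambda> * (len T d + \<epsilon>)" "walk H (\<nu> b x) (\<nu> b y) r2"
    using canonical_walk_edge[OF d(1) H] d(2) by auto
  obtain r3 where r3: "r3 \<le> \<Lambda> * ((n - y) + (n - y) * \<epsilon>)" "walk H (\<nu> b y) (\<nu> b n) r3"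
    using chain_walk[OF H ch, of b y "n - y"] d by auto
  have pos: "0 < len T d"
    using d(1) good by (cases d) (auto simp: good_template_def ylen_def used_def)
  have "r1 + (r2 + r3) \<le> \<Lambda> * (x + x * \<epsilon> + (len T d + \<epsilon>) + ((n - y) + (n - y) * \<epsilon>))"
    using r1(1) r2(1) r3(1) by (simp add: distrib_left)
  also have "\<dots> \<le> \<Lambda> * (real n - s + P * \<epsilon>)"
  proof -
    have "real x + len T d + (n - y) = real n - s" using d(3,4,7) by simp
    \<comment> \<open>The walk has at most \<open>P\<close> edges, because the shortcut replaces at
      least one chain edge; each edge contributes one error.\<close>
    moreover have "(x + 1 + (n - y)) \<le> P" using d(3,4,5,7) pos by simp
    then have "real (x + 1 + (n - y)) * \<epsilon> \<le> P * \<epsilon>" using scale(2) by (intro mult_right_mono) auto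
    ultimately have "x + x * \<epsilon> + (len T d + \<epsilon>) + ((n - y) + (n - y) * \<epsilon>) \<le> real n - s + P * \<epsilon>"
      by (simp add: algebra_simps)
    then show ?thesis using scale(1) by simp
  qed
  finally show ?thesis using walk_trans[OF r1(2) walk_trans[OF r2(2) r3(2)]] by blast
qed

text \<open>There are at least two branches, hence at least \<open>2 * P\<close> chain edges among
  the edges whose total error is at most 1/2. A walk through the hub along two branches thus has
  error at most 1/2.\<close>

lemma P_eps: "P * \<epsilon> \<le> 1 / 4"
proof -
  have "(\<lambda>(b, i). Chain b i) ` ({..<2} \<times> {..<P}) \<subseteq> D" using nR by (auto simp: descs_def)
  then have "card ((\<lambda>(b, i). Chain b i) ` ({..<2::nat} \<times> {..<P})) \<le> card D" by (rule card_mono[OF finite_D])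
  moreover have "card ((\<lambda>(b, i). Chain b i) ` ({..<2::nat} \<times> {..<P})) = 2 * P"
    by (subst card_image) (auto simp: inj_on_def)
  ultimately have "real (2 * P) * \<epsilon> \<le> card D * \<epsilon>" using scale(2) by (intro mult_right_mono) auto
  then show ?thesis using scale(3) by simp
qed

text \<open>By \<open>t_spannerI\<close> one walk per edge suffices: the edge itself, the chain
  around an unbought item, or for a constraint edge the chains through the hub with the bought item
  as a shortcut. \<open>Y 1\<close> need not have a good detour at stretch \<open>t0\<close>, hence
  the proviso on \<open>t\<close>.\<close>

lemma canonical_spanner:
  assumes cov: "cover nU links A1 A2 Ys" and sub: "A1 \<subseteq> {..<nU}" "A2 \<subseteq> {..<nU}" "Ys \<subseteq> {..<nR}"
    and t: "t = t0 \<and> 1 \<in> Ys \<or> t = t1"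
  shows "t_spanner t (canonical A1 A2 Ys) G"
proof (rule t_spannerI[OF wf spanning_canonical[OF sub]])
  note good' = good[unfolded good_template_def]
  let ?H = "canonical A1 A2 Ys"
  have H: "spanning_subgraph ?H G" by (rule spanning_canonical[OF sub])
  have us: "used ?H = {Chain b i | b i. b < B \<and> i < P} \<union> U1 ` A1 \<union> U2 ` A2 \<union> Y ` Ys"
    by (rule used_canonical[OF sub])
  have ch: "\<And>b i. b < B \<Longrightarrow> i < P \<Longrightarrow> Chain b i \<in> used ?H" by (auto simp: us)
  show t_pos: "0 < t" using t t_bounds by auto
  have tt: "t0 \<le> t" using t t_bounds by auto
  have up: "t0 * real x \<le> t * real x" for x using tt by (rule mult_right_mono) simp
  have w: "\<exists>r \<le> t * weight G (eset d). walk ?H (case_prod \<nu> (fst (ends T nR d))) (case_prod \<nu> (snd (ends T nR d))) r"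
    if d: "d \<in> D" for d
  proof -
    \<comment> \<open>From here on only integral lengths have to be compared; 1/2 covers the error
      of a whole walk.\<close>
    have *: "?thesis" if "\<exists>r \<le> \<Lambda> * (x + 1 / 2). walk ?H (case_prod \<nu> (fst (ends T nR d))) (case_prod \<nu> (snd (ends T nR d))) r"
      "x + 1 / 2 \<le> t * len T d" for x
    proof -
      have "\<Lambda> * (x + 1 / 2) \<le> \<Lambda> * (t * len T d)" using that(2) scale(1) by simp
      also have "\<dots> \<le> t * weight G (eset d)"
        using weights'(1)[OF d] t_pos by (metis mult.left_commute mult_le_cancel_left_pos)
      finally show ?thesis using that(1) by (meson order_trans)
    qed
    have detour: "\<exists>r \<le> \<Lambda> * (k + 1 / 2). walk ?H (\<nu> b x) (\<nu> b (x + k)) r" if bx: "b < B" "x + k \<le> P" for b x k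
    proof -
      obtain r where r: "r \<le> \<Lambda> * (k + k * \<epsilon>)" "walk ?H (\<nu> b x) (\<nu> b (x + k)) r"
        using chain_walk[OF H ch bx] by auto
      have "k * \<epsilon> \<le> P * \<epsilon>" using bx(2) scale(2) by (intro mult_right_mono) auto
      then have "\<Lambda> * (k + k * \<epsilon>) \<le> \<Lambda> * (k + 1 / 2)" using P_eps scale(1) by simp
      then show ?thesis using r by (meson order_trans)
    qed
    have own: ?thesis if "d \<in> used ?H"
    proof -
      have "eset d \<in> edges ?H" using that by (simp add: used_def)
      moreover have v: "case_prod \<nu> p \<in> verts ?H" if "valid p" for p
        using that H verts by (cases p) (auto simp: valid_def spanning_subgraph_def)
      ultimately have "walk ?H (case_prod \<nu> (fst (ends T nR d))) (case_prod \<nu> (snd (ends T nR d))) (weight ?H (eset d))"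
        unfolding eset_def using valid_ends[OF d] by (intro walk_edge) auto
      moreover have "weight ?H (eset d) \<le> t * weight G (eset d)"
      proof -
        have "0 \<le> weight G (eset d)" using wf_weight_nonneg[OF wf] d edges' by blast
        then have "1 * weight G (eset d) \<le> t * weight G (eset d)" using tt t_bounds by (intro mult_right_mono) auto
        then show ?thesis using H by (simp add: spanning_subgraph_def)
      qed
      ultimately show ?thesis by blast
    qed
    have w1: "\<exists>r \<le> \<Lambda> * (real n - 2 * half T + P * \<epsilon>). walk ?H (\<nu> (nR + u) 0) (\<nu> (nR + u) n) r"
      if "u \<in> A1" "port1 T \<le> n" "n \<le> P" for u n
    proof -
      have "\<exists>r \<le> \<Lambda> * (real n - real (2 * half T) + P * \<epsilon>). walk ?H (\<nu> (nR + u) 0) (\<nu> (nR + u) n) r"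
        by (rule shortcut_walk[OF H ch, of "U1 u" _ "turn1 T - half T" "turn1 T + half T + ul T"])
          (use that sub us good' in auto)
      then show ?thesis by simp
    qed
    have w2: "\<exists>r \<le> \<Lambda> * (real P - 4 * half T + P * \<epsilon>). walk ?H (\<nu> (nR + u) 0) (\<nu> (nR + u) P) r"
      if "u \<in> A2" for u
    proof -
      have "\<exists>r \<le> \<Lambda> * (real P - real (4 * half T) + P * \<epsilon>). walk ?H (\<nu> (nR + u) 0) (\<nu> (nR + u) P) r"
        by (rule shortcut_walk[OF H ch, of "U2 u" _ "turn2 T - 2 * half T" "turn2 T + 2 * half T + ul T"])
          (use that sub us good' in auto)
      then show ?thesis by simp
    qed
    have wy: "\<exists>r \<le> \<Lambda> * (real P - 4 * half T + P * \<epsilon>). walk ?H (\<nu> j 0) (\<nu> j P) r"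
      if "j \<in> Ys" "j \<noteq> 1" for j
    proof -
      have "\<exists>r \<le> \<Lambda> * (real P - real (4 * half T) + P * \<epsilon>). walk ?H (\<nu> j 0) (\<nu> j P) r"
        by (rule shortcut_walk[OF H ch, of "Y j" _ "turn2 T - 2 * half T" "turn2 T + 2 * half T + ylen T j"])
          (use that sub us good' in \<open>auto simp: ylen_def\<close>)
      then show ?thesis by simp
    qed
    have w0: "\<exists>r \<le> \<Lambda> * (real n + P * \<epsilon>). walk ?H (\<nu> b 0) (\<nu> b n) r" if bn: "b < B" "n \<le> P" for b n
    proof -
      obtain r where r: "r \<le> \<Lambda> * (n + n * \<epsilon>)" "walk ?H (\<nu> b 0) (\<nu> b n) r"
        using chain_walk[OF H ch, of b 0 n] bn by auto
      have "n * \<epsilon> \<le> P * \<epsilon>" using bn(2) scale(2) by (intro mult_right_mono) auto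
      then have "\<Lambda> * (n + n * \<epsilon>) \<le> \<Lambda> * (n + P * \<epsilon>)" using scale(1) by simp
      then show ?thesis using r by (meson order_trans)
    qed
    have both: "\<exists>r \<le> \<Lambda> * (x + y + 1 / 2). walk ?H (\<nu> j n) (\<nu> b m) r"
      if xy: "\<exists>r \<le> \<Lambda> * (x + P * \<epsilon>). walk ?H (\<nu> j 0) (\<nu> j n) r" "\<exists>r \<le> \<Lambda> * (y + P * \<epsilon>). walk ?H (\<nu> b 0) (\<nu> b m) r"
      for j n b m x y
    proof -
      obtain r s where r: "r \<le> \<Lambda> * (x + P * \<epsilon>)" "walk ?H (\<nu> j 0) (\<nu> j n) r"
        "s \<le> \<Lambda> * (y + P * \<epsilon>)" "walk ?H (\<nu> b 0) (\<nu> b m) s" using xy by blast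
      have "walk ?H (\<nu> j n) (\<nu> b m) (r + s)"
        using walk_trans[OF walk_sym[OF r(2)]] r(4) hub[of j] hub[of b] by simp
      moreover have "r + s \<le> \<Lambda> * (x + y + 2 * (P * \<epsilon>))" using r(1,3) by (simp add: algebra_simps)
      moreover have "\<Lambda> * (x + y + 2 * (P * \<epsilon>)) \<le> \<Lambda> * (x + y + 1 / 2)" using P_eps scale(1) by simp
      ultimately show ?thesis by (meson order_trans)
    qed
    from d show ?thesis
    proof (cases rule: D_cases)
      case (chain b i)
      then show ?thesis using own us by auto
    next
      case (y j)
      show ?thesis
      proof (cases "j \<in> Ys")
        case True
        then show ?thesis using own us y by auto
      next
        case False
        let ?l = "ylen T j"
        have "\<exists>r \<le> \<Lambda> * (real (4 * half T + ?l) + 1 / 2). walk ?H (\<nu> j (turn2 T - 2 * half T))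
           (\<nu> j (turn2 T - 2 * half T + (4 * half T + ?l))) r"
          by (rule detour) (use y good' in \<open>auto simp: ylen_def\<close>)
        moreover have "turn2 T - 2 * half T + (4 * half T + ?l) = turn2 T + 2 * half T + ?l"
          using good' by auto
        moreover have "real (4 * half T + ?l) + 1 / 2 \<le> t * ?l"
        proof (cases "j = 1")
          case True
          then have "t = t1" using False t by auto
          then show ?thesis using good' True by (simp add: ylen_def)
        next
          case False
          have "real (yl T) + 4 * half T + 1 \<le> t0 * yl T" using good' by blast
          then show ?thesis using False up[of "yl T"] by (simp add: ylen_def)
        qed
        ultimately show ?thesis using y by (intro *[of "real (4 * half T + ?l)"]) simp_all
      qed
    next
      case (u1 u)
      show ?thesis
      proof (cases "u \<in> A1")
        case False
        have "\<exists>r \<le> \<Lambda> * (real (2 * half T + ul T) + 1 / 2). walk ?H (\<nu> (nR + u) (turn1 T - half T))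
           (\<nu> (nR + u) (turn1 T - half T + (2 * half T + ul T))) r"
          by (rule detour) (use u1 good' in auto)
        moreover have "turn1 T - half T + (2 * half T + ul T) = turn1 T + half T + ul T"
          using good' by auto
        moreover have "real (2 * half T + ul T) + 1 / 2 \<le> t * ul T"
        proof -
          have "(t0 - 1) * yl T \<le> (t0 - 1) * ul T" using good' by (intro mult_left_mono) auto
          moreover have "real (yl T) + 4 * half T + 1 \<le> t0 * yl T" using good' by blast
          ultimately show ?thesis using up[of "ul T"] by (simp add: algebra_simps)
        qed
        ultimately show ?thesis using u1 by (intro *[of "real (2 * half T + ul T)"]) simp_all
      qed (use own us u1 in auto)
    next
      case (u2 u)
      show ?thesis
      proof (cases "u \<in> A2")
        case False
        have "\<exists>r \<le> \<Lambda> * (real (4 * half T + ul T) + 1 / 2). walk ?H (\<nu> (nR + u) (turn2 T - 2 * half T))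
           (\<nu> (nR + u) (turn2 T - 2 * half T + (4 * half T + ul T))) r"
          by (rule detour) (use u2 good' in auto)
        moreover have "turn2 T - 2 * half T + (4 * half T + ul T) = turn2 T + 2 * half T + ul T"
          using good' by auto
        moreover have "real (4 * half T + ul T) + 1 / 2 \<le> t * ul T"
        proof -
          have "(t0 - 1) * yl T \<le> (t0 - 1) * ul T" using good' by (intro mult_left_mono) auto
          moreover have "real (yl T) + 4 * half T + 1 \<le> t0 * yl T" using good' by blast
          ultimately show ?thesis using up[of "ul T"] by (simp add: algebra_simps)
        qed
        ultimately show ?thesis using u2 by (intro *[of "real (4 * half T + ul T)"]) simp_all
      qed (use own us u2 in auto)
    next
      case (d0 u)
      then consider "u \<in> A1" | "u \<in> A2" using cov by (auto simp: cover_def)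
      then have "\<exists>r \<le> \<Lambda> * ((real P - 2 * half T) + P * \<epsilon>). walk ?H (\<nu> (nR + u) 0) (\<nu> (nR + u) P) r"
      proof cases
        case 2
        obtain r where r: "r \<le> \<Lambda> * (real P - 4 * half T + P * \<epsilon>)" "walk ?H (\<nu> (nR + u) 0) (\<nu> (nR + u) P) r"
          using w2[OF 2] by blast
        have "\<Lambda> * (real P - 4 * half T + P * \<epsilon>) \<le> \<Lambda> * ((real P - 2 * half T) + P * \<epsilon>)"
          using scale(1) by simp
        then show ?thesis using r by (meson order_trans)
      qed (use w1 good' in auto)
      then obtain r where r: "r \<le> \<Lambda> * ((real P - 2 * half T) + P * \<epsilon>)" "walk ?H (\<nu> (nR + u) 0) (\<nu> (nR + u) P) r"
        by blast
      have "\<Lambda> * ((real P - 2 * half T) + P * \<epsilon>) \<le> \<Lambda> * ((real P - 2 * half T) + 1 / 2)"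
        using P_eps scale(1) by simp
      then have "\<exists>r \<le> \<Lambda> * ((real P - 2 * half T) + 1 / 2). walk ?H (\<nu> (nR + u) 0) (\<nu> (nR + u) P) r"
        using r by (meson order_trans)
      moreover have "(real P - 2 * half T) + 1 / 2 \<le> t * pos2 T"
        using good' up[of "pos2 T"] by linarith
      ultimately show ?thesis using d0 by (intro *[of "real P - 2 * half T"]) simp_all
    next
      case (link u b j)
      have uj: "u < nU" "j < nR" "j \<noteq> 1" using links(1)[OF link(2)] by auto
      have cv: "u \<in> (if b then A2 else A1) \<or> j \<in> Ys" using cov link(2) by (auto simp: cover_def)
      let ?n = "if b then P else port1 T"
      have pP: "port1 T \<le> P" using good' by auto
      have jB: "j < B" "nR + u < B" using uj by auto
      let ?s = "if b then 4 * real (half T) else 2 * real (half T)"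
      have "\<exists>r \<le> \<Lambda> * (real P + real ?n - ?s + 1 / 2). walk ?H (\<nu> j P) (\<nu> (nR + u) ?n) r"
      proof (cases "j \<in> Ys")
        case True
        have nP: "?n \<le> P" using pP by simp
        obtain r where r: "r \<le> \<Lambda> * ((real P - 4 * half T) + real ?n + 1 / 2)" "walk ?H (\<nu> j P) (\<nu> (nR + u) ?n) r"
          using both[OF wy[OF True uj(3)] w0[OF jB(2) nP]] by blast
        have "\<Lambda> * ((real P - 4 * half T) + real ?n + 1 / 2) \<le> \<Lambda> * (real P + real ?n - ?s + 1 / 2)"
          using scale(1) by simp
        then show ?thesis using r by (meson order_trans)
      next
        case False
        then have cu: "u \<in> (if b then A2 else A1)" using cv by simp
        have "\<exists>r \<le> \<Lambda> * ((real ?n - ?s) + P * \<epsilon>). walk ?H (\<nu> (nR + u) 0) (\<nu> (nR + u) ?n) r"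
          using w1[of u "port1 T"] w2[of u] cu pP by (cases b) auto
        from both[OF w0[OF jB(1) order_refl] this]
        show ?thesis by (simp add: algebra_simps)
      qed
      moreover have "real P + real ?n - ?s + 1 / 2 \<le> t * len T (Link u b j)"
      proof -
        have "2 * real (last T) - 4 * half T + 1 \<le> t0 * (2 * pos2 T)"
          "real (port1 T + last T) - 2 * half T + 1 \<le> t0 * (pos1 T + pos2 T)"
          using good' by blast+
        then show ?thesis using up[of "2 * pos2 T"] up[of "pos1 T + pos2 T"] by (cases b) auto
      qed
      ultimately show ?thesis using link by (intro *[of "real P + real ?n - ?s"]) simp_all
    qed
  qed
  fix a b assume "{a, b} \<in> edges G"
  then obtain d where d: "d \<in> D" "{a, b} = eset d" by (auto simp: edges')
  obtain r where r: "r \<le> t * weight G (eset d)"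
    "walk ?H (case_prod \<nu> (fst (ends T nR d))) (case_prod \<nu> (snd (ends T nR d))) r"
    using w[OF d(1)] by blast
  have "walk ?H a b r"
    using d(2) r(2) walk_sym[OF r(2)] unfolding eset_def doubleton_eq_iff by auto
  then show "\<exists>r\<le>t * weight G {a, b}. walk ?H a b r" using r(1) d(2) by auto
qed

end

subsection \<open>Drawing the gadget graph\<close>

text \<open>The equations say that a walk with unit steps that starts to the right and turns at
  \<open>rise\<close>, \<open>turn1\<close>, \<open>port1\<close> and \<open>turn2\<close> is at
  \<open>pos1\<close> after \<open>port1\<close> steps and at \<open>pos2\<close> after
  \<open>last\<close> steps. The strict inequalities keep its two left turning points to the right
  of the hub, and \<open>rise T + half T \<le> turn1 T\<close> makes room for the part of
  \<open>U1\<close> before the turn.\<close>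

definition drawable :: "template \<Rightarrow> bool" where
  "drawable T \<longleftrightarrow> rise T + half T \<le> turn1 T \<and> turn1 T < 2 * rise T \<and>
     2 * rise T + port1 T = pos1 T + 2 * turn1 T \<and> pos1 T + port1 T + last T = pos2 T + 2 * turn2 T \<and>
     turn2 T < pos1 T + port1 T"

text \<open>The branches walk along the horizontal axis with unit steps, turning at \<open>rise\<close>,
  \<open>turn1\<close>, \<open>port1\<close> and \<open>turn2\<close>.\<close>

definition xpos :: "template \<Rightarrow> nat \<Rightarrow> int" where
  "xpos T i = (if i \<le> rise T then int i else if i \<le> turn1 T then 2 * int (rise T) - int i
     else if i \<le> port1 T then int (pos1 T) - int (port1 T) + int i
     else if i \<le> turn2 T then int (pos1 T) + int (port1 T) - int i
     else int (pos2 T) - int (last T) + int i)"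

text \<open>A functional that is not constantly \<open>\<kappa>\<close> on a segment reaches its
  bound \<open>\<kappa>\<close> at most at an end. So two segments on different sides of a level of
  such a functional can only meet in end points.\<close>

lemma segment_touch:
  fixes f :: "'a::real_vector \<Rightarrow> real"
  assumes "linear f" "z \<in> convex hull {p, q}" "f p \<le> \<kappa>" "f q \<le> \<kappa>" "f p < \<kappa> \<or> f q < \<kappa>" "\<kappa> \<le> f z"
  shows "z \<in> {p, q} \<and> f z = \<kappa>"
proof -
  obtain u v where uv: "0 \<le> u" "0 \<le> v" "u + v = 1" "z = u *\<^sub>R p + v *\<^sub>R q"
    using assms(2) by (auto simp: convex_hull_2)
  have fz: "f z = u * f p + v * f q" using assms(1) uv(4) by (simp add: linear_add linear_scale)
  have k: "\<kappa> = u * \<kappa> + v * \<kappa>" using uv(3) by (simp flip: distrib_right)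
  have le: "u * f p \<le> u * \<kappa>" "v * f q \<le> v * \<kappa>" using assms(3,4) uv by (auto intro: mult_left_mono)
  then have eq: "f z = \<kappa>" "u * f p = u * \<kappa>" "v * f q = v * \<kappa>" using fz k assms(6) by linarith+
  from assms(5) show ?thesis
  proof
    assume "f p < \<kappa>"
    then have "u = 0" using eq(2) by simp
    then show ?thesis using uv eq by simp
  next
    assume "f q < \<kappa>"
    then have "v = 0" using eq(3) by simp
    then show ?thesis using uv eq by simp
  qed
qed

lemma segment_touch':
  fixes f :: "'a::real_vector \<Rightarrow> real"
  assumes "linear f" "z \<in> convex hull {p, q}" "\<kappa> \<le> f p" "\<kappa> \<le> f q" "\<kappa> < f p \<or> \<kappa> < f q" "f z \<le> \<kappa>"
  shows "z \<in> {p, q} \<and> f z = \<kappa>"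
  using segment_touch[of "\<lambda>x. - f x" z p q "- \<kappa>"] assms by (auto simp: linear_compose_neg)

lemma segment_ge:
  fixes f :: "'a::real_vector \<Rightarrow> real"
  assumes "linear f" "z \<in> convex hull {p, q}" "\<kappa> \<le> f p" "\<kappa> \<le> f q"
  shows "\<kappa> \<le> f z"
proof -
  have "convex {x. \<kappa> \<le> f x}"
    using convex_linear_vimage[OF assms(1) convex_real_interval(1)[of \<kappa>]] by (simp add: vimage_def atLeast_def)
  then have "convex hull {p, q} \<subseteq> {x. \<kappa> \<le> f x}" using assms by (intro hull_minimal) auto
  then show ?thesis using assms(2) by blast
qed

lemma segment_le:
  fixes f :: "'a::real_vector \<Rightarrow> real"
  assumes "linear f" "z \<in> convex hull {p, q}" "f p \<le> \<kappa>" "f q \<le> \<kappa>"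
  shows "f z \<le> \<kappa>"
  using segment_ge[of "\<lambda>x. - f x" z p q "- \<kappa>"] assms by (auto simp: linear_compose_neg)

locale drawing =
  fixes T :: template and t0 t1 :: real and nR nU c m :: nat
  assumes good: "good_template t0 t1 T" and draw: "drawable T" and c: "last T < 2 ^ c"
begin

abbreviation "x \<equiv> xpos T"
abbreviation "P \<equiv> last T"
abbreviation "B \<equiv> nR + nU"

definition sg :: "nat \<Rightarrow> int" where "sg b = (if b < nR then 1 else -1)"
definition xc :: "nat \<Rightarrow> nat \<Rightarrow> int" where "xc b i = sg b * (2 ^ m * x i)"
text \<open>Branch \<open>b\<close> follows the line of slope \<open>2 ^ (c + b) / 2 ^ m\<close>,
  and the summand \<open>i\<close> makes it climb steadily above that line, so the walk back and
  forth never meets itself. As \<open>last T < 2 ^ c\<close> and all points but the hub have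
  \<open>x \<ge> 1\<close>, this offset is smaller than the gap to the line of the next branch.
  Branches on the left are reflected in the origin.\<close>

definition yc :: "nat \<Rightarrow> nat \<Rightarrow> int" where "yc b i = sg b * (2 ^ (c + b) * x i + int i)"
definition pt :: "nat \<Rightarrow> nat \<Rightarrow> real \<times> real" where "pt b i = (of_int (xc b i), of_int (yc b i))"

lemmas walk = draw[unfolded drawable_def]

lemma basics:
  "0 < half T" "half T < turn1 T" "turn1 T + half T + ul T \<le> port1 T" "port1 T + 2 * half T \<le> turn2 T"
  "turn2 T + 2 * half T + ul T \<le> P" "zl T \<le> yl T" "yl T \<le> ul T" "0 < zl T" "rise T + half T \<le> turn1 T"
proof -
  have "t1 + 1 \<le> zl T" "1 < t0" "t0 \<le> t1" using good unfolding good_template_def by blast+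
  then show "0 < zl T" by simp
qed (use good draw in \<open>unfold good_template_def drawable_def, blast+\<close>)

lemma order: "0 < rise T" "rise T < turn1 T" "turn1 T < port1 T" "port1 T < turn2 T" "turn2 T < P"
  using walk basics by auto

lemma x0 [simp]: "x 0 = 0" by (simp add: xpos_def)

lemma x_pos: "0 < i \<Longrightarrow> i \<le> P \<Longrightarrow> 1 \<le> x i"
  using walk order unfolding xpos_def by auto

lemma x_le: "i \<le> P \<Longrightarrow> x i \<le> int i"
  using walk order unfolding xpos_def by auto

lemma x_step: "i < P \<Longrightarrow> \<bar>x (Suc i) - x i\<bar> = 1"
  using walk order unfolding xpos_def by auto

lemma x_port: "x (port1 T) = int (pos1 T)" "x P = int (pos2 T)"
  using walk order unfolding xpos_def by auto

text \<open>At both left turns the walk goes left up to step \<open>tn\<close> and right from there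
  on, so one formula with half-width \<open>hh\<close> serves both.\<close>

lemma x_turn:
  assumes "(tn, hh) = (turn1 T, half T) \<and> e \<le> port1 T \<or> (tn, hh) = (turn2 T, 2 * half T) \<and> e \<le> P"
    "tn - hh \<le> k" "k \<le> e"
  shows "x k - x (tn - hh) = (if k \<le> tn then int (tn - hh) - int k else int k - int (tn - hh) - 2 * int hh)"
proof -
  note h = basics(9,4)
  have *: "x i = (if i \<le> turn1 T then 2 * int (rise T) - int i else 2 * int (rise T) - 2 * int (turn1 T) + int i)"
    if "rise T \<le> i" "i \<le> port1 T" for i
    using that walk order unfolding xpos_def by auto
  have **: "x i = (if i \<le> turn2 T then int (pos1 T) + int (port1 T) - int i
      else int (pos1 T) + int (port1 T) - 2 * int (turn2 T) + int i)"
    if "port1 T \<le> i" "i \<le> P" for i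
    using that walk order unfolding xpos_def by auto
  from assms(1) show ?thesis
  proof
    assume a: "(tn, hh) = (turn1 T, half T) \<and> e \<le> port1 T"
    then show ?thesis using *[of k] *[of "tn - hh"] assms(2,3) h order by (auto simp: of_nat_diff)
  next
    assume a: "(tn, hh) = (turn2 T, 2 * half T) \<and> e \<le> P"
    then show ?thesis using **[of k] **[of "tn - hh"] assms(2,3) h order by (auto simp: of_nat_diff)
  qed
qed

text \<open>The chain stays strictly to the left of a shortcut around one of its left turns.\<close>

lemma x_left:
  assumes "(tn, hh) = (turn1 T, half T) \<and> e \<le> port1 T \<or> (tn, hh) = (turn2 T, 2 * half T) \<and> e \<le> P"
    and e: "e = tn + hh + l" and k: "tn - hh < k" "k < e" and hh: "hh \<le> tn" "0 < l"
  shows "(x k - x (tn - hh)) * (int e - int (tn - hh)) < (int k - int (tn - hh)) * int l"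
proof -
  define d where "d = int k - int (tn - hh)"
  have d: "0 < d" "d < 2 * int hh + int l" using k e hh by (auto simp: d_def of_nat_diff)
  have ee: "int e - int (tn - hh) = 2 * int hh + int l" using e hh by (simp add: of_nat_diff)
  have h0: "0 < hh" using assms(1) basics(1) by auto
  have xk: "x k - x (tn - hh) = (if k \<le> tn then - d else d - 2 * int hh)"
    using x_turn[OF assms(1), of k] k by (simp add: d_def)
  have "(x k - x (tn - hh)) * (2 * int hh + int l) < d * int l"
  proof (cases "k \<le> tn")
    case True
    have "- d * (2 * int hh + int l) < 0" "0 < d * int l" using d h0 hh by (auto simp: mult_neg_pos)
    then show ?thesis using True xk by simp
  next
    case False
    have "d * (2 * int hh) < (2 * int hh + int l) * (2 * int hh)" using d h0 by (intro mult_strict_right_mono) auto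
    moreover have e: "x k - x (tn - hh) = d - 2 * int hh" using False xk by simp
    ultimately show ?thesis unfolding e by (simp add: algebra_simps)
  qed
  then show ?thesis unfolding ee d_def .
qed

text \<open>The vertical offset from the line of branch \<open>b\<close>, measured on its side of
  the hub. On branch \<open>b\<close> itself it recovers the position \<open>i\<close> along the
  chain, so this functional separates the branch from lower ones and also its consecutive pieces
  from each other.\<close>

definition height :: "nat \<Rightarrow> real \<times> real \<Rightarrow> real" where
  "height b z = of_int (sg b) * snd z - of_int (sg b) * 2 ^ (c + b) / 2 ^ m * fst z"

lemma linear_height: "linear (height b)"
  by (rule linearI) (auto simp: height_def algebra_simps add_divide_distrib)

lemma linear_fst': "linear (fst :: real \<times> real \<Rightarrow> real)"
  by (rule linearI) auto

lemma height_pt: "sg b = sg b' \<Longrightarrow> height b (pt b' i) = (2 ^ (c + b') - (2::real) ^ (c + b)) * of_int (x i) + of_nat i"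
proof -
  assume s: "sg b = sg b'"
  have "sg b' = 1 \<or> sg b' = -1" by (simp add: sg_def)
  then show ?thesis unfolding height_def pt_def s
    by (elim disjE) (simp_all add: xc_def yc_def field_simps)
qed

lemma height_own: "height b (pt b i) = i"
  by (simp add: height_pt)

lemma height_other:
  assumes "b' < b" "sg b = sg b'" "0 < i" "i \<le> P"
  shows "height b (pt b' i) < 0"
proof -
  have xi: "1 \<le> x i" by (rule x_pos[OF assms(3,4)])
  have "(2::real) ^ (c + b) \<ge> 2 ^ (c + b' + 1)" using assms(1) by (intro power_increasing) auto
  then have 1: "2 ^ (c + b') - 2 ^ (c + b) \<le> - ((2::real) ^ (c + b'))" by simp
  have "(2::real) ^ c \<le> 2 ^ (c + b')" by (intro power_increasing) auto
  moreover have "real i < 2 ^ c" using assms(4) c by (metis le_less_trans of_nat_less_iff of_nat_numeral of_nat_power)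
  ultimately have "real i < 2 ^ (c + b')" by linarith
  moreover have "(2 ^ (c + b') - 2 ^ (c + b)) * real_of_int (x i) \<le> - (2 ^ (c + b')) * real_of_int (x i)"
    using 1 xi by (intro mult_right_mono) auto
  moreover have "- (2 ^ (c + b')) * real_of_int (x i) \<le> - (2 ^ (c + b')) * 1"
    using xi by (intro mult_left_mono_neg) auto
  ultimately show ?thesis unfolding height_pt[OF assms(2)] by linarith
qed

lemma pt_hub: "pt b 0 = (0, 0)"
  by (simp add: pt_def xc_def yc_def)

lemma pt_inj:
  assumes "i \<le> P" "i' \<le> P" "pt b i = pt b' i'"
  shows "i = i' \<and> (i = 0 \<or> b = b')"
proof -
  have fx: "fst (pt b i) = real_of_int (sg b) * (2 ^ m * real_of_int (x i))" for b i
    by (simp add: pt_def xc_def)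
  have sgn: "sg b = 1 \<or> sg b = -1" for b by (simp add: sg_def)
  have pos: "0 < 2 ^ m * real_of_int (x i)" if "0 < i" "i \<le> P" for i
    using x_pos[OF that] by simp
  have z: "i = 0 \<longleftrightarrow> fst (pt b i) = 0" if "i \<le> P" for b i
    using pos[of i] that sgn[of b] by (cases "i = 0") (auto simp: fx)
  show ?thesis
  proof (cases "i = 0")
    case True
    then show ?thesis using z[OF assms(1), of b] z[OF assms(2), of b'] assms(3) by simp
  next
    case False
    then have i: "0 < i" "0 < i'" using z[OF assms(1), of b] z[OF assms(2), of b'] assms(3) by auto
    have "sg b = sg b'"
    proof -
      have "fst (pt b i) = fst (pt b' i')" using assms(3) by simp
      moreover define A A' where "A = 2 ^ m * real_of_int (x i)" and "A' = 2 ^ m * real_of_int (x i')"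
      ultimately have "real_of_int (sg b) * A = real_of_int (sg b') * A'" "0 < A" "0 < A'"
        using pos[OF i(1) assms(1)] pos[OF i(2) assms(2)] by (simp_all add: fx)
      then show ?thesis using sgn[of b] sgn[of b'] by auto
    qed
    then have sg: "sg b = sg b'" .
    have "b = b'"
    proof (rule ccontr)
      assume "b \<noteq> b'"
      then consider "b < b'" | "b' < b" by linarith
      then show False
      proof cases
        case 1
        from height_other[OF this sg[symmetric] i(1) assms(1)] show False
          unfolding assms(3) height_own by simp
      next
        case 2
        from height_other[OF this sg i(2) assms(2)] show False
          unfolding assms(3)[symmetric] height_own by simp
      qed
    qed
    have "real i = height b (pt b i)" by (rule height_own[symmetric])
    also have "pt b i = pt b i'" using assms(3) unfolding \<open>b = b'\<close> .
    also have "height b (pt b i') = real i'" by (rule height_own)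
    finally show ?thesis using \<open>b = b'\<close> by simp
  qed
qed

text \<open>All edges but the constraint edges, as branch, first and last position. Constraint edges
  may cross others, but canonical spanners avoid them.\<close>

definition skel :: "(nat \<times> nat \<times> nat) set" where
  "skel = {(b, i, Suc i) | b i. b < B \<and> i < P} \<union>
     {(b, turn1 T - half T, turn1 T + half T + ul T) | b. nR \<le> b \<and> b < B} \<union>
     {(b, turn2 T - 2 * half T, turn2 T + 2 * half T + ul T) | b. nR \<le> b \<and> b < B} \<union>
     {(j, turn2 T - 2 * half T, turn2 T + 2 * half T + ylen T j) | j. j < nR}"

definition short :: "nat \<Rightarrow> nat \<Rightarrow> bool" where
  "short s e \<longleftrightarrow> (\<exists>tn hh l. ((tn, hh) = (turn1 T, half T) \<and> e \<le> port1 T \<or>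
     (tn, hh) = (turn2 T, 2 * half T) \<and> e \<le> P) \<and> s = tn - hh \<and> e = tn + hh + l \<and> hh \<le> tn \<and> 0 < l)"

lemma skel_cases:
  assumes "(b, s, e) \<in> skel"
  shows "b < B" "s < e" "e \<le> P" "e = Suc s \<or> short s e"
proof -
  have l: "0 < ul T" "\<And>j. 0 < ylen T j" "\<And>j. ylen T j \<le> ul T" "0 < half T"
    using basics by (auto simp: ylen_def)
  have g: "half T \<le> turn1 T" "turn1 T + half T + ul T \<le> port1 T" "port1 T + 2 * half T \<le> turn2 T"
    "turn2 T + 2 * half T + ul T \<le> P" using basics by auto
  have y: "turn2 T + 2 * half T + ylen T j \<le> P" for j using g(4) l(3)[of j] by linarith
  have s1: "short (turn1 T - half T) (turn1 T + half T + ul T)"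
    unfolding short_def using l g by (intro exI[of _ "turn1 T"] exI[of _ "half T"] exI[of _ "ul T"]) auto
  have s2: "short (turn2 T - 2 * half T) (turn2 T + 2 * half T + ul T)"
    unfolding short_def using l g by (intro exI[of _ "turn2 T"] exI[of _ "2 * half T"] exI[of _ "ul T"]) auto
  have s3: "short (turn2 T - 2 * half T) (turn2 T + 2 * half T + ylen T j)" for j
    unfolding short_def using l(2)[of j] g y by (intro exI[of _ "turn2 T"] exI[of _ "2 * half T"] exI[of _ "ylen T j"]) auto
  have lt: "turn1 T - half T < turn1 T + half T + ul T" "turn2 T - 2 * half T < turn2 T + 2 * half T + ul T"
    "turn2 T - 2 * half T < turn2 T + 2 * half T + ylen T j" for j using l by auto
  have le: "turn1 T + half T + ul T \<le> P" using g by auto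
  show "b < B" "s < e" "e \<le> P" "e = Suc s \<or> short s e"
    using assms s1 s2 s3 lt le g(4) y unfolding skel_def by auto
qed

text \<open>The ranges of two shortcuts on a branch do not overlap, since \<open>port1\<close> lies
  between the turns; an overlap thus involves a chain edge inside the range of a shortcut.\<close>

lemma skel_overlap:
  assumes "(b, s, e) \<in> skel" "(b, s', e') \<in> skel" "\<not> e \<le> s'" "\<not> e' \<le> s" "(s, e) \<noteq> (s', e')"
  shows "e' = Suc s' \<and> s \<le> s' \<and> e' \<le> e \<and> short s e \<or> e = Suc s \<and> s' \<le> s \<and> e \<le> e' \<and> short s' e'"
proof (cases "e = Suc s \<or> e' = Suc s'")
  case True
  then show ?thesis using skel_cases[OF assms(1)] skel_cases[OF assms(2)] assms(3-5) by auto
next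
  case False
  have g: "turn1 T + half T + ul T \<le> port1 T" "port1 T + 2 * half T \<le> turn2 T" using basics by auto
  show ?thesis using assms False g unfolding skel_def by auto
qed

lemma short_plane:
  assumes sh: "short s e" and k: "s \<le> k" "Suc k \<le> e" "e \<le> P"
    and z: "z \<in> convex hull {pt b s, pt b e}" "z \<in> convex hull {pt b k, pt b (Suc k)}"
  shows "z \<in> {pt b s, pt b e} \<inter> {pt b k, pt b (Suc k)}"
proof -
  obtain tn hh l where t: "(tn, hh) = (turn1 T, half T) \<and> e \<le> port1 T \<or> (tn, hh) = (turn2 T, 2 * half T) \<and> e \<le> P"
    "s = tn - hh" "e = tn + hh + l" "hh \<le> tn" "0 < l" using sh by (auto simp: short_def)
  have h0: "0 < hh" using t(1) basics(1) by auto
  define d where "d = real e - real s"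
  have se: "s < e" "Suc s < e" using t(2-5) h0 by auto
  then have d: "0 < d" by (simp add: d_def)
  \<comment> \<open>The horizontal coordinate, sheared along the shortcut: \<open>G\<close> is
    constant on the shortcut and, by \<open>x_left\<close>, smaller at all chain points strictly
    between its ends.\<close>
  define G where "G z = of_int (sg b) / 2 ^ m * fst z - height b z * (real l / d)" for z
  have lin: "linear G"
    by (rule linearI) (auto simp: G_def height_def algebra_simps add_divide_distrib)
  have s2: "real_of_int (sg b) * real_of_int (sg b) = 1" by (simp add: sg_def)
  have Gp: "G (pt b i) = x i - i * (real l / d)" for i
    using s2 by (simp add: G_def height_own) (simp add: pt_def xc_def field_simps)
  define \<kappa> where "\<kappa> = x s - s * (real l / d)"
  have Gs: "G (pt b s) = \<kappa>" by (simp add: Gp \<kappa>_def)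
  have "x e - x s = int l" using x_turn[OF t(1), of e] t(2-5) by (auto simp: of_nat_diff)
  then have xe: "real_of_int (x e) = x s + l" by linarith
  have "real e * (l / d) = s * (l / d) + l" using d unfolding d_def by (simp add: field_simps)
  then have Ge: "G (pt b e) = \<kappa>" using xe by (simp add: Gp \<kappa>_def)
  have Gk: "G (pt b i) < \<kappa>" if "s < i" "i < e" for i
  proof -
    have "(x i - x s) * (int e - int s) < (int i - int s) * int l"
      using x_left[OF t(1) t(3), of i] that t by auto
    then have "real_of_int ((x i - x s) * (int e - int s)) < real_of_int ((int i - int s) * int l)"
      by (simp only: of_int_less_iff)
    then have "(x i - x s) * d < (real i - real s) * l" by (simp add: d_def)
    then have "x i - x s < (real i - real s) * l / d" using d by (simp add: pos_less_divide_eq)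
    then show ?thesis by (simp add: Gp \<kappa>_def diff_divide_distrib algebra_simps)
  qed
  have "\<kappa> \<le> G z" by (rule segment_ge[OF lin z(1)]) (simp_all add: Gs Ge)
  moreover have "G (pt b i) \<le> \<kappa>" if "s \<le> i" "i \<le> e" for i
    using Gk[of i] Gs Ge that by (cases "i = s"; cases "i = e") auto
  moreover have "G (pt b k) < \<kappa> \<or> G (pt b (Suc k)) < \<kappa>"
    using Gk[of k] Gk[of "Suc k"] k se by (cases "s = k") auto
  ultimately have *: "z \<in> {pt b k, pt b (Suc k)} \<and> G z = \<kappa>"
    using k by (intro segment_touch[OF lin z(2)]) auto
  then obtain i where i: "i = k \<or> i = Suc k" "z = pt b i" by auto
  have "i = s \<or> i = e" using Gk[of i] * i k by fastforce
  then show ?thesis using i * by auto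
qed

text \<open>A linear functional separates the two segments and attains the separating value only at
  an end of each: the horizontal coordinate for opposite sides of the hub, \<open>height\<close> for
  two branches on one side and for successive pieces of one branch. The remaining case is a shortcut
  and a chain edge in its range.\<close>

lemma skel_plane:
  assumes d: "(b, s, e) \<in> skel" "(b', s', e') \<in> skel" and ne: "{pt b s, pt b e} \<noteq> {pt b' s', pt b' e'}"
    and z: "z \<in> convex hull {pt b s, pt b e}" "z \<in> convex hull {pt b' s', pt b' e'}"
  shows "z \<in> {pt b s, pt b e} \<inter> {pt b' s', pt b' e'}"
proof -
  have fx: "fst (pt b i) = real_of_int (sg b) * (2 ^ m * real_of_int (x i))" for b i
    by (simp add: pt_def xc_def)
  have pos: "0 < 2 ^ m * real_of_int (x i)" if "0 < i" "i \<le> P" for i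
    using x_pos[OF that] by simp
  have sides: "z \<in> {pt b s, pt b e} \<inter> {pt b' s', pt b' e'}"
    if d: "(b, s, e) \<in> skel" "(b', s', e') \<in> skel" and sg: "sg b = 1" "sg b' = -1"
      and z: "z \<in> convex hull {pt b s, pt b e}" "z \<in> convex hull {pt b' s', pt b' e'}" for b s e b' s' e'
  proof -
    note i = skel_cases[OF d(1)] skel_cases[OF d(2)]
    have r: "0 \<le> fst (pt b k)" "0 < k \<Longrightarrow> 0 < fst (pt b k)" if "k \<le> P" for k
      using pos[of k] that sg by (cases "k = 0"; simp add: fx)+
    have l: "fst (pt b' k) \<le> 0" "0 < k \<Longrightarrow> fst (pt b' k) < 0" if "k \<le> P" for k
      using pos[of k] that sg by (cases "k = 0"; simp add: fx)+
    have a: "fst z \<le> 0" by (rule segment_le[OF linear_fst' z(2)]) (use l i in auto)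
    have c: "0 \<le> fst z" by (rule segment_ge[OF linear_fst' z(1)]) (use r i in auto)
    have "z \<in> {pt b s, pt b e} \<and> fst z = 0"
      by (rule segment_touch'[OF linear_fst' z(1)]) (use r i a in auto)
    moreover have "z \<in> {pt b' s', pt b' e'} \<and> fst z = 0"
      by (rule segment_touch[OF linear_fst' z(2)]) (use l i c in auto)
    ultimately show ?thesis by blast
  qed
  have cones: "z \<in> {pt b s, pt b e} \<inter> {pt b' s', pt b' e'}"
    if d: "(b, s, e) \<in> skel" "(b', s', e') \<in> skel" and sg: "sg b = sg b'" and b: "b' < b"
      and z: "z \<in> convex hull {pt b s, pt b e}" "z \<in> convex hull {pt b' s', pt b' e'}" for b s e b' s' e'
  proof -
    note i = skel_cases[OF d(1)] skel_cases[OF d(2)]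
    have l: "height b (pt b' k) \<le> 0" "0 < k \<Longrightarrow> height b (pt b' k) < 0" if "k \<le> P" for k
      using height_other[OF b sg, of k] that by (cases "k = 0"; simp add: pt_hub height_def)+
    have a: "height b z \<le> 0" by (rule segment_le[OF linear_height z(2)]) (use l i in auto)
    have c: "0 \<le> height b z" by (rule segment_ge[OF linear_height z(1)]) (simp_all add: height_own)
    have "z \<in> {pt b s, pt b e} \<and> height b z = 0"
      by (rule segment_touch'[OF linear_height z(1)]) (use i a in \<open>auto simp: height_own\<close>)
    moreover have "z \<in> {pt b' s', pt b' e'} \<and> height b z = 0"
      by (rule segment_touch[OF linear_height z(2)]) (use l i c in auto)
    ultimately show ?thesis by blast
  qed
  have slabs: "z \<in> {pt b s, pt b e} \<inter> {pt b s', pt b e'}"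
    if d: "(b, s, e) \<in> skel" "(b, s', e') \<in> skel" and le: "e \<le> s'"
      and z: "z \<in> convex hull {pt b s, pt b e}" "z \<in> convex hull {pt b s', pt b e'}" for b s e s' e'
  proof -
    note i = skel_cases[OF d(1)] skel_cases[OF d(2)]
    have a: "height b z \<le> e" by (rule segment_le[OF linear_height z(1)]) (use i in \<open>auto simp: height_own\<close>)
    have c: "e \<le> height b z" by (rule segment_ge[OF linear_height z(2)]) (use le i in \<open>auto simp: height_own\<close>)
    have "z \<in> {pt b s, pt b e} \<and> height b z = e"
      by (rule segment_touch[OF linear_height z(1)]) (use i c in \<open>auto simp: height_own\<close>)
    moreover have "z \<in> {pt b s', pt b e'} \<and> height b z = e"
      by (rule segment_touch'[OF linear_height z(2)]) (use le i a in \<open>auto simp: height_own\<close>)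
    ultimately show ?thesis by blast
  qed
  consider "sg b \<noteq> sg b'" | "sg b = sg b'" "b < b'" | "sg b = sg b'" "b' < b" | "b = b'" by force
  then show ?thesis
  proof cases
    case 1
    then have "sg b = 1 \<and> sg b' = -1 \<or> sg b' = 1 \<and> sg b = -1" by (auto simp: sg_def split: if_splits)
    then show ?thesis using sides[OF d _ _ z] sides[OF d(2,1) _ _ z(2,1)] by blast
  next
    case 2
    then show ?thesis using cones[OF d(2,1) _ _ z(2,1)] by auto
  next
    case 3
    then show ?thesis using cones[OF d _ _ z] by auto
  next
    case 4
    note d' = d(2)[folded 4] and z' = z(2)[folded 4]
    have n: "(s, e) \<noteq> (s', e')" using ne 4 by auto
    consider "e \<le> s'" | "e' \<le> s" | "\<not> e \<le> s'" "\<not> e' \<le> s" by blast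
    then show ?thesis
    proof cases
      case 1
      then show ?thesis using slabs[OF d(1) d' _ z(1) z'] 4 by simp
    next
      case 2
      then show ?thesis using slabs[OF d' d(1) _ z' z(1)] 4 by auto
    next
      case 3
      from skel_overlap[OF d(1) d' 3 n] show ?thesis
      proof
        assume a: "e' = Suc s' \<and> s \<le> s' \<and> e' \<le> e \<and> short s e"
        then show ?thesis using short_plane[of s e s' z b] z(1) z' skel_cases(3)[OF d(1)] 4 by auto
      next
        assume a: "e = Suc s \<and> s' \<le> s \<and> e \<le> e' \<and> short s' e'"
        then show ?thesis using short_plane[of s' e' s z b] z(1) z' skel_cases(3)[OF d'] 4 by auto
      qed
    qed
  qed
qed

end

text \<open>\<open>planar\<close> also forbids an edge to pass through a foreign vertex. Since every
  vertex lies on some edge, this follows from the absence of crossings.\<close>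

lemma planar_straight:
  fixes H :: "'v wgraph" and pos :: "'v \<Rightarrow> real \<times> real"
  assumes inj: "inj_on pos (verts H)" and wf: "\<And>e. e \<in> edges H \<Longrightarrow> e \<subseteq> verts H \<and> card e = 2"
    and inc: "\<And>v. v \<in> verts H \<Longrightarrow> \<exists>e\<in>edges H. v \<in> e"
    and plane: "\<And>e f. e \<in> edges H \<Longrightarrow> f \<in> edges H \<Longrightarrow> e \<noteq> f \<Longrightarrow>
       convex hull (pos ` e) \<inter> convex hull (pos ` f) \<subseteq> pos ` e \<inter> pos ` f"
  shows "planar H"
proof -
  have "\<exists>u v. e = {u, v} \<and> u \<noteq> v" if "e \<in> edges H" for e
    using wf[OF that] by (auto simp: card_2_iff)
  then obtain a b where ab: "\<And>e. e \<in> edges H \<Longrightarrow> e = {a e, b e} \<and> a e \<noteq> b e" by metis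
  define \<gamma> where "\<gamma> e = linepath (pos (a e)) (pos (b e))" for e
  have img: "path_image (\<gamma> e) = convex hull (pos ` e)" if "e \<in> edges H" for e
  proof -
    have "pos ` e = {pos (a e), pos (b e)}" using ab[OF that] by (metis image_empty image_insert)
    then show ?thesis by (simp add: \<gamma>_def segment_convex_hull)
  qed
  have int: "pos ` (e \<inter> f) = pos ` e \<inter> pos ` f" if "e \<in> edges H" "f \<in> edges H" for e f
    using inj_on_image_Int[OF inj] wf[OF that(1)] wf[OF that(2)] by blast
  have "arc (\<gamma> e) \<and> {pathstart (\<gamma> e), pathfinish (\<gamma> e)} = pos ` e \<and>
        path_image (\<gamma> e) \<inter> pos ` verts H \<subseteq> pos ` e" if e: "e \<in> edges H" for e
  proof -
    have v: "a e \<in> verts H" "b e \<in> verts H" "a e \<noteq> b e" using ab[OF e] wf[OF e] by auto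
    then have "pos (a e) \<noteq> pos (b e)" using inj by (auto dest: inj_onD)
    moreover have "{pos (a e), pos (b e)} = pos ` e" using ab[OF e] by (metis image_empty image_insert)
    moreover have "p \<in> pos ` e" if p: "p \<in> path_image (\<gamma> e)" "p \<in> pos ` verts H" for p
    proof -
      obtain w where w: "w \<in> verts H" "p = pos w" using p(2) by blast
      obtain f where f: "f \<in> edges H" "w \<in> f" using inc[OF w(1)] by blast
      show ?thesis
      proof (cases "f = e")
        case False
        have "p \<in> convex hull (pos ` f)" using f(2) w(2) by (intro hull_inc) auto
        then show ?thesis using plane[OF e f(1)] False p(1) img[OF e] by auto
      qed (use f w in auto)
    qed
    then have "path_image (\<gamma> e) \<inter> pos ` verts H \<subseteq> pos ` e" by blast
    ultimately show ?thesis by (simp add: \<gamma>_def)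
  qed
  then show ?thesis
    unfolding planar_def
    by (intro exI[of _ pos] exI[of _ \<gamma>] conjI ballI impI inj) (use plane int img in auto)
qed

text \<open>The real number \<open>\<tau> = t - 1\<close> enters only through roundings; all conditions on a
  template have enough slack for that.\<close>

definition mk_template :: "real \<Rightarrow> nat \<Rightarrow> nat \<Rightarrow> nat \<Rightarrow> nat \<Rightarrow> nat \<Rightarrow> nat \<Rightarrow> template" where
  "mk_template \<tau> h y z k p d = (let w1 = nat \<lfloor>\<tau> * p / 2\<rfloor>; w = nat \<lfloor>(\<tau> * (p + d) + 3 / 2 * h) / 2\<rfloor> in
     \<lparr>turn1 = w1 + 1 + w1, turn2 = w1 + 1 + w1 + (p - 1) + (w - w1), port1 = w1 + 1 + w1 + (p - 1),
      last = w1 + 1 + w1 + (p - 1) + (w - w1) + (d + (w - w1)), pos1 = p, pos2 = p + d,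
      half = h, yl = y, zl = z, ul = k * y, rise = w1 + 1\<rparr>)"

lemma nat_floor_bounds: "0 \<le> (x::real) \<Longrightarrow> real (nat \<lfloor>x\<rfloor>) \<le> x \<and> x < real (nat \<lfloor>x\<rfloor>) + 1"
  by (simp add: of_nat_floor)

text \<open>Up to rounding, \<open>port1\<close> is \<open>t1 * pos1\<close>, while
  \<open>last\<close> is chosen \<open>3 / 2 * h\<close> above \<open>t1 * pos2\<close>. Links with
  \<open>b\<close> false and \<open>D0\<close> then exceed the stretch by \<open>3 / 2 * h\<close>,
  which lies between 0 and the saving \<open>2 * h\<close> of \<open>U1\<close>; links with
  \<open>b\<close> true exceed it by \<open>3 * h\<close>, which lies between the
  \<open>2 * h\<close> of \<open>U1\<close> and the \<open>4 * h\<close> of \<open>U2\<close> or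
  \<open>Y\<close>. The margins of \<open>h / 2\<close> or more absorb the roundings, and
  \<open>tol\<close> bounds how far \<open>t0\<close> may lie below \<open>t1\<close>.\<close>

lemma mk_template_good:
  fixes t0 t1 \<tau> :: real and h y z k p d :: nat
  assumes t: "1 < t0" "t0 \<le> t1" "\<tau> = t1 - 1" and h: "8 \<le> h" and k: "1 \<le> k" and zy: "z \<le> y" "t1 + 1 \<le> z"
    and y: "4 * h + 1 \<le> (t0 - 1) * y" and z: "4 * h + 1 \<le> (t1 - 1) * z"
    and d: "2 * h + k * y \<le> d" "4 * h + 4 \<le> \<tau> * d"
    and p: "2 * (k * y) + 3 * y \<le> p" "2 * h + 2 \<le> \<tau> * p" "\<tau> * d / 2 + h + 3 \<le> p" "h + k * y + 1 \<le> p"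
    and tol: "(t1 - t0) * (p + (p + d)) \<le> h / 2 - 1"
  defines "T \<equiv> mk_template \<tau> h y z k p d"
  shows "good_template t0 t1 T" "drawable T"
    "yl T = y" "zl T = z" "ul T = k * y" "half T = h"
proof -
  define w1 where "w1 = nat \<lfloor>\<tau> * p / 2\<rfloor>"
  define w where "w = nat \<lfloor>(\<tau> * (p + d) + 3 / 2 * h) / 2\<rfloor>"
  have \<tau>: "0 < \<tau>" using t by simp
  have p1: "1 \<le> p" using p(4) by simp
  have w1: "real w1 \<le> \<tau> * p / 2" "\<tau> * p / 2 < real w1 + 1"
    using nat_floor_bounds[of "\<tau> * p / 2"] \<tau> by (auto simp: w1_def)
  have "0 \<le> (\<tau> * (p + d) + 3 / 2 * h) / 2" using \<tau> by simp
  from nat_floor_bounds[OF this, folded w_def]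
  have w: "2 * real w \<le> \<tau> * (real p + real d) + 3 / 2 * h" "\<tau> * (real p + real d) + 3 / 2 * h < 2 * real w + 2"
    by (simp_all add: field_simps)
  have hr: "8 \<le> real h" using h by simp
  have e: "\<tau> * (real p + real d) = \<tau> * p + \<tau> * d" by (simp add: distrib_left)
  have "real w1 + 2 * h \<le> real w"
    using w1 w d(2) e hr by simp
  then have ww: "w1 + 2 * h \<le> w" by linarith
  have w1h: "h \<le> w1"
  proof -
    have "real h < real w1 + 1" using w1 p(2) by simp
    then show ?thesis by linarith
  qed
  have wp: "w - w1 + 1 \<le> p"
  proof -
    have "real w - w1 < \<tau> * d / 2 + 3 / 4 * h + 1" using w1 w e by (simp add: field_simps)
    then have "real w - w1 + 1 < real p + 1" using p(3) hr by linarith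
    then show ?thesis using ww by linarith
  qed
  have T: "turn1 T = 2 * w1 + 1" "port1 T = p + 2 * w1" "turn2 T = p + w1 + w" "last T = p + d + 2 * w"
    "pos1 T = p" "pos2 T = p + d" "half T = h" "yl T = y" "zl T = z" "ul T = k * y" "rise T = w1 + 1"
    unfolding T_def mk_template_def Let_def w1_def[symmetric] w_def[symmetric]
    using p1 ww by auto
  show "yl T = y" "zl T = z" "ul T = k * y" "half T = h" by fact+
  show "drawable T" unfolding drawable_def T using w1h ww wp by auto
  have yk: "y \<le> k * y" using k by simp
  have tol1: "(t1 - t0) * (p + d) \<le> h / 2 - 1"
  proof -
    have "(t1 - t0) * (p + d) \<le> (t1 - t0) * (p + (p + d))" using t by (intro mult_left_mono) auto
    then show ?thesis using tol by linarith
  qed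
  define S1 S2 E1 E2 where "S1 = \<tau> * p" and "S2 = \<tau> * (real p + real d)"
    and "E1 = (t1 - t0) * (p + (p + d))" and "E2 = (t1 - t0) * (p + d)"
  have t1e: "t1 = 1 + \<tau>" and t0e: "t0 = 1 + \<tau> - (t1 - t0)" using t by simp_all
  have b: "t0 * real (p + (p + d)) = real (p + (p + d)) + S1 + S2 - E1"
    "t0 * real (2 * (p + d)) = 2 * real (p + d) + 2 * S2 - 2 * E2"
    "t0 * real (p + d) = real (p + d) + S2 - E2"
    unfolding S1_def S2_def E1_def E2_def by (subst t0e, simp add: algebra_simps)+
  have c: "t1 * real (p + (p + d)) = real (p + (p + d)) + S1 + S2"
    "t1 * real (2 * (p + d)) = 2 * real (p + d) + 2 * S2" "t1 * real (p + d) = real (p + d) + S2"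
    unfolding S1_def S2_def t1e by (simp_all add: algebra_simps)
  have W: "2 * real w1 \<le> S1" "S1 < 2 * real w1 + 2" "2 * real w \<le> S2 + 3 / 2 * h" "S2 + 3 / 2 * h < 2 * real w + 2"
    using w1 w by (simp_all add: S1_def S2_def)
  have E: "E1 \<le> h / 2 - 1" "E2 \<le> h / 2 - 1" using tol tol1 by (simp_all add: E1_def E2_def)
  show "good_template t0 t1 T"
    unfolding good_template_def T
  proof (intro conjI)
    show "h < 2 * w1 + 1" "2 * w1 + 1 + h + k * y \<le> p + 2 * w1" using w1h p(4) by simp_all
    show "p + 2 * w1 + 2 * h \<le> p + w1 + w" using ww by simp
    show "p + w1 + w + 2 * h + k * y \<le> p + d + 2 * w" using ww d(1) by simp
    show "real (p + 2 * w1 + (p + d + 2 * w)) - real (2 * h) + 1 \<le> t0 * real (p + (p + d))"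
      unfolding b using W E hr by simp
    show "2 * real (p + d + 2 * w) - real (4 * h) + 1 \<le> t0 * real (2 * (p + d))"
      unfolding b using W E hr by simp
    show "real (p + d + 2 * w) - real (2 * h) + 1 \<le> t0 * real (p + d)"
      unfolding b using W E hr by simp
    show "real y + real (4 * h) + 1 \<le> t0 * real y" using y by (simp add: algebra_simps)
    show "real z + real (4 * h) + 1 \<le> t1 * real z" using z by (simp add: algebra_simps)
    show "t1 * real (p + (p + d)) + 1 \<le> real (p + 2 * w1 + (p + d + 2 * w))"
      unfolding c using W hr by simp
    show "t1 * real (2 * (p + d)) + 1 \<le> 2 * real (p + d + 2 * w) - real (2 * h)"
      unfolding c using W hr by simp
    show "t1 * real (p + d) + 1 \<le> real (p + d + 2 * w)"
      unfolding c using W hr by simp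
  qed (use t h k zy yk p(1) in \<open>auto intro: mult_le_mono\<close>)
qed

section \<open>Existence of templates\<close>

lemma template_exists:
  assumes "1 < t" "1 \<le> k"
  shows "\<exists>T. good_template t t T \<and> drawable T \<and> ul T = k * yl T"
proof -
  define \<tau> where "\<tau> = t - 1"
  have \<tau>: "0 < \<tau>" using assms by (simp add: \<tau>_def)
  \<comment> \<open>With \<open>h = 8\<close> the numerators are left-hand sides required by
    \<open>mk_template_good\<close>: 33 = 4 * 8 + 1, 36 = 4 * 8 + 4 and 18 = 2 * 8 + 2.\<close>
  obtain y :: nat where y: "33 / \<tau> + t + 1 \<le> y" using real_arch_simple by blast
  obtain d :: nat where d: "36 / \<tau> + 16 + real k * y \<le> d" using real_arch_simple by blast
  obtain p :: nat where p: "2 * (real k * y) + 3 * real y + 18 / \<tau> + \<tau> * d / 2 + 11 \<le> p"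
    using real_arch_simple by blast
  have pos: "0 < 33 / \<tau>" "0 < 36 / \<tau>" "0 < 18 / \<tau>" "0 \<le> \<tau> * d / 2" "0 \<le> real k * y" using \<tau> by auto
  have y1: "33 / \<tau> \<le> y" "t + 1 \<le> y" using y pos assms by linarith+
  have d1: "36 / \<tau> \<le> d" "16 + real k * y \<le> d" using d pos by linarith+
  have p1: "18 / \<tau> \<le> p" "2 * (real k * y) + 3 * real y \<le> p" "\<tau> * d / 2 + 8 + 3 \<le> p" "8 + real k * y + 1 \<le> p"
    using p pos by linarith+
  have n: "2 * 8 + k * y \<le> d" "2 * (k * y) + 3 * y \<le> p" "8 + k * y + 1 \<le> p"
  proof -
    have "real (2 * 8 + k * y) \<le> real d" "real (2 * (k * y) + 3 * y) \<le> real p" "real (8 + k * y + 1) \<le> real p"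
      using d1(2) p1(2,4) by simp_all
    then show "2 * 8 + k * y \<le> d" "2 * (k * y) + 3 * y \<le> p" "8 + k * y + 1 \<le> p"
      by (simp_all only: of_nat_le_iff)
  qed
  have m: "real (4 * 8 + 1) \<le> \<tau> * y" "real (4 * 8 + 4) \<le> \<tau> * d" "real (2 * 8 + 2) \<le> \<tau> * p"
    using y1(1) d1(1) p1(1) \<tau> by (simp_all add: pos_divide_le_eq mult.commute)
  have "good_template t t (mk_template \<tau> 8 y y k p d) \<and> drawable (mk_template \<tau> 8 y y k p d) \<and>
     ul (mk_template \<tau> 8 y y k p d) = k * yl (mk_template \<tau> 8 y y k p d)"
    using mk_template_good[of t t \<tau> 8 k y y d p] assms \<tau> y1 d1 p1 n m by (simp add: \<tau>_def)
  then show ?thesis by blast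
qed

text \<open>For the dilation problem the stretch can be chosen, and 2 avoids roundings. With
  \<open>z = 4 * h + 1\<close> the detour of \<open>Y 1\<close> has length \<open>2 * z - 1\<close>:
  admissible at stretch 2, too long at \<open>2 - 2 / z\<close>. Items of length
  \<open>4 * h + 4\<close> still have admissible detours at the smaller stretch.\<close>

lemma template_exists_gap:
  assumes "1 \<le> k"
  shows "\<exists>T t0. good_template t0 2 T \<and> drawable T \<and> ul T = k * yl T \<and> t0 * zl T + 1 \<le> zl T + 4 * half T"
proof -
  \<comment> \<open>The relevant lengths add up to at most \<open>(10 * k + 13) * z\<close>, so
    lowering the stretch by \<open>2 / z\<close> costs at most \<open>20 * k + 26\<close>;
    \<open>h\<close> is so large that \<open>h / 2 - 1\<close> exceeds this.\<close>
  define h where "h = 100 * k + 100"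
  define t0 :: real where "t0 = 2 - 2 / (4 * h + 1)"
  define y z where "y = 4 * h + 4" and "z = 4 * h + 1"
  define p where "p = 2 * (k * y) + 3 * y"
  define d where "d = 2 * h + k * y"
  have H: "0 < real (4 * h + 1)" by simp
  have t: "1 < t0" "t0 \<le> 2" unfolding t0_def by (auto simp: field_simps h_def)
  have ky: "y \<le> k * y" using assms by simp
  have g: "2 - t0 = 2 / real z" by (simp add: t0_def z_def)
  have zp: "0 < real z" by (simp add: z_def)
  have tol: "(2 - t0) * real (p + (p + d)) \<le> h / 2 - 1"
  proof -
    have "p + (p + d) = (5 * k + 6) * y + 2 * h" by (simp add: p_def d_def algebra_simps)
    also have "\<dots> \<le> (5 * k + 6) * (2 * z) + z" by (intro add_mono mult_le_mono) (auto simp: y_def z_def h_def)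
    also have "\<dots> = (10 * k + 13) * z" by (simp add: algebra_simps)
    finally have "real (p + (p + d)) \<le> real ((10 * k + 13) * z)" by (rule of_nat_mono)
    then have "2 / real z * real (p + (p + d)) \<le> 2 / real z * real ((10 * k + 13) * z)"
      using zp by (intro mult_left_mono) auto
    also have "\<dots> = 20 * k + 26" using zp by simp
    also have "\<dots> \<le> h / 2 - 1" by (simp add: h_def)
    finally show ?thesis unfolding g .
  qed
  have t0z: "(t0 - 1) * z = real z - 2" using zp g by (simp add: field_simps)
  have yv: "(t0 - 1) * y \<ge> 4 * h + 1"
  proof -
    have "(2 - t0) * y \<le> 3" unfolding g by (simp add: y_def z_def h_def field_simps)
    then show ?thesis by (simp add: y_def algebra_simps)
  qed
  have pr: "8 \<le> h" "z \<le> y" "2 * h + k * y \<le> d" "2 * (k * y) + 3 * y \<le> p" "h + k * y + 1 \<le> p"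
    using ky by (auto simp: h_def z_def y_def p_def d_def)
  have nt: "4 * h + 4 \<le> d" "2 * h + 2 \<le> p" "d + 2 * (h + 3) \<le> 2 * p" "3 \<le> z" "4 * h + 1 \<le> z"
  proof -
    show "4 * h + 4 \<le> d" using ky y_def d_def by linarith
    show "2 * h + 2 \<le> p" by (simp add: y_def p_def)
    show "3 \<le> z" "4 * h + 1 \<le> z" by (simp_all add: z_def h_def)
    obtain q where q: "q = k * y" by blast
    have "2 * p = 4 * q + 6 * y" "d = 2 * h + q" by (simp_all add: p_def d_def q)
    then show "d + 2 * (h + 3) \<le> 2 * p" using y_def by (simp add: algebra_simps)
  qed
  have "real (4 * h + 4) \<le> real d" "real (2 * h + 2) \<le> real p" "real (d + 2 * (h + 3)) \<le> real (2 * p)"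
    "real 3 \<le> real z" "real (4 * h + 1) \<le> real z"
    by (intro of_nat_mono nt)+
  then have re: "real (4 * h + 4) \<le> 1 * real d" "real (2 * h + 2) \<le> 1 * real p" "1 * real d / 2 + h + 3 \<le> real p"
    "2 + 1 \<le> real z" "real (4 * h + 1) \<le> (2 - 1) * real z" by simp_all
  have yv': "real (4 * h + 1) \<le> (t0 - 1) * real y" using yv by simp
  have one: "(1::real) = 2 - 1" by simp
  note M = mk_template_good[OF t one pr(1) assms pr(2) re(4) yv' re(5) pr(3) re(1) pr(4) re(2,3) pr(5) tol]
  have "t0 * z + 1 \<le> z + 4 * real h" using t0z by (simp add: z_def algebra_simps)
  then show ?thesis using M by (intro exI[of _ "mk_template 1 h y z k p d"] exI[of _ t0]) simp
qed

subsection \<open>Geometric and weighted instances\<close>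

text \<open>The positions \<open>(b, 0)\<close> of all branches are the hub and share the number 0,
  so each branch contributes only \<open>P\<close> further numbers.\<close>

definition index :: "nat \<Rightarrow> nat \<times> nat \<Rightarrow> nat" where
  "index P p = (if snd p = 0 then 0 else fst p * P + snd p)"

definition vertex :: "nat \<Rightarrow> nat \<Rightarrow> nat \<times> nat" where
  "vertex P n = (if n = 0 then (0, 0) else ((n - 1) div P, (n - 1) mod P + 1))"

definition edge_index :: "template \<Rightarrow> nat \<Rightarrow> desc \<Rightarrow> nat \<times> nat" where
  "edge_index T n d = (index (last T) (fst (ends T n d)), index (last T) (snd (ends T n d)))"

fun local_desc :: "desc \<Rightarrow> bool" where
  "local_desc (D0 u) = False"
| "local_desc (Link u b j) = False"
| "local_desc d = True"

lemma index_vertex: "0 < P \<Longrightarrow> index P (vertex P n) = n"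
  by (simp add: index_def vertex_def)

lemma vertex_index: "snd p \<le> P \<Longrightarrow> vertex P (index P p) = (if snd p = 0 then (0, 0) else p)"
  by (cases p; cases "snd p") (auto simp: index_def vertex_def)

lemma index_less: "fst p < B \<Longrightarrow> snd p \<le> P \<Longrightarrow> index P p < B * P + 1"
proof -
  assume p: "fst p < B" "snd p \<le> P"
  have "fst p * P + P \<le> B * P" using p(1) mult_le_mono1[of "Suc (fst p)" B P] by simp
  then show ?thesis using p by (simp add: index_def)
qed

lemma vertex_bounds: "n < B * P + 1 \<Longrightarrow> 0 < B \<Longrightarrow> 0 < P \<Longrightarrow> fst (vertex P n) < B \<and> snd (vertex P n) \<le> P"
  by (auto simp: vertex_def div_less_iff_less_mult Suc_le_eq)

text \<open>Planarity is only demanded of subgraphs that contain all chains, because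
  \<open>planar_straight\<close> needs every vertex on an edge. The list \<open>dl\<close> fixes
  which bit of a solution stands for which edge.\<close>

locale instance_graph = gadget T t0 t1 nR nU links \<nu> "graph_of C I" \<Lambda> \<epsilon>
  for T t0 t1 nR nU links and \<nu> :: "nat \<Rightarrow> nat \<Rightarrow> 'v" and C :: "('i, 'v) graph_class" and I \<Lambda> \<epsilon> +
  fixes dl :: "desc list"
  assumes input: "I \<in> inputs C" and dl: "distinct dl" "set dl = D" and edge_list: "edge_list C I = map eset dl"
    and plane: "\<And>X. X \<subseteq> {d \<in> D. local_desc d} \<Longrightarrow> (\<And>b i. b < B \<Longrightarrow> i < P \<Longrightarrow> Chain b i \<in> X) \<Longrightarrow>
      is_plane C ((graph_of C I)\<lparr>edges := eset ` X\<rparr>)"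

context layout begin

lemma index_neq: "d \<in> D \<Longrightarrow> index P (fst (ends T nR d)) \<noteq> index P (snd (ends T nR d))"
proof
  assume d: "d \<in> D" and e: "index P (fst (ends T nR d)) = index P (snd (ends T nR d))"
  have "canon (fst (ends T nR d)) = canon (snd (ends T nR d))"
    using arg_cong[OF e, of "vertex P"] valid_ends[OF d] by (simp add: vertex_index valid_def canon_def)
  then show False using canon_less[OF d] by simp
qed

lemma card_descs: "card D \<le> B * P + 3 * B + 2 * (B * B)"
proof -
  have fin: "finite {Chain b i | b i. b < B \<and> i < P}" "card {Chain b i | b i. b < B \<and> i < P} \<le> B * P"
  proof -
    have *: "{Chain b i | b i. b < B \<and> i < P} = (\<lambda>(b, i). Chain b i) ` ({..<B} \<times> {..<P})" by auto
    show "finite {Chain b i | b i. b < B \<and> i < P}" unfolding * by simp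
    show "card {Chain b i | b i. b < B \<and> i < P} \<le> B * P"
      unfolding * using card_image_le[of "{..<B} \<times> {..<P}" "\<lambda>(b, i). Chain b i"] by simp
  qed
  have l: "card links \<le> 2 * (nU * nR)"
  proof -
    have "links \<subseteq> {..<nU} \<times> (UNIV :: bool set) \<times> {..<nR}" using links(1) by auto
    from card_mono[OF _ this] show ?thesis by (simp add: card_cartesian_product algebra_simps)
  qed
  obtain q r s where q: "q = B * B" "r = B * P" "s = nU * nR" by blast
  have "s \<le> q" unfolding q by (intro mult_le_mono) auto
  moreover have "card D \<le> B * P + nR + nU + nU + nU + card links"
    unfolding descs_def
    by (intro order.trans[OF card_Un_le] add_mono fin order.trans[OF card_image_le])
      (use links(2) in auto)
  ultimately show ?thesis using l unfolding q[symmetric] by simp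
qed

end

context drawing begin

definition points :: "(rat \<times> rat) list" where
  "points = map (\<lambda>n. case vertex P n of (b, i) \<Rightarrow> (of_int (xc b i), of_int (yc b i))) [0..<B * P + 1]"

lemma point_points: "n < B * P + 1 \<Longrightarrow> point (points ! n) = case_prod pt (vertex P n)"
  by (auto simp: points_def point_def pt_def simp del: upt_Suc split: prod.splits)

lemma length_points: "length points = B * P + 1"
  by (simp add: points_def)

lemma point_index: "fst p < B \<Longrightarrow> snd p \<le> P \<Longrightarrow> point (points ! index P p) = case_prod pt p"
  using index_less[of p B P] vertex_index[of p P] pt_hub by (cases p) (auto simp: point_points)

lemma points_set:
  assumes "0 < B"
  shows "point ` set points = {pt b i | b i. b < B \<and> i \<le> P}"
proof -
  have P: "0 < P" using order by simp
  have "p \<in> {pt b i | b i. b < B \<and> i \<le> P}" if p: "p \<in> point ` set points" for p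
  proof -
    obtain n where n: "n < B * P + 1" "p = point (points ! n)"
      using p by (auto simp: in_set_conv_nth length_points)
    have "p = pt (fst (vertex P n)) (snd (vertex P n))" using n point_points[OF n(1)] by (simp add: case_prod_beta)
    then show ?thesis using vertex_bounds[OF n(1) assms P] by blast
  qed
  moreover have "pt b i \<in> point ` set points" if "b < B" "i \<le> P" for b i
    using point_index[of "(b, i)"] index_less[of "(b, i)" B P] that length_points by (metis fst_conv snd_conv image_eqI nth_mem prod.case)
  ultimately show ?thesis by blast
qed

lemma distinct_points: "0 < B \<Longrightarrow> distinct points"
proof -
  assume B: "0 < B"
  have P: "0 < P" using order by simp
  have "n = n'" if n: "n < B * P + 1" "n' < B * P + 1" "points ! n = points ! n'" for n n'
  proof -
    have "case_prod pt (vertex P n) = case_prod pt (vertex P n')" using n point_points by metis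
    then have "pt (fst (vertex P n)) (snd (vertex P n)) = pt (fst (vertex P n')) (snd (vertex P n'))"
      by (simp add: case_prod_beta)
    then have "snd (vertex P n) = snd (vertex P n') \<and> (snd (vertex P n) = 0 \<or> fst (vertex P n) = fst (vertex P n'))"
      using pt_inj vertex_bounds[OF n(1) B P] vertex_bounds[OF n(2) B P] by blast
    then have "vertex P n = vertex P n'" by (cases "n = 0"; cases "n' = 0") (simp_all add: vertex_def prod_eq_iff)
    then show ?thesis using index_vertex[OF P] by metis
  qed
  then show ?thesis by (auto simp: distinct_conv_nth length_points)
qed

text \<open>Horizontal extents, at scale 1, equal \<open>len\<close> exactly. For a link this uses
  that its ends lie on opposite sides of the hub, so that their horizontal distances from it add
  up.\<close>

lemma x_len:
  assumes "layout T t0 t1 nR nU links \<nu>" "d \<in> descs T nR nU links" "ends T nR d = ((b, i), (b', i'))"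
  shows "\<bar>sg b * x i - sg b' * x i'\<bar> = int (len T d)" "b < B" "i \<le> P" "b' < B" "i' \<le> P"
proof -
  interpret L: layout T t0 t1 nR nU links \<nu> by fact
  show v: "b < B" "i \<le> P" "b' < B" "i' \<le> P" using L.valid_ends[OF assms(2)] by (auto simp: L.valid_def assms(3))
  have sg: "\<bar>sg b * u - sg b * v\<bar> = \<bar>u - v\<bar>" for b u v by (auto simp: sg_def)
  have opp: "\<bar>sg j * u - sg (nR + k) * v\<bar> = u + v" if "j < nR" "0 \<le> u" "0 \<le> v" for j k u v
    using that by (simp add: sg_def)
  have hf: "half T \<le> turn1 T" "2 * half T \<le> turn2 T" using basics by auto
  have tn1: "\<bar>x (turn1 T - half T) - x (turn1 T + half T + ul T)\<bar> = int (ul T)"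
    using x_turn[of "turn1 T" "half T" "turn1 T + half T + ul T" "turn1 T + half T + ul T"] basics hf
      le_trans[OF diff_le_self, of "turn1 T" "turn1 T + half T + ul T" "half T"]
    by (auto simp add: of_nat_diff split: if_splits)
  have tn2: "\<bar>x (turn2 T - 2 * half T) - x (turn2 T + 2 * half T + l)\<bar> = int l"
    if "turn2 T + 2 * half T + l \<le> P" for l
    using x_turn[of "turn2 T" "2 * half T" "turn2 T + 2 * half T + l" "turn2 T + 2 * half T + l"] basics(1) hf that
      le_trans[OF diff_le_self, of "turn2 T" "turn2 T + 2 * half T + l" "2 * half T"]
    by (simp add: of_nat_diff split: if_splits)
  have yb: "turn2 T + 2 * half T + ylen T j \<le> P" for j using basics by (simp add: ylen_def)
  from assms(2) show "\<bar>sg b * x i - sg b' * x i'\<bar> = int (len T d)"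
  proof (cases rule: L.D_cases)
    case (chain b i)
    then show ?thesis using assms(3) x_step[of i] by (auto simp: sg abs_minus_commute)
  next
    case (y j)
    then show ?thesis using assms(3) tn2[OF yb] by (auto simp: sg)
  next
    case (u1 u)
    then show ?thesis using assms(3) tn1 by (auto simp: sg)
  next
    case (u2 u)
    then show ?thesis using assms(3) tn2[of "ul T"] basics by (auto simp: sg)
  next
    case (d0 u)
    then show ?thesis using assms(3) x_port by (auto simp: sg_def)
  next
    case (link u b j)
    then show ?thesis using assms(3) x_port L.links(1)[OF link(2)] opp[of j] by (auto split: if_splits)
  qed
qed

definition err :: real where "err = 2 * (2 ^ (c + B) * real P + real P) / 2 ^ m"

text \<open>A Euclidean length lies between its horizontal extent and the sum of both extents, so
  the vertical extent bounds the error.\<close>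

lemma dist_len:
  assumes "layout T t0 t1 nR nU links \<nu>" "d \<in> descs T nR nU links"
  shows "2 ^ m * len T d \<le> dist (case_prod pt (fst (ends T nR d))) (case_prod pt (snd (ends T nR d)))"
    "dist (case_prod pt (fst (ends T nR d))) (case_prod pt (snd (ends T nR d))) \<le> 2 ^ m * (len T d + err)"
proof -
  obtain b i b' i' where e: "ends T nR d = ((b, i), (b', i'))" by (metis surj_pair)
  note X = x_len[OF assms e]
  define dx dy where "dx = real_of_int (xc b i - xc b' i')" and "dy = real_of_int (yc b i - yc b' i')"
  have dist: "dist (case_prod pt (fst (ends T nR d))) (case_prod pt (snd (ends T nR d))) = sqrt (dx\<^sup>2 + dy\<^sup>2)"
    by (simp add: e pt_def dist_Pair_Pair dist_real_def dx_def dy_def)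
  have "xc b i - xc b' i' = 2 ^ m * (sg b * x i - sg b' * x i')" by (simp add: xc_def algebra_simps)
  then have "\<bar>xc b i - xc b' i'\<bar> = 2 ^ m * int (len T d)" using X(1) by (simp add: abs_mult)
  then have "real_of_int \<bar>xc b i - xc b' i'\<bar> = real_of_int (2 ^ m * int (len T d))" by (rule arg_cong)
  then have dx: "\<bar>dx\<bar> = 2 ^ m * len T d" by (simp add: dx_def)
  have yb: "\<bar>real_of_int (yc b i)\<bar> \<le> 2 ^ (c + B) * P + P" if "b < B" "i \<le> P" for b i
  proof -
    have xi: "0 \<le> real_of_int (x i)" "real_of_int (x i) \<le> real P"
      using x_pos[of i] x_le[of i] that by (cases "i = 0"; simp)+
    have "\<bar>real_of_int (yc b i)\<bar> = 2 ^ (c + b) * real_of_int (x i) + real i"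
      using xi by (auto simp: yc_def sg_def abs_mult)
    also have "\<dots> \<le> 2 ^ (c + B) * real P + real P"
      using xi that by (intro add_mono mult_mono power_increasing) auto
    finally show ?thesis by simp
  qed
  have dy: "\<bar>dy\<bar> \<le> 2 ^ m * err"
    using yb[OF X(2,3)] yb[OF X(4,5)] by (simp add: dy_def err_def)
  have "\<bar>dx\<bar> \<le> sqrt (dx\<^sup>2 + dy\<^sup>2)" by (rule real_sqrt_ge_abs1)
  then show "2 ^ m * len T d \<le> dist (case_prod pt (fst (ends T nR d))) (case_prod pt (snd (ends T nR d)))"
    unfolding dist dx .
  have "sqrt (dx\<^sup>2 + dy\<^sup>2) \<le> \<bar>dx\<bar> + \<bar>dy\<bar>" by (rule sqrt_sum_squares_le_sum_abs)
  then show "dist (case_prod pt (fst (ends T nR d))) (case_prod pt (snd (ends T nR d))) \<le> 2 ^ m * (len T d + err)"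
    unfolding dist dx using dy by (simp add: distrib_left)
qed

text \<open>With \<open>a = 2 ^ c\<close> and \<open>b = 2 ^ B\<close>, the error is at most
  \<open>4 * (a * b * a) / 2 ^ m\<close> and there are at most \<open>8 * (a * (b * b))\<close>
  edges; \<open>m\<close> is chosen so that \<open>2 ^ m = 64 * a ^ 3 * b ^ 3\<close>, which bounds
  the product by 1/2.\<close>

lemma err_small:
  assumes "layout T t0 t1 nR nU links \<nu>" and m: "m = 3 * c + 3 * B + 6"
  shows "0 \<le> err" "card (descs T nR nU links) * err \<le> 1 / 2" "t1 * err \<le> 1 / 2"
proof -
  interpret L: layout T t0 t1 nR nU links \<nu> by fact
  show e0: "0 \<le> err" by (simp add: err_def)
  have cP: "real P \<le> 2 ^ c" using c by (metis of_nat_le_iff of_nat_numeral of_nat_power less_imp_le)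
  have BB: "real B \<le> 2 ^ B"
    by (metis of_nat_le_iff of_nat_numeral of_nat_power less_imp_le less_exp)
  define a b where "a = (2::real) ^ c" and "b = (2::real) ^ B"
  have ab: "1 \<le> a" "1 \<le> b" by (simp_all add: a_def b_def)
  have m2: "(2::real) ^ m = a ^ 3 * b ^ 3 * 64"
    unfolding m a_def b_def by (simp add: power_add power_mult power_mult_distrib mult.commute[of 3])
  have "2 ^ (c + B) * real P + real P \<le> a * b * a + a * b * a"
  proof (rule add_mono)
    show "2 ^ (c + B) * real P \<le> a * b * a"
      using cP by (simp add: power_add a_def b_def)
    have "1 * 1 \<le> a * b" using ab by (intro mult_mono) auto
    then have "1 * a \<le> a * b * a" using ab by (intro mult_right_mono) auto
    then show "real P \<le> a * b * a" using cP unfolding a_def[symmetric] by linarith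
  qed
  then have "2 * (2 ^ (c + B) * real P + real P) \<le> 2 * (a * b * a + a * b * a)"
    by (rule mult_left_mono) simp
  also have "\<dots> = 4 * (a * b * a)" by simp
  finally have "2 * (2 ^ (c + B) * real P + real P) \<le> 4 * (a * b * a)" .
  then have err: "err \<le> 4 * (a * b * a) / (a ^ 3 * b ^ 3 * 64)"
    unfolding err_def m2 by (rule divide_right_mono) (use ab in simp)
  also have "\<dots> = 1 / (16 * (a * (b * b)))" using ab by (simp add: field_simps power3_eq_cube)
  finally have err: "err \<le> 1 / (16 * (a * (b * b)))" .
  have scale: "r * err \<le> 1 / 2" if "r \<le> 8 * (a * (b * b))" for r
  proof -
    have "r * err \<le> (8 * (a * (b * b))) * (1 / (16 * (a * (b * b))))"
      using that err e0 ab by (intro mult_mono) auto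
    also have "\<dots> = 1 / 2" using ab by simp
    finally show ?thesis .
  qed
  have abb: "b * b \<le> a * (b * b)" "a * b \<le> a * (b * b)" "b \<le> b * b" "a \<le> a * (b * b)"
  proof -
    have "1 * (b * b) \<le> a * (b * b)" by (rule mult_right_mono) (use ab in auto)
    then show "b * b \<le> a * (b * b)" by simp
    have "1 * b \<le> b * b" by (rule mult_right_mono) (use ab in auto)
    then show bb: "b \<le> b * b" by simp
    then show "a * b \<le> a * (b * b)" using ab by (intro mult_left_mono) auto
    have bb1: "1 \<le> b * b" using bb ab by linarith
    have "a * 1 \<le> a * (b * b)" using ab bb1 by (intro mult_left_mono) auto
    then show "a \<le> a * (b * b)" by simp
  qed
  have "real (card (descs T nR nU links)) \<le> real (B * P + 3 * B + 2 * (B * B))" using L.card_descs by (rule of_nat_mono)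
  also have "\<dots> = real B * real P + 3 * real B + 2 * (real B * real B)" by simp
  also have "\<dots> \<le> b * a + 3 * b + 2 * (b * b)"
    using BB cP by (intro add_mono mult_mono) (auto simp: a_def b_def)
  also have "\<dots> \<le> 8 * (a * (b * b))" using abb ab mult.commute[of b a] by linarith
  finally show "card (descs T nR nU links) * err \<le> 1 / 2" by (rule scale)
  have "t1 + 1 \<le> zl T" "zl T \<le> P" using good basics by (auto simp: good_template_def)
  then have "t1 \<le> real P" by linarith
  moreover have "real P \<le> a" using cP by (simp add: a_def)
  ultimately have "t1 \<le> 8 * (a * (b * b))" using abb(4) ab by linarith
  then show "t1 * err \<le> 1 / 2" by (rule scale)
qed

lemma local_skel:
  assumes "layout T t0 t1 nR nU links \<nu>" "d \<in> descs T nR nU links" "local_desc d"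
  shows "\<exists>b s e. (b, s, e) \<in> skel \<and> ends T nR d = ((b, s), (b, e))"
proof -
  interpret L: layout T t0 t1 nR nU links \<nu> by fact
  from assms(2) show ?thesis
    by (cases rule: L.D_cases) (use assms(3) in \<open>auto simp: skel_def\<close>)
qed


definition geometric_inst :: "desc list \<Rightarrow> geometric_input" where
  "geometric_inst dl = (points, map (edge_index T nR) dl)"

lemma geometric_inst:
  assumes L: "layout T t0 t1 nR nU links pt" and m: "m = 3 * c + 3 * B + 6"
    and dl: "distinct dl" "set dl = descs T nR nU links"
  shows "instance_graph T t0 t1 nR nU links pt geometric (geometric_inst dl) (2 ^ m) err dl"
proof -
  interpret L: layout T t0 t1 nR nU links pt by fact
  have B: "0 < B" using L.nR by simp
  have P: "0 < P" using order by simp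
  let ?I = "geometric_inst dl"
  have pts: "point (points ! index P (fst (ends T nR d))) = case_prod pt (fst (ends T nR d))"
    "point (points ! index P (snd (ends T nR d))) = case_prod pt (snd (ends T nR d))" if "d \<in> set dl" for d
    using L.valid_ends that dl(2) by (auto simp: L.valid_def intro!: point_index)
  have el: "geometric_edge_list ?I = map L.eset dl"
    by (auto simp: geometric_edge_list_def geometric_inst_def edge_index_def L.eset_def pts)
  have dist: "distinct (map L.eset dl)" using L.eset_inj dl by (simp add: distinct_map)
  have inp: "?I \<in> inputs geometric"
    unfolding geometric_def using el dist distinct_points[OF B] dl(2) L.index_neq L.valid_ends index_less
    by (auto simp: geometric_inst_def edge_index_def length_points L.valid_def simp del: One_nat_def)
  have G: "graph_of geometric ?I = \<lparr>verts = {pt b i | b i. b < B \<and> i \<le> P},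
      edges = L.eset ` descs T nR nU links, weight = diameter\<rparr>"
    using el dl(2) points_set[OF B] by (simp add: geometric_def geometric_graph_def) (simp add: geometric_inst_def)
  interpret Gd: gadget T t0 t1 nR nU links pt "graph_of geometric ?I" "2 ^ m" err
  proof
    show "wf_wgraph (graph_of geometric ?I)" by (rule wf_geometric[OF inp])
    show "edges (graph_of geometric ?I) = (\<lambda>d. {case_prod pt (fst (ends T nR d)), case_prod pt (snd (ends T nR d))}) `
       descs T nR nU links" by (simp add: G L.eset_def[abs_def])
    show "2 ^ m * real (len T d) \<le> weight (graph_of geometric ?I)
        {case_prod pt (fst (ends T nR d)), case_prod pt (snd (ends T nR d))} \<and>
      weight (graph_of geometric ?I) {case_prod pt (fst (ends T nR d)), case_prod pt (snd (ends T nR d))}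
        \<le> 2 ^ m * (real (len T d) + err)" if "d \<in> descs T nR nU links" for d
      using dist_len[OF L that] by (simp add: G diameter_pair)
  qed (use G err_small[OF L m] in simp_all)
  show ?thesis
  proof
    show "edge_list geometric ?I = map L.eset dl" using el by (simp add: geometric_def)
    fix X assume X: "X \<subseteq> {d \<in> descs T nR nU links. local_desc d}"
    have "\<not> edges_cross (L.eset d) (L.eset d')" if d: "d \<in> X" "d' \<in> X" for d d'
    proof -
      have lc: "d \<in> descs T nR nU links" "local_desc d" "d' \<in> descs T nR nU links" "local_desc d'"
        using X d(1,2) by auto
      obtain b s e where e1: "(b, s, e) \<in> skel" "ends T nR d = ((b, s), (b, e))"
        using local_skel[OF L lc(1,2)] by blast
      obtain b' s' e' where e2: "(b', s', e') \<in> skel" "ends T nR d' = ((b', s'), (b', e'))"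
        using local_skel[OF L lc(3,4)] by blast
      note e = e1 e2
      then show ?thesis
        unfolding edges_cross_def L.eset_def using skel_plane[OF e(1,3)] by auto
    qed
    then show "is_plane geometric ((graph_of geometric ?I)\<lparr>edges := L.eset ` X\<rparr>)"
      by (auto simp: geometric_def plane_geometric_def)
  qed (use inp dl in simp_all)
qed

definition weighted_inst :: "desc list \<Rightarrow> weighted_input" where
  "weighted_inst dl = (B * P + 1, map (\<lambda>d. case edge_index T nR d of (i, j) \<Rightarrow> (i, j, of_nat (len T d))) dl)"

text \<open>The same graph with the lengths \<open>len\<close> as exact weights, hence scale 1 and
  error 0. Its planarity is inherited from the geometric drawing, for which the layout by
  \<open>pt\<close> is assumed as well.\<close>

lemma weighted_inst:
  fixes \<nu> defines "\<nu> \<equiv> \<lambda>b i. index P (b, i)"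
  assumes L: "layout T t0 t1 nR nU links \<nu>" and L': "layout T t0 t1 nR nU links pt"
    and dl: "distinct dl" "set dl = descs T nR nU links"
  shows "instance_graph T t0 t1 nR nU links \<nu> weighted (weighted_inst dl) 1 0 dl"
proof -
  interpret L: layout T t0 t1 nR nU links \<nu> by fact
  interpret L': layout T t0 t1 nR nU links pt by fact
  have B: "0 < B" using L.nR by simp
  have P: "0 < P" using order by simp
  let ?I = "weighted_inst dl"
  have \<nu>: "case_prod \<nu> p = index P p" for p by (cases p) (simp add: \<nu>_def)
  have eset: "L.eset d = {fst (edge_index T nR d), snd (edge_index T nR d)}" for d
    by (simp add: L.eset_def \<nu> edge_index_def)
  have el: "weighted_edge_list ?I = map L.eset dl"
    by (simp add: weighted_edge_list_def weighted_inst_def eset case_prod_beta)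
  have dist: "distinct (map L.eset dl)" using L.eset_inj dl by (simp add: distinct_map)
  have len0: "0 < len T d" if "d \<in> descs T nR nU links" for d
    using that
    by (cases rule: L.D_cases) (use basics L.links(1) x_port x_pos[of "port1 T"] x_pos[of P] order in \<open>auto simp: ylen_def\<close>)
  have inp: "?I \<in> inputs weighted"
    unfolding weighted_def using el dist dl(2) L.index_neq L.valid_ends index_less len0
    by (auto simp: weighted_inst_def edge_index_def L.valid_def simp del: One_nat_def)
  have V: "{0..<B * P + 1} = {\<nu> b i | b i. b < B \<and> i \<le> P}"
  proof -
    have "n \<in> {\<nu> b i | b i. b < B \<and> i \<le> P}" if "n < B * P + 1" for n
      using vertex_bounds[OF that B P] index_vertex[OF P, of n]
      by (intro CollectI exI[of _ "fst (vertex P n)"] exI[of _ "snd (vertex P n)"]) (simp add: \<nu>_def)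
    moreover have "\<nu> b i < B * P + 1" if "b < B" "i \<le> P" for b i
      using index_less[of "(b, i)"] that by (simp add: \<nu>_def)
    ultimately show ?thesis by (auto simp del: One_nat_def)
  qed
  have G: "verts (graph_of weighted ?I) = {\<nu> b i | b i. b < B \<and> i \<le> P}"
      "edges (graph_of weighted ?I) = L.eset ` descs T nR nU links"
    using el dl(2) V by (simp_all add: weighted_def weighted_graph_def weighted_inst_def)
  have w: "weight (graph_of weighted ?I) (L.eset d) = len T d" if "d \<in> descs T nR nU links" for d
    using weight_weighted[OF inp, of "fst (edge_index T nR d)" "snd (edge_index T nR d)" "of_nat (len T d)"] that dl(2)
    by (force simp: eset weighted_inst_def case_prod_beta)
  interpret Gd: gadget T t0 t1 nR nU links \<nu> "graph_of weighted ?I" 1 0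
  proof
    show "wf_wgraph (graph_of weighted ?I)" by (rule wf_weighted[OF inp])
  qed (use G w in \<open>simp_all add: L.eset_def[abs_def]\<close>)
  show ?thesis
  proof
    show "edge_list weighted ?I = map L.eset dl" using el by (simp add: weighted_def)
    fix X assume X: "X \<subseteq> {d \<in> descs T nR nU links. local_desc d}"
      and ch: "\<And>b i. b < B \<Longrightarrow> i < P \<Longrightarrow> Chain b i \<in> X"
    let ?H = "(graph_of weighted ?I)\<lparr>edges := L.eset ` X\<rparr>"
    define pos where "pos n = case_prod pt (vertex P n)" for n
    have pos: "pos (index P p) = case_prod pt p" if "snd p \<le> P" for p
      using vertex_index[OF that] pt_hub by (cases p) (auto simp: pos_def)
    have img: "pos ` L.eset d = L'.eset d" if "d \<in> descs T nR nU links" for d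
      using L.valid_ends[OF that] by (simp add: eset edge_index_def L'.eset_def pos L.valid_def)
    have "planar ?H"
    proof (rule planar_straight[of pos])
      show "inj_on pos (verts ?H)"
      proof (rule inj_onI)
        fix v w assume "v \<in> verts ?H" "w \<in> verts ?H" and e: "pos v = pos w"
        then obtain b i b' i' where v: "v = \<nu> b i" "b < B" "i \<le> P" "w = \<nu> b' i'" "b' < B" "i' \<le> P"
          using G by auto
        then have "pt b i = pt b' i'" using e by (simp add: \<nu>_def pos)
        then have "i = i' \<and> (i = 0 \<or> b = b')" using pt_inj v by blast
        then show "v = w" by (auto simp: v \<nu>_def index_def)
      qed
      show "e \<subseteq> verts ?H \<and> card e = 2" if "e \<in> edges ?H" for e
        using that Gd.wf X G by (auto simp: wf_wgraph_def)
      show "\<exists>e\<in>edges ?H. v \<in> e" if vH: "v \<in> verts ?H" for v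
      proof -
        obtain b i where v: "v = \<nu> b i" "b < B" "i \<le> P" using vH G by auto
        have "v \<in> L.eset (Chain b (if i < P then i else P - 1))"
          unfolding eset using v P by (auto simp: edge_index_def \<nu>_def)
        moreover have "Chain b (if i < P then i else P - 1) \<in> X" using ch v P by auto
        ultimately show ?thesis by auto
      qed
      fix f g assume fg: "f \<in> edges ?H" "g \<in> edges ?H" "f \<noteq> g"
      then obtain d d' where d: "d \<in> X" "d' \<in> X" "f = L.eset d" "g = L.eset d'" by auto
      have dD: "d \<in> descs T nR nU links" "d' \<in> descs T nR nU links" using d X by auto
      have lc: "d \<in> descs T nR nU links" "local_desc d" "d' \<in> descs T nR nU links" "local_desc d'"
        using X d(1,2) by auto
      obtain b s e where e1: "(b, s, e) \<in> skel" "ends T nR d = ((b, s), (b, e))"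
        using local_skel[OF L' lc(1,2)] by blast
      obtain b' s' e' where e2: "(b', s', e') \<in> skel" "ends T nR d' = ((b', s'), (b', e'))"
        using local_skel[OF L' lc(3,4)] by blast
      note e = e1 e2
      have "d \<noteq> d'" using fg d by auto
      then have ne: "L'.eset d \<noteq> L'.eset d'" using L'.eset_inj dD by (auto dest: inj_onD)
      then show "convex hull (pos ` f) \<inter> convex hull (pos ` g) \<subseteq> pos ` f \<inter> pos ` g"
        using skel_plane[OF e(1,3)] unfolding d(3,4) img[OF dD(1)] img[OF dD(2)]
        by (auto simp: L'.eset_def e(2,4))
    qed
    then show "is_plane weighted ?H" by (simp add: weighted_def)
  qed (use inp dl in simp_all)
qed

end

subsection \<open>From colour constraints to covers\<close>

text \<open>A grid of \<open>Nc\<close> cells is numbered row by row, with rows of length \<open>Wm + 1\<close>.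
  The colours on the sides of cell \<open>i\<close> are kept in slots: \<open>2 * i + 1\<close> on top,
  \<open>2 * (i + Wm)\<close> left, \<open>2 * (i + Wm) + 3\<close> at the bottom and \<open>2 * (i + Wm) + 2\<close> right.
  A slot is represented in unary by one Boolean variable per colour.\<close>

definition tuples :: "'c list \<Rightarrow> ('c \<times> 'c \<times> 'c \<times> 'c) list" where
  "tuples cols = List.product cols (List.product cols (List.product cols cols))"

definition slot_lits :: "'c list \<Rightarrow> nat \<Rightarrow> 'c \<Rightarrow> nat \<Rightarrow> (nat \<times> bool \<times> nat) list" where
  "slot_lits cols s c j = map (\<lambda>k. (s * length cols + k, cols ! k = c, j)) [0..<length cols]"

text \<open>A tuple can be kept, that is its item \<open>Y j\<close> not bought, only if all these
  literals hold. For a tuple that the cell does not allow, two opposite literals of one variable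
  make this impossible, unless that variable is bought with both values.\<close>

definition term_lits :: "'c list \<Rightarrow> nat \<Rightarrow> bool \<Rightarrow> nat \<Rightarrow> 'c \<times> 'c \<times> 'c \<times> 'c \<Rightarrow> nat \<Rightarrow> (nat \<times> bool \<times> nat) list" where
  "term_lits cols Wm good i q j = (case q of (n, w, s, e) \<Rightarrow>
     if good then slot_lits cols (2 * i + 1) n j @ slot_lits cols (2 * (i + Wm)) w j @
       slot_lits cols (2 * (i + Wm) + 3) s j @ slot_lits cols (2 * (i + Wm) + 2) e j
     else [((2 * i + 1) * length cols, True, j), ((2 * i + 1) * length cols, False, j)])"

definition ok_tuple :: "('t \<Rightarrow> 'c \<Rightarrow> 'c \<Rightarrow> 'c \<Rightarrow> 'c \<Rightarrow> bool) \<Rightarrow> 't \<Rightarrow> 'c \<times> 'c \<times> 'c \<times> 'c \<Rightarrow> bool" where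
  "ok_tuple ok t q = (case q of (n, w, s, e) \<Rightarrow> ok t n w s e)"

lemma div_mod_unique: "(a::nat) * n + b = a' * n + b' \<Longrightarrow> b < n \<Longrightarrow> b' < n \<Longrightarrow> a = a' \<and> b = b'"
  by (metis add.commute div_mult_self1 div_less less_nat_zero_code mod_less mod_mult_self1 add_0)

locale csp =
  fixes cols :: "'c list" and ok :: "'t \<Rightarrow> 'c \<Rightarrow> 'c \<Rightarrow> 'c \<Rightarrow> 'c \<Rightarrow> bool"
    and \<omega> :: "nat \<Rightarrow> 't" and Nc Wm :: nat and c1 :: 'c
  assumes distinct: "distinct cols" and c1: "c1 \<in> set cols" and Nc: "0 < Nc" and Wm: "0 < Wm"
begin

abbreviation "C \<equiv> length cols"
abbreviation "K \<equiv> length (tuples cols)"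

text \<open>Each tuple of colours occurs in two copies \<open>c\<close>, so that giving up a cell costs
  more than the one unit by which the budgets of the reductions may exceed the optimum.\<close>

definition code :: "nat \<Rightarrow> nat \<Rightarrow> nat \<Rightarrow> nat" where
  "code i c r = 2 + 2 * K * i + K * c + r"

definition nR :: nat where "nR = 2 + 2 * K * Nc"
definition nU :: nat where "nU = 2 * (Nc + Wm + 1) * C"
text \<open>The right side of the last cell, where the tableau announces the verdict.\<close>

definition zslot :: nat where "zslot = 2 * (Nc - 1 + Wm) + 2"

definition term_of :: "nat \<Rightarrow> nat \<Rightarrow> nat \<Rightarrow> (nat \<times> bool \<times> nat) list" where
  "term_of i r j = term_lits cols Wm (ok_tuple ok (\<omega> i) (tuples cols ! r)) i (tuples cols ! r) j"

definition links :: "(nat \<times> bool \<times> nat) set" where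
  "links = set (slot_lits cols zslot c1 0) \<union>
     (\<Union>i<Nc. \<Union>c<2. \<Union>r<K. set (term_of i r (code i c r)))"

definition solution :: "(nat \<Rightarrow> 'c) \<Rightarrow> bool" where
  "solution \<alpha> \<longleftrightarrow> (\<forall>s. \<alpha> s \<in> set cols) \<and>
     (\<forall>i<Nc. ok (\<omega> i) (\<alpha> (2 * i + 1)) (\<alpha> (2 * (i + Wm))) (\<alpha> (2 * (i + Wm) + 3)) (\<alpha> (2 * (i + Wm) + 2)))"

lemma set_tuples: "set (tuples cols) = set cols \<times> set cols \<times> set cols \<times> set cols"
  by (simp add: tuples_def)

lemma distinct_tuples: "distinct (tuples cols)"
  unfolding tuples_def by (intro distinct_product distinct)

lemma C_pos: "0 < C" using c1 by (cases cols) auto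

lemma div_slot: "k < C \<Longrightarrow> (s * C + k) div C = s" "k < C \<Longrightarrow> (s * C + k) mod C = k"
  by (subst div_mult_self3; auto) (subst mod_mult_self3; auto)

lemma K_pos: "0 < K" using c1 set_tuples by (metis SigmaI length_pos_if_in_set)

lemma code_inj: "inj_on (\<lambda>(i, c, r). code i c r) ({..<Nc} \<times> {..<2} \<times> {..<K})"
proof (rule inj_onI)
  fix x y assume xy: "x \<in> {..<Nc} \<times> {..<2} \<times> {..<K}" "y \<in> {..<Nc} \<times> {..<2} \<times> {..<K}"
    "(case x of (i, c, r) \<Rightarrow> code i c r) = (case y of (i, c, r) \<Rightarrow> code i c r)"
  obtain i c r i' c' r' where e: "x = (i, c, r)" "y = (i', c', r')" by (metis prod_cases3)
  have *: "c < 2" "r < K" "c' < 2" "r' < K" "code i c r = code i' c' r'"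
    using xy by (auto simp: e)
  have b: "K * c + r < 2 * K" "K * c' + r' < 2 * K"
    using * by (cases c; simp; cases c'; simp)+
  have "i * (2 * K) + (K * c + r) = i' * (2 * K) + (K * c' + r')"
    using *(5) by (simp add: code_def algebra_simps)
  then have 1: "i = i'" "K * c + r = K * c' + r'" using div_mod_unique b by blast+
  then have "c * K + r = c' * K + r'" by (simp add: mult.commute)
  then have "c = c' \<and> r = r'" by (rule div_mod_unique) (use * in auto)
  then show "x = y" using 1 e by simp
qed

lemma code_range: "i < Nc \<Longrightarrow> c < 2 \<Longrightarrow> r < K \<Longrightarrow> 2 \<le> code i c r \<and> code i c r < nR"
proof -
  assume "i < Nc" "c < 2" "r < K"
  then have 1: "2 * K * (i + 1) \<le> 2 * K * Nc" by (intro mult_le_mono2) simp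
  have "c = 0 \<or> c = 1" using \<open>c < 2\<close> by auto
  then have "2 * K * i + K * c + r < 2 * K * Nc" using 1 \<open>r < K\<close> by (elim disjE) simp_all
  then show ?thesis by (simp add: code_def nR_def)
qed

lemma slot_lits_range: "(u, b, j') \<in> set (slot_lits cols s c j) \<Longrightarrow> s < 2 * (Nc + Wm + 1) \<Longrightarrow> u < nU \<and> j' = j"
proof -
  assume *: "(u, b, j') \<in> set (slot_lits cols s c j)" "s < 2 * (Nc + Wm + 1)"
  then obtain k where k: "k < C" "u = s * C + k" "j' = j" by (auto simp: slot_lits_def)
  have "(s + 1) * C \<le> 2 * (Nc + Wm + 1) * C" using *(2) by (intro mult_le_mono1) simp
  then show ?thesis using k by (simp add: nU_def)
qed

lemma term_range: "(u, b, j') \<in> set (term_of i r j) \<Longrightarrow> i < Nc \<Longrightarrow> u < nU \<and> j' = j"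
proof -
  assume *: "(u, b, j') \<in> set (term_of i r j)" "i < Nc"
  obtain n w s e where q: "tuples cols ! r = (n, w, s, e)" by (metis prod_cases4)
  have "(2 * i + 1) * C < nU"
    unfolding nU_def using *(2) C_pos by (intro mult_strict_right_mono) auto
  then show ?thesis
    using * slot_lits_range[of u b j']
    by (auto simp: term_of_def term_lits_def q split: if_splits)
qed

lemma links_range: "(u, b, j) \<in> links \<Longrightarrow> u < nU \<and> j < nR \<and> j \<noteq> 1"
proof -
  assume "(u, b, j) \<in> links"
  then consider "(u, b, j) \<in> set (slot_lits cols zslot c1 0)"
    | i c r where "i < Nc" "c < 2" "r < K" "(u, b, j) \<in> set (term_of i r (code i c r))"
    by (auto simp: links_def)
  then show ?thesis
  proof cases
    case 1
    then show ?thesis using slot_lits_range[OF 1] Nc by (simp add: zslot_def nR_def)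
  next
    case 2
    then show ?thesis using term_range[OF 2(4,1)] code_range[OF 2(1,2,3)] by auto
  qed
qed

lemma finite_links: "finite links" by (simp add: links_def)

text \<open>In each copy of a cell exactly the tuple that the solution shows there is kept, so
  \<open>K - 1\<close> items are bought; every variable is bought once, with its actual
  value.\<close>

lemma solution_cover:
  assumes "solution \<alpha>"
  shows "\<exists>A1 A2 Ys. cover nU links A1 A2 Ys \<and> A1 \<subseteq> {..<nU} \<and> A2 \<subseteq> {..<nU} \<and> Ys \<subseteq> {2..<nR} \<union> {0} \<and>
     card A1 + card A2 = nU \<and> card (Ys - {0}) = 2 * (K - 1) * Nc \<and> (0 \<in> Ys \<longleftrightarrow> \<alpha> zslot \<noteq> c1)"
proof -
  define A2 where "A2 = {u. u < nU \<and> cols ! (u mod C) = \<alpha> (u div C)}"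
  define A1 where "A1 = {..<nU} - A2"
  have A: "A2 \<subseteq> {..<nU}" "A1 \<subseteq> {..<nU}" by (auto simp: A1_def A2_def)
  define q where "q i = (\<alpha> (2 * i + 1), \<alpha> (2 * (i + Wm)), \<alpha> (2 * (i + Wm) + 3), \<alpha> (2 * (i + Wm) + 2))" for i
  have "q i \<in> set (tuples cols)" for i using assms by (auto simp: q_def set_tuples solution_def)
  then have "\<exists>r<K. tuples cols ! r = q i" for i by (metis in_set_conv_nth)
  then obtain r where r: "\<And>i. r i < K" "\<And>i. tuples cols ! r i = q i" by metis
  define Yt where "Yt = (\<lambda>(i, c, k). code i c k) ` (SIGMA i : {..<Nc}. {..<2} \<times> ({..<K} - {r i}))"
  define Ys where "Ys = Yt \<union> (if \<alpha> zslot \<noteq> c1 then {0} else {})"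
  have Yt: "Yt \<subseteq> {2..<nR}" using code_range by (auto simp: Yt_def)
  have "card Yt = card (SIGMA i : {..<Nc}. {..<2::nat} \<times> ({..<K} - {r i}))"
    unfolding Yt_def by (rule card_image, rule inj_on_subset[OF code_inj]) auto
  also have "\<dots> = (\<Sum>i<Nc. 2 * (K - 1))"
    by (subst card_SigmaI) (auto simp: card_cartesian_product r)
  finally have cY: "card Yt = 2 * (K - 1) * Nc" by simp
  have "Ys - {0} = Yt" using Yt by (auto simp: Ys_def)
  moreover have "card A1 + card A2 = nU"
    using card_Diff_subset[of A2 "{..<nU}"] A card_mono[OF _ A(1)] finite_subset[OF A(1)]
    by (simp add: A1_def)
  moreover
  have lit: "u \<in> (if b then A2 else A1)"
    if l: "(u, b, j') \<in> set (slot_lits cols s (\<alpha> s) j)" "u < nU" for u b j' s j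
    proof -
    obtain k where k: "k < C" "u = s * C + k" "b \<longleftrightarrow> cols ! k = \<alpha> s"
      using l(1) by (auto simp: slot_lits_def)
    have "u div C = s" "u mod C = k" unfolding k(2) using div_slot k(1) by auto
    then show ?thesis using k l(2) by (auto simp: A1_def A2_def)
  qed
  have "cover nU links A1 A2 Ys"
    unfolding cover_def
  proof (intro conjI allI impI ballI)
    show "u \<in> A1 \<or> u \<in> A2" if "u < nU" for u using that by (auto simp: A1_def)
  next
    fix l assume l: "l \<in> links"
    obtain u b j where lj: "l = (u, b, j)" by (cases l)
    have u: "u < nU" using links_range l lj by blast
    have "u \<in> (if b then A2 else A1) \<or> j \<in> Ys"
    proof -
      consider "(u, b, j) \<in> set (slot_lits cols zslot c1 0)"
        | i c k where "i < Nc" "c < 2" "k < K" "(u, b, j) \<in> set (term_of i k (code i c k))"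
        using l lj by (auto simp: links_def)
      then show ?thesis
      proof cases
        case 1
        then have "j = 0" by (auto simp: slot_lits_def)
        then show ?thesis using lit[of u b j zslot 0] 1 u by (cases "\<alpha> zslot = c1") (auto simp: Ys_def)
      next
        case 2
        have j: "j = code i c k" using term_range[OF 2(4,1)] by simp
        show ?thesis
        proof (cases "k = r i")
          case False
          then have "j \<in> Yt" using 2 j by (force simp: Yt_def)
          then show ?thesis by (simp add: Ys_def)
        next
          case True
          have "ok_tuple ok (\<omega> i) (q i)" using assms 2(1) by (simp add: ok_tuple_def q_def solution_def)
          then have "(u, b, j) \<in> set (term_lits cols Wm True i (q i) j)"
            using 2(4) True j by (simp add: term_of_def r)
          then obtain s where "(u, b, j) \<in> set (slot_lits cols s (\<alpha> s) j)"
            unfolding term_lits_def q_def by auto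
          from lit[OF this u] show ?thesis by simp
        qed
      qed
    qed
    then show "case l of (u, b, j) \<Rightarrow> u \<in> (if b then A2 else A1) \<or> j \<in> Ys" by (simp add: lj)
  qed
  ultimately show ?thesis
    using A cY Yt by (intro exI[of _ A1] exI[of _ A2] exI[of _ Ys]) (auto simp: Ys_def)
qed

lemma slot_sat:
  "(\<forall>(u, b, j')\<in>set (slot_lits cols s c j). u \<in> (if b then A2 else A1)) \<longleftrightarrow>
     (\<forall>k<C. s * C + k \<in> (if cols ! k = c then A2 else A1))"
  by (auto simp: slot_lits_def)

text \<open>Two colours of one slot disagree in the variable of the first colour, so both can be
  asserted only if that variable is bought with both values.\<close>

lemma slot_sat_unique:
  assumes "\<forall>(u, b, j')\<in>set (slot_lits cols s c j). u \<in> (if b then A2 else A1)"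
    "\<forall>(u, b, j')\<in>set (slot_lits cols s c' j'). u \<in> (if b then A2 else A1)" "c \<in> set cols" "c \<noteq> c'"
  shows "\<exists>k<C. s * C + k \<in> A1 \<inter> A2"
proof -
  obtain k where k: "k < C" "cols ! k = c" using assms(3) by (metis in_set_conv_nth)
  have "s * C + k \<in> A2" using assms(1)[unfolded slot_sat, rule_format, OF k(1)] k(2) by simp
  moreover have "s * C + k \<in> A1" using assms(2)[unfolded slot_sat, rule_format, OF k(1)] assms(4) k(2) by simp
  ultimately show ?thesis using k by blast
qed

definition sat :: "nat set \<Rightarrow> nat set \<Rightarrow> (nat \<times> bool \<times> nat) list \<Rightarrow> bool" where
  "sat A1 A2 ls \<longleftrightarrow> (\<forall>(u, b, j)\<in>set ls. u \<in> (if b then A2 else A1))"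

lemma sat_append: "sat A1 A2 (l @ l') \<longleftrightarrow> sat A1 A2 l \<and> sat A1 A2 l'"
  by (simp add: sat_def ball_Un)

definition touched :: "nat set \<Rightarrow> nat set" where
  "touched X = {i. i < Nc \<and> (\<exists>k<C. (2 * i + 1) * C + k \<in> X \<or> (2 * (i + Wm)) * C + k \<in> X \<or>
     (2 * (i + Wm) + 3) * C + k \<in> X \<or> (2 * (i + Wm) + 2) * C + k \<in> X)}"

text \<open>A variable belongs to one slot, and a slot is the top, the left, the bottom or the right
  side of at most one cell each.\<close>

lemma card_touched: "finite X \<Longrightarrow> card (touched X) \<le> 4 * card X"
proof -
  assume X: "finite X"
  let ?f = "\<lambda>u. (u div C - 1) div 2" and ?g = "\<lambda>u. u div C div 2 - Wm"
    and ?h = "\<lambda>u. (u div C - 3) div 2 - Wm" and ?k = "\<lambda>u. (u div C - 2) div 2 - Wm"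
  note d = div_slot(1)
  have "i \<in> ?f ` X \<union> ?g ` X \<union> ?h ` X \<union> ?k ` X" if it: "i \<in> touched X" for i
  proof -
    obtain k where k: "k < C" "(2 * i + 1) * C + k \<in> X \<or> (2 * (i + Wm)) * C + k \<in> X \<or>
       (2 * (i + Wm) + 3) * C + k \<in> X \<or> (2 * (i + Wm) + 2) * C + k \<in> X"
      using it unfolding touched_def by blast
    have 1: "i = ?f ((2 * i + 1) * C + k)" using d[OF k(1), of "2 * i + 1"] by simp
    have 2: "i = ?g ((2 * (i + Wm)) * C + k)" unfolding d[OF k(1)] by simp
    have 3: "i = ?h ((2 * (i + Wm) + 3) * C + k)" unfolding d[OF k(1)] by simp
    have 4: "i = ?k ((2 * (i + Wm) + 2) * C + k)" unfolding d[OF k(1)] by simp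
    from k(2) show ?thesis
    proof (elim disjE)
      assume "(2 * i + 1) * C + k \<in> X" then show ?thesis using imageI[of _ X ?f] 1 by (metis UnCI)
    next
      assume "(2 * (i + Wm)) * C + k \<in> X" then show ?thesis using imageI[of _ X ?g] 2 by (metis UnCI)
    next
      assume "(2 * (i + Wm) + 3) * C + k \<in> X" then show ?thesis using imageI[of _ X ?h] 3 by (metis UnCI)
    next
      assume "(2 * (i + Wm) + 2) * C + k \<in> X" then show ?thesis using imageI[of _ X ?k] 4 by (metis UnCI)
    qed
  qed
  then have "touched X \<subseteq> ?f ` X \<union> ?g ` X \<union> ?h ` X \<union> ?k ` X" by blast
  then have "card (touched X) \<le> card (?f ` X \<union> ?g ` X \<union> ?h ` X \<union> ?k ` X)"
    using X by (intro card_mono) auto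
  also have "\<dots> \<le> card (?f ` X) + card (?g ` X) + card (?h ` X) + card (?k ` X)"
    by (meson add_le_mono1 card_Un_le le_trans)
  also have "\<dots> \<le> card X + card X + card X + card X"
    using X by (intro add_mono card_image_le)
  finally show ?thesis by simp
qed

text \<open>In a cell none of whose variables is bought with both values, at most one tuple can be
  kept, and only an allowed one.\<close>

lemma term_sat_unique:
  assumes "sat A1 A2 (term_of i r j)" "sat A1 A2 (term_of i r' j')" "r < K" "r' < K" "i < Nc"
    "i \<notin> touched (A1 \<inter> A2)"
  shows "r = r'" "ok_tuple ok (\<omega> i) (tuples cols ! r)"
proof -
  have nt: "(2 * i + 1) * C + k \<notin> A1 \<inter> A2" "(2 * (i + Wm)) * C + k \<notin> A1 \<inter> A2"
     "(2 * (i + Wm) + 3) * C + k \<notin> A1 \<inter> A2" "(2 * (i + Wm) + 2) * C + k \<notin> A1 \<inter> A2" if "k < C" for k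
    using assms(5,6) that unfolding touched_def by blast+
  have okr: "ok_tuple ok (\<omega> i) (tuples cols ! r)" if "sat A1 A2 (term_of i r j)" for r j
  proof (rule ccontr)
    assume "\<not> ?thesis"
    then have "(2 * i + 1) * C + 0 \<in> A1 \<inter> A2"
      using that by (cases "tuples cols ! r") (auto simp: term_of_def term_lits_def sat_def)
    then show False using nt(1)[OF C_pos] by simp
  qed
  show "ok_tuple ok (\<omega> i) (tuples cols ! r)" using okr assms(1) .
  obtain n w s e where q: "tuples cols ! r = (n, w, s, e)" by (metis prod_cases4)
  obtain n' w' s' e' where q': "tuples cols ! r' = (n', w', s', e')" by (metis prod_cases4)
  have mem: "n \<in> set cols" "w \<in> set cols" "s \<in> set cols" "e \<in> set cols"
    using nth_mem[OF assms(3)] by (auto simp: q set_tuples)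
  have 1: "sat A1 A2 (slot_lits cols (2 * i + 1) n j)" "sat A1 A2 (slot_lits cols (2 * (i + Wm)) w j)"
    "sat A1 A2 (slot_lits cols (2 * (i + Wm) + 3) s j)" "sat A1 A2 (slot_lits cols (2 * (i + Wm) + 2) e j)"
    using assms(1) okr[OF assms(1)] by (auto simp: term_of_def term_lits_def q sat_append)
  have 2: "sat A1 A2 (slot_lits cols (2 * i + 1) n' j')" "sat A1 A2 (slot_lits cols (2 * (i + Wm)) w' j')"
    "sat A1 A2 (slot_lits cols (2 * (i + Wm) + 3) s' j')" "sat A1 A2 (slot_lits cols (2 * (i + Wm) + 2) e' j')"
    using assms(2) okr[OF assms(2)] by (auto simp: term_of_def term_lits_def q' sat_append)
  have "n = n'" using slot_sat_unique[OF 1(1)[unfolded sat_def] 2(1)[unfolded sat_def]] nt(1) mem by blast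
  moreover have "w = w'" using slot_sat_unique[OF 1(2)[unfolded sat_def] 2(2)[unfolded sat_def]] nt(2) mem by blast
  moreover have "s = s'" using slot_sat_unique[OF 1(3)[unfolded sat_def] 2(3)[unfolded sat_def]] nt(3) mem by blast
  moreover have "e = e'" using slot_sat_unique[OF 1(4)[unfolded sat_def] 2(4)[unfolded sat_def]] nt(4) mem by blast
  ultimately have "tuples cols ! r = tuples cols ! r'" using q q' by simp
  then show "r = r'" using distinct_tuples assms(3,4) by (simp add: nth_eq_iff_index_eq)
qed

text \<open>The tuples that are kept at copy \<open>c\<close> of cell \<open>i\<close>.\<close>

definition off :: "nat set \<Rightarrow> nat \<Rightarrow> nat \<Rightarrow> nat set" where
  "off Ys i c = {r. r < K \<and> code i c r \<notin> Ys}"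

lemma off_sat:
  assumes "cover nU links A1 A2 Ys" "r \<in> off Ys i c" "i < Nc" "c < 2"
  shows "sat A1 A2 (term_of i r (code i c r))"
proof -
  have r: "r < K" "code i c r \<notin> Ys" using assms(2) by (auto simp: off_def)
  have "u \<in> (if b then A2 else A1)" if "(u, b, j) \<in> set (term_of i r (code i c r))" for u b j
  proof -
    have "(u, b, j) \<in> links" using that assms(3,4) r(1) by (auto simp: links_def)
    then have "u \<in> (if b then A2 else A1) \<or> j \<in> Ys" using assms(1) by (auto simp: cover_def)
    then show ?thesis using term_range[OF that assms(3)] r(2) by auto
  qed
  then show ?thesis by (auto simp: sat_def)
qed

lemma card_Ys_lower:
  assumes "finite Ys"
  shows "(\<Sum>i<Nc. \<Sum>c<2. K - card (off Ys i c)) + (if 0 \<in> Ys then 1 else 0) \<le> card Ys"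
proof -
  let ?S = "SIGMA i : {..<Nc}. SIGMA c : {..<2}. {..<K} - off Ys i c"
  have off: "off Ys i c \<subseteq> {..<K}" for i c by (auto simp: off_def)
  have "card ?S = (\<Sum>i<Nc. \<Sum>c<2. K - card (off Ys i c))"
    using off by (simp add: card_Diff_subset finite_subset[OF off])
  moreover have "card ((\<lambda>(i, c, r). code i c r) ` ?S) = card ?S"
    by (rule card_image, rule inj_on_subset[OF code_inj]) auto
  moreover have "(\<lambda>(i, c, r). code i c r) ` ?S \<subseteq> Ys - {0}"
    by (auto simp: off_def code_def)
  then have "card ((\<lambda>(i, c, r). code i c r) ` ?S) \<le> card (Ys - {0})"
    using assms by (intro card_mono) auto
  moreover have "card Ys = card (Ys - {0}) + (if 0 \<in> Ys then 1 else 0)"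
    using assms card_Suc_Diff1[of Ys 0] by auto
  ultimately show ?thesis by linarith
qed

text \<open>This is the origin of the price \<open>8 * K + 2\<close>. A variable bought with both
  values frees at most 4 cells with \<open>2 * K\<close> items each, so it saves at most
  \<open>8 * K\<close> and leaves a loss of 2. In all other cells each copy keeps at most one tuple
  and buys at least \<open>K - 1\<close> items. Hence a cost less than 2 above the optimum means
  that no variable is bought twice and that every cell keeps a tuple.\<close>

lemma cover_solution:
  assumes cov: "cover nU links A1 A2 Ys" and sub: "A1 \<subseteq> {..<nU}" "A2 \<subseteq> {..<nU}" and fin: "finite Ys"
    and cost: "(8 * K + 2) * (card A1 + card A2) + card Ys < (8 * K + 2) * nU + 2 * (K - 1) * Nc + 2"
  shows "\<exists>\<alpha>. solution \<alpha> \<and> (0 \<notin> Ys \<longrightarrow> \<alpha> zslot = c1)"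
    "(8 * K + 2) * nU + 2 * (K - 1) * Nc + (if 0 \<in> Ys then 1 else 0) \<le> (8 * K + 2) * (card A1 + card A2) + card Ys"
proof -
  define X where "X = A1 \<inter> A2"
  have f: "finite A1" "finite A2" "finite X" using sub by (auto simp: X_def intro: finite_subset)
  have "A1 \<union> A2 = {..<nU}" using cov sub by (auto simp: cover_def)
  then have cA: "card A1 + card A2 = nU + card X"
    using card_Un_Int[OF f(1,2)] by (simp add: X_def)
  have off1: "card (off Ys i c) \<le> 1" if "i < Nc" "c < 2" "i \<notin> touched X" for i c
  proof (rule ccontr)
    assume "\<not> ?thesis"
    then obtain r r' where "r \<in> off Ys i c" "r' \<in> off Ys i c" "r \<noteq> r'"
      by (metis One_nat_def card_le_Suc0_iff_eq card.infinite zero_le_one)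
    then show False
      using term_sat_unique(1)[OF off_sat[OF cov _ that(1,2)] off_sat[OF cov _ that(1,2)], of r r'] that
      by (auto simp: X_def off_def)
  qed
  have offK: "card (off Ys i c) \<le> K" for i c
    using card_mono[of "{..<K}" "off Ys i c"] by (auto simp: off_def)
  have "2 * (K - 1) * Nc \<le> (\<Sum>i<Nc. (\<Sum>c<2. K - card (off Ys i c)) + (if i \<in> touched X then 2 * K else 0))"
  proof -
    have "2 * (K - 1) \<le> (\<Sum>c<2. K - card (off Ys i c)) + (if i \<in> touched X then 2 * K else 0)" if "i < Nc" for i
    proof (cases "i \<in> touched X")
      case False
      then have "K - 1 \<le> K - card (off Ys i c)" if "c < 2" for c
        using off1[OF \<open>i < Nc\<close> that] by simp
      from this[of 0] this[of 1] show ?thesis by (simp add: numeral_2_eq_2)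
    qed simp
    then have "(\<Sum>i<Nc. 2 * (K - 1)) \<le> (\<Sum>i<Nc. (\<Sum>c<2. K - card (off Ys i c)) + (if i \<in> touched X then 2 * K else 0))"
      by (intro sum_mono) auto
    then show ?thesis by (simp add: mult.commute)
  qed
  also have "\<dots> = (\<Sum>i<Nc. \<Sum>c<2. K - card (off Ys i c)) + 2 * K * card (touched X)"
  proof -
    have "{..<Nc} \<inter> {i. i \<in> touched X} = touched X" by (auto simp: touched_def)
    then show ?thesis by (simp add: sum.distrib sum.If_cases)
  qed
  also have "\<dots> \<le> card Ys + 2 * K * (4 * card X)"
    using card_Ys_lower[OF fin] card_touched[OF f(3)] by (intro add_mono mult_le_mono2) auto
  finally have low: "2 * (K - 1) * Nc \<le> card Ys + 8 * K * card X" by simp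
  have "(8 * K + 2) * (card A1 + card A2) = (8 * K + 2) * nU + 8 * K * card X + 2 * card X"
    unfolding cA by (simp add: algebra_simps)
  then have "card X = 0" using cost low by linarith
  then have X: "X = {}" using f(3) by simp
  have not: "i \<notin> touched X" for i by (simp add: X touched_def)
  have "(\<Sum>i<Nc. 2 * (K - 1)) \<le> (\<Sum>i<Nc. \<Sum>c<2. K - card (off Ys i c))"
  proof (rule sum_mono)
    fix i assume i: "i \<in> {..<Nc}"
    have "K - 1 \<le> K - card (off Ys i c)" if "c < 2" for c using off1[of i c] i that not by auto
    from this[of 0] this[of 1] show "2 * (K - 1) \<le> (\<Sum>c<2. K - card (off Ys i c))"
      by (simp add: numeral_2_eq_2)
  qed
  then have "2 * (K - 1) * Nc + (if 0 \<in> Ys then 1 else 0) \<le> card Ys"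
    using card_Ys_lower[OF fin] by (simp add: mult.commute)
  then show "(8 * K + 2) * nU + 2 * (K - 1) * Nc + (if 0 \<in> Ys then 1 else 0) \<le>
      (8 * K + 2) * (card A1 + card A2) + card Ys"
    using cA X by simp
  have "\<exists>r<K. \<exists>j. sat A1 A2 (term_of i r j)" if i: "i < Nc" for i
  proof (rule ccontr)
    assume no: "\<not> ?thesis"
    have "off Ys i c = {}" if "c < 2" for c
      using no off_sat[OF cov _ i that] by (auto simp: off_def)
    then have "(\<Sum>c<2. K - card (off Ys i c)) = 2 * K" by (simp add: numeral_2_eq_2)
    moreover have "(\<Sum>k<Nc. \<Sum>c<2. K - card (off Ys k c)) =
        (\<Sum>c<2. K - card (off Ys i c)) + (\<Sum>k\<in>{..<Nc} - {i}. \<Sum>c<2. K - card (off Ys k c))"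
      using i by (intro sum.remove) auto
    moreover have "(\<Sum>k\<in>{..<Nc} - {i}. 2 * (K - 1)) \<le> (\<Sum>k\<in>{..<Nc} - {i}. \<Sum>c<2. K - card (off Ys k c))"
    proof (rule sum_mono)
      fix k assume k: "k \<in> {..<Nc} - {i}"
      have "K - 1 \<le> K - card (off Ys k c)" if "c < 2" for c using off1[of k c] k that not by auto
      from this[of 0] this[of 1] show "2 * (K - 1) \<le> (\<Sum>c<2. K - card (off Ys k c))"
        by (simp add: numeral_2_eq_2)
    qed
    moreover have "(\<Sum>k\<in>{..<Nc} - {i}. 2 * (K - 1)) = 2 * (K - 1) * (Nc - 1)"
      using i by (simp add: mult.commute)
    moreover have "2 * (K - 1) * (Nc - 1) + 2 * K = 2 * (K - 1) * Nc + 2"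
      using i K_pos by (cases Nc; cases K) (auto simp: algebra_simps)
    ultimately have "2 * (K - 1) * Nc + 2 \<le> card Ys" using card_Ys_lower[OF fin] by linarith
    moreover have "(8 * K + 2) * (card A1 + card A2) = (8 * K + 2) * nU" using cA X by simp
    ultimately show False using cost by linarith
  qed
  then obtain r j where rj: "\<And>i. i < Nc \<Longrightarrow> r i < K" "\<And>i. i < Nc \<Longrightarrow> sat A1 A2 (term_of i (r i) (j i))"
    by metis
  \<comment> \<open>The colour of a slot is read off from the literals rather than from a tuple,
    since neighbouring cells share slots; the colours of kept tuples are then the unique ones whose
    literals hold.\<close>
  define \<alpha> where "\<alpha> s = (if \<exists>c\<in>set cols. sat A1 A2 (slot_lits cols s c 0)
     then SOME c. c \<in> set cols \<and> sat A1 A2 (slot_lits cols s c 0) else c1)" for s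
  have sat0: "sat A1 A2 (slot_lits cols s c j) \<longleftrightarrow> sat A1 A2 (slot_lits cols s c 0)" for s c j
    by (auto simp: sat_def slot_lits_def)
  have \<alpha>: "\<alpha> s = c" if "c \<in> set cols" "sat A1 A2 (slot_lits cols s c j)" for s c j
  proof -
    let ?P = "\<lambda>c. c \<in> set cols \<and> sat A1 A2 (slot_lits cols s c 0)"
    have P: "?P c" using that sat0 by blast
    then have "?P (SOME c. ?P c)" by (rule someI)
    then have "(SOME c. ?P c) = c"
      using slot_sat_unique[of s "SOME c. ?P c" 0 A2 A1 c 0] P X unfolding sat_def X_def by auto
    then show ?thesis using P by (auto simp: \<alpha>_def)
  qed
  have \<alpha>c: "\<alpha> s \<in> set cols" for s
    using someI_ex[of "\<lambda>c. c \<in> set cols \<and> sat A1 A2 (slot_lits cols s c 0)"] c1 by (auto simp: \<alpha>_def)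
  have "ok (\<omega> i) (\<alpha> (2 * i + 1)) (\<alpha> (2 * (i + Wm))) (\<alpha> (2 * (i + Wm) + 3)) (\<alpha> (2 * (i + Wm) + 2))"
    if i: "i < Nc" for i
  proof -
    have okt: "ok_tuple ok (\<omega> i) (tuples cols ! r i)"
      using term_sat_unique(2)[OF rj(2)[OF i] rj(2)[OF i] rj(1)[OF i] rj(1)[OF i] i] not by (simp add: X_def)
    obtain n w s e where q: "tuples cols ! r i = (n, w, s, e)" by (metis prod_cases4)
    have mem: "n \<in> set cols" "w \<in> set cols" "s \<in> set cols" "e \<in> set cols"
      using nth_mem[OF rj(1)[OF i]] by (auto simp: q set_tuples)
    have 1: "sat A1 A2 (slot_lits cols (2 * i + 1) n (j i))" "sat A1 A2 (slot_lits cols (2 * (i + Wm)) w (j i))"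
      "sat A1 A2 (slot_lits cols (2 * (i + Wm) + 3) s (j i))" "sat A1 A2 (slot_lits cols (2 * (i + Wm) + 2) e (j i))"
      using rj(2)[OF i] okt by (auto simp: term_of_def term_lits_def q sat_append)
    show ?thesis
      using okt by (simp only: \<alpha>[OF mem(1) 1(1)] \<alpha>[OF mem(2) 1(2)] \<alpha>[OF mem(3) 1(3)] \<alpha>[OF mem(4) 1(4)] ok_tuple_def q prod.case)
  qed
  moreover have "\<alpha> zslot = c1" if "0 \<notin> Ys"
  proof -
    have "u \<in> (if b then A2 else A1)" if l: "(u, b, j) \<in> set (slot_lits cols zslot c1 0)" for u b j
    proof -
      have "(u, b, j) \<in> links" "j = 0" using l by (auto simp: links_def slot_lits_def)
      then have "u \<in> (if b then A2 else A1) \<or> j \<in> Ys" using cov by (auto simp: cover_def)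
      then show ?thesis using \<open>j = 0\<close> \<open>0 \<notin> Ys\<close> by simp
    qed
    then have "sat A1 A2 (slot_lits cols zslot c1 0)" by (auto simp: sat_def)
    then show ?thesis by (rule \<alpha>[OF c1])
  qed
  ultimately show "\<exists>\<alpha>. solution \<alpha> \<and> (0 \<notin> Ys \<longrightarrow> \<alpha> zslot = c1)"
    using \<alpha>c unfolding solution_def by blast
qed

end

subsection \<open>Solutions, light spanners and the tell-tale edges\<close>

lemma finite_spanning:
  fixes G :: "'v wgraph"
  assumes "finite (edges G)"
  shows "finite {H. spanning_subgraph H G}"
proof -
  have "{H. spanning_subgraph H G} \<subseteq> (\<lambda>X. G\<lparr>edges := X\<rparr>) ` Pow (edges G)"
  proof
    fix H assume "H \<in> {H. spanning_subgraph H G}"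
    then have "H = G\<lparr>edges := edges H\<rparr>" "edges H \<in> Pow (edges G)" by (simp_all add: spanning_subgraph_def)
    then show "H \<in> (\<lambda>X. G\<lparr>edges := X\<rparr>) ` Pow (edges G)" by (rule image_eqI)
  qed
  then show ?thesis by (rule finite_subset) (use assms in simp)
qed

lemma arg_min_exists:
  fixes f :: "'a \<Rightarrow> 'b::linorder"
  assumes "finite {x. P x}" "P a"
  shows "\<exists>x. is_arg_min f P x"
  using ex_is_arg_min_if_finite[OF assms(1), of f] assms(2) by (auto simp: is_arg_min_def)

lemma is_arg_min_le: "is_arg_min (f :: 'a \<Rightarrow> 'b::linorder) P x \<Longrightarrow> P y \<Longrightarrow> f x \<le> f y"
  by (auto simp: is_arg_min_def not_less)

text \<open>A solution is preceded by the bit \<open>True\<close>, hence the shift from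
  \<open>k\<close> to \<open>Suc k\<close>.\<close>

lemma solves_answer:
  assumes f: "solves f Pr" and p: "(q, S) \<in> Pr"
    and S: "S \<noteq> {}" "\<And>bs. bs \<in> S \<Longrightarrow> k < length bs \<and> (bs ! k \<noteq> neg \<longleftrightarrow> yes)"
  shows "Suc k < length (f q) \<and> (f q ! Suc k \<noteq> neg \<longleftrightarrow> yes)"
proof -
  obtain bs where "bs \<in> S" "f q = True # bs" using bspec[OF f[unfolded solves_def] p] S(1) by auto
  then show ?thesis using S(2) by simp
qed

locale reduction = S: csp cols ok \<omega> Nc Wm c1 +
  instance_graph T t0 t1 "csp.nR cols Nc" "csp.nU cols Nc Wm" "csp.links cols ok \<omega> Nc Wm c1" \<nu> C I \<Lambda> \<epsilon> dl
  for cols :: "'c list" and ok :: "'t \<Rightarrow> 'c \<Rightarrow> 'c \<Rightarrow> 'c \<Rightarrow> 'c \<Rightarrow> bool" and \<omega> Nc Wm c1 T t0 t1 and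
    \<nu> :: "nat \<Rightarrow> nat \<Rightarrow> 'v" and C :: "('i, 'v) graph_class" and I \<Lambda> \<epsilon> dl +
  fixes yes :: bool
  assumes ul: "ul T = (8 * S.K + 2) * yl T" and sol: "\<exists>\<alpha>. S.solution \<alpha>"
    and yes: "yes \<longleftrightarrow> (\<exists>\<alpha>. S.solution \<alpha> \<and> \<alpha> S.zslot = c1)"
    and first: "2 \<le> length dl" "dl ! 0 = Y 0" "dl ! 1 = Y 1"
begin

abbreviation "G \<equiv> graph_of C I"

definition base :: nat where "base = (8 * S.K + 2) * S.nU + 2 * (S.K - 1) * Nc"
text \<open>The final 1 covers the errors of all weights, which amount to at most 1/2.\<close>

definition V :: nat where "V = (S.nR + S.nU) * P + yl T * base + 1"

lemma yl_big: "2 < zl T" "zl T \<le> yl T"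
proof -
  have "t1 + 1 \<le> zl T" "1 < t0" "t0 \<le> t1" "zl T \<le> yl T" using good by (auto simp: good_template_def)
  then show "2 < zl T" "zl T \<le> yl T" by linarith+
qed

text \<open>Since \<open>ul\<close> is a multiple of \<open>yl\<close>, the cost of the selection is
  an integral number of units \<open>yl\<close>, and the budget \<open>V + yl T\<close> leaves at
  most one unit above \<open>base\<close>. That excludes constraint edges, which waste two units
  each, and buying \<open>Y 0\<close> uses the unit up. As \<open>zl T > 1\<close>,
  \<open>Y 1\<close> cannot be paid for in addition. At budget \<open>V\<close> there is no spare
  unit at all.\<close>

lemma spanner_cost:
  assumes t: "t_spanner t1 H G" and w: "total_weight H \<le> \<Lambda> * real (V + yl T)"
  shows "Y 0 \<notin> used H \<Longrightarrow> yes" "Y 1 \<in> used H \<Longrightarrow> yes"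
    "total_weight H \<le> \<Lambda> * V \<Longrightarrow> yes \<and> Y 0 \<notin> used H"
proof -
  define cost where "cost = (8 * S.K + 2) * (card (selU1 H) + card (selU2 H)) + card (selY H)"
  define z where "z = (if Y 1 \<in> used H then zl T else 0)"
  have "\<Lambda> * real ((S.nR + S.nU) * P + yl T * cost + z + 2 * yl T * card (con H)) \<le> total_weight H"
    using spanner_lower[OF t] unfolding ul by (simp add: cost_def z_def algebra_simps)
  then have lo: "(S.nR + S.nU) * P + yl T * cost + z + 2 * yl T * card (con H) \<le> r" if "total_weight H \<le> \<Lambda> * real r" for r
  proof -
    have "\<Lambda> * real ((S.nR + S.nU) * P + yl T * cost + z + 2 * yl T * card (con H)) \<le> \<Lambda> * real r"
      using \<open>_ \<le> total_weight H\<close> that by linarith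
    then show ?thesis using scale(1) by (simp only: mult_le_cancel_left_pos of_nat_le_iff)
  qed
  have lo1: "yl T * (cost + 2 * card (con H)) + z \<le> yl T * (base + 1) + 1"
    using lo[OF w] by (simp add: V_def algebra_simps)
  have y0: "1 < yl T" using yl_big by simp
  \<comment> \<open>Rounding: a surplus of length 1 is less than one unit
    \<open>yl T\<close>.\<close>
  have mono: "a \<le> b" if "yl T * a \<le> yl T * b + 1" for a b
  proof (rule ccontr)
    assume "\<not> a \<le> b"
    then have "yl T * Suc b \<le> yl T * a" by (intro mult_le_mono2) simp
    then show False using that y0 by simp
  qed
  have c1: "cost + 2 * card (con H) \<le> base + 1" by (rule mono) (use lo1 in simp)
  have fin: "finite (selY H)" using selY_subset(1)[of H] by (rule finite_subset) simp
  have "cost < base + 2" using c1 by simp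
  note sol = S.cover_solution[OF cover_selection[OF t] selY_subset(2,3) fin this[unfolded cost_def base_def]]
  have lb: "base + (if 0 \<in> selY H then 1 else 0) \<le> cost" using sol(2) by (simp add: cost_def base_def)
  then have "card (con H) = 0" using c1 by simp
  then have con: "con H = {}" using touch_card(5) by simp
  have Y0: "0 \<in> selY H \<longleftrightarrow> Y 0 \<in> used H" unfolding selY_no_con[OF con] by simp
  have yes': "yes" if "Y 0 \<notin> used H" using sol(1) that Y0 yes by auto
  then show "Y 0 \<notin> used H \<Longrightarrow> yes" .
  show "yes" if "Y 1 \<in> used H"
  proof -
    have "yl T * cost + zl T \<le> yl T * (base + 1) + 1" using lo1 that by (simp add: z_def con)
    then have "yl T * cost + 1 < yl T * Suc base" using yl_big by simp
    then have "cost \<noteq> Suc base" by auto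
    then have "cost \<le> base" using c1 by (simp add: con)
    then have "0 \<notin> selY H" using lb by (auto split: if_splits)
    then show ?thesis using yes' Y0 by simp
  qed
  show "yes \<and> Y 0 \<notin> used H" if "total_weight H \<le> \<Lambda> * V"
  proof -
    have "cost \<le> base" by (rule mono) (use lo[OF that] in \<open>simp add: V_def con\<close>)
    then have "0 \<notin> selY H" using lb by (auto split: if_splits)
    then show ?thesis using yes' Y0 by simp
  qed
qed

text \<open>If the verdict is \<open>c1\<close>, the unit not spent on \<open>Y 0\<close> pays for
  \<open>Y 1\<close>, because \<open>zl T \<le> yl T\<close>; this is what yields stretch
  \<open>t0\<close>.\<close>

lemma canonical_solution:
  assumes "S.solution \<alpha>"
  shows "\<exists>H. t_spanner t1 H G \<and> is_plane C H \<and> total_weight H \<le> \<Lambda> * (V + yl T) \<and>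
      (\<alpha> S.zslot = c1 \<longrightarrow> total_weight H \<le> \<Lambda> * V)"
    "\<alpha> S.zslot = c1 \<Longrightarrow> \<exists>H. t_spanner t0 H G \<and> total_weight H \<le> \<Lambda> * (V + yl T)"
proof -
  obtain A1 A2 Ys where A: "cover S.nU S.links A1 A2 Ys" "A1 \<subseteq> {..<S.nU}" "A2 \<subseteq> {..<S.nU}"
      "Ys \<subseteq> {2..<S.nR} \<union> {0}" "card A1 + card A2 = S.nU" "card (Ys - {0}) = 2 * (S.K - 1) * Nc"
      "0 \<in> Ys \<longleftrightarrow> \<alpha> S.zslot \<noteq> c1"
    using S.solution_cover[OF assms] by blast
  have Ys: "Ys \<subseteq> {..<S.nR}" "1 \<notin> Ys" "finite Ys" using A(4) nR by (auto intro: finite_subset)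
  have card: "card Ys = 2 * (S.K - 1) * Nc + (if 0 \<in> Ys then 1 else 0)"
    using A(6) card_Suc_Diff1[OF Ys(3), of 0] by (cases "0 \<in> Ys") simp_all
  have bound: "(S.nR + S.nU) * P + ul T * (card A1 + card A2) + yl T * card Ys + 1 = V + (if 0 \<in> Ys then yl T else 0)"
    unfolding A(5) card ul by (simp add: V_def base_def algebra_simps)
  have wt: "\<Lambda> * (real ((S.nR + S.nU) * P + ul T * (card A1 + card A2) + yl T * card Ys) + r + 1 / 2) \<le> \<Lambda> * (real (V + (if 0 \<in> Ys then yl T else 0)) + r)" for r
    using scale(1) unfolding bound[symmetric] by (intro mult_left_mono) auto
  let ?H = "canonical A1 A2 Ys"
  have wH: "total_weight ?H \<le> \<Lambda> * real (V + (if 0 \<in> Ys then yl T else 0))"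
    using canonical_weight[OF A(2,3) Ys(1)] wt[of 0] Ys(2) by (simp add: algebra_simps)
  have le: "\<Lambda> * real V \<le> \<Lambda> * real (V + yl T)" using scale(1) by (intro mult_left_mono) auto
  have "t_spanner t1 ?H G" using canonical_spanner[OF A(1-3) Ys(1)] by simp
  moreover have "is_plane C ?H"
    unfolding canonical_def by (rule plane) (use canonical_subset[OF A(2,3) Ys(1)] in auto)
  moreover have "total_weight ?H \<le> \<Lambda> * (V + yl T)" using wH le by (auto split: if_splits)
  moreover have "\<alpha> S.zslot = c1 \<longrightarrow> total_weight ?H \<le> \<Lambda> * V"
  proof
    assume "\<alpha> S.zslot = c1"
    then have "0 \<notin> Ys" using A(7) by simp
    then show "total_weight ?H \<le> \<Lambda> * V" using wH by simp
  qed
  ultimately show "\<exists>H. t_spanner t1 H G \<and> is_plane C H \<and> total_weight H \<le> \<Lambda> * (V + yl T) \<and>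
      (\<alpha> S.zslot = c1 \<longrightarrow> total_weight H \<le> \<Lambda> * V)" by blast
  assume c1: "\<alpha> S.zslot = c1"
  let ?H1 = "canonical A1 A2 (insert 1 Ys)"
  have Y1: "insert 1 Ys \<subseteq> {..<S.nR}" using Ys nR by auto
  have "cover S.nU S.links A1 A2 (insert 1 Ys)" using A(1) by (auto simp: cover_def)
  then have "t_spanner t0 ?H1 G" using canonical_spanner[OF _ A(2,3) Y1] by simp
  moreover have "total_weight ?H1 \<le> \<Lambda> * (V + yl T)"
  proof -
    have d: "insert 1 Ys - {1} = Ys" using Ys(2) by simp
    have "total_weight ?H1 \<le> \<Lambda> * (real V + zl T)"
      using canonical_weight[OF A(2,3) Y1] wt[of "zl T"] A(7) c1 unfolding d by (simp add: algebra_simps)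
    also have "\<dots> \<le> \<Lambda> * (V + yl T)" using scale(1) yl_big by (intro mult_left_mono) auto
    finally show ?thesis .
  qed
  ultimately show "\<exists>H. t_spanner t0 H G \<and> total_weight H \<le> \<Lambda> * (V + yl T)" by blast
qed

lemma finite_edges: "finite (edges G)"
  using finite_D by (simp add: edges')

lemma selected_all:
  assumes H: "spanning_subgraph H G"
  shows "\<exists>bs. length bs = length (edge_list C I) \<and> selected_subgraph C I bs = H"
proof (intro exI[of _ "map (\<lambda>e. e \<in> edges H) (edge_list C I)"] conjI)
  have "edges H \<subseteq> set (edge_list C I)" using H dl edge_list by (auto simp: spanning_subgraph_def edges')
  have "{edge_list C I ! i | i. i < length (edge_list C I) \<and> map (\<lambda>e. e \<in> edges H) (edge_list C I) ! i} = edges H"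
  proof (intro equalityI subsetI)
    fix e assume "e \<in> {edge_list C I ! i | i. i < length (edge_list C I) \<and> map (\<lambda>e. e \<in> edges H) (edge_list C I) ! i}"
    then obtain i where "i < length (edge_list C I)" "map (\<lambda>e. e \<in> edges H) (edge_list C I) ! i" "e = edge_list C I ! i"
      by blast
    then show "e \<in> edges H" by simp
  next
    fix e assume e: "e \<in> edges H"
    then have "e \<in> set (edge_list C I)" using \<open>edges H \<subseteq> _\<close> by blast
    then obtain i where "i < length (edge_list C I)" "edge_list C I ! i = e" unfolding in_set_conv_nth by blast
    then show "e \<in> {edge_list C I ! i | i. i < length (edge_list C I) \<and> map (\<lambda>e. e \<in> edges H) (edge_list C I) ! i}"
      using e by (intro CollectI exI[of _ i]) simp
  qed
  then show "selected_subgraph C I (map (\<lambda>e. e \<in> edges H) (edge_list C I)) = H"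
    using H by (simp add: selected_subgraph_def spanning_subgraph_def)
qed simp

lemma used_selected:
  assumes "i < length dl"
  shows "dl ! i \<in> used (selected_subgraph C I bs) \<longleftrightarrow> bs ! i"
proof -
  have d: "dl ! i \<in> D" using assms dl by (metis nth_mem)
  have "eset (dl ! i) \<in> {edge_list C I ! i | i. i < length (edge_list C I) \<and> bs ! i} \<longleftrightarrow> bs ! i"
  proof
    assume "eset (dl ! i) \<in> {edge_list C I ! i | i. i < length (edge_list C I) \<and> bs ! i}"
    then obtain j where j: "j < length dl" "eset (dl ! i) = eset (dl ! j)" "bs ! j" by (auto simp: edge_list)
    have "dl ! i = dl ! j" using j eset_inj d dl(2) nth_mem[OF j(1)] by (auto dest: inj_onD)
    then show "bs ! i" using j assms dl(1) by (auto simp: nth_eq_iff_index_eq)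
  qed (use assms in \<open>auto simp: edge_list intro!: exI[of _ i]\<close>)
  then show ?thesis using d by (simp add: used_def selected_subgraph_def)
qed

lemma arg_min_bits:
  fixes f :: "'v wgraph \<Rightarrow> 'b::linorder"
  assumes Q: "\<And>H. Q H \<Longrightarrow> spanning_subgraph H G" and a: "Q a"
  shows "{bs. length bs = length (edge_list C I) \<and> is_arg_min f Q (selected_subgraph C I bs)} \<noteq> {}"
proof -
  have "finite {H. Q H}" using finite_spanning[OF finite_edges] by (rule rev_finite_subset) (use Q in auto)
  from arg_min_exists[OF this a, of f] obtain H where H: "is_arg_min f Q H" ..
  then have "spanning_subgraph H G" using Q by (simp add: is_arg_min_def)
  from selected_all[OF this] obtain bs where "length bs = length (edge_list C I)" "selected_subgraph C I bs = H" by blast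
  then have "bs \<in> {bs. length bs = length (edge_list C I) \<and> is_arg_min f Q (selected_subgraph C I bs)}" using H by simp
  then show ?thesis by blast
qed

lemma spanner_exists: "\<exists>H. t_spanner t1 H G \<and> is_plane C H \<and> total_weight H \<le> \<Lambda> * (V + yl T) \<and>
    (yes \<longrightarrow> total_weight H \<le> \<Lambda> * V)"
proof (cases yes)
  case True
  then show ?thesis using yes canonical_solution(1) by blast
next
  case False
  then show ?thesis using sol canonical_solution(1) by blast
qed

lemma light_iff:
  assumes "Q \<in> {\<lambda>H. True, is_plane C}"
  shows "(\<exists>H. t_spanner t1 H G \<and> Q H \<and> total_weight H \<le> \<Lambda> * V) \<longleftrightarrow> yes"
proof
  assume "\<exists>H. t_spanner t1 H G \<and> Q H \<and> total_weight H \<le> \<Lambda> * V"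
  then obtain H where H: "t_spanner t1 H G" "total_weight H \<le> \<Lambda> * V" by blast
  have "\<Lambda> * real V \<le> \<Lambda> * real (V + yl T)" using scale(1) by (intro mult_left_mono) auto
  then show yes using spanner_cost(3)[OF H(1) _ H(2)] H(2) by linarith
qed (use spanner_exists assms in auto)

text \<open>A minimum is at most as heavy as the canonical spanner, so \<open>spanner_cost\<close>
  applies to it although it need not be canonical itself. The bit of \<open>Y 0\<close>, the first
  edge, is clear exactly if \<open>yes\<close>.\<close>

lemma minimum_bit:
  assumes Q: "Q \<in> {\<lambda>H. True, is_plane C}"
    and bs: "length bs = length (edge_list C I)"
      "is_arg_min total_weight (\<lambda>H. t_spanner t1 H G \<and> Q H) (selected_subgraph C I bs)"
  shows "0 < length bs \<and> (bs ! 0 \<noteq> True \<longleftrightarrow> yes)"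
proof -
  let ?H = "selected_subgraph C I bs"
  obtain H where H: "t_spanner t1 H G" "Q H" "total_weight H \<le> \<Lambda> * (V + yl T)" "yes \<longrightarrow> total_weight H \<le> \<Lambda> * V"
    using spanner_exists Q by auto
  have le: "total_weight ?H \<le> total_weight H" using is_arg_min_le[OF bs(2)] H by blast
  have t: "t_spanner t1 ?H G" using bs(2) by (simp add: is_arg_min_def)
  have w: "total_weight ?H \<le> \<Lambda> * real (V + yl T)" using le H(3) by simp
  have "Y 0 \<in> used ?H \<longleftrightarrow> \<not> yes" using spanner_cost[OF t w] le H(4) by linarith
  moreover have "Y 0 \<in> used ?H \<longleftrightarrow> bs ! 0" using used_selected[of 0 bs, OF less_le_trans[OF _ first(1)]] first(2) by simp
  ultimately show ?thesis using bs(1) first edge_list by auto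
qed

theorem MWS_answer:
  assumes "solves f (MWS C t1)"
  shows "Suc 0 < length (f (encode C I)) \<and> (f (encode C I) ! Suc 0 \<noteq> True \<longleftrightarrow> yes)"
proof (rule solves_answer[OF assms])
  let ?S = "{bs. length bs = length (edge_list C I) \<and>
       is_arg_min total_weight (\<lambda>H. t_spanner t1 H G) (selected_subgraph C I bs)}"
  show "(encode C I, ?S) \<in> MWS C t1" using input by (auto simp: MWS_def)
  obtain H where "t_spanner t1 H G" using spanner_exists by blast
  then show "?S \<noteq> {}" by (intro arg_min_bits) (auto simp: t_spanner_def)
  show "0 < length bs \<and> (bs ! 0 \<noteq> True \<longleftrightarrow> yes)" if "bs \<in> ?S" for bs
    using minimum_bit[of "\<lambda>H. True" bs] that by simp
qed

theorem MWPS_answer: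
  assumes "solves f (MWPS C t1)"
  shows "Suc 0 < length (f (encode C I)) \<and> (f (encode C I) ! Suc 0 \<noteq> True \<longleftrightarrow> yes)"
proof (rule solves_answer[OF assms])
  let ?S = "{bs. length bs = length (edge_list C I) \<and>
       is_arg_min total_weight (\<lambda>H. t_spanner t1 H G \<and> is_plane C H) (selected_subgraph C I bs)}"
  show "(encode C I, ?S) \<in> MWPS C t1" using input by (auto simp: MWPS_def)
  obtain H where "t_spanner t1 H G \<and> is_plane C H" using spanner_exists by blast
  then show "?S \<noteq> {}" by (intro arg_min_bits) (auto simp: t_spanner_def)
  show "0 < length bs \<and> (bs ! 0 \<noteq> True \<longleftrightarrow> yes)" if "bs \<in> ?S" for bs
    using minimum_bit[of "is_plane C" bs] that by simp
qed

text \<open>Minimality gives dilation at most \<open>t1\<close> always, and at most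
  \<open>t0\<close> if \<open>yes\<close>. In the latter case \<open>z_required\<close> forces
  \<open>Y 1\<close>; conversely, within the budget \<open>Y 1\<close> is affordable only if
  \<open>yes\<close>.\<close>

theorem MDG_answer:
  assumes f: "solves f (MDG C)" and gap: "t0 * zl T + 1 \<le> zl T + 4 * half T"
    and w: "of_rat w = \<Lambda> * real (V + yl T)" "w > 0"
  shows "Suc 1 < length (f (encode C I @ enc_rat w)) \<and> (f (encode C I @ enc_rat w) ! Suc 1 \<noteq> False \<longleftrightarrow> yes)"
proof (rule solves_answer[OF f])
  let ?P = "\<lambda>H. spanning_subgraph H G \<and> total_weight H \<le> of_rat w"
  let ?S = "{bs. length bs = length (edge_list C I) \<and>
     is_arg_min (\<lambda>H. dilation H G) ?P (selected_subgraph C I bs)}"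
  show "(encode C I @ enc_rat w, ?S) \<in> MDG C" using input w(2) by (auto simp: MDG_def)
  obtain H where "t_spanner t1 H G" "total_weight H \<le> \<Lambda> * (V + yl T)" using spanner_exists by blast
  then have "?P H" using w(1) by (simp add: t_spanner_def)
  then show "?S \<noteq> {}" by (intro arg_min_bits) auto
  fix bs assume "bs \<in> ?S"
  then have bs: "length bs = length (edge_list C I)" "is_arg_min (\<lambda>H. dilation H G) ?P (selected_subgraph C I bs)" by auto
  let ?H = "selected_subgraph C I bs"
  have H: "spanning_subgraph ?H G" "total_weight ?H \<le> \<Lambda> * real (V + yl T)"
    using bs(2) w(1) by (auto simp: is_arg_min_def)
  have le: "dilation ?H G \<le> dilation H' G" if "spanning_subgraph H' G" "total_weight H' \<le> \<Lambda> * (V + yl T)" for H'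
    using is_arg_min_le[OF bs(2), of H'] that w(1) by simp
  obtain H1 where H1: "t_spanner t1 H1 G" "total_weight H1 \<le> \<Lambda> * (V + yl T)" using spanner_exists by blast
  have t1: "t_spanner t1 ?H G"
    using le[of H1] H1 H(1) by (auto simp: t_spanner_def)
  have "Y 1 \<in> used ?H" if y: yes
  proof -
    obtain H0 where H0: "t_spanner t0 H0 G" "total_weight H0 \<le> \<Lambda> * (V + yl T)"
      using canonical_solution(2) yes y by blast
    then have "t_spanner t0 ?H G" using le[of H0] H(1) by (auto simp: t_spanner_def)
    then show ?thesis by (rule z_required[OF _ gap])
  qed
  then have "Y 1 \<in> used ?H \<longleftrightarrow> yes" using spanner_cost(2)[OF t1 H(2)] by blast
  moreover have "Y 1 \<in> used ?H \<longleftrightarrow> bs ! 1" using used_selected[of 1 bs, OF less_le_trans[OF _ first(1)]] first(3) by simp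
  ultimately show "1 < length bs \<and> (bs ! 1 \<noteq> False \<longleftrightarrow> yes)" using bs(1) first edge_list by simp
qed

end

subsection \<open>The computation tableau\<close>

text \<open>\<open>Ver\<close> passes the state and, for each tape, a symbol and a head flag from
  row to row; \<open>Hor\<close> serves the step rows, \<open>Ini\<close> the first row, and
  \<open>Fin\<close> carries the verdict along the last row.\<close>

datatype colour = Blank | Ver nat "(nat \<times> bool) list" | Hor nat "nat list" "bool list" "bool list"
  | Ini nat | Fin bool

text \<open>Row 0 consists of a corner, blanks, the cell \<open>IH\<close> that announces the heads
  to its right, given symbols \<open>IS\<close>, guessed symbols \<open>IG\<close> and an end. Step
  rows use \<open>Lf\<close>, \<open>Cc\<close> and \<open>Rt\<close>; in the last row
  \<open>F0\<close> and \<open>F1\<close> inspect cells 0 and 1 of the output tape. The right side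
  of a row's last cell is also the left side of the next row's first cell; the conditions of these
  cells ignore it, except at the very end of the last row.\<close>

datatype cell = I0 | IB | IH | IS nat | IG | IE | Lf | Cc | Rt | FL | FN | F0 | F1

text \<open>In the halting state the machine idles, so that every computation can be followed for
  exactly \<open>T\<close> steps.\<close>

definition next_of :: "machine \<Rightarrow> nat \<Rightarrow> nat list \<Rightarrow> nat \<times> (nat \<times> move) list" where
  "next_of M q syms = (if q = 1 then (1, map (\<lambda>a. (a, Stay)) syms) else delta M q syms)"

definition iver :: "machine \<Rightarrow> nat \<Rightarrow> bool \<Rightarrow> colour" where
  "iver M a h = Ver 0 (map (\<lambda>j. (if j = 0 then a else 0, h)) [0..<n_tapes M])"

text \<open>The horizontal colour within a step row broadcasts the state and the symbols read on all
  tapes; its flags say which heads cross the boundary to the right or to the left.\<close>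

definition ok_step :: "machine \<Rightarrow> colour \<Rightarrow> colour \<Rightarrow> colour \<Rightarrow> colour \<Rightarrow> bool" where
  "ok_step M n w s e \<longleftrightarrow> (\<exists>q cs syms rs ls rs' ls'. n = Ver q cs \<and> w = Hor q syms rs ls \<and>
     e = Hor q syms rs' ls' \<and> length syms = n_tapes M \<and> length rs' = n_tapes M \<and> length ls = n_tapes M \<and>
     (\<forall>j<n_tapes M. (snd (cs ! j) \<longrightarrow> fst (cs ! j) = syms ! j) \<and>
        (rs' ! j \<longleftrightarrow> snd (cs ! j) \<and> snd (snd (next_of M q syms) ! j) = Go_Right) \<and>
        (ls ! j \<longleftrightarrow> snd (cs ! j) \<and> snd (snd (next_of M q syms) ! j) = Go_Left)) \<and>
     s = Ver (fst (next_of M q syms)) (map (\<lambda>j.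
        (if snd (cs ! j) then fst (snd (next_of M q syms) ! j) else fst (cs ! j),
         snd (cs ! j) \<and> snd (snd (next_of M q syms) ! j) = Stay \<or> rs ! j \<or> ls' ! j)) [0..<n_tapes M]))"

fun ok_cell :: "machine \<Rightarrow> cell \<Rightarrow> colour \<Rightarrow> colour \<Rightarrow> colour \<Rightarrow> colour \<Rightarrow> bool" where
  "ok_cell M I0 n w s e \<longleftrightarrow> s = Blank \<and> e = Ini 0"
| "ok_cell M IB n w s e \<longleftrightarrow> w \<in> {Ini 0, Ini 2} \<and> s = iver M 0 False \<and> e = Ini 0"
| "ok_cell M IH n w s e \<longleftrightarrow> s = iver M 0 False \<and> e = Ini 1"
| "ok_cell M (IS a) n w s e \<longleftrightarrow> (\<exists>h\<in>{0, 1}. w = Ini h \<and> s = iver M a (h = 1)) \<and> e = Ini 0"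
| "ok_cell M IG n w s e \<longleftrightarrow> (\<exists>a. s = iver M a False \<and>
     (w = Ini 0 \<and> (a \<in> {1, 2} \<and> e = Ini 0 \<or> a = 0 \<and> e = Ini 2) \<or> w = Ini 2 \<and> a = 0 \<and> e = Ini 2))"
| "ok_cell M IE n w s e \<longleftrightarrow> s = Blank"
| "ok_cell M Lf n w s e \<longleftrightarrow> s = Blank \<and> (\<exists>q syms ls. e = Hor q syms (replicate (n_tapes M) False) ls)"
| "ok_cell M Cc n w s e \<longleftrightarrow> ok_step M n w s e"
| "ok_cell M Rt n w s e \<longleftrightarrow> s = Blank \<and> (\<exists>q syms rs. w = Hor q syms rs (replicate (n_tapes M) False))"
| "ok_cell M FL n w s e \<longleftrightarrow> e = Fin False"
| "ok_cell M FN n w s e \<longleftrightarrow> (\<exists>b. w = Fin b \<and> e = Fin b)"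
| "ok_cell M F0 n w s e \<longleftrightarrow> (\<exists>q cs. n = Ver q cs \<and> e = Fin (q = 1 \<and> fst (cs ! 1) = 2))"
| "ok_cell M F1 n w s e \<longleftrightarrow> (\<exists>b q cs. w = Fin b \<and> n = Ver q cs \<and> e = Fin (b \<and> fst (cs ! 1) \<notin> {1, 2}))"

definition colours :: "machine \<Rightarrow> colour set" where
  "colours M = {Blank, Fin True, Fin False} \<union> Ini ` {0, 1, 2} \<union>
     (\<lambda>(q, cs). Ver q cs) ` ({..<n_states M} \<times> {cs. set cs \<subseteq> {..<n_symbols M} \<times> UNIV \<and> length cs = n_tapes M}) \<union>
     (\<lambda>(q, syms, rs, ls). Hor q syms rs ls) ` ({..<n_states M} \<times>
        {syms. set syms \<subseteq> {..<n_symbols M} \<and> length syms = n_tapes M} \<times>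
        {rs. set rs \<subseteq> UNIV \<and> length rs = n_tapes M} \<times> {ls. set ls \<subseteq> UNIV \<and> length ls = n_tapes M})"

lemma finite_colours: "finite (colours M)"
  unfolding colours_def
  by (intro finite_UnI finite_imageI finite_SigmaI finite_lists_length_eq) auto

locale tableau =
  fixes M :: machine and x :: "bool list" and L T :: nat
  assumes wf: "wf_machine M" and no_query: "query_state M = None"
begin

abbreviation "k \<equiv> n_tapes M"
text \<open>Column \<open>p0\<close> is cell 0 of the tapes. During \<open>T\<close> steps the heads
  stay within columns 2 to \<open>2 * T + 2\<close>, so none reaches the border columns 0 and
  \<open>Wm\<close>; \<open>gs\<close> is the first column behind the encoded input.\<close>

definition p0 :: nat where "p0 = T + 2"
definition Wm :: nat where "Wm = 2 * T + 4 + 2 * length x + L"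
definition W :: nat where "W = Wm + 1"
definition gs :: nat where "gs = T + 3 + 2 * length x"

definition cell_at :: "nat \<Rightarrow> nat \<Rightarrow> cell" where
  "cell_at r p =
     (if r = 0 then
        (if p = 0 then I0 else if p \<le> T then IB else if p = T + 1 then IH
         else if p < gs then IS (if enc_bits x ! (p - p0) then 2 else 1)
         else if p < gs + L then IG else if p < Wm then IB else IE)
      else if r \<le> T then (if p = 0 then Lf else if p < Wm then Cc else Rt)
      else (if p = 0 then FL else if p = p0 then F0 else if p = p0 + 1 then F1 else FN))"

lemma tapes: "2 \<le> k" using wf by (simp add: wf_machine_def)

lemma length_enc_bits: "length (enc_bits z) = 2 * length z + 1"
  by (induction z) (auto simp: enc_bits_def enc_list_def)

section \<open>Configurations of the verifier as colours\<close>

definition cfg :: "bool list \<Rightarrow> nat \<Rightarrow> config" where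
  "cfg v t = (step M (\<lambda>_. []) ^^ t) (init_config M v)"

definition st :: "bool list \<Rightarrow> nat \<Rightarrow> nat" where "st v t = fst (cfg v t)"
definition tp :: "bool list \<Rightarrow> nat \<Rightarrow> nat \<Rightarrow> tape" where "tp v t j = snd (cfg v t) ! j"
definition syms :: "bool list \<Rightarrow> nat \<Rightarrow> nat list" where "syms v t = map (\<lambda>j. read (tp v t j)) [0..<k]"
definition nx where "nx v t = next_of M (st v t) (syms v t)"

lemma cfg_Suc: "cfg v (Suc t) = step M (\<lambda>_. []) (cfg v t)"
  by (simp add: cfg_def)

lemma act_read: "act (read tap, Stay) tap = tap"
  by (cases tap) (simp add: read_def)

lemma wf_next:
  assumes "q < n_states M" "length ss = k" "set ss \<subseteq> {..<n_symbols M}"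
  shows "fst (next_of M q ss) < n_states M" "length (snd (next_of M q ss)) = k"
    "fst ` set (snd (next_of M q ss)) \<subseteq> {..<n_symbols M}"
  using wf assms by (auto simp: wf_machine_def next_of_def)

text \<open>Cells to the right of position \<open>t\<close> are unchanged after \<open>t\<close>
  steps; \<open>accepts_iff\<close> needs this to see that the block of output bits ends.\<close>

definition inv :: "bool list \<Rightarrow> nat \<Rightarrow> bool" where
  "inv v t \<longleftrightarrow> st v t < n_states M \<and> length (snd (cfg v t)) = k \<and>
     (\<forall>j<k. (\<forall>i. fst (tp v t j) i < n_symbols M) \<and> \<bar>snd (tp v t j)\<bar> \<le> int t \<and>
        (\<forall>i > int t. fst (tp v t j) i = fst (tp v 0 j) i))"

lemma step_eq:
  assumes "inv v t"
  shows "st v (Suc t) = fst (nx v t)" "\<And>j. j < k \<Longrightarrow> tp v (Suc t) j = act (snd (nx v t) ! j) (tp v t j)"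
    "length (snd (cfg v (Suc t))) = k" "length (snd (nx v t)) = k"
proof -
  obtain q Ts where c: "cfg v t = (q, Ts)" by force
  have len: "length Ts = k" using assms by (simp add: inv_def c)
  have "map (\<lambda>j. read (Ts ! j)) [0..<k] = map read Ts"
    by (rule nth_equalityI) (use len in auto)
  then have ss: "syms v t = map read Ts" by (simp add: syms_def tp_def c)
  have "read (Ts ! j) < n_symbols M" if "j < k" for j
    using assms that by (simp add: inv_def tp_def c read_def)
  then have "set (syms v t) \<subseteq> {..<n_symbols M}" by (auto simp: syms_def tp_def c)
  then have l: "length (snd (nx v t)) = k"
    unfolding nx_def using assms by (intro wf_next(2)) (auto simp: inv_def syms_def)
  have *: "step M (\<lambda>_. []) (q, Ts) = (fst (nx v t), map2 act (snd (nx v t)) Ts)"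
  proof (cases "q = 1")
    case True
    have "map2 act (map (\<lambda>a. (a, Stay)) (map read Ts)) Ts = Ts"
      by (rule nth_equalityI) (auto simp: act_read)
    then show ?thesis using True by (simp add: step.simps nx_def next_of_def st_def c ss)
  next
    case False
    then show ?thesis using no_query by (simp add: step.simps nx_def next_of_def st_def c ss case_prod_beta)
  qed
  show "st v (Suc t) = fst (nx v t)" "length (snd (cfg v (Suc t))) = k"
    using * len l by (simp_all add: cfg_Suc c st_def)
  show "tp v (Suc t) j = act (snd (nx v t) ! j) (tp v t j)" if "j < k" for j
    using * len l that by (simp add: cfg_Suc c tp_def)
  show "length (snd (nx v t)) = k" by fact
qed

lemma inv: "inv v t"
proof (induction t)
  case 0
  have n: "2 < n_symbols M" "0 < n_states M" using wf by (auto simp: wf_machine_def)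
  have "fst (tape_of z) i < n_symbols M" "snd (tape_of z) = 0" for z i
    using n by (auto simp: tape_of_def)
  then show ?case using tapes n
    by (auto simp: inv_def st_def cfg_def init_config_def tp_def nth_Cons')
next
  case (Suc t)
  note e = step_eq[OF Suc]
  have "read (tp v t j) < n_symbols M" if "j < k" for j
    using Suc that by (auto simp: inv_def read_def)
  then have ss: "set (syms v t) \<subseteq> {..<n_symbols M}" "length (syms v t) = k" by (auto simp: syms_def)
  have q: "st v t < n_states M" using Suc by (simp add: inv_def)
  have n: "fst (nx v t) < n_states M" "fst ` set (snd (nx v t)) \<subseteq> {..<n_symbols M}"
    using wf_next[OF q ss(2,1)] by (auto simp: nx_def)
  have "(\<forall>i. fst (tp v (Suc t) j) i < n_symbols M) \<and> \<bar>snd (tp v (Suc t) j)\<bar> \<le> int (Suc t) \<and>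
        (\<forall>i > int (Suc t). fst (tp v (Suc t) j) i = fst (tp v 0 j) i)" if j: "j < k" for j
  proof -
    obtain a m where am: "snd (nx v t) ! j = (a, m)" by force
    have "(a, m) \<in> set (snd (nx v t))" using am j e(4) by (metis nth_mem)
    then have a: "a < n_symbols M" using n(2) by force
    obtain c h where ch: "tp v t j = (c, h)" by force
    have s: "\<And>i. c i < n_symbols M" "\<bar>h\<bar> \<le> int t" "\<And>i. i > int t \<Longrightarrow> c i = fst (tp v 0 j) i"
      using Suc j ch by (auto simp: inv_def)
    show ?thesis using s a by (auto simp: e(2)[OF j] am ch split: move.split)
  qed
  then show ?case using e n(1) by (simp add: inv_def)
qed

lemmas steps = step_eq[OF inv]

definition content :: "bool list \<Rightarrow> nat \<Rightarrow> nat \<Rightarrow> colour" where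
  "content v t p = Ver (st v t)
     (map (\<lambda>j. (fst (tp v t j) (int p - int p0), snd (tp v t j) = int p - int p0)) [0..<k])"

definition hor :: "bool list \<Rightarrow> nat \<Rightarrow> nat \<Rightarrow> colour" where
  "hor v t p = Hor (st v t) (syms v t)
     (map (\<lambda>j. snd (tp v t j) = int p - 1 - int p0 \<and> snd (snd (nx v t) ! j) = Go_Right) [0..<k])
     (map (\<lambda>j. snd (tp v t j) = int p - int p0 \<and> snd (snd (nx v t) ! j) = Go_Left) [0..<k])"

lemma content_Suc:
  "content v (Suc t) p = Ver (fst (nx v t)) (map (\<lambda>j.
     (if snd (tp v t j) = int p - int p0 then fst (snd (nx v t) ! j) else fst (tp v t j) (int p - int p0),
      snd (tp v t j) = int p - int p0 \<and> snd (snd (nx v t) ! j) = Stay \<or>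
      (snd (tp v t j) = int p - 1 - int p0 \<and> snd (snd (nx v t) ! j) = Go_Right) \<or>
      (snd (tp v t j) = int (Suc p) - int p0 \<and> snd (snd (nx v t) ! j) = Go_Left))) [0..<k])"
proof -
  have "(fst (act (a, m) tap) i, snd (act (a, m) tap) = i) =
     (if snd tap = i then a else fst tap i, snd tap = i \<and> m = Stay \<or> snd tap = i - 1 \<and> m = Go_Right \<or>
       snd tap = i + 1 \<and> m = Go_Left)" for a m tap i
    by (cases tap) (auto split: move.split)
  from this[of "fst (snd (nx v t) ! j)" "snd (snd (nx v t) ! j)" "tp v t j" "int p - int p0" for j]
  show ?thesis by (simp add: content_def steps algebra_simps)
qed

lemma read_syms: "j < k \<Longrightarrow> snd (tp v t j) = i \<Longrightarrow> fst (tp v t j) i = syms v t ! j"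
  by (auto simp: syms_def read_def)

lemma step_ok: "ok_step M (content v t p) (hor v t p) (content v (Suc t) p) (hor v t (Suc p))"
  unfolding ok_step_def
  apply (rule exI[of _ "st v t"])
  apply (rule exI[of _ "map (\<lambda>j. (fst (tp v t j) (int p - int p0), snd (tp v t j) = int p - int p0)) [0..<k]"])
  apply (rule exI[of _ "syms v t"])
  apply (rule exI)+
  apply (intro conjI)
        apply (simp add: content_def)
       apply (simp add: hor_def)
      apply (simp add: hor_def)
     apply (simp add: syms_def)
    apply simp
   apply simp
  by (auto simp: content_Suc nx_def[symmetric] read_syms)

text \<open>State and symbols in the horizontal colours are guessed at the left border. Every cell
  confirms the state, but the symbol of a tape is confirmed only by the cell that holds the head of
  that tape.\<close>

lemma step_unique:
  assumes "ok_step M (content v t p) w s (Hor q' syms' rs' ls')" "w = Hor q ss rs ls"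
  shows "q = st v t" "q' = q" "syms' = ss"
    "\<And>j. j < k \<Longrightarrow> snd (tp v t j) = int p - int p0 \<Longrightarrow> ss ! j = syms v t ! j"
    "length ss = k" "length ls = k" "length rs' = k"
    "ss = syms v t \<Longrightarrow> ls = map (\<lambda>j. snd (tp v t j) = int p - int p0 \<and> snd (snd (nx v t) ! j) = Go_Left) [0..<k]"
    "ss = syms v t \<Longrightarrow> rs' = map (\<lambda>j. snd (tp v t j) = int p - int p0 \<and> snd (snd (nx v t) ! j) = Go_Right) [0..<k]"
  using assms read_syms
  by (auto simp: ok_step_def content_def nx_def intro!: nth_equalityI)

lemma step_unique_s:
  assumes "ok_step M (content v t p) (hor v t p) s (hor v t (Suc p))"
  shows "s = content v (Suc t) p"
  using assms by (auto simp: ok_step_def content_Suc hor_def nx_def[symmetric] content_def[of v t])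

lemma init_content:
  "content v 0 p = iver M (if p0 \<le> p \<and> p - p0 < length v then if v ! (p - p0) then 2 else 1 else 0) (p = p0)"
proof -
  have "tp v 0 j = (if j = 0 then tape_of v else tape_of [])" if "j < k" for j
    using that by (auto simp: tp_def cfg_def init_config_def nth_Cons')
  then show ?thesis
    by (auto simp: content_def iver_def st_def cfg_def init_config_def tape_of_def nat_diff_distrib)
qed

text \<open>Halting with the output \<open>[True]\<close>, as far as cells 0 and 1 of the output
  tape can tell.\<close>

definition accepts :: "bool list \<Rightarrow> bool" where
  "accepts v \<longleftrightarrow> st v T = 1 \<and> fst (tp v T 1) 0 = 2 \<and> fst (tp v T 1) 1 \<notin> {1, 2}"

definition tableau :: "(nat \<Rightarrow> colour) \<Rightarrow> (nat \<Rightarrow> colour) \<Rightarrow> bool" where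
  "tableau V H \<longleftrightarrow> (\<forall>r\<le>T + 1. \<forall>p\<le>Wm. ok_cell M (cell_at r p) (V (r * W + p)) (H (r * W + p))
     (V ((r + 1) * W + p)) (H (r * W + p + 1)))"

lemma head_range: "t \<le> T \<Longrightarrow> j < k \<Longrightarrow> \<bar>snd (tp v t j)\<bar> \<le> int T"
  using inv[of v t] by (fastforce simp: inv_def)

lemma hor_ends:
  assumes "t \<le> T"
  shows "map (\<lambda>j. snd (tp v t j) = int 1 - 1 - int p0 \<and> snd (snd (nx v t) ! j) = Go_Right) [0..<k] = replicate k False"
    "map (\<lambda>j. snd (tp v t j) = int Wm - int p0 \<and> snd (snd (nx v t) ! j) = Go_Left) [0..<k] = replicate k False"
  using head_range[OF assms, of _ v] by (auto simp: p0_def Wm_def intro!: nth_equalityI; force)+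

lemma content_colours: "content v t p \<in> colours M"
proof -
  have "(\<lambda>(q, cs). Ver q cs) (st v t, map (\<lambda>j. (fst (tp v t j) (int p - int p0), snd (tp v t j) = int p - int p0)) [0..<k])
     \<in> colours M"
    unfolding colours_def
    by (rule UnI1, rule UnI2, rule imageI) (use inv[of v t] in \<open>auto simp: inv_def\<close>)
  then show ?thesis by (simp add: content_def)
qed

lemma hor_colours: "hor v t p \<in> colours M"
proof -
  have "(\<lambda>(q, syms, rs, ls). Hor q syms rs ls) (st v t, syms v t,
     map (\<lambda>j. snd (tp v t j) = int p - 1 - int p0 \<and> snd (snd (nx v t) ! j) = Go_Right) [0..<k],
     map (\<lambda>j. snd (tp v t j) = int p - int p0 \<and> snd (snd (nx v t) ! j) = Go_Left) [0..<k]) \<in> colours M"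
    unfolding colours_def
    by (rule UnI2, rule imageI) (use inv[of v t] in \<open>auto simp: inv_def syms_def read_def\<close>)
  then show ?thesis by (simp add: hor_def)
qed

lemma tableau_complete:
  assumes y: "length y \<le> L"
  defines "v \<equiv> enc_bits x @ y"
  shows "\<exists>V H. tableau V H \<and> range V \<subseteq> colours M \<and> range H \<subseteq> colours M \<and>
     H ((T + 2) * W) = Fin (accepts v)"
proof -
  define a0 where "a0 \<longleftrightarrow> st v T = 1 \<and> fst (tp v T 1) 0 = 2"
  define vc where "vc r p = (if r = 0 \<or> T + 1 < r \<or> p = 0 \<or> Wm \<le> p then Blank else content v (r - 1) p)" for r p
  \<comment> \<open>For \<open>p = 0\<close> this is the left border of row \<open>r\<close> and the
    right border of row \<open>r - 1\<close> at once; the verdict leaving the last row therefore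
    sits at \<open>r = T + 2\<close>.\<close>
  define hc where "hc r p =
     (if p = 0 then (if r = T + 2 then Fin (accepts v) else Blank)
      else if r = 0 then (if p = p0 then Ini 1 else if gs + length y < p \<and> p \<le> gs + L then Ini 2 else Ini 0)
      else if r \<le> T then hor v (r - 1) p
      else if p \<le> p0 then Fin False else if p = p0 + 1 then Fin a0 else Fin (accepts v))" for r p
  define V where "V i = vc (i div W) (i mod W)" for i
  define H where "H i = hc (i div W) (i mod W)" for i
  have dm: "(r * W + p) div W = r" "(r * W + p) mod W = p" if "p \<le> Wm" for r p
  proof -
    have "p < W" "W \<noteq> 0" using that by (auto simp: W_def)
    then show "(r * W + p) div W = r" by (subst div_mult_self3) auto
    show "(r * W + p) mod W = p" using \<open>p < W\<close> by (subst mod_mult_self3) auto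
  qed
  have Vv: "V (r * W + p) = vc r p" "H (r * W + p) = hc r p" if "p \<le> Wm" for r p
    using dm[OF that] by (simp_all add: V_def H_def)
  have He: "H (r * W + p + 1) = (if p < Wm then hc r (p + 1) else hc (r + 1) 0)" if "p \<le> Wm" for r p
  proof (cases "p < Wm")
    case True
    then show ?thesis using Vv(2)[of "p + 1" r] by simp
  next
    case False
    then have e: "r * W + p + 1 = (r + 1) * W + 0" using that by (simp add: W_def)
    show ?thesis unfolding e using Vv(2)[of 0 "r + 1"] False by simp
  qed
  have lv: "length v = 2 * length x + 1 + length y" by (simp add: v_def length_enc_bits)
  have "ok_cell M (cell_at r p) (vc r p) (hc r p) (vc (r + 1) p) (if p < Wm then hc r (p + 1) else hc (r + 1) 0)"
    if rp: "r \<le> T + 1" "p \<le> Wm" for r p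
  proof -
    consider "r = 0" | "0 < r" "r \<le> T" | "r = T + 1" using rp by linarith
    then show ?thesis
    proof cases
      case 1
      consider "p = 0" | "0 < p" "p \<le> T" | "p = T + 1" | "p0 \<le> p" "p < gs" | "gs \<le> p" "p < gs + L"
        | "gs + L \<le> p" "p < Wm" | "p = Wm"
        using rp unfolding p0_def gs_def Wm_def by linarith
      then show ?thesis
      proof cases
        case 4
        then have c: "cell_at r p = IS (if enc_bits x ! (p - p0) then 2 else 1)"
          using 1 by (auto simp: cell_at_def p0_def)
        have i: "p - p0 < length (enc_bits x)" using 4 by (simp add: length_enc_bits gs_def p0_def)
        then have vx: "v ! (p - p0) = enc_bits x ! (p - p0)" by (simp add: v_def nth_append)
        have "p < Wm" "0 < p" using 4 by (auto simp: gs_def Wm_def p0_def)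
        then show ?thesis
          using 1 4 c i vx by (auto simp: vc_def hc_def init_content lv length_enc_bits)
      next
        case 5
        then have c: "cell_at r p = IG" using 1 by (auto simp: cell_at_def gs_def p0_def)
        have "p < Wm" "p0 < p" using 5 by (auto simp: gs_def Wm_def p0_def)
        then show ?thesis
          using 1 5 c by (auto simp: vc_def hc_def init_content lv gs_def p0_def)
      qed (use 1 y in \<open>auto simp: cell_at_def vc_def hc_def init_content lv gs_def p0_def Wm_def\<close>)
    next
      case 2
      have r1: "r - 1 \<le> T" "Suc (r - 1) = r" using 2 by auto
      consider "p = 0" | "0 < p" "p < Wm" | "p = Wm" using rp by linarith
      then show ?thesis
      proof cases
        case 1
        have "0 < Wm" by (simp add: Wm_def)
        then show ?thesis using 1 2 hor_ends(1)[OF r1(1), of v] by (auto simp: cell_at_def vc_def hc_def hor_def)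
      next
        case p: 2
        then show ?thesis using 2 step_ok[of v "r - 1" p] r1 by (auto simp: cell_at_def vc_def hc_def)
      next
        case 3
        have "0 < Wm" by (simp add: Wm_def)
        then show ?thesis using 3 2 hor_ends(2)[OF r1(1), of v] by (auto simp: cell_at_def vc_def hc_def hor_def)
      qed
    next
      case 3
      have w: "p0 + 1 < Wm" "0 < p0" by (auto simp: Wm_def p0_def)
      have k1: "1 < k" using tapes by simp
      have c0: "content v T p0 = Ver (st v T) cs \<Longrightarrow> fst (cs ! 1) = fst (tp v T 1) 0" for cs
        using k1 by (auto simp: content_def)
      have c1: "content v T (p0 + 1) = Ver (st v T) cs \<Longrightarrow> fst (cs ! 1) = fst (tp v T 1) 1" for cs
        using k1 by (auto simp: content_def)
      obtain cs0 cs1 where cs: "content v T p0 = Ver (st v T) cs0" "content v T (p0 + 1) = Ver (st v T) cs1"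
        by (auto simp: content_def)
      show ?thesis
        using 3 w c0[OF cs(1)] c1[OF cs(2)] cs rp
        by (auto simp: cell_at_def vc_def hc_def a0_def accepts_def)
    qed
  qed
  then have "ok_cell M (cell_at r p) (V (r * W + p)) (H (r * W + p)) (V ((r + 1) * W + p)) (H (r * W + p + 1))"
    if "r \<le> T + 1" "p \<le> Wm" for r p
    unfolding Vv(1)[OF that(2), of r] Vv(2)[OF that(2), of r] Vv(1)[OF that(2), of "r + 1"] He[OF that(2), of r]
    using that by blast
  then have "tableau V H" unfolding tableau_def by blast
  moreover have "range V \<subseteq> colours M"
    using content_colours by (auto simp: V_def vc_def) (auto simp: colours_def)
  moreover have "range H \<subseteq> colours M"
  proof -
    have "Blank \<in> colours M" "Fin b \<in> colours M" "Ini 0 \<in> colours M" "Ini 1 \<in> colours M" "Ini 2 \<in> colours M" for b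
      by (cases b) (auto simp: colours_def)
    then show ?thesis using hor_colours by (auto simp: H_def hc_def)
  qed
  moreover have "H ((T + 2) * W) = Fin (accepts v)"
    using Vv(2)[of 0 "T + 2"] by (simp add: hc_def)
  ultimately show ?thesis by blast
qed

lemma tableau_sound:
  assumes tab: "tableau V H"
  shows "\<exists>y. length y \<le> L \<and> (H ((T + 2) * W) = Fin True \<longrightarrow> accepts (enc_bits x @ y))"
proof -
  have ok: "ok_cell M (cell_at r p) (V (r * W + p)) (H (r * W + p)) (V ((r + 1) * W + p)) (H (r * W + p + 1))"
    if "r \<le> T + 1" "p \<le> Wm" for r p
    using tab that by (simp add: tableau_def)
  have ok0: "ok_cell M (cell_at 0 p) (V p) (H p) (V (W + p)) (H (p + 1))" if "p \<le> Wm" for p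
    using ok[of 0 p] that by simp
  have H0: "H p = Ini (if p = p0 then 1 else 0)" if pg: "0 < p" "p \<le> gs" for p
  proof -
    have p: "p - 1 \<le> Wm" "p - 1 + 1 = p" using pg by (auto simp: gs_def Wm_def)
    consider "p = 1" | "1 < p" "p \<le> T + 1" | "p = p0" | "p0 < p" using pg unfolding p0_def by linarith
    then show ?thesis
      using ok0[OF p(1)] pg p(2)
      by cases (auto simp: cell_at_def gs_def p0_def split: if_splits)
  qed
  \<comment> \<open>\<open>Ini 0\<close> means that the witness may still continue and
    \<open>Ini 2\<close> that it has ended, so the guessed symbols are bits followed by
    blanks.\<close>
  have guess: "\<exists>y. length y \<le> l \<and> H (gs + l) = Ini (if length y = l then 0 else 2) \<and>
      (\<forall>j<l. V (W + (gs + j)) = iver M (if j < length y then if y ! j then 2 else 1 else 0) False)" if "l \<le> L" for l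
    using that
  proof (induction l)
    case 0
    have "H gs = Ini 0" using H0[of gs] by (simp add: gs_def p0_def)
    then show ?case by simp
  next
    case (Suc l)
    then obtain y where y: "length y \<le> l" "H (gs + l) = Ini (if length y = l then 0 else 2)"
      "\<forall>j<l. V (W + (gs + j)) = iver M (if j < length y then if y ! j then 2 else 1 else 0) False" by auto
    have c: "cell_at 0 (gs + l) = IG" using Suc.prems by (simp add: cell_at_def gs_def)
    have "gs + l \<le> Wm" using Suc.prems by (simp add: gs_def Wm_def)
    from ok0[OF this, unfolded c] obtain a where a: "V (W + (gs + l)) = iver M a False"
      "H (gs + l) = Ini 0 \<and> (a \<in> {1, 2} \<and> H (gs + l + 1) = Ini 0 \<or> a = 0 \<and> H (gs + l + 1) = Ini 2) \<or>
       H (gs + l) = Ini 2 \<and> a = 0 \<and> H (gs + l + 1) = Ini 2" by auto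
    show ?case
    proof (cases "length y = l \<and> a \<in> {1, 2}")
      case True
      then have "H (gs + l + 1) = Ini 0" using a(2) y(2) by auto
      then show ?thesis using True a(1) y(3)
        by (intro exI[of _ "y @ [a = 2]"]) (auto simp: less_Suc_eq nth_append)
    next
      case False
      then have "a = 0" "H (gs + l + 1) = Ini 2" using a(2) y(2) by (auto split: if_splits)
      then show ?thesis using a(1) y by (intro exI[of _ y]) (auto simp: less_Suc_eq)
    qed
  qed
  obtain y where y: "length y \<le> L" "H (gs + L) = Ini (if length y = L then 0 else 2)"
      "\<And>j. j < L \<Longrightarrow> V (W + (gs + j)) = iver M (if j < length y then if y ! j then 2 else 1 else 0) False"
    using guess[of L] by auto
  define v where "v = enc_bits x @ y"
  have lv: "length v = 2 * length x + 1 + length y" by (simp add: v_def length_enc_bits)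
  have V1: "V (W + p) = content v 0 p" if "0 < p" "p < Wm" for p
  proof -
    consider "p \<le> T" | "p = T + 1" | "p0 \<le> p" "p < gs" | "gs \<le> p" "p < gs + L" | "gs + L \<le> p"
      unfolding p0_def gs_def by linarith
    then show ?thesis
    proof cases
      case 3
      then have c: "cell_at 0 p = IS (if enc_bits x ! (p - p0) then 2 else 1)" by (simp add: cell_at_def p0_def)
      have "V (W + p) = iver M (if enc_bits x ! (p - p0) then 2 else 1) (p = p0)"
        using ok0[of p] H0[of p] that 3 by (auto simp: c split: if_splits)
      moreover have "p - p0 < length (enc_bits x)" using 3 by (simp add: length_enc_bits gs_def p0_def)
      ultimately show ?thesis using 3 by (simp add: init_content v_def nth_append)
    next
      case 4
      define j where "j = p - gs"
      have j: "p = gs + j" "j < L" using 4 by (auto simp: j_def)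
      have pj: "p0 \<le> p" "p \<noteq> p0" "p - p0 = length (enc_bits x) + j"
        using 4 j by (auto simp: gs_def p0_def length_enc_bits)
      then show ?thesis using y(3)[OF j(2)] by (simp add: j(1)[symmetric] init_content v_def nth_append)
    next
      case 5
      then have "cell_at 0 p = IB" using that by (auto simp: cell_at_def gs_def)
      then show ?thesis using ok0[of p] that 5 y(1) by (auto simp: init_content lv gs_def p0_def)
    qed (use ok0[of p] that in \<open>auto simp: cell_at_def init_content p0_def\<close>)
  qed
  have rows: "\<forall>p. 0 < p \<longrightarrow> p < Wm \<longrightarrow> V ((t + 1) * W + p) = content v t p" if "t \<le> T" for t
    using that
  proof (induction t)
    case 0
    then show ?case using V1 by simp
  next
    case (Suc t)
    define r where "r = t + 1"
    have t: "t \<le> T" "r \<le> T" "0 < r" using Suc.prems by (auto simp: r_def)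
    have IH: "V (r * W + p) = content v t p" if "0 < p" "p < Wm" for p
      using Suc.IH t(1) that by (simp add: r_def)
    have Wm1: "1 < Wm" by (simp add: Wm_def)
    obtain q ss ls0 where h1: "H (r * W + 1) = Hor q ss (replicate k False) ls0"
      using ok[of r 0] t by (auto simp: cell_at_def)
    have stp: "ok_step M (content v t p) (H (r * W + p)) (V ((r + 1) * W + p)) (H (r * W + p + 1))"
      if "0 < p" "p < Wm" for p
      using ok[of r p] t that IH[OF that] by (simp add: cell_at_def)
    have shape: "\<exists>rs ls. H (r * W + p) = Hor q ss rs ls" if "0 < p" "p \<le> Wm" for p
      using that
    proof (induction p)
      case (Suc p)
      show ?case
      proof (cases "p = 0")
        case True
        then show ?thesis using h1 by simp
      next
        case False
        then obtain rs ls where h: "H (r * W + p) = Hor q ss rs ls" using Suc by auto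
        obtain q' ss' rs' ls' where h': "H (r * W + p + 1) = Hor q' ss' rs' ls'"
          using stp[of p] False Suc.prems by (auto simp: ok_step_def)
        have "q' = q" "ss' = ss"
          using step_unique(2,3)[OF stp[of p, unfolded h'] h] False Suc.prems by auto
        then show ?thesis using h' by simp
      qed
    qed simp
    have stp2: "\<exists>rs ls rs' ls'. H (r * W + p) = Hor q ss rs ls \<and> H (r * W + p + 1) = Hor q ss rs' ls' \<and>
       ok_step M (content v t p) (Hor q ss rs ls) (V ((r + 1) * W + p)) (Hor q ss rs' ls')"
      if p: "0 < p" "p < Wm" for p
      using shape[of p] shape[of "p + 1"] stp[OF p] p by fastforce
    have q: "q = st v t" "length ss = k"
      using stp2[of 1] Wm1 step_unique(1,5) by (metis zero_less_one)+
    \<comment> \<open>Every head lies in some inner column of the row, where the broadcast symbol is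
      compared with the one under the head.\<close>
    have ss: "ss = syms v t"
    proof (rule nth_equalityI)
      show "length ss = length (syms v t)" using q by (simp add: syms_def)
      fix j assume "j < length ss"
      then have j: "j < k" using q by simp
      define p where "p = nat (int p0 + snd (tp v t j))"
      have "\<bar>snd (tp v t j)\<bar> \<le> int T" by (rule head_range[OF t(1) j])
      then have p: "0 < p" "p < Wm" "snd (tp v t j) = int p - int p0" by (auto simp: p_def p0_def Wm_def)
      show "ss ! j = syms v t ! j"
        using stp2[OF p(1,2)] step_unique(4)[OF _ refl j p(3)] by metis
    qed
    have Hh: "H (r * W + p) = hor v t p" if p: "0 < p" "p \<le> Wm" for p
    proof -
      obtain rs ls where h: "H (r * W + p) = Hor q ss rs ls" using shape[OF p] by blast
      have "ls = map (\<lambda>j. snd (tp v t j) = int p - int p0 \<and> snd (snd (nx v t) ! j) = Go_Left) [0..<k]"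
      proof (cases "p < Wm")
        case True
        then obtain rs' ls' where "ok_step M (content v t p) (Hor q ss rs ls) (V ((r + 1) * W + p)) (Hor q ss rs' ls')"
          using stp2[OF p(1) True] h by auto
        from step_unique(8)[OF this refl ss] show ?thesis .
      next
        case False
        then have "p = Wm" using p by simp
        then have "ls = replicate k False" using ok[of r p] t Wm1 h by (auto simp: cell_at_def)
        then show ?thesis using hor_ends(2)[OF t(1), of v] \<open>p = Wm\<close> by simp
      qed
      moreover have "rs = map (\<lambda>j. snd (tp v t j) = int p - 1 - int p0 \<and> snd (snd (nx v t) ! j) = Go_Right) [0..<k]"
      proof (cases "p = 1")
        case True
        then have "rs = replicate k False" using h h1 by simp
        then show ?thesis using hor_ends(1)[OF t(1), of v] True by simp
      next
        case False
        then have p1: "0 < p - 1" "p - 1 < Wm" "r * W + (p - 1) + 1 = r * W + p" "int (p - 1) = int p - 1"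
          using p by auto
        then obtain rs0 ls0 where
          "ok_step M (content v t (p - 1)) (Hor q ss rs0 ls0) (V ((r + 1) * W + (p - 1))) (Hor q ss rs ls)"
          using stp2[OF p1(1,2)] h unfolding p1(3) by auto
        from step_unique(9)[OF this refl ss] show ?thesis unfolding p1(4) .
      qed
      ultimately show ?thesis using h q ss by (simp add: hor_def)
    qed
    have "V ((r + 1) * W + p) = content v (Suc t) p" if p: "0 < p" "p < Wm" for p
    proof (rule step_unique_s)
      show "ok_step M (content v t p) (hor v t p) (V ((r + 1) * W + p)) (hor v t (Suc p))"
        using stp[OF p] Hh[of p] Hh[of "p + 1"] p by simp
    qed
    then show ?case by (simp add: r_def)
  qed
  have "accepts v" if fin: "H ((T + 2) * W) = Fin True"
  proof -
    have fr: "ok_cell M (cell_at (T + 1) p) (V ((T + 1) * W + p)) (H ((T + 1) * W + p)) (V ((T + 2) * W + p))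
        (H ((T + 1) * W + p + 1))" if "p \<le> Wm" for p
      using ok[of "T + 1" p] that by simp
    \<comment> \<open>Backwards from the right border, as a cell \<open>FN\<close> merely passes the
      verdict on.\<close>
    have last: "H ((T + 1) * W + p) = Fin True" if "p0 + 2 \<le> p" "p \<le> W" for p
      using that(2,1)
    proof (induction p rule: inc_induct)
      case base
      then show ?case using fin by (simp add: algebra_simps)
    next
      case (step p)
      have "cell_at (T + 1) p = FN" "p \<le> Wm" using step by (auto simp: cell_at_def W_def)
      then show ?case using fr[of p] step by auto
    qed
    have w: "p0 + 1 < Wm" "0 < p0" by (auto simp: Wm_def p0_def)
    have k1: "1 < k" using tapes by simp
    have V0: "V ((T + 1) * W + p0) = content v T p0" "V ((T + 1) * W + (p0 + 1)) = content v T (p0 + 1)"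
      using rows[of T] w by auto
    have "cell_at (T + 1) (p0 + 1) = F1" "cell_at (T + 1) p0 = F0" using w by (auto simp: cell_at_def)
    moreover have "H ((T + 1) * W + (p0 + 1) + 1) = Fin True"
      using last[of "p0 + 2"] w by (simp add: W_def)
    ultimately have "H ((T + 1) * W + (p0 + 1)) = Fin True" "fst (tp v T 1) 1 \<notin> {1, 2}"
      using fr[of "p0 + 1"] w V0 k1 by (auto simp: content_def)
    moreover from this have "st v T = 1 \<and> fst (tp v T 1) 0 = 2"
      using fr[of p0] w V0 k1 \<open>cell_at (T + 1) p0 = F0\<close> by (auto simp: content_def add.assoc)
    ultimately show ?thesis by (simp add: accepts_def)
  qed
  then show ?thesis using y(1) v_def by blast
qed

lemma accepts_iff:
  assumes n: "n \<le> T" "fst (cfg v n) = 1" "contents (snd (cfg v n) ! 1) = [b]"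
  shows "accepts v \<longleftrightarrow> b"
proof -
  have "cfg v (n + i) = cfg v n" for i
  proof (induction i)
    case (Suc i)
    then show ?case using n(2) by (cases "cfg v n") (simp add: step.simps cfg_Suc)
  qed simp
  from this[of "T - n"] have c: "cfg v T = cfg v n" using n(1) by simp
  have s: "st v T = 1" and t: "contents (tp v T 1) = [b]" using n by (simp_all add: st_def tp_def c)
  let ?P = "\<lambda>i. fst (tp v T 1) (int i) \<notin> {1, 2}"
  have ini: "fst (tp v 0 1) i = 0" for i
    using tapes by (auto simp: tp_def cfg_def init_config_def tape_of_def)
  have "fst (tp v T 1) (int (T + 1)) = fst (tp v 0 1) (int (T + 1))"
    using inv[of v T] tapes unfolding inv_def by auto
  then have ex: "?P (T + 1)" using ini by simp
  have "length (contents (tp v T 1)) = (LEAST i. ?P i)" by (simp add: contents_def)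
  then have l: "(LEAST i. ?P i) = 1" using t by simp
  have p1: "?P 1" using LeastI[of ?P, OF ex] l by simp
  have "\<not> ?P 0" using not_less_Least[of 0 ?P] l by simp
  moreover have "b = (fst (tp v T 1) 0 = 2)" using t l by (simp add: contents_def)
  ultimately show ?thesis using s p1 by (auto simp: accepts_def)
qed

end

subsection \<open>From verifiers to instances\<close>

lemma distinct_concat_map:
  assumes "distinct xs" "\<And>x. x \<in> set xs \<Longrightarrow> distinct (f x)"
    "\<And>x y z. x \<in> set xs \<Longrightarrow> y \<in> set xs \<Longrightarrow> z \<in> set (f x) \<Longrightarrow> z \<in> set (f y) \<Longrightarrow> x = y"
  shows "distinct (concat (map f xs))"
  using assms
proof (induction xs)
  case (Cons a xs)
  have "distinct (concat (map f xs))" by (rule Cons.IH) (use Cons.prems in auto)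
  moreover have "set (f a) \<inter> set (concat (map f xs)) = {}"
    using Cons.prems(1,3) by fastforce
  ultimately show ?case using Cons.prems(2) by simp
qed simp

lemma concat_map_mult:
  "concat (map f [0..<a * b]) = concat (map (\<lambda>r. concat (map (\<lambda>p. f (r * b + p)) [0..<b])) [0..<a])"
proof (induction a)
  case (Suc a)
  have "[0..<Suc a * b] = [0..<a * b] @ map (\<lambda>p. a * b + p) [0..<b]"
    using upt_add_eq_append[of 0 "a * b" b] map_add_upt[of "a * b" b] by (simp add: add.commute)
  then show ?case using Suc.IH by (simp add: comp_def)
qed simp

text \<open>The tell-tale edges come first, so that their bits have the fixed positions 0 and 1 in
  every solution.\<close>

definition desc_list :: "template \<Rightarrow> nat \<Rightarrow> nat \<Rightarrow> (nat \<times> bool \<times> nat) list \<Rightarrow> desc list" where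
  "desc_list T nR nU ls = [Y 0, Y 1] @ concat (map (\<lambda>b. map (Chain b) [0..<last T]) [0..<nR + nU]) @
     map Y [2..<nR] @ concat (map (\<lambda>u. [U1 u, U2 u, D0 u]) [0..<nU]) @ map (\<lambda>(u, b, j). Link u b j) ls"

lemma set_desc_list: "2 \<le> nR \<Longrightarrow> set (desc_list T nR nU ls) = descs T nR nU (set ls)"
proof -
  assume "2 \<le> nR"
  then have "{..<nR} = {0, 1} \<union> {2..<nR}" by auto
  then have "Y ` {..<nR} = {Y 0, Y 1} \<union> Y ` {2..<nR}" by simp
  moreover have "set (concat (map (\<lambda>u. [U1 u, U2 u, D0 u]) [0..<nU])) = U1 ` {..<nU} \<union> U2 ` {..<nU} \<union> D0 ` {..<nU}"
    by auto
  moreover have "set (concat (map (\<lambda>b. map (Chain b) [0..<last T]) [0..<nR + nU])) =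
      {Chain b i | b i. b < nR + nU \<and> i < last T}" by auto
  ultimately show ?thesis unfolding desc_list_def descs_def set_append by simp blast
qed

lemma distinct_desc_list: "distinct ls \<Longrightarrow> distinct (desc_list T nR nU ls)"
proof -
  assume ls: "distinct ls"
  have "distinct (concat (map (\<lambda>b. map (Chain b) [0..<last T]) [0..<nR + nU]))"
    by (rule distinct_concat_map) (auto simp: distinct_map inj_on_def)
  moreover have "distinct (concat (map (\<lambda>u. [U1 u, U2 u, D0 u]) [0..<nU]))"
    by (rule distinct_concat_map) auto
  moreover have "distinct (map Y [2..<nR])" by (simp add: distinct_map inj_on_def)
  moreover have "distinct (map (\<lambda>(u, b, j). Link u b j) ls)"
    using ls by (auto simp: distinct_map inj_on_def)
  ultimately show ?thesis unfolding desc_list_def distinct_append by auto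
qed

context csp begin

definition link_list :: "(nat \<times> bool \<times> nat) list" where
  "link_list = slot_lits cols zslot c1 0 @ concat (map (\<lambda>i. concat (map (\<lambda>c.
     concat (map (\<lambda>r. term_of i r (code i c r)) [0..<K])) [0..<2])) [0..<Nc])"

lemma set_link_list: "set link_list = links"
  by (auto simp: link_list_def links_def)

lemma distinct_slot_lits: "distinct (slot_lits cols s c j)"
  by (auto simp: slot_lits_def distinct_map inj_on_def)

lemma distinct_term: "distinct (term_of i r j)"
proof -
  obtain n w s e where q: "tuples cols ! r = (n, w, s, e)" by (metis prod_cases4)
  have d: "a div C = s" if "(a, z) \<in> set (slot_lits cols s c j)" for a z s c
    using that div_slot(1) by (auto simp: slot_lits_def)
  have o: "2 * i + 1 \<noteq> 2 * (i + Wm)" "2 * i + 1 \<noteq> 2 * (i + Wm) + 2" "2 * (i + Wm) \<noteq> 2 * (i + Wm) + 3"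
    "2 * i + 1 \<noteq> 2 * (i + Wm) + 3" by presburger+
  have disj: "set (slot_lits cols s c j) \<inter> set (slot_lits cols s' c' j) = {}" if n: "s \<noteq> s'" for s s' c c'
  proof -
    have False if "z \<in> set (slot_lits cols s c j)" "z \<in> set (slot_lits cols s' c' j)" for z
    proof -
      obtain a y where "z = (a, y)" by (metis surj_pair)
      then show False using d[of a y s c] d[of a y s' c'] that n by simp
    qed
    then show ?thesis by blast
  qed
  show ?thesis
  proof (cases "ok_tuple ok (\<omega> i) (n, w, s, e)")
    case True
    have "distinct (slot_lits cols (2 * i + 1) n j @ slot_lits cols (2 * (i + Wm)) w j @
       slot_lits cols (2 * (i + Wm) + 3) s j @ slot_lits cols (2 * (i + Wm) + 2) e j)"
      unfolding distinct_append set_append Int_Un_distrib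
      by (intro conjI distinct_slot_lits) (use o in \<open>simp_all only: disj Un_empty_left, simp_all add: disj\<close>)
    then show ?thesis using True by (simp only: term_of_def term_lits_def q split if_True)
  qed (simp add: term_of_def term_lits_def q)
qed

lemma distinct_link_list: "distinct link_list"
proof -
  have t: "j' = code i c r" if "i < Nc" "(u, b, j') \<in> set (term_of i r (code i c r))" for i c r u b j'
    using term_range[OF that(2,1)] by simp
  have inj: "i = i' \<and> c = c' \<and> r = r'"
    if "i < Nc" "c < 2" "r < K" "i' < Nc" "c' < 2" "r' < K" "z \<in> set (term_of i r (code i c r))"
      "z \<in> set (term_of i' r' (code i' c' r'))" for i c r i' c' r' z
  proof -
    obtain u b j where z: "z = (u, b, j)" by (metis prod_cases3)
    have "(\<lambda>(i, c, r). code i c r) (i, c, r) = (\<lambda>(i, c, r). code i c r) (i', c', r')"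
      using t[OF that(1)] t[OF that(4)] that(7,8) unfolding z by fastforce
    from inj_onD[OF code_inj this] show ?thesis using that by auto
  qed
  have "distinct (concat (map (\<lambda>i. concat (map (\<lambda>c. concat (map (\<lambda>r. term_of i r (code i c r)) [0..<K])) [0..<2])) [0..<Nc]))"
    by (intro distinct_concat_map distinct_upt distinct_term) (use inj in fastforce)+
  moreover have "z \<notin> set (term_of i r (code i c r))"
    if z: "z \<in> set (slot_lits cols zslot c1 0)" and ir: "i < Nc" "c < 2" "r < K" for i c r z
  proof
    assume zt: "z \<in> set (term_of i r (code i c r))"
    obtain u b j where e: "z = (u, b, j)" by (metis prod_cases3)
    have "j = 0" using z(1) by (auto simp: e slot_lits_def)
    then show False using t[OF ir(1), of u b j r c] zt code_range[OF ir] by (simp add: e)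
  qed
  then have "set (slot_lits cols zslot c1 0) \<inter> set (concat (map (\<lambda>i. concat (map (\<lambda>c.
     concat (map (\<lambda>r. term_of i r (code i c r)) [0..<K])) [0..<2])) [0..<Nc])) = {}"
    by (simp add: disjoint_iff)
  ultimately show ?thesis by (simp add: link_list_def distinct_slot_lits)
qed

end

locale verifier =
  fixes A B :: "bool list set" and M :: machine and pA pB :: "nat poly" and cols :: "colour list"
  assumes M: "wf_machine M" "query_state M = None" "computes_within M (\<lambda>_. []) pB (\<lambda>x. [x \<in> B])"
    and A: "\<And>x. x \<in> A \<longleftrightarrow> (\<exists>y. length y \<le> poly pA (length x) \<and> enc_bits x @ y \<in> B)"
    and cols: "distinct cols" "set cols = colours M"
begin

definition guess :: "nat \<Rightarrow> nat" where "guess n = poly pA n"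
text \<open>The argument of the polynomial bounds the length of the word
  \<open>enc_bits x @ y\<close> that the verifier reads.\<close>

definition time :: "nat \<Rightarrow> nat" where "time n = poly pB (2 * n + 1 + guess n)"
definition width :: "nat \<Rightarrow> nat" where "width n = 2 * time n + 5 + 2 * n + guess n"
definition cells :: "nat \<Rightarrow> nat" where "cells n = (time n + 2) * width n"
definition cell_of :: "bool list \<Rightarrow> nat \<Rightarrow> cell" where
  "cell_of x i = tableau.cell_at x (guess (length x)) (time (length x)) (i div width (length x)) (i mod width (length x))"

lemma csp: "csp cols (cells n) (width n - 1) (Fin True)"
  by unfold_locales (auto simp: cols colours_def cells_def width_def)

context
  fixes x :: "bool list"
begin

interpretation csp cols "ok_cell M" "cell_of x" "cells (length x)" "width (length x) - 1" "Fin True" by (rule csp)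
interpretation tableau M x "guess (length x)" "time (length x)" by unfold_locales (rule M)+

lemma WW: "Wm = width (length x) - 1" "W = width (length x)" "0 < width (length x)"
  by (simp_all add: width_def Wm_def W_def)

lemma zslot_eq: "zslot = 2 * (cells (length x) + Wm)"
proof -
  have "0 < cells (length x)" by (simp add: cells_def width_def)
  then show ?thesis unfolding zslot_def WW(1) by simp
qed

lemma accepts_B: "length y \<le> guess (length x) \<Longrightarrow> accepts (enc_bits x @ y) \<longleftrightarrow> enc_bits x @ y \<in> B"
proof -
  assume y: "length y \<le> guess (length x)"
  let ?v = "enc_bits x @ y"
  obtain k where k: "k \<le> poly pB (length ?v)" "fst ((step M (\<lambda>_. []) ^^ k) (init_config M ?v)) = 1"
    "contents (snd ((step M (\<lambda>_. []) ^^ k) (init_config M ?v)) ! 1) = [?v \<in> B]"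
    using M(3) unfolding computes_within_def by blast
  have "poly pB (length ?v) \<le> time (length x)"
    unfolding time_def using y by (intro poly_nat_mono) (simp add: length_enc_bits)
  then show ?thesis using accepts_iff[of k ?v] k by (simp add: cfg_def)
qed

lemma solution_tableau: "solution \<alpha> \<Longrightarrow> tableau (\<lambda>i. \<alpha> (2 * i + 1)) (\<lambda>i. \<alpha> (2 * (i + Wm)))"
proof -
  assume s: "solution \<alpha>"
  have "ok_cell M (cell_at r p) (\<alpha> (2 * i + 1)) (\<alpha> (2 * (i + Wm))) (\<alpha> (2 * (i + W) + 1)) (\<alpha> (2 * (i + 1 + Wm)))"
    if "r \<le> time (length x) + 1" "p \<le> Wm" "i = r * W + p" for r p i
  proof -
    have p: "p < width (length x)" using that WW by linarith
    have "i < (r + 1) * width (length x)" using that p WW by simp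
    also have "\<dots> \<le> cells (length x)" unfolding cells_def using that by (intro mult_le_mono) auto
    finally have "i < cells (length x)" .
    then have "ok_cell M (cell_of x i) (\<alpha> (2 * i + 1)) (\<alpha> (2 * (i + Wm))) (\<alpha> (2 * (i + Wm) + 3)) (\<alpha> (2 * (i + Wm) + 2))"
      using s unfolding solution_def WW(1) by blast
    moreover have "cell_of x i = cell_at r p" using p that WW by (simp add: cell_of_def)
    moreover have "2 * (i + W) + 1 = 2 * (i + Wm) + 3" "2 * (i + 1 + Wm) = 2 * (i + Wm) + 2" by (simp_all add: W_def)
    ultimately show ?thesis by (simp only:)
  qed
  note ok = this
  have "ok_cell M (cell_at r p) (\<alpha> (2 * (r * W + p) + 1)) (\<alpha> (2 * (r * W + p + Wm)))
     (\<alpha> (2 * ((r + 1) * W + p) + 1)) (\<alpha> (2 * (r * W + p + 1 + Wm)))" if "r \<le> time (length x) + 1" "p \<le> Wm" for r p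
  proof -
    have "r * W + p + W = (r + 1) * W + p" by simp
    then show ?thesis using ok[OF that refl] by (simp only:)
  qed
  then show ?thesis unfolding tableau_def by blast
qed

lemma tableau_solution:
  assumes "tableau V H" "range V \<subseteq> colours M" "range H \<subseteq> colours M"
  shows "\<exists>\<alpha>. solution \<alpha> \<and> \<alpha> zslot = H (cells (length x))"
proof -
  \<comment> \<open>Odd slots take the vertical and even slots the horizontal colours, so the two
    colourings do not interfere.\<close>
  define \<alpha> where "\<alpha> s = (if odd s then V (s div 2) else H (s div 2 - Wm))" for s
  have a: "\<alpha> (2 * i + 1) = V i" "\<alpha> (2 * (i + Wm)) = H i" "\<alpha> (2 * (i + Wm) + 3) = V (i + W)"
    "\<alpha> (2 * (i + Wm) + 2) = H (i + 1)" for i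
  proof -
    have "2 * (i + Wm) + 3 = 2 * (i + W) + 1" by (simp add: W_def)
    then show "\<alpha> (2 * (i + Wm) + 3) = V (i + W)" by (simp only: \<alpha>_def) simp
    have "2 * (i + Wm) + 2 = 2 * (i + 1 + Wm)" by simp
    then show "\<alpha> (2 * (i + Wm) + 2) = H (i + 1)" by (simp only: \<alpha>_def) simp
  qed (simp_all add: \<alpha>_def)
  have "ok_cell M (cell_of x i) (V i) (H i) (V (i + W)) (H (i + 1))" if "i < cells (length x)" for i
  proof -
    define r p where "r = i div width (length x)" and "p = i mod width (length x)"
    have i: "i = r * W + p" "p \<le> Wm" using WW mod_less_divisor[OF WW(3), of i] by (auto simp: r_def p_def)
    have "r < time (length x) + 2" using that WW(3) by (simp add: r_def cells_def div_less_iff_less_mult)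
    then have "ok_cell M (cell_at r p) (V (r * W + p)) (H (r * W + p)) (V ((r + 1) * W + p)) (H (r * W + p + 1))"
      using assms(1) i(2) unfolding tableau_def by auto
    moreover have "(r + 1) * W + p = i + W" using i(1) by simp
    moreover have "cell_of x i = cell_at r p" by (simp add: cell_of_def r_def p_def)
    ultimately show ?thesis by (simp only: i(1)[symmetric])
  qed
  then have "solution \<alpha>"
    unfolding solution_def using assms(2,3) a cols WW(1) by (auto simp: \<alpha>_def)
  moreover have "\<alpha> zslot = H (cells (length x))" unfolding zslot_eq by (rule a(2))
  ultimately show ?thesis by blast
qed

text \<open>Acceptance is not among the conditions on the cells, so for every word even the run on
  the empty witness gives a solution.\<close>

lemma solution_exists: "\<exists>\<alpha>. solution \<alpha>"
proof -
  obtain V H where "tableau V H" "range V \<subseteq> colours M" "range H \<subseteq> colours M"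
    using tableau_complete[of "[]"] by auto
  from tableau_solution[OF this] show ?thesis by blast
qed

lemma solution_iff: "(\<exists>\<alpha>. solution \<alpha> \<and> \<alpha> zslot = Fin True) \<longleftrightarrow> x \<in> A"
proof
  assume "\<exists>\<alpha>. solution \<alpha> \<and> \<alpha> zslot = Fin True"
  then obtain \<alpha> where s: "solution \<alpha>" "\<alpha> zslot = Fin True" by blast
  have "\<alpha> (2 * (cells (length x) + Wm)) = Fin True" using s(2) by (simp only: zslot_eq)
  then have "\<alpha> (2 * ((time (length x) + 2) * W + Wm)) = Fin True" by (simp only: cells_def WW(2))
  then obtain y where "length y \<le> guess (length x)" "accepts (enc_bits x @ y)"
    using tableau_sound[OF solution_tableau[OF s(1)]] by blast
  then show "x \<in> A" using A accepts_B by (auto simp: guess_def)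
next
  assume "x \<in> A"
  then obtain y where y: "length y \<le> guess (length x)" "enc_bits x @ y \<in> B" using A by (auto simp: guess_def)
  obtain V H where VH: "tableau V H" "range V \<subseteq> colours M" "range H \<subseteq> colours M"
      "H ((time (length x) + 2) * W) = Fin (accepts (enc_bits x @ y))"
    using tableau_complete[OF y(1)] by blast
  have "H (cells (length x)) = Fin True" using VH(4) accepts_B[OF y(1)] y(2) by (simp add: cells_def WW(2))
  then show "\<exists>\<alpha>. solution \<alpha> \<and> \<alpha> zslot = Fin True" using tableau_solution[OF VH(1-3)] by auto
qed

end

end

subsection \<open>Writing down the instances\<close>

definition prefix_free :: "('a \<Rightarrow> bool list) \<Rightarrow> bool" where
  "prefix_free f \<longleftrightarrow> (\<forall>a b u v. f a @ u = f b @ v \<longrightarrow> a = b \<and> u = v)"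

lemma prefix_freeD: "prefix_free f \<Longrightarrow> f a @ u = f b @ v \<Longrightarrow> a = b \<and> u = v"
  by (simp add: prefix_free_def)

lemma prefix_free_list:
  assumes "prefix_free f"
  shows "prefix_free (enc_list f)"
  unfolding prefix_free_def
proof (intro allI impI)
  fix xs ys u v
  assume "enc_list f xs @ u = enc_list f ys @ v"
  then show "xs = ys \<and> u = v"
  proof (induction xs arbitrary: ys)
    case Nil
    then show ?case by (cases ys) (auto simp: enc_list_def)
  next
    case (Cons x xs)
    then obtain y ys' where ys: "ys = y # ys'" by (cases ys) (auto simp: enc_list_def)
    have "f x @ (enc_list f xs @ u) = f y @ (enc_list f ys' @ v)"
      using Cons.prems by (simp add: ys enc_list_def)
    from prefix_freeD[OF assms this] show ?case using Cons.IH[of ys'] ys by simp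
  qed
qed

lemma prefix_free_pair:
  assumes "prefix_free f" "prefix_free g"
  shows "prefix_free (\<lambda>(a, b). f a @ g b)"
  unfolding prefix_free_def
proof (intro allI impI)
  fix p q u v assume e: "(case p of (a, b) \<Rightarrow> f a @ g b) @ u = (case q of (a, b) \<Rightarrow> f a @ g b) @ v"
  obtain a b c d where p: "p = (a, b)" "q = (c, d)" by (metis surj_pair)
  have "f a @ (g b @ u) = f c @ (g d @ v)" using e by (simp add: p)
  from prefix_freeD[OF assms(1) this] have "a = c" "g b @ u = g d @ v" by auto
  with prefix_freeD[OF assms(2) this(2)] show "p = q \<and> u = v" by (simp add: p)
qed

lemma prefix_free_comp: "prefix_free f \<Longrightarrow> inj g \<Longrightarrow> prefix_free (\<lambda>a. f (g a))"
  unfolding prefix_free_def inj_def by blast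

lemma inj_bin: "inj bin"
proof (rule injI)
  fix a b :: nat assume "bin a = bin b"
  then show "a = b"
  proof (induction a arbitrary: b rule: less_induct)
    case (less a)
    show ?case
    proof (cases "a = 0 \<or> b = 0")
      case True
      then show ?thesis using less.prems bin.simps[of a] bin.simps[of b] by (auto split: if_splits)
    next
      case False
      then have "odd a = odd b" "bin (a div 2) = bin (b div 2)"
        using less.prems bin.simps[of a] bin.simps[of b] by auto
      moreover have "a div 2 < a" using False by simp
      ultimately show ?thesis using less.IH[of "a div 2" "b div 2"]
        by (metis even_two_times_div_two odd_two_times_div_two_succ)
    qed
  qed
qed

lemma prefix_free_nat: "prefix_free enc_nat"
proof -
  have "prefix_free (\<lambda>b. [b])" by (simp add: prefix_free_def)
  from prefix_free_comp[OF prefix_free_list[OF this] inj_bin] show ?thesis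
    by (simp add: enc_nat_def[abs_def] enc_bits_def)
qed

lemma prefix_free_int: "prefix_free enc_int"
proof -
  have "prefix_free (\<lambda>b. [b])" by (simp add: prefix_free_def)
  moreover have "inj (\<lambda>k. (k < 0, nat \<bar>k\<bar>))" by (auto simp: inj_def nat_eq_iff2 abs_if split: if_splits)
  ultimately have "prefix_free (\<lambda>k. case (k < 0, nat \<bar>k\<bar>) of (a, b) \<Rightarrow> [a] @ enc_nat b)"
    by (rule prefix_free_comp[OF prefix_free_pair[OF _ prefix_free_nat]])
  then show ?thesis by (simp add: enc_int_def[abs_def])
qed

lemma prefix_free_rat: "prefix_free enc_rat"
proof -
  have "inj (\<lambda>r. (fst (quotient_of r), nat (snd (quotient_of r))))"
  proof (rule injI)
    fix r s :: rat
    assume "(fst (quotient_of r), nat (snd (quotient_of r))) = (fst (quotient_of s), nat (snd (quotient_of s)))"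
    then have "quotient_of r = quotient_of s"
      using quotient_of_denom_pos'[of r] quotient_of_denom_pos'[of s] by (auto simp: prod_eq_iff)
    then show "r = s" by (metis quotient_of_div surj_pair)
  qed
  then have "prefix_free (\<lambda>r. case (fst (quotient_of r), nat (snd (quotient_of r))) of (a, b) \<Rightarrow> enc_int a @ enc_nat b)"
    by (rule prefix_free_comp[OF prefix_free_pair[OF prefix_free_int prefix_free_nat]])
  then show ?thesis by (simp add: enc_rat_def[abs_def])
qed

lemma prefix_free_geometric: "prefix_free (encode geometric)"
proof -
  have "encode geometric = (\<lambda>(ps, es). enc_list (\<lambda>(a, b). enc_rat a @ enc_rat b) ps @
       enc_list (\<lambda>(i, j). enc_nat i @ enc_nat j) es)" by (simp add: geometric_def)
  moreover have "prefix_free \<dots>"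
    by (rule prefix_free_pair[OF prefix_free_list[OF prefix_free_pair[OF prefix_free_rat prefix_free_rat]]
        prefix_free_list[OF prefix_free_pair[OF prefix_free_nat prefix_free_nat]]])
  ultimately show ?thesis by (simp only:)
qed

lemma prefix_free_unary: "prefix_free (\<lambda>n. replicate n True @ [False])"
  unfolding prefix_free_def
proof (intro allI impI)
  fix n k and u v :: "bool list"
  assume "(replicate n True @ [False]) @ u = (replicate k True @ [False]) @ v"
  then show "n = k \<and> u = v"
  proof (induction n arbitrary: k)
    case 0
    then show ?case by (cases k) auto
  next
    case (Suc n)
    then show ?case by (cases k) auto
  qed
qed

lemma prefix_free_weighted: "prefix_free (encode weighted)"
proof -
  have "encode weighted = (\<lambda>(n, es). (replicate n True @ [False]) @
       enc_list (\<lambda>(i, p). enc_nat i @ (\<lambda>(j, r). enc_nat j @ enc_rat r) p) es)"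
    by (simp add: weighted_def case_prod_unfold)
  moreover have "prefix_free \<dots>"
    by (rule prefix_free_pair[OF prefix_free_unary prefix_free_list[OF prefix_free_pair[OF prefix_free_nat
        prefix_free_pair[OF prefix_free_nat prefix_free_rat]]]])
  ultimately show ?thesis by (simp only:)
qed

section \<open>Binary expansions and the loops that print them\<close>

lemma bin_double: "0 < z \<Longrightarrow> bin (2 * z) = False # bin z"
  by (subst bin.simps) simp

lemma bin_shift: "0 < z \<Longrightarrow> bin (2 ^ e * z) = replicate e False @ bin z"
proof (induction e)
  case (Suc e)
  then show ?case using bin_double[of "2 ^ e * z"] by (simp add: mult.assoc)
qed simp

text \<open>Multiplication by \<open>2 ^ e\<close> prepends zeros, and adding
  \<open>i < 2 ^ e\<close> fills them with the digits of \<open>i\<close>; numbers of this form can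
  be printed without arithmetic on large numbers.\<close>

lemma bin_low: "0 < z \<Longrightarrow> i < 2 ^ e \<Longrightarrow> bin (2 ^ e * z + i) = map (\<lambda>j. odd (i div 2 ^ j)) [0..<e] @ bin z"
proof (induction e arbitrary: i)
  case (Suc e)
  have "bin (2 ^ Suc e * z + i) = odd i # bin (2 ^ e * z + i div 2)"
    by (subst bin.simps) (use Suc.prems in \<open>simp add: mult.assoc\<close>)
  also have "bin (2 ^ e * z + i div 2) = map (\<lambda>j. odd (i div 2 div 2 ^ j)) [0..<e] @ bin z"
    by (rule Suc.IH) (use Suc.prems in auto)
  also have "odd i # map (\<lambda>j. odd (i div 2 div 2 ^ j)) [0..<e] @ bin z = map (\<lambda>j. odd (i div 2 ^ j)) [0..<Suc e] @ bin z"
    by (simp add: upt_conv_Cons[of 0 "Suc e"] map_Suc_upt[symmetric] comp_def div_mult2_eq del: upt_Suc)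
  finally show ?case .
qed simp

definition payload :: "bool list \<Rightarrow> bool list" where
  "payload bs = concat (map (\<lambda>b. [True, b]) bs)"

lemma payload_append: "payload (a @ b) = payload a @ payload b"
  by (simp add: payload_def)

lemma payload_replicate: "payload (replicate n False) = concat (replicate n [True, False])"
  by (simp add: payload_def)

lemma enc_nat_payload: "enc_nat n = payload (bin n) @ [False]"
  by (simp add: enc_nat_def enc_bits_def enc_list_def payload_def)

lemma enc_nat_shift: "0 < z \<Longrightarrow> enc_nat (2 ^ e * z) = concat (replicate e [True, False]) @ enc_nat z"
  by (simp add: enc_nat_payload bin_shift payload_append payload_replicate)

lemma enc_rat_int: "enc_rat (of_int k) = (k < 0) # enc_nat (nat \<bar>k\<bar>) @ enc_nat 1"
  by (simp add: enc_rat_def enc_int_def)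

lemma enc_rat_nat: "enc_rat (of_nat k) = False # enc_nat k @ enc_nat 1"
  using enc_rat_int[of "int k"] by simp

fun seqs :: "em list \<Rightarrow> em" where
  "seqs [] = Out []"
| "seqs (a # as) = Seq a (seqs as)"

lemma eval_seqs: "eval (seqs es) x env = concat (map (\<lambda>e. eval e x env) es)"
  by (induction es) auto

lemma closed_seqs: "scoped A (seqs es) \<longleftrightarrow> (\<forall>e\<in>set es. scoped A e)"
  by (induction es) auto

lemma bit_ok_seqs: "bit_ok (seqs es) n env \<longleftrightarrow> (\<forall>e\<in>set es. bit_ok e n env)"
  by (induction es) auto

lemma poly_aexp: "\<exists>e. avars e \<subseteq> avars a \<and> (\<forall>env. aval e env = poly p (aval a env))"
proof (induction p)
  case 0
  show ?case by (rule exI[of _ "Const 0"]) simp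
next
  case (pCons c p)
  then obtain e where "avars e \<subseteq> avars a" "\<And>env. aval e env = poly p (aval a env)" by blast
  then show ?case by (intro exI[of _ "Plus (Const c) (Times a e)"]) auto
qed

definition cmap :: "(nat \<Rightarrow> 'a list) \<Rightarrow> nat \<Rightarrow> 'a list" where
  "cmap f k = concat (map f [0..<k])"

lemma cmap_simps [simp]: "cmap f 0 = []" "cmap f (Suc k) = cmap f k @ f k"
  by (simp_all add: cmap_def)

lemma cmap_add: "cmap f (a + b) = cmap f a @ cmap (\<lambda>i. f (a + i)) b"
  by (induction b) auto

lemma cmap_cong: "(\<And>i. i < k \<Longrightarrow> f i = g i) \<Longrightarrow> cmap f k = cmap g k"
  by (induction k) auto

lemma cmap_mult: "cmap f (a * b) = cmap (\<lambda>r. cmap (\<lambda>p. f (r * b + p)) b) a"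
  unfolding cmap_def by (rule concat_map_mult)

lemma cmap_first: "0 < k \<Longrightarrow> cmap f k = f 0 @ cmap (\<lambda>i. f (Suc i)) (k - 1)"
  using cmap_add[of f 1 "k - 1"] by simp

lemma eval_For: "eval (For v e a) x env = cmap (\<lambda>i. eval a x (env(v := i))) (aval e env)"
  by (simp add: cmap_def)

lemma concat_map_concat: "concat (map g (concat (map f xs))) = concat (map (\<lambda>x. concat (map g (f x))) xs)"
  by (induction xs) auto

lemma concat_map_map: "concat (map g (map f xs)) = concat (map (\<lambda>x. g (f x)) xs)"
  by (simp add: comp_def)

text \<open>Edges whose indices are arithmetic expressions, to be emitted inside loops. The chain
  edge at the hub and \<open>Y 1\<close> are separate cases, since the number of the hub and the
  length of \<open>Y 1\<close> do not obey the general formulas.\<close>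

datatype adesc = AChain0 aexp | AChain aexp aexp | AZ | AY aexp | AU1 aexp | AU2 aexp | AD0 aexp
  | ALink aexp bool aexp

fun adval :: "(nat \<Rightarrow> nat) \<Rightarrow> adesc \<Rightarrow> desc" where
  "adval env (AChain0 b) = Chain (aval b env) 0"
| "adval env (AChain b i) = Chain (aval b env) (Suc (aval i env))"
| "adval env AZ = Y 1"
| "adval env (AY j) = Y (aval j env)"
| "adval env (AU1 u) = U1 (aval u env)"
| "adval env (AU2 u) = U2 (aval u env)"
| "adval env (AD0 u) = D0 (aval u env)"
| "adval env (ALink u b j) = Link (aval u env) b (aval j env)"

fun advars :: "adesc \<Rightarrow> nat set" where
  "advars (AChain0 b) = avars b"
| "advars (AChain b i) = avars b \<union> avars i"
| "advars AZ = {}"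
| "advars (AY j) = avars j"
| "advars (AU1 u) = avars u"
| "advars (AU2 u) = avars u"
| "advars (AD0 u) = avars u"
| "advars (ALink u b j) = avars u \<union> avars j"

abbreviation cst where "cst k e \<equiv> Times (Const k) e"

locale program = verifier A B M pA pB cols
  for A B M pA pB cols +
  fixes aG aT :: aexp and T :: template and t0 t1 :: real
  assumes aG: "avars aG \<subseteq> {0}" "\<And>env. aval aG env = guess (env 0)"
    and aT: "avars aT \<subseteq> {0}" "\<And>env. aval aT env = time (env 0)"
    and good: "good_template t0 t1 T"
begin

abbreviation "C \<equiv> length cols"
abbreviation "K \<equiv> length (tuples cols)"
abbreviation "P \<equiv> last T"

definition aWm :: aexp where "aWm = Plus (cst 2 aT) (Plus (Const 4) (Plus (cst 2 (Var 0)) aG))"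
definition aW :: aexp where "aW = Plus aWm (Const 1)"
definition aN :: aexp where "aN = Times (Plus aT (Const 2)) aW"
definition aR :: aexp where "aR = Plus (Const 2) (cst (2 * K) aN)"
definition aU :: aexp where "aU = cst (2 * C) (Plus aN (Plus aWm (Const 1)))"

abbreviation "nR n \<equiv> csp.nR cols (cells n)"
abbreviation "nU n \<equiv> csp.nU cols (cells n) (width n - 1)"

lemma csp': "csp cols (cells n) (width n - 1) (Fin True)"
  by unfold_locales (auto simp: cols colours_def cells_def width_def)

lemmas csp_defs = csp.nR_def[OF csp'] csp.nU_def[OF csp'] csp.zslot_def[OF csp'] csp.code_def[OF csp']
  csp.term_of_def[OF csp'] csp.link_list_def[OF csp']

lemma avals: "aval aWm env = width (env 0) - 1" "aval aW env = width (env 0)" "aval aN env = cells (env 0)"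
  "aval aR env = nR (env 0)" "aval aU env = nU (env 0)"
proof -
  show m: "aval aWm env = width (env 0) - 1" by (simp add: aWm_def aG aT width_def)
  show w: "aval aW env = width (env 0)" by (simp add: aW_def m) (simp add: width_def)
  show n: "aval aN env = cells (env 0)" by (simp add: aN_def w aT cells_def)
  show "aval aR env = nR (env 0)" by (simp add: aR_def n csp_defs)
  show "aval aU env = nU (env 0)" unfolding csp_defs by (simp add: aU_def m n)
qed

lemma avars_sub: "avars aWm \<subseteq> {0}" "avars aW \<subseteq> {0}" "avars aN \<subseteq> {0}" "avars aR \<subseteq> {0}" "avars aU \<subseteq> {0}"
  using aG aT by (auto simp: aWm_def aW_def aN_def aR_def aU_def)

definition slot_prog :: "(adesc \<Rightarrow> em) \<Rightarrow> aexp \<Rightarrow> colour \<Rightarrow> aexp \<Rightarrow> em" where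
  "slot_prog out s c j =
     seqs (map (\<lambda>k. out (ALink (Plus (cst C s) (Const k)) (cols ! k = c) j)) [0..<C])"

definition term_prog :: "(adesc \<Rightarrow> em) \<Rightarrow> cell \<Rightarrow> aexp \<Rightarrow> aexp \<Rightarrow> colour \<times> colour \<times> colour \<times> colour \<Rightarrow> em" where
  "term_prog out cl i j q = (case q of (n, w, s, e) \<Rightarrow>
     let s1 = Plus (cst 2 i) (Const 1); s2 = cst 2 (Plus i aWm) in
     if ok_tuple (ok_cell M) cl q then
       seqs [slot_prog out s1 n j, slot_prog out s2 w j, slot_prog out (Plus s2 (Const 3)) s j,
         slot_prog out (Plus s2 (Const 2)) e j]
     else seqs [out (ALink (cst C s1) True j), out (ALink (cst C s1) False j)])"

definition cell_prog :: "(adesc \<Rightarrow> em) \<Rightarrow> cell \<Rightarrow> aexp \<Rightarrow> em" where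
  "cell_prog out cl i = seqs (map (\<lambda>c. seqs (map (\<lambda>r. term_prog out cl i
     (Plus (Const (2 + K * c + r)) (cst (2 * K) i)) (tuples cols ! r)) [0..<K])) [0..<2])"

text \<open>The kinds of cells occupy known intervals, so one loop per interval prints them; only
  cells with input symbols depend on the bits of \<open>x\<close>. In \<open>enc_bits x\<close> each
  bit is preceded by \<open>True\<close> and the end is marked by \<open>False\<close>, which
  accounts for the cells \<open>IS 2\<close> before the tests and for the last
  \<open>IS 1\<close>.\<close>

definition row_first :: "(adesc \<Rightarrow> em) \<Rightarrow> em" where
  "row_first out = (let cl = cell_prog out; v = Var 1; n = Var 0; g = Plus (Plus aT (Const 3)) (cst 2 n) in
     seqs [cl I0 (Const 0), For 1 aT (cl IB (Plus (Const 1) v)), cl IH (Plus aT (Const 1)),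
       For 1 n (seqs [cl (IS 2) (Plus (Plus aT (Const 2)) (cst 2 v)),
         Bit 1 (cl (IS 2) (Plus (Plus aT (Const 3)) (cst 2 v))) (cl (IS 1) (Plus (Plus aT (Const 3)) (cst 2 v)))]),
       cl (IS 1) (Plus (Plus aT (Const 2)) (cst 2 n)), For 1 aG (cl IG (Plus g v)),
       For 1 (Plus aT (Const 1)) (cl IB (Plus (Plus g aG) v)), cl IE aWm])"

definition row_step :: "(adesc \<Rightarrow> em) \<Rightarrow> em" where
  "row_step out = (let cl = cell_prog out; b = Times (Plus (Var 1) (Const 1)) aW in
     seqs [cl Lf b, For 2 (Plus (cst 2 aT) (Plus (Const 3) (Plus (cst 2 (Var 0)) aG)))
         (cl Cc (Plus b (Plus (Const 1) (Var 2)))), cl Rt (Plus b aWm)])"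

definition row_last :: "(adesc \<Rightarrow> em) \<Rightarrow> em" where
  "row_last out = (let cl = cell_prog out; b = Times (Plus aT (Const 1)) aW in
     seqs [cl FL b, For 1 (Plus aT (Const 1)) (cl FN (Plus b (Plus (Const 1) (Var 1)))),
       cl F0 (Plus b (Plus aT (Const 2))), cl F1 (Plus b (Plus aT (Const 3))),
       For 1 (Plus aT (Plus (Const 1) (Plus (cst 2 (Var 0)) aG))) (cl FN (Plus b (Plus aT (Plus (Const 4) (Var 1)))))])"

text \<open>The order is that of \<open>desc_list\<close>. Colours and tuples depend on the verifier
  alone and are unrolled into the program; branches, variables and cells are run through by
  loops.\<close>

definition edge_prog :: "(adesc \<Rightarrow> em) \<Rightarrow> em" where
  "edge_prog out = seqs [out (AY (Const 0)), out AZ,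
     For 1 (Plus aR aU) (Seq (out (AChain0 (Var 1))) (For 2 (Const (P - 1)) (out (AChain (Var 1) (Var 2))))),
     For 1 (cst (2 * K) aN) (out (AY (Plus (Const 2) (Var 1)))),
     For 1 aU (seqs [out (AU1 (Var 1)), out (AU2 (Var 1)), out (AD0 (Var 1))]),
     slot_prog out (cst 2 (Plus aN aWm)) (Fin True) (Const 0),
     row_first out, For 1 aT (row_step out), row_last out]"

definition edge_descs :: "bool list \<Rightarrow> desc list" where
  "edge_descs x = desc_list T (nR (length x)) (nU (length x))
     (csp.link_list cols (ok_cell M) (cell_of x) (cells (length x)) (width (length x) - 1) (Fin True))"

text \<open>The encoding \<open>g\<close> of a single edge is left open, so that one program serves
  geometric and weighted instances. \<open>AY\<close> must not denote \<open>Y 1\<close>, which has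
  its own case.\<close>

definition valid_out :: "bool list \<Rightarrow> (adesc \<Rightarrow> em) \<Rightarrow> (desc \<Rightarrow> bool list) \<Rightarrow> bool" where
  "valid_out x out g \<longleftrightarrow> (\<forall>a env. env 0 = length x \<longrightarrow> (\<forall>j. a = AY j \<longrightarrow> aval j env \<noteq> 1) \<longrightarrow>
     eval (out a) x env = g (adval env a))"

definition lit_text :: "(desc \<Rightarrow> bool list) \<Rightarrow> (nat \<times> bool \<times> nat) list \<Rightarrow> bool list" where
  "lit_text g ls = concat (map g (map (\<lambda>(u, b, j). Link u b j) ls))"

definition cell_text :: "(desc \<Rightarrow> bool list) \<Rightarrow> nat \<Rightarrow> cell \<Rightarrow> nat \<Rightarrow> bool list" where
  "cell_text g n cl i = cmap (\<lambda>c. cmap (\<lambda>r. lit_text g (term_lits cols (width n - 1)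
     (ok_tuple (ok_cell M) cl (tuples cols ! r)) i (tuples cols ! r) (2 + 2 * K * i + K * c + r))) K) 2"

lemma lit_text_append: "lit_text g (a @ b) = lit_text g a @ lit_text g b"
  by (simp add: lit_text_def)

lemma enc_bits_nth:
  "j < length x \<Longrightarrow> enc_bits x ! (2 * j) = True" "j < length x \<Longrightarrow> enc_bits x ! (2 * j + 1) = x ! j"
  "enc_bits x ! (2 * length x) = False"
proof -
  show "enc_bits x ! (2 * length x) = False"
    by (induction x) (simp_all add: enc_bits_Cons, simp add: enc_bits_def enc_list_def)
  show "j < length x \<Longrightarrow> enc_bits x ! (2 * j) = True"
    by (induction x arbitrary: j; case_tac j) (simp_all add: enc_bits_Cons)
  show "j < length x \<Longrightarrow> enc_bits x ! (2 * j + 1) = x ! j"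
    by (induction x arbitrary: j; case_tac j) (simp_all add: enc_bits_Cons)
qed

lemma lit_text_concat: "lit_text g (concat (map f xs)) = concat (map (\<lambda>i. lit_text g (f i)) xs)"
  by (induction xs) (auto simp: lit_text_def)

context
  fixes x :: "bool list" and out g
  assumes out: "valid_out x out g"
begin

lemma out_link: "env 0 = length x \<Longrightarrow> eval (out (ALink u b j)) x env = g (Link (aval u env) b (aval j env))"
  using out unfolding valid_out_def by fastforce

lemma eval_slot: "env 0 = length x \<Longrightarrow>
    eval (slot_prog out s c j) x env = lit_text g (slot_lits cols (aval s env) c (aval j env))"
  by (simp add: slot_prog_def eval_seqs lit_text_def slot_lits_def comp_def out_link mult.commute)

lemma eval_term: "env 0 = length x \<Longrightarrow>
    eval (term_prog out cl i j q) x env =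
    lit_text g (term_lits cols (width (length x) - 1) (ok_tuple (ok_cell M) cl q) (aval i env) q (aval j env))"
  by (cases q) (simp add: term_prog_def Let_def term_lits_def eval_slot avals out_link lit_text_append
      lit_text_def[of _ "[a, b]" for a b] mult.commute add.commute)

lemma eval_cell: "env 0 = length x \<Longrightarrow> eval (cell_prog out cl i) x env = cell_text g (length x) cl (aval i env)"
  unfolding cell_prog_def cell_text_def eval_seqs cmap_def concat_map_map
  by (simp add: eval_term ac_simps)


lemma cell_of_row: "p < width (length z) \<Longrightarrow>
    cell_of z (r * width (length z) + p) = tableau.cell_at z (guess (length z)) (time (length z)) r p"
  by (simp add: cell_of_def)

lemma eval_row_first:
  assumes e: "env 0 = length x"
  shows "eval (row_first out) x env = cmap (\<lambda>p. cell_text g (length x) (cell_of x p) p) (width (length x))"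
proof -
  define n t l where "n = length x" and "t = time n" and "l = guess n"
  define F where "F = cell_text g n"
  define f where "f p = F (cell_of x p) p" for p
  interpret tableau M x l t by unfold_locales (rule M)+
  have w: "width n = 1 + t + 1 + n * 2 + 1 + l + (t + 1) + 1" by (simp add: width_def t_def l_def)
  have f: "f p = F (cell_at 0 p) p" if "p < width n" for p
    using cell_of_row[of p x 0] that by (simp add: f_def n_def t_def l_def)
  note d = cell_at_def gs_def p0_def Wm_def n_def[symmetric]
  have split: "cmap f (width n) = f 0 @ cmap (\<lambda>i. f (1 + i)) t @ f (t + 1) @ cmap (\<lambda>i. f (t + 2 + i)) (n * 2) @
      f (t + 2 + 2 * n) @ cmap (\<lambda>i. f (t + 3 + 2 * n + i)) l @ cmap (\<lambda>i. f (t + 3 + 2 * n + l + i)) (t + 1) @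
      f (2 * t + 4 + 2 * n + l)"
    unfolding w cmap_add by (simp add: ac_simps eval_nat_numeral)
  have 1: "f 0 = F I0 0" by (subst f) (simp_all add: w d)
  have 2: "cmap (\<lambda>i. f (1 + i)) t = cmap (\<lambda>i. F IB (1 + i)) t"
    by (rule cmap_cong, subst f) (simp_all add: w d)
  have 3: "f (t + 1) = F IH (t + 1)" by (subst f) (simp_all add: w d)
  have 4: "cmap (\<lambda>i. f (t + 2 + i)) (n * 2) =
     cmap (\<lambda>j. F (IS 2) (t + 2 + 2 * j) @ F (IS (if x ! j then 2 else 1)) (t + 3 + 2 * j)) n"
  proof (subst cmap_mult, rule cmap_cong)
    fix j assume j: "j < n"
    have "f (t + 2 + 2 * j) = F (IS 2) (t + 2 + 2 * j)"
      by (subst f) (use j enc_bits_nth(1)[of j x] in \<open>simp_all add: w d\<close>)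
    moreover have "f (t + 2 + (2 * j + 1)) = F (IS (if x ! j then 2 else 1)) (t + 2 + (2 * j + 1))"
      by (subst f) (use j enc_bits_nth(2)[of j x] in \<open>simp_all add: w d\<close>)
    ultimately show "cmap (\<lambda>p. f (t + 2 + (j * 2 + p))) 2 =
        F (IS 2) (t + 2 + 2 * j) @ F (IS (if x ! j then 2 else 1)) (t + 3 + 2 * j)"
      by (simp add: eval_nat_numeral ac_simps)
  qed
  have 5: "f (t + 2 + 2 * n) = F (IS 1) (t + 2 + 2 * n)"
    by (subst f) (use enc_bits_nth(3)[of x] in \<open>simp_all add: w d\<close>)
  have 6: "cmap (\<lambda>i. f (t + 3 + 2 * n + i)) l = cmap (\<lambda>i. F IG (t + 3 + 2 * n + i)) l"
    by (rule cmap_cong, subst f) (simp_all add: w d)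
  have 7: "cmap (\<lambda>i. f (t + 3 + 2 * n + l + i)) (t + 1) = cmap (\<lambda>i. F IB (t + 3 + 2 * n + l + i)) (t + 1)"
    by (rule cmap_cong, subst f) (simp_all add: w d)
  have 8: "f (2 * t + 4 + 2 * n + l) = F IE (2 * t + 4 + 2 * n + l)" by (subst f) (simp_all add: w d)
  have wm: "width n - 1 = 2 * t + 4 + 2 * n + l" by (simp add: w)
  have ev: "eval (cell_prog out cl i) x env' = F cl (aval i env')" if "env' 0 = n" for cl i env'
    using eval_cell that by (simp add: F_def n_def)
  have av: "aval aT env' = t" "aval aG env' = l" "aval aWm env' = 2 * t + 4 + 2 * n + l" if "env' 0 = n" for env'
    using that wm by (simp_all add: aT aG avals t_def l_def)
  have e': "env 0 = n" using e by (simp add: n_def)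
  have "eval (row_first out) x env = F I0 0 @ cmap (\<lambda>i. F IB (1 + i)) t @ F IH (t + 1) @
     cmap (\<lambda>j. F (IS 2) (t + 2 + 2 * j) @ F (IS (if x ! j then 2 else 1)) (t + 3 + 2 * j)) n @
     F (IS 1) (t + 2 + 2 * n) @ cmap (\<lambda>i. F IG (t + 3 + 2 * n + i)) l @
     cmap (\<lambda>i. F IB (t + 3 + 2 * n + l + i)) (t + 1) @ F IE (2 * t + 4 + 2 * n + l)"
    unfolding row_first_def Let_def eval_seqs
    by (simp del: eval.simps(3) cmap_simps add: eval_For ev av e' eval_seqs if_distrib[of "\<lambda>c. F (IS c) _"] cong: if_cong)
  also have "\<dots> = cmap f (width n)" by (simp only: split 1 2 3 4 5 6 7 8)
  finally show ?thesis by (simp only: f_def[abs_def] F_def n_def)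
qed

lemma eval_row_step:
  assumes e: "env 0 = length x" "env 1 < time (length x)"
  shows "eval (row_step out) x env = cmap (\<lambda>p. cell_text g (length x)
    (cell_of x ((env 1 + 1) * width (length x) + p)) ((env 1 + 1) * width (length x) + p)) (width (length x))"
proof -
  define n t l where "n = length x" and "t = time n" and "l = guess n"
  define F where "F = cell_text g n"
  define b where "b = (env 1 + 1) * width n"
  define f where "f p = F (cell_of x (b + p)) (b + p)" for p
  interpret tableau M x l t by unfold_locales (rule M)+
  have w: "width n = 1 + (2 * t + (3 + (2 * n + l))) + 1" by (simp add: width_def t_def l_def)
  have f: "f p = F (cell_at (env 1 + 1) p) (b + p)" if "p < width n" for p
    using cell_of_row[of p x "env 1 + 1"] that unfolding f_def b_def n_def t_def l_def by (simp only:)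
  have e': "env 0 = n" "env 1 < t" using e by (simp_all add: n_def t_def)
  note d = cell_at_def gs_def p0_def Wm_def n_def[symmetric]
  have split: "cmap f (width n) = f 0 @ cmap (\<lambda>i. f (1 + i)) (2 * t + (3 + (2 * n + l))) @ f (2 * t + 4 + 2 * n + l)"
    unfolding w cmap_add[of _ "1 + (2 * t + (3 + (2 * n + l)))" 1] cmap_add[of _ 1 "2 * t + (3 + (2 * n + l))"]
    by (simp add: ac_simps eval_nat_numeral)
  have 1: "f 0 = F Lf b" by (subst f) (use e' in \<open>simp_all add: w d\<close>)
  have 2: "cmap (\<lambda>i. f (1 + i)) (2 * t + (3 + (2 * n + l))) = cmap (\<lambda>i. F Cc (b + (1 + i))) (2 * t + (3 + (2 * n + l)))"
    by (rule cmap_cong, subst f) (use e' in \<open>simp_all add: w d\<close>)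
  have 3: "f (2 * t + 4 + 2 * n + l) = F Rt (b + (2 * t + 4 + 2 * n + l))"
    by (subst f) (use e' in \<open>simp_all add: w d\<close>)
  have wm: "width n - 1 = 2 * t + 4 + 2 * n + l" by (simp add: w)
  have ev: "eval (cell_prog out cl i) x env' = F cl (aval i env')" if "env' 0 = n" for cl i env'
    using eval_cell that by (simp add: F_def n_def)
  have av: "aval aT env' = t" "aval aG env' = l" "aval aWm env' = 2 * t + 4 + 2 * n + l"
    "aval aW env' = width n" if "env' 0 = n" for env'
    using that wm by (simp_all add: aT aG avals t_def l_def)
  have "eval (row_step out) x env = F Lf b @ cmap (\<lambda>i. F Cc (b + (1 + i))) (2 * t + (3 + (2 * n + l))) @
     F Rt (b + (2 * t + 4 + 2 * n + l))"
    unfolding row_step_def Let_def eval_seqs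
    by (simp del: eval.simps(3) cmap_simps add: eval_For ev av e'(1) b_def algebra_simps)
  also have "\<dots> = cmap f (width n)" by (simp only: split 1 2 3)
  finally show ?thesis by (simp only: f_def[abs_def] F_def b_def n_def)
qed

lemma eval_row_last:
  assumes e: "env 0 = length x"
  shows "eval (row_last out) x env = cmap (\<lambda>p. cell_text g (length x)
    (cell_of x ((time (length x) + 1) * width (length x) + p)) ((time (length x) + 1) * width (length x) + p)) (width (length x))"
proof -
  define n t l where "n = length x" and "t = time n" and "l = guess n"
  define F where "F = cell_text g n"
  define b where "b = (t + 1) * width n"
  define f where "f p = F (cell_of x (b + p)) (b + p)" for p
  interpret tableau M x l t by unfold_locales (rule M)+
  have w: "width n = 1 + (t + 1) + 1 + 1 + (t + (1 + (2 * n + l)))" by (simp add: width_def t_def l_def)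
  have f: "f p = F (cell_at (t + 1) p) (b + p)" if "p < width n" for p
    using cell_of_row[of p x "t + 1"] that unfolding f_def b_def n_def t_def l_def by (simp only:)
  have e': "env 0 = n" using e by (simp add: n_def)
  note d = cell_at_def gs_def p0_def Wm_def n_def[symmetric]
  have split: "cmap f (width n) = f 0 @ cmap (\<lambda>i. f (1 + i)) (t + 1) @ f (t + 2) @ f (t + 3) @
      cmap (\<lambda>i. f (t + (4 + i))) (t + (1 + (2 * n + l)))"
    unfolding w cmap_add[of _ "1 + (t + 1) + 1 + 1" "t + (1 + (2 * n + l))"] cmap_add[of _ "1 + (t + 1) + 1" 1]
      cmap_add[of _ "1 + (t + 1)" 1] cmap_add[of _ 1 "t + 1"]
    by (simp add: ac_simps eval_nat_numeral)
  have 1: "f 0 = F FL b" by (subst f) (simp_all add: w d)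
  have 2: "cmap (\<lambda>i. f (1 + i)) (t + 1) = cmap (\<lambda>i. F FN (b + (1 + i))) (t + 1)"
    by (rule cmap_cong, subst f) (simp_all add: w d)
  have 3: "f (t + 2) = F F0 (b + (t + 2))" "f (t + 3) = F F1 (b + (t + 3))"
    by (subst f; simp add: w d)+
  have 4: "cmap (\<lambda>i. f (t + (4 + i))) (t + (1 + (2 * n + l))) = cmap (\<lambda>i. F FN (b + (t + (4 + i)))) (t + (1 + (2 * n + l)))"
    by (rule cmap_cong, subst f) (simp_all add: w d)
  have ev: "eval (cell_prog out cl i) x env' = F cl (aval i env')" if "env' 0 = n" for cl i env'
    using eval_cell that by (simp add: F_def n_def)
  have av: "aval aT env' = t" "aval aG env' = l" "aval aW env' = width n" if "env' 0 = n" for env'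
    using that by (simp_all add: aT aG avals t_def l_def)
  have "eval (row_last out) x env = F FL b @ cmap (\<lambda>i. F FN (b + (1 + i))) (t + 1) @ F F0 (b + (t + 2)) @
     F F1 (b + (t + 3)) @ cmap (\<lambda>i. F FN (b + (t + (4 + i)))) (t + (1 + (2 * n + l)))"
    unfolding row_last_def Let_def eval_seqs
    by (simp del: eval.simps(3) cmap_simps add: eval_For ev av e' b_def algebra_simps)
  also have "\<dots> = cmap f (width n)" by (simp only: split 1 2 3 4)
  finally show ?thesis by (simp only: f_def[abs_def] F_def b_def t_def n_def)
qed

lemma eval_edges:
  assumes e: "env 0 = length x"
  shows "eval (edge_prog out) x env = concat (map g (edge_descs x))"
proof -
  define n where "n = length x"
  have o: "eval (out a) x env' = g (adval env' a)" if "env' 0 = n" "\<forall>j. a = AY j \<longrightarrow> aval j env' \<noteq> 1" for a env'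
    using out that unfolding valid_out_def n_def by blast
  have e': "env 0 = n" using e by (simp add: n_def)
  have es: "eval (slot_prog out s c j) x env' = lit_text g (slot_lits cols (aval s env') c (aval j env'))"
    if "env' 0 = n" for s c j env'
    using eval_slot that by (simp add: n_def)
  have P: "0 < P" using good by (simp add: good_template_def)
  let ?cs = "cmap (\<lambda>i. cell_text g n (cell_of x i) i) (cells n)"
  have rows: "eval (row_first out) x env @ eval (For 1 aT (row_step out)) x env @ eval (row_last out) x env = ?cs"
  proof -
    let ?r = "\<lambda>r. cmap (\<lambda>p. cell_text g n (cell_of x (r * width n + p)) (r * width n + p)) (width n)"
    have "?cs = cmap ?r (1 + time n + 1)"
      unfolding cells_def by (subst cmap_mult) simp
    also have "\<dots> = ?r 0 @ cmap (\<lambda>i. ?r (1 + i)) (time n) @ ?r (time n + 1)"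
      unfolding cmap_add[of _ "1 + time n" 1] cmap_add[of _ 1 "time n"] by simp
    also have "?r 0 = eval (row_first out) x env" by (simp add: eval_row_first[of env, OF e] n_def)
    also have "cmap (\<lambda>i. ?r (1 + i)) (time n) = eval (For 1 aT (row_step out)) x env"
      unfolding eval_For aT(2) e' by (rule cmap_cong) (use e in \<open>simp add: eval_row_step n_def\<close>)
    also have "?r (time n + 1) = eval (row_last out) x env" by (simp add: eval_row_last[of env, OF e] n_def)
    finally show ?thesis by simp
  qed
  have N0: "0 < cells n" by (simp add: cells_def width_def)
  have zslot: "csp.zslot (cells n) (width n - 1) = 2 * (cells n + (width n - 1))"
    unfolding csp_defs using N0 by simp
  have links: "lit_text g (csp.link_list cols (ok_cell M) (cell_of x) (cells n) (width n - 1) (Fin True)) =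
      lit_text g (slot_lits cols (2 * (cells n + (width n - 1))) (Fin True) 0) @ ?cs"
    unfolding csp.link_list_def[OF csp'] zslot csp.term_of_def[OF csp'] csp.code_def[OF csp']
      lit_text_append lit_text_concat cell_text_def cmap_def ..
  have Ys: "concat (map g (map Y [2..<nR n])) = cmap (\<lambda>j. g (Y (2 + j))) (2 * K * cells n)"
  proof -
    have eq: "[2..<nR n] = map (\<lambda>j. j + 2) [0..<2 * K * cells n]" unfolding csp_defs map_add_upt by (simp add: add.commute)
    show ?thesis unfolding eq cmap_def by (simp add: comp_def)
  qed
  have "edge_descs x = [Y 0, Y 1] @ concat (map (\<lambda>b. map (Chain b) [0..<P]) [0..<nR n + nU n]) @
     map Y [2..<nR n] @ concat (map (\<lambda>u. [U1 u, U2 u, D0 u]) [0..<nU n]) @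
     map (\<lambda>(u, b, j). Link u b j) (csp.link_list cols (ok_cell M) (cell_of x) (cells n) (width n - 1) (Fin True))"
    by (simp only: edge_descs_def desc_list_def n_def)
  then have "concat (map g (edge_descs x)) = g (Y 0) @ g (Y 1) @
      concat (map g (concat (map (\<lambda>b. map (Chain b) [0..<P]) [0..<nR n + nU n]))) @ concat (map g (map Y [2..<nR n])) @
      concat (map g (concat (map (\<lambda>u. [U1 u, U2 u, D0 u]) [0..<nU n]))) @
      lit_text g (csp.link_list cols (ok_cell M) (cell_of x) (cells n) (width n - 1) (Fin True))"
    by (simp only: map_append concat_append lit_text_def list.map concat.simps append_Nil2 append_assoc)
  also have "\<dots> = g (Y 0) @ g (Y 1) @
      cmap (\<lambda>b. cmap (\<lambda>i. g (Chain b i)) P) (nR n + nU n) @ cmap (\<lambda>j. g (Y (2 + j))) (2 * K * cells n) @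
      cmap (\<lambda>u. g (U1 u) @ g (U2 u) @ g (D0 u)) (nU n) @
      lit_text g (slot_lits cols (2 * (cells n + (width n - 1))) (Fin True) 0) @ ?cs"
    unfolding Ys links unfolding concat_map_concat concat_map_map by (simp add: cmap_def)
  also have "\<dots> = eval (edge_prog out) x env"
    unfolding edge_prog_def eval_seqs list.map concat.simps rows[symmetric]
    by (simp del: eval.simps(3) cmap_simps add: eval_For[of _ "Plus a b" for a b] eval_For[of _ "Const k" for k]
        eval_For[of _ "Times a b" for a b] eval_For[of _ aU] avals e' o es
        cmap_first[OF P] eval_seqs)
  finally show ?thesis by simp
qed

end

definition closed_out :: "(adesc \<Rightarrow> em) \<Rightarrow> bool" where
  "closed_out out \<longleftrightarrow> (\<forall>a A. advars a \<subseteq> A \<longrightarrow> 0 \<in> A \<longrightarrow> scoped A (out a)) \<and> (\<forall>a n env. bit_ok (out a) n env)"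

context
  fixes out assumes out: "closed_out out"
begin

lemma sub:
  assumes "0 \<in> S"
  shows "avars aWm \<subseteq> S" "avars aW \<subseteq> S" "avars aN \<subseteq> S" "avars aR \<subseteq> S" "avars aU \<subseteq> S" "avars aG \<subseteq> S" "avars aT \<subseteq> S"
proof -
  have "{0} \<subseteq> S" using assms by simp
  from avars_sub[THEN subset_trans, OF this] aG(1)[THEN subset_trans, OF this] aT(1)[THEN subset_trans, OF this]
  show "avars aWm \<subseteq> S" "avars aW \<subseteq> S" "avars aN \<subseteq> S" "avars aR \<subseteq> S" "avars aU \<subseteq> S" "avars aG \<subseteq> S" "avars aT \<subseteq> S" .
qed

lemma closed_adesc: "advars a \<subseteq> S \<Longrightarrow> 0 \<in> S \<Longrightarrow> scoped S (out a)" "bit_ok (out a) n env"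
  using out by (auto simp: closed_out_def)

lemma closed_slot: "avars s \<union> avars j \<subseteq> S \<Longrightarrow> 0 \<in> S \<Longrightarrow> scoped S (slot_prog out s c j)" "bit_ok (slot_prog out s c j) n env"
  by (auto simp: slot_prog_def closed_seqs bit_ok_seqs closed_adesc)

lemma closed_term: "avars i \<union> avars j \<subseteq> S \<Longrightarrow> 0 \<in> S \<Longrightarrow> scoped S (term_prog out cl i j q)" "bit_ok (term_prog out cl i j q) n env"
  by (cases q; simp add: term_prog_def Let_def closed_adesc closed_slot sub)+

lemma closed_cell: "avars i \<subseteq> S \<Longrightarrow> 0 \<in> S \<Longrightarrow> scoped S (cell_prog out cl i)" "bit_ok (cell_prog out cl i) n env"
  by (simp_all add: cell_prog_def closed_seqs bit_ok_seqs closed_term)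

lemma closed_edges: "scoped {0} (edge_prog out)" "env 0 = n \<Longrightarrow> bit_ok (edge_prog out) n env"
  by (simp_all add: edge_prog_def row_first_def row_step_def row_last_def Let_def closed_adesc closed_slot
      closed_cell sub)

end

end

locale hardness = program A B M pA pB cols aG aT T t0 t1
  for A B M pA pB cols aG aT T t0 t1 +
  assumes draw: "drawable T" and ul: "ul T = (8 * K + 2) * yl T"
begin

abbreviation "links x \<equiv> csp.links cols (ok_cell M) (cell_of x) (cells (length x)) (width (length x) - 1) (Fin True)"

definition scale_exp :: "nat \<Rightarrow> nat" where "scale_exp k = 3 * P + 3 * (nR k + nU k) + 6"

definition budget :: "nat \<Rightarrow> nat" where
  "budget k = (nR k + nU k) * P + yl T * ((8 * K + 2) * nU k + 2 * (K - 1) * cells k) + 1"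

text \<open>Any exponent \<open>c\<close> with \<open>last T < 2 ^ c\<close> would do; taking
  \<open>last T\<close> itself makes it a constant of the program.\<close>

lemma drawing: "drawing T t0 t1 P"
  by unfold_locales (rule good draw less_exp)+

lemma positive: "half T < turn1 T" "2 * half T < turn2 T" "0 < port1 T" "0 < P"
  using good by (auto simp: good_template_def)

lemma layoutI:
  fixes x :: "bool list" and \<nu> :: "nat \<Rightarrow> nat \<Rightarrow> 'v"
  defines "k \<equiv> length x"
  assumes "\<And>b. \<nu> b 0 = \<nu> 0 0"
    "\<And>b i b' i'. i \<le> P \<Longrightarrow> i' \<le> P \<Longrightarrow> \<nu> b i = \<nu> b' i' \<Longrightarrow> i = i' \<and> (i = 0 \<or> b = b')"
  shows "layout T t0 t1 (nR k) (nU k) (links x) \<nu>"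
proof
  show "2 \<le> nR k" unfolding csp_defs by simp
  show "u < nU k \<and> j < nR k \<and> j \<noteq> 1" if "(u, b, j) \<in> links x" for u b j
    unfolding k_def by (rule csp.links_range[OF csp' that])
  show "finite (links x)" by (rule csp.finite_links[OF csp'])
qed (use good assms in auto)

lemma edge_descs: "distinct (edge_descs x)"
  "set (edge_descs x) = descs T (nR (length x)) (nU (length x)) (links x)"
  "2 \<le> length (edge_descs x)" "edge_descs x ! 0 = Y 0" "edge_descs x ! 1 = Y 1"
proof -
  show "distinct (edge_descs x)"
    unfolding edge_descs_def by (intro distinct_desc_list csp.distinct_link_list[OF csp'])
  have "2 \<le> nR (length x)" unfolding csp_defs by simp
  then show "set (edge_descs x) = descs T (nR (length x)) (nU (length x)) (links x)"
    unfolding edge_descs_def by (simp only: set_desc_list csp.set_link_list[OF csp'])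
qed (simp_all add: edge_descs_def desc_list_def)

lemma reductionI:
  assumes "instance_graph T t0 t1 (nR (length x)) (nU (length x)) (links x) \<nu> GC I \<Lambda> \<epsilon> (edge_descs x)"
  shows "reduction cols (ok_cell M) (cell_of x) (cells (length x)) (width (length x) - 1) (Fin True) T t0 t1
    \<nu> GC I \<Lambda> \<epsilon> (edge_descs x) (x \<in> A)"
  by (rule reduction.intro[OF csp' assms], rule reduction_axioms.intro)
    (use ul edge_descs solution_exists[of x] solution_iff[of x] in simp_all)

context
  fixes GC :: "('i, 'v) graph_class" and I \<nu> \<Lambda> \<epsilon>
  assumes inst: "\<And>x. instance_graph T t0 t1 (nR (length x)) (nU (length x)) (links x) (\<nu> x) GC (I x) (\<Lambda> x) (\<epsilon> x) (edge_descs x)"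
begin

lemmas red = reductionI[OF inst]

lemma V_budget:
  fixes x :: "bool list"
  shows "reduction.V cols (cells (length x)) (width (length x) - 1) T = budget (length x)"
  unfolding reduction.V_def[OF red] reduction.base_def[OF red] budget_def ..

text \<open>Membership of the printed word in the language might be due to another instance with the
  same code; prefix-freeness rules this out.\<close>

lemma decision_hard:
  assumes pf: "prefix_free (encode GC)" and E: "well_formed E"
    and ev: "\<And>x. eval E x (lenv x) = encode GC (I x) @ enc_rat (w x)"
    and w: "\<And>x. of_rat (w x) = \<Lambda> x * real (budget (length x))" "\<And>x. 0 < w x"
  shows "poly_reducible A (LWS GC t1)" "poly_reducible A (LWPS GC t1)"
proof -
  have inj: "I' = I x \<and> w' = w x" if "encode GC I' @ enc_rat w' = encode GC (I x) @ enc_rat (w x)" for I' w' x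
    using prefix_freeD[OF prefix_free_pair[OF pf prefix_free_rat], of "(I', w')" "[]" "(I x, w x)" "[]"] that by simp
  note li = reduction.light_iff[OF red, unfolded V_budget w(1)[symmetric]]
  have input: "I x \<in> inputs GC" for x using instance_graph.input[OF inst] .
  have "x \<in> A \<longleftrightarrow> eval E x (lenv x) \<in> LWS GC t1" for x
    using li[of "\<lambda>H. True" x] input[of x] w(2)[of x] inj[of _ _ x] unfolding ev LWS_def by auto
  then show "poly_reducible A (LWS GC t1)"
    unfolding poly_reducible_def using poly_time_eval[OF E] by blast
  have "x \<in> A \<longleftrightarrow> eval E x (lenv x) \<in> LWPS GC t1" for x
    using li[of "is_plane GC" x] input[of x] w(2)[of x] inj[of _ _ x] unfolding ev LWPS_def by auto
  then show "poly_reducible A (LWPS GC t1)"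
    unfolding poly_reducible_def using poly_time_eval[OF E] by blast
qed

text \<open>The bit at position \<open>Suc 0\<close>, behind the leading \<open>True\<close>,
  belongs to \<open>Y 0\<close>. It is negated because a minimum spanner contains this edge exactly
  for rejected words.\<close>

lemma search_hard:
  assumes E: "well_formed E" and ev: "\<And>x. eval E x (lenv x) = encode GC (I x)"
  shows "Turing_reducible A (MWS GC t1)" "Turing_reducible A (MWPS GC t1)"
  by (rule Turing_reducible_eval[OF E, of _ "Suc 0" True], unfold ev,
      rule reduction.MWS_answer[OF red] reduction.MWPS_answer[OF red], assumption)+

lemma MDG_hard:
  assumes E: "well_formed E"
    and ev: "\<And>x. eval E x (lenv x) = encode GC (I x) @ enc_rat (w x)"
    and w: "\<And>x. of_rat (w x) = \<Lambda> x * real (budget (length x) + yl T)" "\<And>x. 0 < w x"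
    and gap: "t0 * zl T + 1 \<le> zl T + 4 * half T"
  shows "Turing_reducible A (MDG GC)"
proof (rule Turing_reducible_eval[OF E, of _ "Suc 1" False], unfold ev)
  fix x f assume f: "solves f (MDG GC)"
  show "Suc 1 < length (f (encode GC (I x) @ enc_rat (w x))) \<and> (f (encode GC (I x) @ enc_rat (w x)) ! Suc 1 \<noteq> False) = (x \<in> A)"
    by (rule reduction.MDG_answer[OF red f gap]) (simp_all only: V_budget w)
qed

end

fun aends :: "adesc \<Rightarrow> aexp \<times> aexp" where
  "aends (AChain0 b) = (Const 0, Plus (cst P b) (Const 1))"
| "aends (AChain b i) = (Plus (cst P b) (Plus i (Const 1)), Plus (cst P b) (Plus i (Const 2)))"
| "aends AZ = (Const (P + (turn2 T - 2 * half T)), Const (P + (turn2 T + 2 * half T + zl T)))"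
| "aends (AY j) = (Plus (cst P j) (Const (turn2 T - 2 * half T)), Plus (cst P j) (Const (turn2 T + 2 * half T + yl T)))"
| "aends (AU1 u) = (Plus (cst P (Plus aR u)) (Const (turn1 T - half T)),
     Plus (cst P (Plus aR u)) (Const (turn1 T + half T + ul T)))"
| "aends (AU2 u) = (Plus (cst P (Plus aR u)) (Const (turn2 T - 2 * half T)),
     Plus (cst P (Plus aR u)) (Const (turn2 T + 2 * half T + ul T)))"
| "aends (AD0 u) = (Const 0, Plus (cst P (Plus aR u)) (Const P))"
| "aends (ALink u b j) = (Plus (cst P j) (Const P), Plus (cst P (Plus aR u)) (Const (if b then P else port1 T)))"

fun alen :: "adesc \<Rightarrow> nat" where
  "alen (AChain0 b) = 1"
| "alen (AChain b i) = 1"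
| "alen AZ = zl T"
| "alen (AY j) = yl T"
| "alen (AU1 u) = ul T"
| "alen (AU2 u) = ul T"
| "alen (AD0 u) = pos2 T"
| "alen (ALink u b j) = (if b then 2 * pos2 T else pos1 T + pos2 T)"

lemma aends_index:
  assumes "\<forall>j. a = AY j \<longrightarrow> aval j env \<noteq> 1"
  shows "edge_index T (nR (env 0)) (adval env a) = (aval (fst (aends a)) env, aval (snd (aends a)) env)"
    "len T (adval env a) = alen a"
  using assms positive by (cases a; simp add: edge_index_def index_def avals ylen_def mult.commute)+

lemma avars_ends: "advars a \<subseteq> S \<Longrightarrow> 0 \<in> S \<Longrightarrow> avars (fst (aends a)) \<subseteq> S \<and> avars (snd (aends a)) \<subseteq> S"
  using avars_sub by (cases a) auto

definition geo_out :: "adesc \<Rightarrow> em" where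
  "geo_out a = seqs [Out [True], Num (fst (aends a)), Num (snd (aends a))]"

definition wei_out :: "adesc \<Rightarrow> em" where
  "wei_out a = seqs [Out [True], Num (fst (aends a)), Num (snd (aends a)), Out (enc_rat (of_nat (alen a)))]"

lemma closed_outs: "closed_out geo_out" "closed_out wei_out"
  by (simp_all add: closed_out_def geo_out_def wei_out_def avars_ends)

lemma valid_outs:
  "valid_out x geo_out (\<lambda>d. True # (case edge_index T (nR (length x)) d of (i, j) \<Rightarrow> enc_nat i @ enc_nat j))"
  "valid_out x wei_out (\<lambda>d. True # (case edge_index T (nR (length x)) d of (i, j) \<Rightarrow>
     enc_nat i @ enc_nat j @ enc_rat (of_nat (len T d))))"
proof -
  have ends: "edge_index T (nR (length x)) (adval env a) = (aval (fst (aends a)) env, aval (snd (aends a)) env)"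
    if "env 0 = length x" "\<forall>j. a = AY j \<longrightarrow> aval j env \<noteq> 1" for a env
    using aends_index(1)[OF that(2)] that(1) by simp
  show "valid_out x geo_out (\<lambda>d. True # (case edge_index T (nR (length x)) d of (i, j) \<Rightarrow> enc_nat i @ enc_nat j))"
    unfolding valid_out_def geo_out_def by (auto simp del: One_nat_def simp: ends)
  show "valid_out x wei_out (\<lambda>d. True # (case edge_index T (nR (length x)) d of (i, j) \<Rightarrow>
     enc_nat i @ enc_nat j @ enc_rat (of_nat (len T d))))"
    unfolding valid_out_def wei_out_def by (auto simp del: One_nat_def simp: ends aends_index(2))
qed

end

section \<open>Coordinates, weights and budgets\<close>

context hardness begin

definition aExp :: aexp where "aExp = Plus (cst 3 (Plus aR aU)) (Const (3 * P + 6))"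
definition aBudget :: "nat \<Rightarrow> aexp" where
  "aBudget e = Plus (cst P (Plus aR aU)) (Plus (cst (yl T * (8 * K + 2)) aU)
     (Plus (cst (yl T * (2 * (K - 1))) aN) (Const (1 + e))))"

lemma aval_exp: "aval aExp env = scale_exp (env 0)"
  by (simp add: aExp_def scale_exp_def avals)

lemma aval_budget: "aval (aBudget e) env = budget (env 0) + e"
  by (simp add: aBudget_def budget_def avals algebra_simps)

lemma sub0:
  assumes "0 \<in> S"
  shows "avars aN \<subseteq> S" "avars aR \<subseteq> S" "avars aU \<subseteq> S" "avars aExp \<subseteq> S" "avars (aBudget e) \<subseteq> S"
proof -
  have "{0} \<subseteq> S" using assms by simp
  note s = avars_sub[THEN subset_trans, OF this]
  show "avars aN \<subseteq> S" "avars aR \<subseteq> S" "avars aU \<subseteq> S" by (rule s)+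
  then show "avars aExp \<subseteq> S" "avars (aBudget e) \<subseteq> S" by (simp_all add: aExp_def aBudget_def)
qed

abbreviation "mm x \<equiv> scale_exp (length x)"
abbreviation "geo x \<equiv> drawing.geometric_inst T (nR (length x)) (nU (length x)) P (mm x) (edge_descs x)"
abbreviation "wei x \<equiv> drawing.weighted_inst T (nR (length x)) (nU (length x)) (edge_descs x)"

lemma geo_instance:
  "instance_graph T t0 t1 (nR (length x)) (nU (length x)) (links x)
     (drawing.pt T (nR (length x)) P (mm x)) geometric (geo x) (2 ^ mm x)
     (drawing.err T (nR (length x)) (nU (length x)) P (mm x)) (edge_descs x)"
proof (rule drawing.geometric_inst[OF drawing _ _ edge_descs(1,2)])
  show "layout T t0 t1 (nR (length x)) (nU (length x)) (links x) (drawing.pt T (nR (length x)) P (mm x))"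
    by (rule layoutI) (use drawing.pt_hub[OF drawing] drawing.pt_inj[OF drawing] in auto)
qed (simp add: scale_exp_def)

lemma wei_instance:
  "instance_graph T t0 t1 (nR (length x)) (nU (length x)) (links x)
     (\<lambda>b i. index P (b, i)) weighted (wei x) 1 0 (edge_descs x)"
proof (rule drawing.weighted_inst[OF drawing _ _ edge_descs(1,2)])
  show "layout T t0 t1 (nR (length x)) (nU (length x)) (links x) (drawing.pt T (nR (length x)) P (mm x))"
    by (rule layoutI) (use drawing.pt_hub[OF drawing] drawing.pt_inj[OF drawing] in auto)
  show "layout T t0 t1 (nR (length x)) (nU (length x)) (links x) (\<lambda>b i. index P (b, i))"
  proof (rule layoutI)
    fix b i b' i' assume i: "i \<le> P" "i' \<le> P" and e: "index P (b, i) = index P (b', i')"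
    show "i = i' \<and> (i = 0 \<or> b = b')"
      using arg_cong[OF e, of "vertex P"] i by (auto simp: vertex_index split: if_splits)
  qed (simp add: index_def)
qed

definition wei_prog :: em where
  "wei_prog = seqs [For 1 (cst P (Plus aR aU)) (Out [True]), Out [True, False], edge_prog wei_out, Out [False]]"

lemma eval_wei: "eval wei_prog x (lenv x) = encode weighted (wei x)"
proof -
  have l: "lenv x 0 = length x" by (simp add: lenv_def)
  have "concat (map (\<lambda>i. [True]) [0..<n]) = replicate n True" for n
    by (induction n) (auto simp: replicate_append_same)
  moreover have "replicate n True @ True # y = True # replicate n True @ y" for n y
    by (metis replicate_app_Cons_same)
  ultimately show ?thesis
    unfolding wei_prog_def eval_seqs drawing.weighted_inst_def[OF drawing] weighted_def enc_list_def
    by (simp add: eval_edges[where env = "lenv x", OF valid_outs(2) l] avals l case_prod_beta comp_def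
      mult.commute[of P] del: One_nat_def) (simp add: Suc_eq_plus1[symmetric] del: Suc_eq_plus1)
qed

text \<open>The first coordinate is printed as its sign, \<open>scale_exp\<close> zeros and the
  digits of \<open>xpos\<close>; the second as its sign, the \<open>P\<close> low digits that hold
  \<open>i\<close>, then \<open>b\<close> zeros, then the digits of \<open>xpos\<close> again. Each
  ends with the denominator 1.\<close>

definition pt_prog :: "bool \<Rightarrow> aexp \<Rightarrow> nat \<Rightarrow> em" where
  "pt_prog s b i = (let z = payload (bin (nat (xpos T i))) @ [False] @ enc_nat 1 in
     seqs [Out [True, s], For 2 aExp (Out [True, False]),
       Out (z @ [s] @ payload (map (\<lambda>j. odd (i div 2 ^ j)) [0..<P])), For 2 b (Out [True, False]), Out z])"

definition geo_prog :: em where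
  "geo_prog = seqs [Out (True # enc_rat 0 @ enc_rat 0),
     For 1 aR (seqs (map (\<lambda>i. pt_prog False (Var 1) (Suc i)) [0..<P])),
     For 1 aU (seqs (map (\<lambda>i. pt_prog True (Plus aR (Var 1)) (Suc i)) [0..<P])),
     Out [False], edge_prog geo_out, Out [False]]"

definition coord_text :: "nat \<Rightarrow> nat \<Rightarrow> nat \<Rightarrow> bool list" where
  "coord_text k b i = enc_rat (of_int (drawing.xc T (nR k) (scale_exp k) b i)) @
     enc_rat (of_int (drawing.yc T (nR k) P b i))"

lemma enc_rat_signed: "0 < z \<Longrightarrow> enc_rat (of_int (if s then - int z else int z)) = s # enc_nat z @ enc_nat 1"
  unfolding enc_rat_int by simp

lemma eval_pt:
  assumes e: "env 0 = k" and s: "s \<longleftrightarrow> \<not> aval b env < nR k" and i: "0 < i" "i \<le> P"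
  shows "eval (pt_prog s b i) x env = True # coord_text k (aval b env) i"
proof -
  define z where "z = nat (xpos T i)"
  have x: "1 \<le> xpos T i" using drawing.x_pos[OF drawing i] .
  then have z: "0 < z" "xpos T i = int z" by (simp_all add: z_def)
  have sg: "drawing.sg (nR k) (aval b env) = (if s then - 1 else 1)" by (simp add: drawing.sg_def[OF drawing] s)
  have "drawing.xc T (nR k) (scale_exp k) (aval b env) i = (if s then - int (2 ^ scale_exp k * z) else int (2 ^ scale_exp k * z))"
    by (simp add: drawing.xc_def[OF drawing] sg z(2))
  moreover have "0 < 2 ^ scale_exp k * z" using z(1) by simp
  ultimately have X: "enc_rat (of_int (drawing.xc T (nR k) (scale_exp k) (aval b env) i)) =
      s # enc_nat (2 ^ scale_exp k * z) @ enc_nat 1" by (simp only: enc_rat_signed)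
  have "drawing.yc T (nR k) P (aval b env) i = (if s then - int (2 ^ P * (2 ^ aval b env * z) + i) else int (2 ^ P * (2 ^ aval b env * z) + i))"
    by (simp add: drawing.yc_def[OF drawing] sg z(2) power_add mult.assoc)
  moreover have "0 < 2 ^ P * (2 ^ aval b env * z) + i" using z(1) by simp
  ultimately have Y: "enc_rat (of_int (drawing.yc T (nR k) P (aval b env) i)) =
      s # enc_nat (2 ^ P * (2 ^ aval b env * z) + i) @ enc_nat 1" by (simp only: enc_rat_signed)
  have "i < 2 ^ P" using i(2) less_exp[of P] by linarith
  then have low: "enc_nat (2 ^ P * (2 ^ aval b env * z) + i) =
      payload (map (\<lambda>j. odd (i div 2 ^ j)) [0..<P]) @ concat (replicate (aval b env) [True, False]) @ payload (bin z) @ [False]"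
    unfolding enc_nat_payload using z(1) by (simp add: bin_low bin_shift payload_append payload_replicate)
  have rep: "concat (map (\<lambda>i. [True, False]) [0..<n]) = concat (replicate n [True, False])" for n
    by (simp add: map_replicate_const)
  show ?thesis
    unfolding coord_text_def X Y low enc_nat_shift[OF z(1)] pt_prog_def Let_def eval_seqs z_def[symmetric]
    by (simp add: rep aval_exp e enc_nat_payload[of z])
qed

lemma geo_points:
  "enc_list (\<lambda>(a, b). enc_rat a @ enc_rat b) (drawing.points T (nR k) (nU k) P (scale_exp k)) =
   True # enc_rat 0 @ enc_rat 0 @
   cmap (\<lambda>b. cmap (\<lambda>i. True # coord_text k b (Suc i)) P) (nR k) @
   cmap (\<lambda>b. cmap (\<lambda>i. True # coord_text k (nR k + b) (Suc i)) P) (nU k) @ [False]"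
proof -
  let ?f = "\<lambda>n. True # coord_text k (fst (vertex P n)) (snd (vertex P n))"
  have "enc_list (\<lambda>(a, b). enc_rat a @ enc_rat b) (drawing.points T (nR k) (nU k) P (scale_exp k)) =
      cmap ?f (1 + (nR k + nU k) * P) @ [False]"
    unfolding drawing.points_def[OF drawing] enc_list_def cmap_def map_map comp_def
    by (simp add: coord_text_def case_prod_beta add.commute del: upt_Suc)
  also have "cmap ?f (1 + (nR k + nU k) * P) = ?f 0 @ cmap (\<lambda>b. cmap (\<lambda>i. ?f (1 + (b * P + i))) P) (nR k + nU k)"
    unfolding cmap_add cmap_mult by simp
  also have "cmap (\<lambda>b. cmap (\<lambda>i. ?f (1 + (b * P + i))) P) (nR k + nU k) =
      cmap (\<lambda>b. cmap (\<lambda>i. True # coord_text k b (Suc i)) P) (nR k + nU k)"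
    by (intro cmap_cong) (simp add: vertex_def)
  also have "?f 0 = True # enc_rat 0 @ enc_rat 0"
    by (simp add: vertex_def coord_text_def drawing.xc_def[OF drawing] drawing.yc_def[OF drawing] drawing.x0[OF drawing])
  finally show ?thesis by (simp add: cmap_add)
qed

lemma eval_geo: "eval geo_prog x (lenv x) = encode geometric (geo x)"
proof -
  let ?k = "length x"
  have l: "lenv x 0 = ?k" by (simp add: lenv_def)
  have 1: "eval (For 1 aR (seqs (map (\<lambda>i. pt_prog False (Var 1) (Suc i)) [0..<P]))) x (lenv x) =
      cmap (\<lambda>b. cmap (\<lambda>i. True # coord_text ?k b (Suc i)) P) (nR ?k)"
    unfolding eval_For avals l
  proof (rule cmap_cong)
    fix b assume b: "b < nR ?k"
    show "eval (seqs (map (\<lambda>i. pt_prog False (Var 1) (Suc i)) [0..<P])) x ((lenv x)(1 := b)) =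
        cmap (\<lambda>i. True # coord_text ?k b (Suc i)) P"
      unfolding eval_seqs concat_map_map cmap_def[symmetric]
      by (rule cmap_cong, subst eval_pt[of _ ?k]) (use b l in auto)
  qed
  have 2: "eval (For 1 aU (seqs (map (\<lambda>i. pt_prog True (Plus aR (Var 1)) (Suc i)) [0..<P]))) x (lenv x) =
      cmap (\<lambda>b. cmap (\<lambda>i. True # coord_text ?k (nR ?k + b) (Suc i)) P) (nU ?k)"
    unfolding eval_For avals l
  proof (rule cmap_cong)
    fix b
    show "eval (seqs (map (\<lambda>i. pt_prog True (Plus aR (Var 1)) (Suc i)) [0..<P])) x ((lenv x)(1 := b)) =
        cmap (\<lambda>i. True # coord_text ?k (nR ?k + b) (Suc i)) P"
      unfolding eval_seqs concat_map_map cmap_def[symmetric]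
      by (rule cmap_cong, subst eval_pt[of _ ?k]) (use l in \<open>auto simp: avals\<close>)
  qed
  have enc: "encode geometric (geo x) = enc_list (\<lambda>(a, b). enc_rat a @ enc_rat b)
        (drawing.points T (nR ?k) (nU ?k) P (mm x)) @
      concat (map (\<lambda>d. True # (case edge_index T (nR ?k) d of (i, j) \<Rightarrow> enc_nat i @ enc_nat j)) (edge_descs x)) @ [False]"
    by (simp add: geometric_def drawing.geometric_inst_def[OF drawing] enc_list_def comp_def)
  show ?thesis
    unfolding geo_prog_def eval_seqs list.map 1 2 enc geo_points
    by (simp add: eval_edges[where env = "lenv x", OF valid_outs(1) l])
qed

text \<open>The scale enters as zeros before the digits, as for the coordinates; \<open>e\<close> is
  0 or, for the dilation problem, the extra unit \<open>yl T\<close>.\<close>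

definition weight_prog :: "aexp \<Rightarrow> nat \<Rightarrow> em" where
  "weight_prog a e = seqs [Out [False], For 1 a (Out [True, False]), Num (aBudget e), Out (enc_nat 1)]"

lemma eval_weight: "env 0 = k \<Longrightarrow> eval (weight_prog a e) x env = enc_rat (of_nat (2 ^ aval a env * (budget k + e)))"
proof -
  assume e: "env 0 = k"
  have "0 < budget k + e" by (simp add: budget_def)
  note s = enc_nat_shift[OF this]
  have rep: "concat (map (\<lambda>i. [True, False]) [0..<n]) = concat (replicate n [True, False])" for n
    by (simp add: map_replicate_const)
  show ?thesis
    unfolding weight_prog_def eval_seqs enc_rat_nat s by (simp add: rep aval_budget e)
qed

lemma well_formed_progs: "well_formed wei_prog" "well_formed geo_prog"
  "well_formed (Seq wei_prog (weight_prog (Const 0) e))" "well_formed (Seq geo_prog (weight_prog aExp e))"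
proof -
  have pt: "scoped S (pt_prog s b i)" if "0 \<in> S" "2 \<notin> S" "avars b \<subseteq> S" for S s b i
    using that sub0[of S] by (simp add: pt_prog_def Let_def)
  have pt': "bit_ok (pt_prog s b i) n env" for s b i n env by (simp add: pt_prog_def Let_def)
  have w: "scoped {0} (weight_prog a e)" if "avars a \<subseteq> {0}" for a
    using that by (simp add: weight_prog_def sub0)
  have w': "bit_ok (weight_prog a e) n env" for a n env by (simp add: weight_prog_def)
  have "scoped {0} wei_prog" "scoped {0} geo_prog"
    by (simp_all add: wei_prog_def geo_prog_def closed_edges(1)[OF closed_outs(1)] closed_edges(1)[OF closed_outs(2)]
        sub0 closed_seqs pt)
  moreover have "bit_ok wei_prog (length x) (lenv x)" "bit_ok geo_prog (length x) (lenv x)" for x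
    by (simp_all add: wei_prog_def geo_prog_def closed_edges(2)[OF closed_outs(1)] closed_edges(2)[OF closed_outs(2)]
        bit_ok_seqs pt' lenv_def)
  ultimately show "well_formed wei_prog" "well_formed geo_prog"
    "well_formed (Seq wei_prog (weight_prog (Const 0) e))" "well_formed (Seq geo_prog (weight_prog aExp e))"
    by (simp_all add: well_formed_def w w' sub0)
qed

lemma budget_pos: "0 < budget k" by (simp add: budget_def)

lemma lenv0: "lenv x 0 = length x" by (simp add: lenv_def)

lemma eval_wei_weight: "eval (Seq wei_prog (weight_prog (Const 0) e)) x (lenv x) =
    encode weighted (wei x) @ enc_rat (of_nat (budget (length x) + e))"
  by (simp add: eval_wei eval_weight[where env = "lenv x", OF lenv0])

lemma eval_geo_weight: "eval (Seq geo_prog (weight_prog aExp e)) x (lenv x) =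
    encode geometric (geo x) @ enc_rat (of_nat (2 ^ mm x * (budget (length x) + e)))"
  by (simp add: eval_geo eval_weight[where env = "lenv x", OF lenv0] aval_exp lenv0)

theorem geometric_hard:
  "poly_reducible A (LWS geometric t1)" "poly_reducible A (LWPS geometric t1)"
  "Turing_reducible A (MWS geometric t1)" "Turing_reducible A (MWPS geometric t1)"
  "t0 * zl T + 1 \<le> zl T + 4 * half T \<Longrightarrow> Turing_reducible A (MDG geometric)"
proof -
  note ev = eval_geo_weight[of 0, unfolded add_0_right] eval_geo_weight[of "yl T"]
  show "poly_reducible A (LWS geometric t1)" "poly_reducible A (LWPS geometric t1)"
    by (rule decision_hard[OF geo_instance prefix_free_geometric well_formed_progs(4) ev(1)];
        simp add: budget_pos of_rat_mult of_rat_power)+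
  show "Turing_reducible A (MWS geometric t1)" "Turing_reducible A (MWPS geometric t1)"
    by (rule search_hard[OF geo_instance well_formed_progs(2) eval_geo])+
  show "Turing_reducible A (MDG geometric)" if "t0 * zl T + 1 \<le> zl T + 4 * half T"
    by (rule MDG_hard[OF geo_instance well_formed_progs(4) ev(2) _ _ that])
      (simp_all add: budget_pos of_rat_mult of_rat_power of_rat_add add_pos_nonneg)
qed

theorem weighted_hard:
  "poly_reducible A (LWS weighted t1)" "poly_reducible A (LWPS weighted t1)"
  "Turing_reducible A (MWS weighted t1)" "Turing_reducible A (MWPS weighted t1)"
  "t0 * zl T + 1 \<le> zl T + 4 * half T \<Longrightarrow> Turing_reducible A (MDG weighted)"
proof -
  note ev = eval_wei_weight[of 0, unfolded add_0_right] eval_wei_weight[of "yl T"]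
  show "poly_reducible A (LWS weighted t1)" "poly_reducible A (LWPS weighted t1)"
    by (rule decision_hard[OF wei_instance prefix_free_weighted well_formed_progs(3) ev(1)];
        simp add: budget_pos)+
  show "Turing_reducible A (MWS weighted t1)" "Turing_reducible A (MWPS weighted t1)"
    by (rule search_hard[OF wei_instance well_formed_progs(1) eval_wei])+
  show "Turing_reducible A (MDG weighted)" if "t0 * zl T + 1 \<le> zl T + 4 * half T"
    by (rule MDG_hard[OF wei_instance well_formed_progs(3) ev(2) _ _ that])
      (simp_all add: budget_pos of_rat_add add_pos_nonneg)
qed

end

section \<open>Assembling the reductions\<close>

lemma verifier_exists:
  assumes "in_NP A"
  obtains B M pA pB cols where "verifier A B M pA pB cols"
proof -
  obtain B pA where B: "poly_time_decidable B"
      "\<And>x. x \<in> A \<longleftrightarrow> (\<exists>y. length y \<le> poly pA (length x) \<and> enc_bits x @ y \<in> B)"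
    using assms unfolding in_NP_def by blast
  obtain M pB where M: "wf_machine M" "query_state M = None" "computes_within M (\<lambda>_. []) pB (\<lambda>x. [x \<in> B])"
    using B(1) unfolding poly_time_decidable_def poly_time_def by blast
  obtain cols where "set cols = colours M" "distinct cols"
    using finite_distinct_list[OF finite_colours] by blast
  then show ?thesis using that[of B M pA pB cols] M B(2) by (simp add: verifier_def)
qed

lemma hardness_exists:
  assumes "verifier A B M pA pB cols" "good_template t0 t1 T" "drawable T"
    "ul T = (8 * length (tuples cols) + 2) * yl T"
  obtains aG aT where "hardness A B M pA pB cols aG aT T t0 t1"
proof -
  interpret verifier A B M pA pB cols by fact
  obtain aG where G: "avars aG \<subseteq> {0}" "\<And>env. aval aG env = guess (env 0)"
    using poly_aexp[of "Var 0" pA] by (auto simp: guess_def)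
  obtain aT where T: "avars aT \<subseteq> {0}" "\<And>env. aval aT env = time (env 0)"
    using poly_aexp[of "Plus (Plus (Times (Const 2) (Var 0)) (Const 1)) aG" pB] G by (fastforce simp: time_def)
  have "hardness A B M pA pB cols aG aT T t0 t1"
    by unfold_locales (use G T assms in auto)
  then show ?thesis by (rule that)
qed

text \<open>Two templates are needed: one with \<open>t0 = t1 = t\<close> for the problems with
  fixed stretch, and one with stretch 2 and a gap below it for the dilation problem, which does not
  mention \<open>t\<close>. Both use the price ratio from \<open>cover_solution\<close>.\<close>

lemma in_NP_reducible:
  fixes t :: real
  assumes "in_NP A" and t: "t > 1"
  shows "poly_reducible A (LWS geometric t) \<and> poly_reducible A (LWPS geometric t) \<and>
         Turing_reducible A (MWS geometric t) \<and> Turing_reducible A (MWPS geometric t) \<and>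
         Turing_reducible A (MDG geometric) \<and>
         poly_reducible A (LWS weighted t) \<and> poly_reducible A (LWPS weighted t) \<and>
         Turing_reducible A (MWS weighted t) \<and> Turing_reducible A (MWPS weighted t) \<and>
         Turing_reducible A (MDG weighted)"
proof -
  obtain B M pA pB cols where V: "verifier A B M pA pB cols" using verifier_exists[OF assms(1)] .
  let ?k = "8 * length (tuples cols) + 2"
  have k: "1 \<le> ?k" by simp
  obtain T where T: "good_template t t T" "drawable T" "ul T = ?k * yl T" using template_exists[OF t k] by blast
  obtain aG aT where H: "hardness A B M pA pB cols aG aT T t t" using hardness_exists[OF V T] .
  obtain T' t0 where T': "good_template t0 2 T'" "drawable T'" "ul T' = ?k * yl T'"
      "t0 * zl T' + 1 \<le> zl T' + 4 * half T'"
    using template_exists_gap[OF k] by blast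
  obtain aG' aT' where H': "hardness A B M pA pB cols aG' aT' T' t0 2" using hardness_exists[OF V T'(1-3)] .
  show ?thesis
    by (intro conjI hardness.geometric_hard(1-4)[OF H] hardness.weighted_hard(1-4)[OF H]
        hardness.geometric_hard(5)[OF H' T'(4)] hardness.weighted_hard(5)[OF H' T'(4)])
qed

theorem corollary2:
  fixes t :: real
  assumes "t > 1"
  shows "NP_hard (LWS geometric t) \<and> NP_hard (LWPS geometric t) \<and>
         NP_hard_search (MWS geometric t) \<and> NP_hard_search (MWPS geometric t) \<and>
         NP_hard_search (MDG geometric) \<and>
         NP_hard (LWS weighted t) \<and> NP_hard (LWPS weighted t) \<and>
         NP_hard_search (MWS weighted t) \<and> NP_hard_search (MWPS weighted t) \<and>
         NP_hard_search (MDG weighted)"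
  unfolding NP_hard_def NP_hard_search_def using in_NP_reducible[OF _ assms] by simp

end
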